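(* Let $\{u(t,x): (t,x)\in(0,\infty)\times\mathbb{R}\}$ be the solution to the parabolic Anderson model with narrow wedge initial condition $$\partial_t u(t,x)=\tfrac12\partial_x^2u(t,x)+u(t,x)\,\xi(t,x),\qquad u(0)=\delta_0,$$ where $\xi$ is space-time white noise on $\mathbb{R}_+\times\mathbb{R}$. Then for every fixed $t>0$, almost surely, $$\liminf_{R\to\infty}\frac{\max_{|x|\le R}\left(\log u(t,x)+\frac{x^2}{2t}\right)}{(\log R)^{2/3}}\ \ge\ \frac14\left(\frac t2\right)^{1/3}.$$
   Context: $\xi$ is space-time white noise on $\mathbb{R}_+\times\mathbb{R}$, i.e. the centered Gaussian noise with covariance $\mathrm{E}[\xi(t,x)\xi(s,y)]=\delta_0(t-s)\delta_0(x-y)$. The equation is understood in the mild sense of Walsh: $u$ is the (unique) random field adapted to the filtration of $\xi$, continuous on $(0,\infty)\times\mathbb{R}$ and with $\sup_{(t,x)\in(0,T]\times\mathbb{R}}\|u(t,x)\|_k/\boldsymbol{p}_t(x)<\infty$ for all $T>0$, $k\ge2$ (where $\|Z\|_k=(\mathrm{E}|Z|^k)^{1/k}$), such that for all $t>0$, $x\in\mathbb{R}$, a.s. $$u(t,x)=\boldsymbol{p}_t(x)+\int_0^t\int_{\mathbb{R}}\boldsymbol{p}_{t-s}(x-y)\,u(s,y)\,\xi(ds\,dy),\qquad \boldsymbol{p}_t(x)=\frac{1}{\sqrt{2\pi t}}e^{-x^2/(2t)},$$ the stochastic integral being the Walsh–Itô integral. The solution is a.s. strictly positive on $(0,\infty)\times\mathbb{R}$,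 so that $\log u(t,x)$ is well defined. *)

theory Defs
  imports "HOL-Probability.Probability"
begin

definition heat_kernel :: "real \<Rightarrow> real \<Rightarrow> real" where
  "heat_kernel t x = 1 / sqrt (2 * pi * t) * exp (- x\<^sup>2 / (2 * t))"

(* Value \<top> when |Z|^k is not integrable, where the Bochner integral would return 0. *)
definition Lk_norm :: "'a measure \<Rightarrow> real \<Rightarrow> ('a \<Rightarrow> real) \<Rightarrow> ennreal" where
  "Lk_norm M k Z =
     (if integrable M (\<lambda>\<omega>. \<bar>Z \<omega>\<bar> powr k)
      then ennreal ((\<integral>\<omega>. \<bar>Z \<omega>\<bar> powr k \<partial>M) powr (1 / k)) else \<top>)"


subsection \<open>Space-time white noise\<close>

(* The Dirac mass at 0 counts as a centered Gaussian law. *)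
definition centered_gaussian :: "'a measure \<Rightarrow> ('a \<Rightarrow> real) \<Rightarrow> bool" where
  "centered_gaussian M X \<longleftrightarrow>
     X \<in> borel_measurable M \<and>
     ((AE \<omega> in M. X \<omega> = 0) \<or> (\<exists>\<sigma>>0. distributed M lborel X (normal_density 0 \<sigma>)))"

definition centered_gaussian_process ::
    "'a measure \<Rightarrow> 'i set \<Rightarrow> ('i \<Rightarrow> 'a \<Rightarrow> real) \<Rightarrow> bool" where
  "centered_gaussian_process M I X \<longleftrightarrow>
     (\<forall>J c. finite J \<and> J \<subseteq> I \<longrightarrow> centered_gaussian M (\<lambda>\<omega>. \<Sum>i\<in>J. c i * X i \<omega>))"

definition noise_sets :: "(real \<times> real) set set" where
  "noise_sets = {A \<in> sets borel. A \<subseteq> {0..} \<times> UNIV \<and> emeasure lborel A < \<infinity>}"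

(* White noise as a Gaussian process indexed by space-time sets, the first coordinate being time:
   W A stands for the noise integrated over A, so that the covariance
   delta(t - s) delta(x - y) becomes E[W A * W B] = Leb (A \<inter> B). *)
definition white_noise :: "'a measure \<Rightarrow> ((real \<times> real) set \<Rightarrow> 'a \<Rightarrow> real) \<Rightarrow> bool" where
  "white_noise M W \<longleftrightarrow>
     centered_gaussian_process M noise_sets W \<and>
     (\<forall>A\<in>noise_sets. \<forall>B\<in>noise_sets.
        (\<integral>\<omega>. W A \<omega> * W B \<omega> \<partial>M) = measure lborel (A \<inter> B))"

(* Augmented by the null sets, as usual; only the sigma-algebra of the result is meaningful,
   its measure is the trivial one. *)
definition noise_filtration ::
    "'a measure \<Rightarrow> ((real \<times> real) set \<Rightarrow> 'a \<Rightarrow> real) \<Rightarrow> real \<Rightarrow> 'a measure" where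
  "noise_filtration M W t =
     sigma (space M)
       ({W A -` B \<inter> space M | A B.
           A \<in> noise_sets \<and> A \<subseteq> {0..t} \<times> UNIV \<and> B \<in> sets borel} \<union> null_sets M)"


subsection \<open>The Walsh--Ito integral\<close>

(* An entry (a, b, A, X) encodes the elementary integrand X(\<omega>) 1_{(a,b]}(s) 1_A(y). *)
type_synonym 'a walsh_simple = "(real \<times> real \<times> real set \<times> ('a \<Rightarrow> real)) list"

definition walsh_simple ::
    "'a measure \<Rightarrow> ((real \<times> real) set \<Rightarrow> 'a \<Rightarrow> real) \<Rightarrow> 'a walsh_simple \<Rightarrow> bool" where
  "walsh_simple M W es \<longleftrightarrow>
     (\<forall>(a, b, A, X)\<in>set es.
        0 \<le> a \<and> a < b \<and> A \<in> sets borel \<and> emeasure lborel A < \<infinity> \<and>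
        X \<in> borel_measurable (noise_filtration M W a) \<and> (\<exists>K. \<forall>\<omega>\<in>space M. \<bar>X \<omega>\<bar> \<le> K))"

definition simple_integrand :: "'a walsh_simple \<Rightarrow> real \<Rightarrow> real \<Rightarrow> 'a \<Rightarrow> real" where
  "simple_integrand es s y \<omega> =
     (\<Sum>(a, b, A, X)\<leftarrow>es. X \<omega> * indicator {a<..b} s * indicator A y)"

definition simple_integral ::
    "((real \<times> real) set \<Rightarrow> 'a \<Rightarrow> real) \<Rightarrow> 'a walsh_simple \<Rightarrow> 'a \<Rightarrow> real" where
  "simple_integral W es \<omega> = (\<Sum>(a, b, A, X)\<leftarrow>es. X \<omega> * W ({a<..b} \<times> A) \<omega>)"

(* I is (a version of) the integral of f(s,y) against W(ds dy): the L2 extension of the integral of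
   simple integrands. Integrands approximable in this sense are, up to a null set of ds dy dP,
   exactly the square-integrable predictable ones. Measurability is required only up to null sets,
   as for a field with almost surely continuous paths; it cannot be dropped, since nn_integral of a
   non-measurable function is only a lower integral. *)
definition has_walsh_integral ::
    "'a measure \<Rightarrow> ((real \<times> real) set \<Rightarrow> 'a \<Rightarrow> real) \<Rightarrow>
     (real \<Rightarrow> real \<Rightarrow> 'a \<Rightarrow> real) \<Rightarrow> ('a \<Rightarrow> real) \<Rightarrow> bool" where
  "has_walsh_integral M W f I \<longleftrightarrow>
     (\<lambda>((s, y), \<omega>). f s y \<omega>) \<in> borel_measurable (completion (lborel \<Otimes>\<^sub>M M)) \<and>
     I \<in> borel_measurable M \<and>
     (\<exists>es :: nat \<Rightarrow> 'a walsh_simple. (\<forall>n. walsh_simple M W (es n)) \<and>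
        (\<lambda>n. \<integral>\<^sup>+((s, y), \<omega>). ennreal ((simple_integrand (es n) s y \<omega> - f s y \<omega>)\<^sup>2)
               \<partial>completion (lborel \<Otimes>\<^sub>M M)) \<longlonglongrightarrow> 0 \<and>
        (\<lambda>n. \<integral>\<^sup>+\<omega>. ennreal ((simple_integral W (es n) \<omega> - I \<omega>)\<^sup>2) \<partial>M) \<longlonglongrightarrow> 0)"


subsection \<open>The parabolic Anderson model started from the Dirac mass at 0\<close>

(* Only the values u t x with t > 0 matter. *)
definition pam_narrow_wedge_solution ::
    "'a measure \<Rightarrow> ((real \<times> real) set \<Rightarrow> 'a \<Rightarrow> real) \<Rightarrow> (real \<Rightarrow> real \<Rightarrow> 'a \<Rightarrow> real) \<Rightarrow> bool" where
  "pam_narrow_wedge_solution M W u \<longleftrightarrow>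
     (\<forall>t>0. \<forall>x. u t x \<in> borel_measurable (noise_filtration M W t)) \<and>
     (AE \<omega> in M. continuous_on ({0<..} \<times> UNIV) (\<lambda>(t, x). u t x \<omega>)) \<and>
     (\<forall>T>0. \<forall>k\<ge>2.
        (SUP (t, x)\<in>{0<..T} \<times> UNIV. Lk_norm M k (u t x) / ennreal (heat_kernel t x)) < \<infinity>) \<and>
     (\<forall>t>0. \<forall>x. \<exists>I.
        has_walsh_integral M W
          (\<lambda>s y \<omega>. indicator {0<..<t} s * heat_kernel (t - s) (x - y) * u s y \<omega>) I \<and>
        (AE \<omega> in M. u t x \<omega> = heat_kernel t x + I \<omega>))"

end

theory Submission
  imports Defs "HOL-Real_Asymp.Real_Asymp"
begin

text \<open>Let \<open>T\<close> be a tube of width of order \<open>(ln R) powr (-1/3)\<close> around the segment from the origin to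
  \<open>(t, x)\<close>. By the Cameron--Martin formula, weighting with the exponential martingale of \<open>a * W T\<close>
  adds the potential \<open>a\<close> on \<open>T\<close> to the noise, so the weighted mean of \<open>u t x\<close> solves a deterministic
  heat equation with a box potential. It is at least about \<open>exp ((a - pi\<^sup>2 / (8 * w\<^sup>2)) * t)\<close> times the
  heat kernel, the correction being the principal Dirichlet eigenvalue of the tube. With \<open>a\<close> of order
  \<open>(ln R) powr (2/3)\<close> the weight has relative entropy of order \<open>ln R\<close>, so the event it describes
  should occur at one of the roughly \<open>R powr (1/2)\<close> points \<open>x\<close> of a grid in \<open>[0, R]\<close>.

  To make this rigorous one needs almost independent copies. By the Ito isometry, the error of
  replacing \<open>u t x\<close> by its conditional expectation given the noise in a sector of slope \<open>c\<close> around the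
  segment obeys a Volterra inequality and is of relative size \<open>c powr (-1/2)\<close>. For \<open>c\<close> a suitable
  multiple of the grid spacing, the sectors of different grid points are disjoint, so the proxies are
  independent, and the second-moment method applied to clipped versions of \<open>u t x\<close>
  times truncated weights bounds the probability that \<open>u\<close> is small on the whole grid. These bounds
  are summable along \<open>R = exp n\<close>, and the Borel--Cantelli lemma concludes.\<close>

subsection \<open>Square-integrable functions\<close>

text \<open>Square roots of \<open>R\<close> enter for the following reason. Under its own law a
  weight of entropy \<open>h\<close> is typically of size \<open>exp h\<close>, so it is truncated
  at a level \<open>K\<close> slightly above \<open>exp h\<close>. For grid spacing \<open>D\<close>
  the localization error has mean square of order \<open>1 / D\<close>; by the Cauchy--Schwarz
  inequality it costs \<open>sqrt (K / D)\<close> against a truncated weight, so \<open>D\<close>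
  has to exceed \<open>K\<close>. The average over \<open>N\<close> grid points has variance of
  order at most \<open>L\<^sup>2 * K / N\<close>, where \<open>L\<close> is the clipping level, so
  \<open>N\<close> has to exceed \<open>K\<close> too. As \<open>N * D\<close> is at most
  \<open>R\<close>, both are of order \<open>R powr (1/2)\<close>, and the entropy must stay below
  \<open>ln R / 2\<close>. Optimized over height and width at this entropy, the exponent
  \<open>(a - pi\<^sup>2 / (8 * w\<^sup>2)) * t\<close> equals
  \<open>3 / 4 * (2 * pi\<^sup>2) powr (-1/3)\<close>, about 0.277, times
  \<open>t powr (1/3) * (ln R) powr (2/3)\<close>. The theorem asks for less than 0.199, and the gap
  pays for all crude estimates.\<close>

lemma square_integrable_mult:
  fixes f g :: "'b \<Rightarrow> real"
  assumes [measurable]: "f \<in> borel_measurable M" "g \<in> borel_measurable M"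
    and f: "integrable M (\<lambda>x. (f x)\<^sup>2)" and g: "integrable M (\<lambda>x. (g x)\<^sup>2)"
  shows "integrable M (\<lambda>x. f x * g x)"
proof (rule Bochner_Integration.integrable_bound)
  show "integrable M (\<lambda>x. (f x)\<^sup>2 + (g x)\<^sup>2)" using f g by simp
  have "\<bar>f x * g x\<bar> \<le> (f x)\<^sup>2 + (g x)\<^sup>2" for x
    using sum_squares_bound[of "\<bar>f x\<bar>" "\<bar>g x\<bar>"] mult_nonneg_nonneg[of "\<bar>f x\<bar>" "\<bar>g x\<bar>"]
    by (simp add: abs_mult del: mult_nonneg_nonneg)
  then show "AE x in M. norm (f x * g x) \<le> norm ((f x)\<^sup>2 + (g x)\<^sup>2)" by simp
qed measurable

lemma square_integrable_add:
  fixes f g :: "'b \<Rightarrow> real"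
  assumes "f \<in> borel_measurable M" "g \<in> borel_measurable M"
    and "integrable M (\<lambda>x. (f x)\<^sup>2)" "integrable M (\<lambda>x. (g x)\<^sup>2)"
  shows "integrable M (\<lambda>x. (f x + g x)\<^sup>2)"
  using square_integrable_mult[OF assms] assms by (simp add: power2_sum mult.assoc)

lemma square_integrable_diff:
  fixes f g :: "'b \<Rightarrow> real"
  assumes "f \<in> borel_measurable M" "g \<in> borel_measurable M"
    and "integrable M (\<lambda>x. (f x)\<^sup>2)" "integrable M (\<lambda>x. (g x)\<^sup>2)"
  shows "integrable M (\<lambda>x. (f x - g x)\<^sup>2)"
  using square_integrable_mult[OF assms] assms by (simp add: power2_diff mult.assoc)

lemma Cauchy_Schwarz_integral:
  fixes f g :: "'b \<Rightarrow> real"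
  assumes [measurable]: "f \<in> borel_measurable M" "g \<in> borel_measurable M"
    and f: "integrable M (\<lambda>x. (f x)\<^sup>2)" and g: "integrable M (\<lambda>x. (g x)\<^sup>2)"
  shows "(\<integral>x. \<bar>f x * g x\<bar> \<partial>M) \<le> sqrt (\<integral>x. (f x)\<^sup>2 \<partial>M) * sqrt (\<integral>x. (g x)\<^sup>2 \<partial>M)"
proof -
  have i: "integrable M (\<lambda>x. \<bar>f x * g x\<bar>)"
    using square_integrable_mult[OF assms] by simp
  have "(\<integral>\<^sup>+x. ennreal \<bar>f x\<bar> * ennreal \<bar>g x\<bar> \<partial>M)\<^sup>2 \<le>
        (\<integral>\<^sup>+x. (ennreal \<bar>f x\<bar>)\<^sup>2 \<partial>M) * (\<integral>\<^sup>+x. (ennreal \<bar>g x\<bar>)\<^sup>2 \<partial>M)"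
    by (rule Cauchy_Schwarz_nn_integral) measurable
  also have "(\<integral>\<^sup>+x. (ennreal \<bar>f x\<bar>)\<^sup>2 \<partial>M) = ennreal (\<integral>x. (f x)\<^sup>2 \<partial>M)"
    using f by (simp add: ennreal_power nn_integral_eq_integral)
  also have "(\<integral>\<^sup>+x. (ennreal \<bar>g x\<bar>)\<^sup>2 \<partial>M) = ennreal (\<integral>x. (g x)\<^sup>2 \<partial>M)"
    using g by (simp add: ennreal_power nn_integral_eq_integral)
  also have "(\<integral>\<^sup>+x. ennreal \<bar>f x\<bar> * ennreal \<bar>g x\<bar> \<partial>M) = ennreal (\<integral>x. \<bar>f x * g x\<bar> \<partial>M)"
    using i by (simp add: ennreal_mult[symmetric] abs_mult[symmetric] nn_integral_eq_integral)
  finally have "ennreal ((\<integral>x. \<bar>f x * g x\<bar> \<partial>M)\<^sup>2) \<le> ennreal ((\<integral>x. (f x)\<^sup>2 \<partial>M) * (\<integral>x. (g x)\<^sup>2 \<partial>M))"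
    by (simp add: ennreal_power ennreal_mult)
  then have "(\<integral>x. \<bar>f x * g x\<bar> \<partial>M)\<^sup>2 \<le> (\<integral>x. (f x)\<^sup>2 \<partial>M) * (\<integral>x. (g x)\<^sup>2 \<partial>M)"
    by simp
  then have "\<bar>\<integral>x. \<bar>f x * g x\<bar> \<partial>M\<bar> \<le> sqrt ((\<integral>x. (f x)\<^sup>2 \<partial>M) * (\<integral>x. (g x)\<^sup>2 \<partial>M))"
    by (metis real_sqrt_abs real_sqrt_le_mono)
  then show ?thesis by (simp add: real_sqrt_mult)
qed

lemma nn_integral_square_finite_imp_integrable:
  fixes f :: "'b \<Rightarrow> real"
  assumes [measurable]: "f \<in> borel_measurable M" and "(\<integral>\<^sup>+x. ennreal ((f x)\<^sup>2) \<partial>M) < \<infinity>"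
  shows "integrable M (\<lambda>x. (f x)\<^sup>2)"
  using assms by (intro integrableI_bounded) auto

lemma (in finite_measure) square_integrable_imp_integrable':
  fixes f :: "'a \<Rightarrow> real"
  assumes "f \<in> borel_measurable M" "integrable M (\<lambda>x. (f x)\<^sup>2)"
  shows "integrable M f"
  using square_integrable_mult[of f M "\<lambda>_. 1"] assms by simp

lemma borel_measurable_fst_snd:
  "(fst :: real \<times> real \<Rightarrow> real) \<in> borel_measurable borel" "(snd :: real \<times> real \<Rightarrow> real) \<in> borel_measurable borel"
  by (auto intro!: borel_measurable_continuous_onI continuous_intros)

subsection \<open>Centered Gaussian variables\<close>

text \<open>Completing the square. This is the one-dimensional Cameron--Martin formula: the factor
  \<open>exp (c * x)\<close> moves the mean to \<open>c * \<sigma>\<^sup>2\<close>.\<close>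

lemma normal_density_exp_shift:
  assumes "0 < \<sigma>"
  shows "normal_density 0 \<sigma> x * exp (c * x) = exp (c\<^sup>2 * \<sigma>\<^sup>2 / 2) * normal_density (c * \<sigma>\<^sup>2) \<sigma> x"
proof -
  have "- (x - 0)\<^sup>2 / (2 * \<sigma>\<^sup>2) + c * x = c\<^sup>2 * \<sigma>\<^sup>2 / 2 + (- (x - c * \<sigma>\<^sup>2)\<^sup>2 / (2 * \<sigma>\<^sup>2))"
    using assms by (simp add: field_simps power2_eq_square)
  then have "exp (- (x - 0)\<^sup>2 / (2 * \<sigma>\<^sup>2)) * exp (c * x) = exp (c\<^sup>2 * \<sigma>\<^sup>2 / 2) * exp (- (x - c * \<sigma>\<^sup>2)\<^sup>2 / (2 * \<sigma>\<^sup>2))"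
    by (simp only: exp_add[symmetric])
  then show ?thesis unfolding normal_density_def by simp
qed

context prob_space
begin

text \<open>The Dirac mass at 0 has no density and is treated apart. Writing every formula through
  the second moment merges the two cases, so that no later argument has to distinguish them.\<close>

lemma centered_gaussian_exp_moments:
  assumes X: "centered_gaussian M X"
  shows "integrable M (\<lambda>\<omega>. (X \<omega>)\<^sup>2)" "integrable M X" "expectation X = 0"
    "has_bochner_integral M (\<lambda>\<omega>. exp (c * X \<omega>)) (exp (c\<^sup>2 * expectation (\<lambda>\<omega>. (X \<omega>)\<^sup>2) / 2))"
    "has_bochner_integral M (\<lambda>\<omega>. X \<omega> * exp (c * X \<omega>))
       (c * expectation (\<lambda>\<omega>. (X \<omega>)\<^sup>2) * exp (c\<^sup>2 * expectation (\<lambda>\<omega>. (X \<omega>)\<^sup>2) / 2))"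
    "expectation (\<lambda>\<omega>. iexp (c * X \<omega>)) = exp (- c\<^sup>2 * expectation (\<lambda>\<omega>. (X \<omega>)\<^sup>2) / 2)"
proof -
  have [measurable]: "X \<in> borel_measurable M" using X by (simp add: centered_gaussian_def)
  have "(AE \<omega> in M. X \<omega> = 0) \<or> (\<exists>\<sigma>>0. distributed M lborel X (normal_density 0 \<sigma>))"
    using X by (simp add: centered_gaussian_def)
  then have "integrable M (\<lambda>\<omega>. (X \<omega>)\<^sup>2) \<and> integrable M X \<and> expectation X = 0 \<and>
    has_bochner_integral M (\<lambda>\<omega>. exp (c * X \<omega>)) (exp (c\<^sup>2 * expectation (\<lambda>\<omega>. (X \<omega>)\<^sup>2) / 2)) \<and>
    has_bochner_integral M (\<lambda>\<omega>. X \<omega> * exp (c * X \<omega>))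
       (c * expectation (\<lambda>\<omega>. (X \<omega>)\<^sup>2) * exp (c\<^sup>2 * expectation (\<lambda>\<omega>. (X \<omega>)\<^sup>2) / 2)) \<and>
    expectation (\<lambda>\<omega>. iexp (c * X \<omega>)) = exp (- c\<^sup>2 * expectation (\<lambda>\<omega>. (X \<omega>)\<^sup>2) / 2)"
  proof
    assume ae: "AE \<omega> in M. X \<omega> = 0"
    have e2: "expectation (\<lambda>\<omega>. (X \<omega>)\<^sup>2) = 0"
      using ae by (subst integral_cong_AE[where g="\<lambda>_. 0"]) auto
    have i: "integrable M f" if "f \<in> borel_measurable M" "AE \<omega> in M. f \<omega> = k" for f :: "'a \<Rightarrow> real" and k
      using that by (subst integrable_cong_AE[where g="\<lambda>_. k"]) auto
    have I: "expectation f = k" if "f \<in> borel_measurable M" "AE \<omega> in M. f \<omega> = k" for f :: "'a \<Rightarrow> real" and k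
      using that by (subst integral_cong_AE[where g="\<lambda>_. k"]) (auto simp: prob_space)
    have "expectation (\<lambda>\<omega>. iexp (c * X \<omega>)) = expectation (\<lambda>\<omega>. 1::complex)"
      using ae by (intro integral_cong_AE) auto
    then have "expectation (\<lambda>\<omega>. iexp (c * X \<omega>)) = 1" by (simp add: prob_space)
    moreover have "has_bochner_integral M (\<lambda>\<omega>. exp (c * X \<omega>)) 1"
      unfolding has_bochner_integral_iff using ae by (intro conjI i[of _ 1] I) auto
    moreover have "has_bochner_integral M (\<lambda>\<omega>. X \<omega> * exp (c * X \<omega>)) 0"
      unfolding has_bochner_integral_iff using ae by (intro conjI i[of _ 0] I) auto
    moreover have "integrable M (\<lambda>\<omega>. (X \<omega>)\<^sup>2)" "integrable M X" "expectation X = 0"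
      using ae by (auto intro!: i[of _ 0] I)
    ultimately show ?thesis by (simp add: e2)
  next
    assume "\<exists>\<sigma>>0. distributed M lborel X (normal_density 0 \<sigma>)"
    then obtain \<sigma> where s: "\<sigma> > 0" and d: "distributed M lborel X (normal_density 0 \<sigma>)" by auto
    have hb: "has_bochner_integral M (\<lambda>\<omega>. g (X \<omega>)) k"
      if "has_bochner_integral lborel (\<lambda>x. normal_density 0 \<sigma> x * g x) k" "g \<in> borel_measurable borel"
      for g :: "real \<Rightarrow> real" and k
      using that distributed_integrable[OF d, of g] distributed_integral[OF d, of g]
      by (simp add: has_bochner_integral_iff)
    have m2: "has_bochner_integral M (\<lambda>\<omega>. (X \<omega>)\<^sup>2) (\<sigma>\<^sup>2)"
      using normal_moment_even[OF s, of 0 1] by (intro hb) auto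
    then have e2: "expectation (\<lambda>\<omega>. (X \<omega>)\<^sup>2) = \<sigma>\<^sup>2" by (rule has_bochner_integral_integral_eq)
    have m1: "has_bochner_integral M X 0"
      using normal_moment_nz_1[OF s, of 0] by (intro hb) auto
    have ex: "has_bochner_integral M (\<lambda>\<omega>. exp (c * X \<omega>)) (exp (c\<^sup>2 * \<sigma>\<^sup>2 / 2))"
    proof (rule hb)
      have "has_bochner_integral lborel (\<lambda>x. exp (c\<^sup>2 * \<sigma>\<^sup>2 / 2) * normal_density (c * \<sigma>\<^sup>2) \<sigma> x) (exp (c\<^sup>2 * \<sigma>\<^sup>2 / 2) * 1)"
        using s by (intro has_bochner_integral_mult_right) (simp add: has_bochner_integral_iff)
      then show "has_bochner_integral lborel (\<lambda>x. normal_density 0 \<sigma> x * exp (c * x)) (exp (c\<^sup>2 * \<sigma>\<^sup>2 / 2))"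
        by (simp add: normal_density_exp_shift[OF s])
    qed simp
    have xex: "has_bochner_integral M (\<lambda>\<omega>. X \<omega> * exp (c * X \<omega>)) (c * \<sigma>\<^sup>2 * exp (c\<^sup>2 * \<sigma>\<^sup>2 / 2))"
    proof (rule hb[of "\<lambda>x. x * exp (c * x)"])
      have "has_bochner_integral lborel (\<lambda>x. exp (c\<^sup>2 * \<sigma>\<^sup>2 / 2) * (normal_density (c * \<sigma>\<^sup>2) \<sigma> x * x))
          (exp (c\<^sup>2 * \<sigma>\<^sup>2 / 2) * (c * \<sigma>\<^sup>2))"
        by (intro has_bochner_integral_mult_right normal_moment_nz_1[OF s])
      moreover have "(\<lambda>x. exp (c\<^sup>2 * \<sigma>\<^sup>2 / 2) * (normal_density (c * \<sigma>\<^sup>2) \<sigma> x * x)) = (\<lambda>x. normal_density 0 \<sigma> x * (x * exp (c * x)))"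
        using normal_density_exp_shift[OF s, of _ c] by (simp add: fun_eq_iff mult_ac)
      ultimately show "has_bochner_integral lborel (\<lambda>x. normal_density 0 \<sigma> x * (x * exp (c * x))) (c * \<sigma>\<^sup>2 * exp (c\<^sup>2 * \<sigma>\<^sup>2 / 2))"
        by (metis mult.commute)
    qed simp
    have "distributed M lborel (\<lambda>x. (X x - 0) / \<sigma>) std_normal_density"
      using normal_standard_normal_convert[of \<sigma> X 0] s d by simp
    then have ds: "distr M lborel (\<lambda>x. X x / \<sigma>) = std_normal_distribution"
      by (simp add: distributed_def)
    have "expectation (\<lambda>\<omega>. iexp (c * X \<omega>)) = (CLINT x|distr M lborel (\<lambda>x. X x / \<sigma>). iexp ((c * \<sigma>) * x))"
      using s by (subst integral_distr) (auto simp: mult.assoc)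
    also have "\<dots> = char std_normal_distribution (c * \<sigma>)"
      unfolding ds char_def by simp
    also have "\<dots> = exp (- c\<^sup>2 * \<sigma>\<^sup>2 / 2)"
      by (simp add: char_std_normal_distribution power_mult_distrib)
    finally show ?thesis using m1 m2 ex xex e2 by (simp add: has_bochner_integral_iff)
  qed
  then show "integrable M (\<lambda>\<omega>. (X \<omega>)\<^sup>2)" "integrable M X" "expectation X = 0"
    "has_bochner_integral M (\<lambda>\<omega>. exp (c * X \<omega>)) (exp (c\<^sup>2 * expectation (\<lambda>\<omega>. (X \<omega>)\<^sup>2) / 2))"
    "has_bochner_integral M (\<lambda>\<omega>. X \<omega> * exp (c * X \<omega>))
       (c * expectation (\<lambda>\<omega>. (X \<omega>)\<^sup>2) * exp (c\<^sup>2 * expectation (\<lambda>\<omega>. (X \<omega>)\<^sup>2) / 2))"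
    "expectation (\<lambda>\<omega>. iexp (c * X \<omega>)) = exp (- c\<^sup>2 * expectation (\<lambda>\<omega>. (X \<omega>)\<^sup>2) / 2)"
    by auto
qed

end

subsection \<open>White noise over disjoint regions\<close>

text \<open>Generalizes \<open>noise_filtration\<close> from time slabs to arbitrary regions,
  because localization conditions on the noise in a sector. The null sets matter since
  \<open>W\<close> is additive only almost surely.\<close>

definition noise_alg ::
    "'a measure \<Rightarrow> ((real \<times> real) set \<Rightarrow> 'a \<Rightarrow> real) \<Rightarrow> (real \<times> real) set \<Rightarrow> 'a measure" where
  "noise_alg M W S =
     sigma (space M)
       ({W A -` B \<inter> space M | A B. A \<in> noise_sets \<and> A \<subseteq> S \<and> B \<in> sets borel} \<union> null_sets M)"

lemma noise_filtration_eq: "noise_filtration M W t = noise_alg M W ({0..t} \<times> UNIV)"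
  by (simp add: noise_filtration_def noise_alg_def)

lemma noise_sets_Int: "A \<in> noise_sets \<Longrightarrow> B \<in> sets borel \<Longrightarrow> A \<inter> B \<in> noise_sets"
  unfolding noise_sets_def
  by (auto intro!: order.strict_trans1[OF emeasure_mono[of "A \<inter> B" A lborel]])

lemma noise_sets_Diff: "A \<in> noise_sets \<Longrightarrow> B \<in> sets borel \<Longrightarrow> A - B \<in> noise_sets"
  unfolding noise_sets_def
  by (auto intro!: order.strict_trans1[OF emeasure_mono[of "A - B" A lborel]])

lemma noise_sets_borel: "A \<in> noise_sets \<Longrightarrow> A \<in> sets borel"
  by (simp add: noise_sets_def)

lemma noise_sets_fmeasurable: "A \<in> noise_sets \<Longrightarrow> A \<in> fmeasurable lborel"
  by (simp add: noise_sets_def fmeasurable_def)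

context prob_space
begin

text \<open>Levy's uniqueness theorem, applied to the law of \<open>X\<close> under the probability density \<open>1 + Z\<close>.\<close>

lemma iexp_weighted_zero_real:
  fixes Z :: "'a \<Rightarrow> real"
  assumes [measurable]: "X \<in> borel_measurable M" "Z \<in> borel_measurable M"
    and bd: "\<And>\<omega>. \<omega> \<in> space M \<Longrightarrow> \<bar>Z \<omega>\<bar> \<le> 1"
    and z: "\<And>a. expectation (\<lambda>\<omega>. iexp (a * X \<omega>) * complex_of_real (Z \<omega>)) = 0"
    and B: "B \<in> sets borel"
  shows "expectation (\<lambda>\<omega>. indicator B (X \<omega>) * Z \<omega>) = 0"
proof -
  have [measurable]: "B \<in> sets borel" by fact
  have iZ: "integrable M Z" by (rule integrable_const_bound[of _ 1]) (auto intro: bd)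
  define D where "D = density M (\<lambda>\<omega>. ennreal (1 + Z \<omega>))"
  define M1 where "M1 = distr D borel X"
  define M2 where "M2 = distr M borel X"
  have nn: "AE \<omega> in M. 0 \<le> 1 + Z \<omega>" using bd by (intro AE_I2) (smt (verit))
  have z0: "expectation Z = 0"
  proof -
    have "complex_of_real (expectation Z) = 0" using z[of 0] by simp
    then show ?thesis by simp
  qed
  have [measurable_cong]: "sets D = sets M" by (simp add: D_def)
  have "emeasure D (space D) = (\<integral>\<^sup>+\<omega>. ennreal (1 + Z \<omega>) \<partial>M)"
    by (simp add: D_def emeasure_density cong: nn_integral_cong)
  also have "\<dots> = ennreal (expectation (\<lambda>\<omega>. 1 + Z \<omega>))"
    using iZ nn by (intro nn_integral_eq_integral) auto
  also have "\<dots> = 1" using iZ z0 by (simp add: prob_space)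
  finally have "prob_space D" by (rule prob_spaceI)
  then interpret D: prob_space D .
  have r1: "real_distribution M1" unfolding M1_def
    by (auto intro!: real_distribution.intro real_distribution_axioms.intro D.prob_space_distr)
  have r2: "real_distribution M2" unfolding M2_def
    by (auto intro!: real_distribution.intro real_distribution_axioms.intro prob_space_distr)
  have "char M1 a = char M2 a" for a
  proof -
    have i1: "integrable M (\<lambda>\<omega>. iexp (a * X \<omega>))"
      by (rule integrable_const_bound[of _ 1]) auto
    have i2: "integrable M (\<lambda>\<omega>. iexp (a * X \<omega>) * complex_of_real (Z \<omega>))"
      by (rule integrable_const_bound[of _ 1]) (auto simp: norm_mult intro: bd)
    have "char M1 a = (CLINT \<omega>|D. iexp (a * X \<omega>))"
      unfolding char_def M1_def by (subst integral_distr) auto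
    also have "\<dots> = (CLINT \<omega>|M. (1 + Z \<omega>) *\<^sub>R iexp (a * X \<omega>))"
      unfolding D_def using nn by (subst integral_density) auto
    also have "\<dots> = (CLINT \<omega>|M. iexp (a * X \<omega>) + iexp (a * X \<omega>) * complex_of_real (Z \<omega>))"
      by (intro Bochner_Integration.integral_cong) (auto simp: scaleR_conv_of_real algebra_simps)
    also have "\<dots> = (CLINT \<omega>|M. iexp (a * X \<omega>))"
      using i1 i2 z by simp
    also have "\<dots> = char M2 a"
      unfolding char_def M2_def by (subst integral_distr) auto
    finally show ?thesis .
  qed
  then have "M1 = M2" by (intro Levy_uniqueness r1 r2) auto
  then have "measure M1 B = measure M2 B" by simp
  moreover have "measure M2 B = expectation (\<lambda>\<omega>. indicator B (X \<omega>))"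
  proof -
    have "measure M2 B = integral\<^sup>L M2 (indicator B)" by (simp add: M2_def)
    also have "\<dots> = expectation (\<lambda>\<omega>. indicator B (X \<omega>))"
      unfolding M2_def by (subst integral_distr) auto
    finally show ?thesis .
  qed
  moreover have "measure M1 B = expectation (\<lambda>\<omega>. indicator B (X \<omega>)) + expectation (\<lambda>\<omega>. indicator B (X \<omega>) * Z \<omega>)"
  proof -
    have "measure M1 B = integral\<^sup>L M1 (indicator B)" by (simp add: M1_def)
    also have "\<dots> = (\<integral>\<omega>. indicator B (X \<omega>) \<partial>D)"
      unfolding M1_def by (subst integral_distr) auto
    also have "\<dots> = (\<integral>\<omega>. (1 + Z \<omega>) *\<^sub>R indicator B (X \<omega>) \<partial>M)"
      unfolding D_def using nn by (subst integral_density) auto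
    also have "\<dots> = (\<integral>\<omega>. indicator B (X \<omega>) + indicator B (X \<omega>) * Z \<omega> \<partial>M)"
      by (intro Bochner_Integration.integral_cong) (auto simp: algebra_simps)
    also have "\<dots> = expectation (\<lambda>\<omega>. indicator B (X \<omega>)) + expectation (\<lambda>\<omega>. indicator B (X \<omega>) * Z \<omega>)"
      by (intro Bochner_Integration.integral_add integrable_const_bound[of _ 1])
         (auto simp: indicator_def intro: bd)
    finally show ?thesis .
  qed
  ultimately show ?thesis by simp
qed

text \<open>Conjugation turns the hypothesis at \<open>-a\<close> into the same hypothesis for
  \<open>cnj (Z \<omega>)\<close>, so the real and imaginary parts of \<open>Z\<close>, divided by a
  positive bound, fall under the real case.\<close>

lemma iexp_weighted_zero:
  fixes Z :: "'a \<Rightarrow> complex"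
  assumes [measurable]: "X \<in> borel_measurable M" "Z \<in> borel_measurable M"
    and bd: "\<And>\<omega>. \<omega> \<in> space M \<Longrightarrow> cmod (Z \<omega>) \<le> K"
    and z: "\<And>a. expectation (\<lambda>\<omega>. iexp (a * X \<omega>) * Z \<omega>) = 0"
    and B: "B \<in> sets borel"
  shows "expectation (\<lambda>\<omega>. complex_of_real (indicator B (X \<omega>)) * Z \<omega>) = 0"
proof -
  have [measurable]: "B \<in> sets borel" by fact
  define L where "L = max K 1"
  have L: "L > 0" and bdL: "\<And>\<omega>. \<omega> \<in> space M \<Longrightarrow> cmod (Z \<omega>) \<le> L"
    using bd by (auto simp: L_def max.coboundedI1)
  have zc: "expectation (\<lambda>\<omega>. iexp (a * X \<omega>) * cnj (Z \<omega>)) = 0" for a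
  proof -
    have "expectation (\<lambda>\<omega>. iexp (a * X \<omega>) * cnj (Z \<omega>)) = expectation (\<lambda>\<omega>. cnj (iexp (-a * X \<omega>) * Z \<omega>))"
      by (intro Bochner_Integration.integral_cong) (auto simp: exp_cnj)
    also have "\<dots> = cnj (expectation (\<lambda>\<omega>. iexp (-a * X \<omega>) * Z \<omega>))" by (subst Bochner_Integration.integral_cnj) (rule refl)
    finally show ?thesis using z[of "-a"] by simp
  qed
  have cm: "cnj \<in> borel_measurable borel"
    by (intro borel_measurable_continuous_onI continuous_intros)
  have i: "integrable M (\<lambda>\<omega>. iexp (a * X \<omega>) * f (Z \<omega>))"
    if "f \<in> borel_measurable borel" "\<And>x. cmod (f x) = cmod x" for a f
    by (rule integrable_const_bound[of _ L]) (use that in \<open>auto simp: norm_mult intro: bdL\<close>)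
  have zr: "expectation (\<lambda>\<omega>. iexp (a * X \<omega>) * complex_of_real (Re (Z \<omega>) / L)) = 0" for a
  proof -
    have "expectation (\<lambda>\<omega>. iexp (a * X \<omega>) * complex_of_real (Re (Z \<omega>) / L)) =
        expectation (\<lambda>\<omega>. (iexp (a * X \<omega>) * Z \<omega> + iexp (a * X \<omega>) * cnj (Z \<omega>)) / (2 * L))"
    proof (intro Bochner_Integration.integral_cong refl)
      fix \<omega>
      have "iexp (a * X \<omega>) * Z \<omega> + iexp (a * X \<omega>) * cnj (Z \<omega>) = iexp (a * X \<omega>) * complex_of_real (2 * Re (Z \<omega>))"
        by (simp add: distrib_left[symmetric] complex_add_cnj)
      then show "iexp (a * X \<omega>) * complex_of_real (Re (Z \<omega>) / L) =
          (iexp (a * X \<omega>) * Z \<omega> + iexp (a * X \<omega>) * cnj (Z \<omega>)) / (2 * L)" by simp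
    qed
    also have "\<dots> = 0" using i[of "\<lambda>x. x" a] i[of cnj a] cm z zc by simp
    finally show ?thesis .
  qed
  have zi: "expectation (\<lambda>\<omega>. iexp (a * X \<omega>) * complex_of_real (Im (Z \<omega>) / L)) = 0" for a
  proof -
    have "expectation (\<lambda>\<omega>. iexp (a * X \<omega>) * complex_of_real (Im (Z \<omega>) / L)) =
        expectation (\<lambda>\<omega>. (iexp (a * X \<omega>) * Z \<omega> - iexp (a * X \<omega>) * cnj (Z \<omega>)) / (2 * L * \<i>))"
    proof (intro Bochner_Integration.integral_cong refl)
      fix \<omega>
      have "iexp (a * X \<omega>) * Z \<omega> - iexp (a * X \<omega>) * cnj (Z \<omega>) = iexp (a * X \<omega>) * (\<i> * complex_of_real (2 * Im (Z \<omega>)))"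
        unfolding right_diff_distrib[symmetric] complex_diff_cnj by (simp add: mult_ac)
      then show "iexp (a * X \<omega>) * complex_of_real (Im (Z \<omega>) / L) =
          (iexp (a * X \<omega>) * Z \<omega> - iexp (a * X \<omega>) * cnj (Z \<omega>)) / (2 * L * \<i>)" by simp
    qed
    also have "\<dots> = 0" using i[of "\<lambda>x. x" a] i[of cnj a] cm z zc by simp
    finally show ?thesis .
  qed
  have "expectation (\<lambda>\<omega>. indicator B (X \<omega>) * (Re (Z \<omega>) / L)) = 0"
    by (rule iexp_weighted_zero_real[OF _ _ _ zr B])
       (use L bdL abs_Re_le_cmod order_trans in \<open>auto simp: abs_divide\<close>, blast)
  moreover have "expectation (\<lambda>\<omega>. indicator B (X \<omega>) * (Im (Z \<omega>) / L)) = 0"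
    by (rule iexp_weighted_zero_real[OF _ _ _ zi B])
       (use L bdL abs_Im_le_cmod order_trans in \<open>auto simp: abs_divide\<close>, blast)
  ultimately have ri: "expectation (\<lambda>\<omega>. indicator B (X \<omega>) * Re (Z \<omega>)) = 0"
    "expectation (\<lambda>\<omega>. indicator B (X \<omega>) * Im (Z \<omega>)) = 0" using L by auto
  have i': "integrable M (\<lambda>\<omega>. complex_of_real (indicator B (X \<omega>)) * Z \<omega>)"
    by (rule integrable_const_bound[of _ L]) (use L in \<open>auto simp: indicator_def intro: bdL\<close>)
  have "Re (expectation (\<lambda>\<omega>. complex_of_real (indicator B (X \<omega>)) * Z \<omega>)) = 0"
    using ri(1) by (subst integral_Re[OF i', symmetric]) simp
  moreover have "Im (expectation (\<lambda>\<omega>. complex_of_real (indicator B (X \<omega>)) * Z \<omega>)) = 0"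
    using ri(2) by (subst integral_Im[OF i', symmetric]) simp
  ultimately show ?thesis by (simp add: complex_eq_iff)
qed

text \<open>Induction on \<open>J\<close> exchanges one exponential at a time for an indicator. The
  exponential of the new index is first absorbed into the weight, and afterwards the indicators
  already obtained are; this is why the weight has to be an arbitrary bounded complex
  variable.\<close>

lemma iexp_weighted_zero_prod:
  fixes Z :: "'a \<Rightarrow> complex" and X :: "'j \<Rightarrow> 'a \<Rightarrow> real"
  assumes "finite J" and "\<And>j. j \<in> J \<Longrightarrow> X j \<in> borel_measurable M" and "Z \<in> borel_measurable M"
    and "\<And>\<omega>. \<omega> \<in> space M \<Longrightarrow> cmod (Z \<omega>) \<le> K"
    and "\<And>a. expectation (\<lambda>\<omega>. iexp (\<Sum>j\<in>J. a j * X j \<omega>) * Z \<omega>) = 0"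
    and "\<And>j. j \<in> J \<Longrightarrow> B j \<in> sets borel"
  shows "expectation (\<lambda>\<omega>. complex_of_real (\<Prod>j\<in>J. indicator (B j) (X j \<omega>)) * Z \<omega>) = 0"
  using assms
proof (induction J arbitrary: Z K)
  case empty
  show ?case using empty(4) by simp
next
  case (insert j J)
  have [measurable]: "Z \<in> borel_measurable M" "X j \<in> borel_measurable M" "B j \<in> sets borel"
    using insert.prems by auto
  have Xm: "X i \<in> borel_measurable M" "B i \<in> sets borel" if "i \<in> J" for i
    using insert.prems that by auto
  have [measurable]: "(\<lambda>\<omega>. \<Prod>i\<in>J. indicat_real (B i) (X i \<omega>)) \<in> borel_measurable M"
    using Xm by measurable
  have pb: "\<bar>\<Prod>i\<in>J. indicat_real (B i) (X i \<omega>)\<bar> \<le> 1" for \<omega>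
    unfolding abs_prod by (intro prod_le_1) auto
  have "expectation (\<lambda>\<omega>. iexp (c * X j \<omega>) *
      (complex_of_real (\<Prod>i\<in>J. indicator (B i) (X i \<omega>)) * Z \<omega>)) = 0" for c
  proof -
    have "expectation (\<lambda>\<omega>. complex_of_real (\<Prod>i\<in>J. indicator (B i) (X i \<omega>)) * (iexp (c * X j \<omega>) * Z \<omega>)) = 0"
    proof (rule insert.IH[of _ K])
      fix a :: "'j \<Rightarrow> real"
      have "(\<Sum>i\<in>insert j J. (a(j := c)) i * X i \<omega>) = c * X j \<omega> + (\<Sum>i\<in>J. a i * X i \<omega>)" for \<omega>
      proof -
        have "(\<Sum>i\<in>J. (a(j := c)) i * X i \<omega>) = (\<Sum>i\<in>J. a i * X i \<omega>)"
          using insert.hyps by (intro sum.cong) auto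
        then show ?thesis using insert.hyps by simp
      qed
      then show "expectation (\<lambda>\<omega>. iexp (\<Sum>i\<in>J. a i * X i \<omega>) * (iexp (c * X j \<omega>) * Z \<omega>)) = 0"
        using insert.prems(4)[of "a(j := c)"] by (simp only: of_real_add distrib_left exp_add mult_ac)
    next
      show "(\<lambda>\<omega>. iexp (c * X j \<omega>) * Z \<omega>) \<in> borel_measurable M" by measurable
      show "cmod (iexp (c * X j \<omega>) * Z \<omega>) \<le> K" if "\<omega> \<in> space M" for \<omega>
        using insert.prems(3)[OF that] by (simp add: norm_mult)
    qed (use Xm in auto)
    then show ?thesis unfolding mult.left_commute[of "iexp _"] .
  qed
  note z' = this
  have "expectation (\<lambda>\<omega>. complex_of_real (indicator (B j) (X j \<omega>)) *
      (complex_of_real (\<Prod>i\<in>J. indicator (B i) (X i \<omega>)) * Z \<omega>)) = 0"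
  proof (rule iexp_weighted_zero[OF _ _ _ z', where K=K])
    fix \<omega> assume w: "\<omega> \<in> space M"
    have "cmod (complex_of_real (\<Prod>i\<in>J. indicator (B i) (X i \<omega>)) * Z \<omega>) \<le> 1 * cmod (Z \<omega>)"
      unfolding norm_mult norm_of_real by (intro mult_right_mono pb) auto
    then show "cmod (complex_of_real (\<Prod>i\<in>J. indicator (B i) (X i \<omega>)) * Z \<omega>) \<le> K"
      using insert.prems(3)[OF w] by simp
  qed measurable
  then show ?case unfolding prod.insert[OF insert.hyps(1,2)] of_real_mult mult.assoc .
qed

end

section \<open>White noise as a random measure, and the sigma-algebras it generates\<close>

locale white_noise_space = prob_space M for M :: "'a measure" +
  fixes W :: "(real \<times> real) set \<Rightarrow> 'a \<Rightarrow> real"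
  assumes white_noise: "white_noise M W"
begin

abbreviation NA :: "(real \<times> real) set \<Rightarrow> 'a measure" where "NA \<equiv> noise_alg M W"

lemma gaussian_W_sum:
  "finite J \<Longrightarrow> J \<subseteq> noise_sets \<Longrightarrow> centered_gaussian M (\<lambda>\<omega>. \<Sum>A\<in>J. c A * W A \<omega>)"
  using white_noise by (auto simp: white_noise_def centered_gaussian_process_def)

lemma gaussian_W: "A \<in> noise_sets \<Longrightarrow> centered_gaussian M (W A)"
  using gaussian_W_sum[of "{A}" "\<lambda>_. 1"] by simp

lemma W_measurable [measurable (raw)]: "A \<in> noise_sets \<Longrightarrow> W A \<in> borel_measurable M"
  using gaussian_W by (auto simp: centered_gaussian_def)

lemma W_square_integrable: "A \<in> noise_sets \<Longrightarrow> integrable M (\<lambda>\<omega>. (W A \<omega>)\<^sup>2)"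
  using centered_gaussian_exp_moments(1)[OF gaussian_W] .

lemma W_integrable: "A \<in> noise_sets \<Longrightarrow> integrable M (W A)"
  using centered_gaussian_exp_moments(2)[OF gaussian_W] .

lemma W_mean: "A \<in> noise_sets \<Longrightarrow> expectation (W A) = 0"
  using centered_gaussian_exp_moments(3)[OF gaussian_W] .

lemma W_cov: "A \<in> noise_sets \<Longrightarrow> B \<in> noise_sets \<Longrightarrow> expectation (\<lambda>\<omega>. W A \<omega> * W B \<omega>) = measure lborel (A \<inter> B)"
  using white_noise by (simp add: white_noise_def)

lemma W_mult_integrable: "A \<in> noise_sets \<Longrightarrow> B \<in> noise_sets \<Longrightarrow> integrable M (\<lambda>\<omega>. W A \<omega> * W B \<omega>)"
  by (intro square_integrable_mult W_square_integrable W_measurable)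

lemma W_var: "A \<in> noise_sets \<Longrightarrow> expectation (\<lambda>\<omega>. (W A \<omega>)\<^sup>2) = measure lborel A"
  using W_cov[of A A] by (simp add: power2_eq_square)

text \<open>The covariance determines the second moment of the difference of the two sides, and it
  is zero. Additivity is thus a consequence of the Gaussian description, but with an exceptional
  null set that depends on the sets.\<close>

lemma W_Int_Diff:
  assumes C: "C \<in> noise_sets" and A: "A \<in> sets borel"
  shows "AE \<omega> in M. W C \<omega> = W (C \<inter> A) \<omega> + W (C - A) \<omega>"
proof -
  let ?P = "C \<inter> A" and ?Q = "C - A"
  have P: "?P \<in> noise_sets" and Q: "?Q \<in> noise_sets" using C A by (auto intro: noise_sets_Int noise_sets_Diff)
  note [measurable] = W_measurable[OF C] W_measurable[OF P] W_measurable[OF Q]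
  have I: "integrable M (\<lambda>\<omega>. (W C \<omega> - (W ?P \<omega> + W ?Q \<omega>))\<^sup>2)"
    by (intro square_integrable_diff square_integrable_add W_square_integrable C P Q) measurable
  have m: "measure lborel C = measure lborel ?P + measure lborel ?Q"
  proof -
    have "?P \<inter> ?Q = {}" by auto
    then show ?thesis
      using P Q measure_Union[of lborel ?P ?Q] by (auto simp: noise_sets_def Int_Diff_Un less_top)
  qed
  have "expectation (\<lambda>\<omega>. (W C \<omega> - (W ?P \<omega> + W ?Q \<omega>))\<^sup>2) =
    expectation (\<lambda>\<omega>. W C \<omega> * W C \<omega> + W ?P \<omega> * W ?P \<omega> + W ?Q \<omega> * W ?Q \<omega> -
      2 * (W C \<omega> * W ?P \<omega>) - 2 * (W C \<omega> * W ?Q \<omega>) + 2 * (W ?P \<omega> * W ?Q \<omega>))"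
    by (intro Bochner_Integration.integral_cong) (auto simp: power2_eq_square algebra_simps)
  also have "\<dots> = measure lborel (C \<inter> C) + measure lborel (?P \<inter> ?P) + measure lborel (?Q \<inter> ?Q) -
      2 * measure lborel (C \<inter> ?P) - 2 * measure lborel (C \<inter> ?Q) + 2 * measure lborel (?P \<inter> ?Q)"
    using C P Q W_mult_integrable W_cov by simp
  also have "C \<inter> ?P = ?P" by auto
  also have "C \<inter> ?Q = ?Q" by auto
  also have "?P \<inter> ?Q = {}" by auto
  finally have "expectation (\<lambda>\<omega>. (W C \<omega> - (W ?P \<omega> + W ?Q \<omega>))\<^sup>2) = 0" using m by simp
  then have "AE \<omega> in M. (W C \<omega> - (W ?P \<omega> + W ?Q \<omega>))\<^sup>2 = 0"
    using integral_nonneg_eq_0_iff_AE[OF I] by simp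
  then show ?thesis by simp
qed

lemma space_NA [simp]: "space (NA S) = space M"
  by (simp add: noise_alg_def space_measure_of_conv)

lemma sets_NA: "sets (NA S) = sigma_sets (space M)
       ({W A -` B \<inter> space M | A B. A \<in> noise_sets \<and> A \<subseteq> S \<and> B \<in> sets borel} \<union> null_sets M)"
  unfolding noise_alg_def using sets.sets_into_space by (subst sets_measure_of) (auto dest: null_setsD2)

lemma NA_subalgebra: "subalgebra M (NA S)"
proof -
  have "sets (NA S) \<subseteq> sets M"
    unfolding sets_NA by (rule sets.sigma_sets_subset) (auto intro!: measurable_sets[OF W_measurable])
  then show ?thesis by (simp add: subalgebra_def)
qed

lemma NA_measurable_M: "f \<in> borel_measurable (NA S) \<Longrightarrow> f \<in> borel_measurable M"
  using NA_subalgebra measurable_from_subalg by blast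

lemma NA_mono: "S \<subseteq> S' \<Longrightarrow> sets (NA S) \<subseteq> sets (NA S')"
  unfolding sets_NA by (intro sigma_sets_mono') blast

lemma NA_measurable_mono: "S \<subseteq> S' \<Longrightarrow> f \<in> borel_measurable (NA S) \<Longrightarrow> f \<in> borel_measurable (NA S')"
  using NA_mono by (metis (no_types, lifting) borel_measurable_subalgebra space_NA)

lemma W_NA_measurable: "A \<in> noise_sets \<Longrightarrow> A \<subseteq> S \<Longrightarrow> W A \<in> borel_measurable (NA S)"
  by (rule measurableI) (auto simp: sets_NA)

lemma null_sets_NA: "N \<in> null_sets M \<Longrightarrow> N \<in> sets (NA S)"
  by (auto simp: sets_NA)

text \<open>The preimages under \<open>f\<close> and \<open>g\<close> differ by null sets, all of
  which belong to \<open>F\<close>. It transfers measurability across identities such as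
  \<open>W_Int_Diff\<close>.\<close>

lemma measurable_AE_subalgebra:
  assumes F: "subalgebra M F" "null_sets M \<subseteq> sets F"
    and f: "f \<in> borel_measurable F" and g: "g \<in> borel_measurable M" and ae: "AE \<omega> in M. f \<omega> = g \<omega>"
  shows "g \<in> borel_measurable F"
proof (rule measurableI)
  fix B :: "'b set" assume B: "B \<in> sets borel"
  have sp: "space F = space M" using F by (simp add: subalgebra_def)
  let ?f = "f -` B \<inter> space M" and ?g = "g -` B \<inter> space M"
  have fs: "?f \<in> sets F" using measurable_sets[OF f B] sp by simp
  have gs: "?g \<in> sets M" using measurable_sets[OF g B] .
  have fM: "?f \<in> sets M" using fs F by (auto simp: subalgebra_def)
  from ae obtain N where N: "N \<in> null_sets M" "{\<omega> \<in> space M. f \<omega> \<noteq> g \<omega>} \<subseteq> N"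
    by (auto elim!: AE_E simp: null_sets_def)
  have n1: "?g - ?f \<in> sets F" using N gs fM F by (intro subsetD[OF F(2)] null_sets_subset[OF N(1)]) auto
  have n2: "?f - ?g \<in> sets F" using N gs fM F by (intro subsetD[OF F(2)] null_sets_subset[OF N(1)]) auto
  have "(?f - (?f - ?g)) \<union> (?g - ?f) \<in> sets F"
    by (rule sets.Un[OF sets.Diff[OF fs n2] n1])
  moreover have "(?f - (?f - ?g)) \<union> (?g - ?f) = ?g" by auto
  ultimately show "g -` B \<inter> space F \<in> sets F" using sp by simp
qed simp

text \<open>An intersection-stable family whose sigma-algebra contains \<open>NA S\<close>, as the
  pi-lambda argument for independence requires. The null sets are adjoined to match the augmentation
  in \<open>noise_alg\<close>.\<close>

definition cylinders :: "(real \<times> real) set \<Rightarrow> 'a set set" where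
  "cylinders S = {{\<omega> \<in> space M. \<forall>A\<in>J. W A \<omega> \<in> B A} | J B. finite J \<and> J \<subseteq> noise_sets \<and> (\<forall>A\<in>J. A \<subseteq> S) \<and>
      (\<forall>A\<in>J. B A \<in> sets borel)} \<union> null_sets M"

lemma cylinder_sets_M:
  assumes "finite J" "J \<subseteq> noise_sets" "\<forall>A\<in>J. B A \<in> sets borel"
  shows "{\<omega> \<in> space M. \<forall>A\<in>J. W A \<omega> \<in> B A} \<in> sets M"
proof -
  have "{\<omega> \<in> space M. W A \<omega> \<in> B A} \<in> sets M" if "A \<in> J" for A
    using measurable_sets[OF W_measurable, of A "B A"] that assms by (auto simp: vimage_def Int_def conj_commute)
  then show ?thesis by (intro sets.sets_Collect_finite_All' sets.sets_Collect_finite_All) (use assms in auto)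
qed

lemma cylinders_events: "cylinders S \<subseteq> events"
  unfolding cylinders_def using cylinder_sets_M by auto

lemma Int_stable_cylinders: "Int_stable (cylinders S)"
proof (rule Int_stableI)
  fix a b assume ab: "a \<in> cylinders S" "b \<in> cylinders S"
  show "a \<inter> b \<in> cylinders S"
  proof (cases "a \<in> null_sets M \<or> b \<in> null_sets M")
    case True
    then have "a \<inter> b \<in> null_sets M"
      using ab cylinders_events by (auto intro: null_set_Int1 null_set_Int2)
    then show ?thesis by (simp add: cylinders_def)
  next
    case False
    with ab obtain J1 B1 J2 B2 where 1: "a = {\<omega> \<in> space M. \<forall>A\<in>J1. W A \<omega> \<in> B1 A}" "finite J1" "J1 \<subseteq> noise_sets"
       "\<forall>A\<in>J1. A \<subseteq> S" "\<forall>A\<in>J1. B1 A \<in> sets borel"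
      and 2: "b = {\<omega> \<in> space M. \<forall>A\<in>J2. W A \<omega> \<in> B2 A}" "finite J2" "J2 \<subseteq> noise_sets"
       "\<forall>A\<in>J2. A \<subseteq> S" "\<forall>A\<in>J2. B2 A \<in> sets borel"
      unfolding cylinders_def by blast
    define B where "B A = (if A \<in> J1 then B1 A else UNIV) \<inter> (if A \<in> J2 then B2 A else UNIV)" for A
    have "a \<inter> b = {\<omega> \<in> space M. \<forall>A\<in>J1 \<union> J2. W A \<omega> \<in> B A}" by (auto simp: 1 2 B_def)
    moreover have "finite (J1 \<union> J2)" "J1 \<union> J2 \<subseteq> noise_sets" "\<forall>A\<in>J1 \<union> J2. A \<subseteq> S" "\<forall>A\<in>J1\<union>J2. B A \<in> sets borel"
      using 1 2 by (auto simp: B_def)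
    ultimately show ?thesis unfolding cylinders_def by blast
  qed
qed

lemma NA_le_cylinders: "sets (NA S) \<subseteq> sigma_sets (space M) (cylinders S)"
proof -
  have "{W A -` B \<inter> space M | A B. A \<in> noise_sets \<and> A \<subseteq> S \<and> B \<in> sets borel} \<union> null_sets M \<subseteq> cylinders S"
  proof -
    have "W A -` B \<inter> space M \<in> cylinders S" if "A \<in> noise_sets" "A \<subseteq> S" "B \<in> sets borel" for A B
    proof -
      have "W A -` B \<inter> space M = {\<omega> \<in> space M. \<forall>A\<in>{A}. W A \<omega> \<in> (\<lambda>_. B) A}" by auto
      then show ?thesis unfolding cylinders_def using that
        by (intro UnI1 CollectI exI[of _ "{A}"] exI[of _ "\<lambda>_. B"]) auto
    qed
    then show ?thesis by (auto simp: cylinders_def)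
  qed
  then show ?thesis unfolding sets_NA by (rule sigma_sets_mono')
qed

text \<open>The joint sum is again centered Gaussian, and disjointness makes every covariance
  between the two families vanish. Hence the variances add, and the Gaussian characteristic function
  factorizes.\<close>

lemma iexp_sums_disjoint:
  assumes J1: "finite J1" "J1 \<subseteq> noise_sets" "\<forall>A\<in>J1. A \<subseteq> S1"
    and J2: "finite J2" "J2 \<subseteq> noise_sets" "\<forall>A\<in>J2. A \<subseteq> S2" and disj: "S1 \<inter> S2 = {}"
  defines "X \<equiv> \<lambda>a \<omega>. \<Sum>A\<in>J1. a A * W A \<omega>" and "Y \<equiv> \<lambda>b \<omega>. \<Sum>A\<in>J2. b A * W A \<omega>"
  shows "expectation (\<lambda>\<omega>. iexp (X a \<omega>) * iexp (Y b \<omega>)) =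
    expectation (\<lambda>\<omega>. iexp (X a \<omega>)) * expectation (\<lambda>\<omega>. iexp (Y b \<omega>))"
proof -
  \<comment> \<open>The empty set may belong to both families, so coefficients are added instead of
    selected.\<close>
  define c where "c A = (if A \<in> J1 then a A else 0) + (if A \<in> J2 then b A else 0)" for A
  have XY: "X a \<omega> + Y b \<omega> = (\<Sum>A\<in>J1 \<union> J2. c A * W A \<omega>)" for \<omega>
  proof -
    have "(\<Sum>A\<in>J1 \<union> J2. c A * W A \<omega>) =
      (\<Sum>A\<in>J1 \<union> J2. if A \<in> J1 then a A * W A \<omega> else 0) + (\<Sum>A\<in>J1 \<union> J2. if A \<in> J2 then b A * W A \<omega> else 0)"
      unfolding sum.distrib[symmetric] by (intro sum.cong) (auto simp: c_def algebra_simps)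
    also have "(\<Sum>A\<in>J1 \<union> J2. if A \<in> J1 then a A * W A \<omega> else 0) = X a \<omega>"
      unfolding X_def using J1 J2 by (intro sum.mono_neutral_cong_right) auto
    also have "(\<Sum>A\<in>J1 \<union> J2. if A \<in> J2 then b A * W A \<omega> else 0) = Y b \<omega>"
      unfolding Y_def using J1 J2 by (intro sum.mono_neutral_cong_right) auto
    finally show ?thesis by simp
  qed
  have gX: "centered_gaussian M (X a)" unfolding X_def using J1 by (intro gaussian_W_sum)
  have gY: "centered_gaussian M (Y b)" unfolding Y_def using J2 by (intro gaussian_W_sum)
  have gXY: "centered_gaussian M (\<lambda>\<omega>. X a \<omega> + Y b \<omega>)"
    unfolding XY using J1 J2 by (intro gaussian_W_sum) auto
  have [measurable]: "X a \<in> borel_measurable M" "Y b \<in> borel_measurable M"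
    using gX gY by (auto simp: centered_gaussian_def)
  have xy: "integrable M (\<lambda>\<omega>. X a \<omega> * Y b \<omega>)"
    by (intro square_integrable_mult centered_gaussian_exp_moments(1) gX gY) measurable
  have "expectation (\<lambda>\<omega>. X a \<omega> * Y b \<omega>) = (\<Sum>A\<in>J1. \<Sum>B\<in>J2. a A * b B * measure lborel (A \<inter> B))"
  proof -
    have "expectation (\<lambda>\<omega>. X a \<omega> * Y b \<omega>) = expectation (\<lambda>\<omega>. \<Sum>A\<in>J1. \<Sum>B\<in>J2. (a A * b B) * (W A \<omega> * W B \<omega>))"
      by (simp add: X_def Y_def sum_product mult_ac)
    also have "\<dots> = (\<Sum>A\<in>J1. \<Sum>B\<in>J2. a A * b B * measure lborel (A \<inter> B))"
      using J1 J2 by (subst Bochner_Integration.integral_sum)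
        (auto intro!: sum.cong Bochner_Integration.integrable_sum W_mult_integrable simp: subset_iff W_cov W_mult_integrable)
    finally show ?thesis .
  qed
  also have "\<dots> = 0"
  proof (intro sum.neutral ballI)
    fix A B assume "A \<in> J1" "B \<in> J2"
    then have "A \<inter> B = {}" using J1 J2 disj by blast
    then show "a A * b B * measure lborel (A \<inter> B) = 0" by simp
  qed
  finally have xy0: "expectation (\<lambda>\<omega>. X a \<omega> * Y b \<omega>) = 0" .
  have v: "expectation (\<lambda>\<omega>. (X a \<omega> + Y b \<omega>)\<^sup>2) = expectation (\<lambda>\<omega>. (X a \<omega>)\<^sup>2) + expectation (\<lambda>\<omega>. (Y b \<omega>)\<^sup>2)"
    using xy xy0 centered_gaussian_exp_moments(1)[OF gX] centered_gaussian_exp_moments(1)[OF gY]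
    by (simp add: power2_sum mult.assoc)
  have e: "expectation (\<lambda>\<omega>. iexp (Z \<omega>)) = exp (- expectation (\<lambda>\<omega>. (Z \<omega>)\<^sup>2) / 2)"
    if "centered_gaussian M Z" for Z
    using centered_gaussian_exp_moments(6)[OF that, of 1] by simp
  have "expectation (\<lambda>\<omega>. iexp (X a \<omega>) * iexp (Y b \<omega>)) = expectation (\<lambda>\<omega>. iexp (X a \<omega> + Y b \<omega>))"
    by (simp add: distrib_left exp_add)
  also have "\<dots> = exp (- (expectation (\<lambda>\<omega>. (X a \<omega>)\<^sup>2) + expectation (\<lambda>\<omega>. (Y b \<omega>)\<^sup>2)) / 2)"
    using e[OF gXY] v by simp
  also have "\<dots> = expectation (\<lambda>\<omega>. iexp (X a \<omega>)) * expectation (\<lambda>\<omega>. iexp (Y b \<omega>))"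
    unfolding e[OF gX] e[OF gY] of_real_mult[symmetric] exp_add[symmetric]
    by (simp add: add_divide_distrib diff_divide_distrib)
  finally show ?thesis .
qed

text \<open>Factorization of characteristic functions is turned into factorization of probabilities
  by applying \<open>iexp_weighted_zero_prod\<close> twice: once to the first family, with a
  centered exponential of the second as weight, then to the second family, with the centered
  indicator of \<open>a\<close> as weight.\<close>

lemma cylinders_indep:
  assumes disj: "S1 \<inter> S2 = {}" and a: "a \<in> cylinders S1" and b: "b \<in> cylinders S2"
  shows "prob (a \<inter> b) = prob a * prob b"
proof (cases "a \<in> null_sets M \<or> b \<in> null_sets M")
  case True
  then have "a \<inter> b \<in> null_sets M"
    using a b cylinders_events by (auto intro: null_set_Int1 null_set_Int2)
  then show ?thesis using True by (auto simp: null_sets_def measure_def)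
next
  case False
  with a b obtain J1 B1 J2 B2 where 1: "a = {\<omega> \<in> space M. \<forall>A\<in>J1. W A \<omega> \<in> B1 A}" "finite J1" "J1 \<subseteq> noise_sets"
     "\<forall>A\<in>J1. A \<subseteq> S1" "\<forall>A\<in>J1. B1 A \<in> sets borel"
    and 2: "b = {\<omega> \<in> space M. \<forall>A\<in>J2. W A \<omega> \<in> B2 A}" "finite J2" "J2 \<subseteq> noise_sets"
     "\<forall>A\<in>J2. A \<subseteq> S2" "\<forall>A\<in>J2. B2 A \<in> sets borel"
    unfolding cylinders_def by blast
  have Wm: "\<And>A. A \<in> J1 \<Longrightarrow> W A \<in> borel_measurable M" "\<And>A. A \<in> J2 \<Longrightarrow> W A \<in> borel_measurable M"
    using 1 2 by (auto intro: W_measurable)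
  have [measurable]: "a \<in> sets M" "b \<in> sets M" using a b cylinders_events by auto
  define X where "X c \<omega> = (\<Sum>A\<in>J1. c A * W A \<omega>)" for c \<omega>
  define Y where "Y c \<omega> = (\<Sum>A\<in>J2. c A * W A \<omega>)" for c \<omega>
  have [measurable]: "X c \<in> borel_measurable M" "Y c \<in> borel_measurable M" for c
    unfolding X_def Y_def using Wm by measurable
  define ia where "ia \<omega> = (\<Prod>A\<in>J1. indicat_real (B1 A) (W A \<omega>))" for \<omega>
  define ib where "ib \<omega> = (\<Prod>A\<in>J2. indicat_real (B2 A) (W A \<omega>))" for \<omega>
  have [measurable]: "ia \<in> borel_measurable M" "ib \<in> borel_measurable M"
    unfolding ia_def ib_def using Wm 1 2 by measurable
  have ia: "ia \<omega> = indicator a \<omega>" if "\<omega> \<in> space M" for \<omega>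
    using that 1(2) by (auto simp: ia_def 1(1) indicator_def)
  have ib: "ib \<omega> = indicator b \<omega>" if "\<omega> \<in> space M" for \<omega>
    using that 2(2) by (auto simp: ib_def 2(1) indicator_def)
  have eia: "expectation ia = prob a" using ia by (subst Bochner_Integration.integral_cong[where g="indicator a"]) auto
  have iei: "integrable M (\<lambda>\<omega>. iexp (Y d \<omega>))" for d
    by (rule integrable_const_bound[of _ 1]) auto
  have step1: "expectation (\<lambda>\<omega>. complex_of_real (ia \<omega>) * (iexp (Y d \<omega>) - expectation (\<lambda>\<omega>. iexp (Y d \<omega>)))) = 0" for d
    unfolding ia_def
  proof (rule iexp_weighted_zero_prod)
    show "cmod (iexp (Y d \<omega>) - expectation (\<lambda>\<omega>. iexp (Y d \<omega>))) \<le> 1 + cmod (expectation (\<lambda>\<omega>. iexp (Y d \<omega>)))" for \<omega>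
      by (rule order_trans[OF norm_triangle_ineq4]) simp
    fix c
    have i: "integrable M (\<lambda>\<omega>. iexp (X c \<omega>))" "integrable M (\<lambda>\<omega>. iexp (X c \<omega>) * iexp (Y d \<omega>))"
      by (auto intro!: integrable_const_bound[of _ 1] simp: norm_mult)
    show "expectation (\<lambda>\<omega>. iexp (\<Sum>A\<in>J1. c A * W A \<omega>) * (iexp (Y d \<omega>) - expectation (\<lambda>\<omega>. iexp (Y d \<omega>)))) = 0"
      using iexp_sums_disjoint[OF 1(2-4) 2(2-4) disj, of c d] i
      unfolding X_def[symmetric] Y_def[symmetric] right_diff_distrib by simp
  qed (use 1 Wm in auto)
  have "expectation (\<lambda>\<omega>. complex_of_real (ib \<omega>) * complex_of_real (ia \<omega> - prob a)) = 0"
    unfolding ib_def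
  proof (rule iexp_weighted_zero_prod)
    have pa: "\<bar>indicator a \<omega> - prob a\<bar> \<le> 1" for \<omega>
      using prob_le_1[of a] measure_nonneg[of M a] by (auto simp: indicator_def)
    show "cmod (complex_of_real (ia \<omega> - prob a)) \<le> 1" if "\<omega> \<in> space M" for \<omega>
      unfolding norm_of_real ia[OF that] by (rule pa)
    fix d
    have i: "integrable M (\<lambda>\<omega>. complex_of_real (ia \<omega>) * iexp (Y d \<omega>))"
       "integrable M (\<lambda>\<omega>. complex_of_real (ia \<omega>))"
      by (auto intro!: integrable_const_bound[of _ 1] simp: norm_mult ia indicator_def)
    have "expectation (\<lambda>\<omega>. complex_of_real (ia \<omega>) * iexp (Y d \<omega>)) =
        expectation (\<lambda>\<omega>. complex_of_real (ia \<omega>)) * expectation (\<lambda>\<omega>. iexp (Y d \<omega>))"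
      using step1[of d] i by (simp add: right_diff_distrib)
    moreover have "expectation (\<lambda>\<omega>. complex_of_real (ia \<omega>)) = prob a"
      using eia by simp
    ultimately show "expectation (\<lambda>\<omega>. iexp (\<Sum>A\<in>J2. d A * W A \<omega>) * complex_of_real (ia \<omega> - prob a)) = 0"
      using i iei[of d] unfolding Y_def[symmetric] of_real_diff right_diff_distrib
      by (simp add: mult.commute)
  qed (use 2 Wm in auto)
  then have "complex_of_real (expectation (\<lambda>\<omega>. ib \<omega> * (ia \<omega> - prob a))) = 0"
    by (simp only: of_real_mult[symmetric] integral_complex_of_real)
  then have "expectation (\<lambda>\<omega>. ib \<omega> * (ia \<omega> - prob a)) = 0" by simp
  moreover have "expectation (\<lambda>\<omega>. ib \<omega> * (ia \<omega> - prob a)) = expectation (\<lambda>\<omega>. indicator (a \<inter> b) \<omega> - prob a * indicator b \<omega>)"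
    by (intro Bochner_Integration.integral_cong) (auto simp: ia ib indicator_def)
  moreover have "\<dots> = prob (a \<inter> b) - prob a * prob b"
    by (subst Bochner_Integration.integral_diff) (auto intro!: integrable_const_bound[of _ 1])
  ultimately show ?thesis by simp
qed

theorem indep_NA:
  assumes "S1 \<inter> S2 = {}"
  shows "indep_set (sets (NA S1)) (sets (NA S2))"
proof -
  have "indep_set (cylinders S1) (cylinders S2)"
    by (intro indep_setI cylinders_events cylinders_indep[OF assms])
  then have "indep_set (sigma_sets (space M) (cylinders S1)) (sigma_sets (space M) (cylinders S2))"
    by (rule indep_set_sigma_sets) (rule Int_stable_cylinders)+
  then show ?thesis
    using NA_le_cylinders[of S1] NA_le_cylinders[of S2] unfolding indep_sets2_eq
    by (auto simp: subset_iff)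
qed

lemma indep_NA_var:
  fixes f g :: "'a \<Rightarrow> real"
  assumes disj: "S1 \<inter> S2 = {}" and f: "f \<in> borel_measurable (NA S1)" and g: "g \<in> borel_measurable (NA S2)"
  shows "indep_var borel f borel g"
  unfolding indep_var_eq
proof (intro conjI)
  have "sigma_sets (space M) {f -` A \<inter> space M |A. A \<in> sets borel} \<subseteq> sets (NA S1)"
    using sets.sigma_sets_subset[of "{f -` A \<inter> space M |A. A \<in> sets borel}" "NA S1"] measurable_sets[OF f] by auto
  moreover have "sigma_sets (space M) {g -` A \<inter> space M |A. A \<in> sets borel} \<subseteq> sets (NA S2)"
    using sets.sigma_sets_subset[of "{g -` A \<inter> space M |A. A \<in> sets borel}" "NA S2"] measurable_sets[OF g] by auto
  ultimately show "indep_set (sigma_sets (space M) {f -` A \<inter> space M |A. A \<in> sets borel})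
      (sigma_sets (space M) {g -` A \<inter> space M |A. A \<in> sets borel})"
    using indep_NA[OF disj] unfolding indep_sets2_eq by blast
qed (use NA_measurable_M f g in auto)

lemma indep_NA_mult:
  fixes f g :: "'a \<Rightarrow> real"
  assumes "S1 \<inter> S2 = {}" "f \<in> borel_measurable (NA S1)" "g \<in> borel_measurable (NA S2)"
    and "integrable M f" "integrable M g"
  shows "integrable M (\<lambda>\<omega>. f \<omega> * g \<omega>)" "expectation (\<lambda>\<omega>. f \<omega> * g \<omega>) = expectation f * expectation g"
  using indep_var_integrable[OF indep_NA_var[OF assms(1-3)] assms(4,5)]
    indep_var_lebesgue_integral[OF indep_NA_var[OF assms(1-3)] assms(4,5)] by auto

end

subsection \<open>Conditional expectations with respect to the noise in a region\<close>

context white_noise_space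
begin

definition cexp :: "(real \<times> real) set \<Rightarrow> ('a \<Rightarrow> real) \<Rightarrow> 'a \<Rightarrow> real" where
  "cexp S X = real_cond_exp M (NA S) X"

lemma NA_sigma_finite: "sigma_finite_subalgebra M (NA S)"
  by (rule finite_measure_subalgebra_is_sigma_finite, unfold_locales) (rule NA_subalgebra)

lemma cexp_measurable: "cexp S X \<in> borel_measurable (NA S)"
  by (simp add: cexp_def)

lemma cexp_measurable_M [measurable]: "cexp S X \<in> borel_measurable M"
  by (simp add: cexp_def)

lemma cexp_integrable: "integrable M X \<Longrightarrow> integrable M (cexp S X)"
  unfolding cexp_def by (rule sigma_finite_subalgebra.real_cond_exp_int(1)[OF NA_sigma_finite])

lemma cexp_square_integrable:
  assumes [measurable]: "X \<in> borel_measurable M" and X: "integrable M (\<lambda>\<omega>. (X \<omega>)\<^sup>2)"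
  shows "integrable M (\<lambda>\<omega>. (cexp S X \<omega>)\<^sup>2)"
  unfolding cexp_def
proof (rule sigma_finite_subalgebra.integrable_convex_cond_exp[OF NA_sigma_finite, where I=UNIV])
  show "integrable M X" using square_integrable_imp_integrable'[OF _ X] by simp
  have "convex_on UNIV (\<lambda>x::real. x\<^sup>2)"
    by (rule convex_on_realI[where f'="\<lambda>x. 2 * x"]) (auto intro!: derivative_eq_intros)
  then show "convex_on UNIV (power2 :: real \<Rightarrow> real)" by simp
qed (use X emeasure_space_1 in auto)

lemma cexp_mult:
  assumes "f \<in> borel_measurable (NA S)" "X \<in> borel_measurable M" "integrable M (\<lambda>\<omega>. f \<omega> * X \<omega>)"
  shows "integrable M (\<lambda>\<omega>. f \<omega> * cexp S X \<omega>)" "expectation (\<lambda>\<omega>. f \<omega> * cexp S X \<omega>) = expectation (\<lambda>\<omega>. f \<omega> * X \<omega>)"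
  unfolding cexp_def
  using sigma_finite_subalgebra.real_cond_exp_intg[OF NA_sigma_finite assms(3,1,2)] by auto

text \<open>Pythagoras: the difference of the two approximants is measurable with respect to
  \<open>NA S\<close>, hence orthogonal to \<open>X - cexp S X\<close>. Later bounds therefore only
  need to exhibit some convenient \<open>Z\<close> instead of computing the conditional
  expectation.\<close>

lemma cexp_best_approx:
  assumes [measurable]: "X \<in> borel_measurable M" and X: "integrable M (\<lambda>\<omega>. (X \<omega>)\<^sup>2)"
    and Z: "Z \<in> borel_measurable (NA S)" and Z2: "integrable M (\<lambda>\<omega>. (Z \<omega>)\<^sup>2)"
  shows "expectation (\<lambda>\<omega>. (X \<omega> - cexp S X \<omega>)\<^sup>2) \<le> expectation (\<lambda>\<omega>. (X \<omega> - Z \<omega>)\<^sup>2)"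
proof -
  have [measurable]: "Z \<in> borel_measurable M" by (rule NA_measurable_M[OF Z])
  define D where "D \<omega> = cexp S X \<omega> - Z \<omega>" for \<omega>
  have D: "D \<in> borel_measurable (NA S)" unfolding D_def using Z cexp_measurable by measurable
  have [measurable]: "D \<in> borel_measurable M" by (rule NA_measurable_M[OF D])
  have D2: "integrable M (\<lambda>\<omega>. (D \<omega>)\<^sup>2)" unfolding D_def
    by (intro square_integrable_diff cexp_square_integrable X Z2) measurable
  have DX: "integrable M (\<lambda>\<omega>. D \<omega> * X \<omega>)" by (intro square_integrable_mult D2 X) measurable
  note DXc = cexp_mult[OF D _ DX, simplified]
  have XC: "integrable M (\<lambda>\<omega>. (X \<omega> - cexp S X \<omega>)\<^sup>2)"
    by (intro square_integrable_diff cexp_square_integrable X) measurable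
  have "expectation (\<lambda>\<omega>. (X \<omega> - Z \<omega>)\<^sup>2) =
     expectation (\<lambda>\<omega>. (X \<omega> - cexp S X \<omega>)\<^sup>2 + (D \<omega>)\<^sup>2 + 2 * (D \<omega> * X \<omega> - D \<omega> * cexp S X \<omega>))"
    by (intro Bochner_Integration.integral_cong) (auto simp: D_def power2_eq_square algebra_simps)
  also have "\<dots> = expectation (\<lambda>\<omega>. (X \<omega> - cexp S X \<omega>)\<^sup>2) + expectation (\<lambda>\<omega>. (D \<omega>)\<^sup>2)"
    using XC D2 DX DXc by simp
  finally show ?thesis by simp
qed

text \<open>Dynkin's argument. Closure under complements uses that the integral over the whole space
  vanishes.\<close>

lemma set_integral_zero_generated:
  fixes Y :: "'a \<Rightarrow> real"
  assumes Y: "integrable M Y" "expectation Y = 0" and G: "G \<subseteq> sets M" "Int_stable G"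
    and z: "\<And>B. B \<in> G \<Longrightarrow> (\<integral>\<omega>\<in>B. Y \<omega> \<partial>M) = 0"
    and B: "B \<in> sigma_sets (space M) G"
  shows "(\<integral>\<omega>\<in>B. Y \<omega> \<partial>M) = 0"
proof -
  have si: "set_integrable M B Y" if "B \<in> sets M" for B
    unfolding set_integrable_def using integrable_mult_indicator[OF that Y(1)] .
  have GM: "sigma_sets (space M) G \<subseteq> sets M" using G by (simp add: sets.sigma_sets_subset)
  have GP: "G \<subseteq> Pow (space M)" using G sets.sets_into_space by auto
  show ?thesis
    using G(2) GP B
  proof (induction B rule: sigma_sets_induct_disjoint)
    case (basic A) then show ?case by (rule z)
  next
    case empty show ?case by (simp add: set_lebesgue_integral_def)
  next
    case (compl A)
    then have A: "A \<in> sets M" using GM by auto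
    have e1: "(\<integral>\<omega>\<in>(A \<union> (space M - A)). Y \<omega> \<partial>M) = (\<integral>\<omega>\<in>A. Y \<omega> \<partial>M) + (\<integral>\<omega>\<in>space M - A. Y \<omega> \<partial>M)"
      by (rule set_integral_Un) (auto intro!: si A)
    have e2: "A \<union> (space M - A) = space M" using sets.sets_into_space[OF A] by auto
    have e3: "(\<integral>\<omega>\<in>space M. Y \<omega> \<partial>M) = 0" using Y by (simp add: set_integral_space)
    have e4: "(\<integral>\<omega>\<in>A. Y \<omega> \<partial>M) = 0" by (rule compl)
    have "(\<integral>\<omega>\<in>space M - A. Y \<omega> \<partial>M) = (\<integral>\<omega>\<in>A \<union> (space M - A). Y \<omega> \<partial>M)"
      unfolding e1 e4 by (rule add_0[symmetric])
    also have "\<dots> = 0" unfolding e2 by (rule e3)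
    finally show ?case .
  next
    case (union A)
    have AM: "A i \<in> sets M" for i using union(2) GM by auto
    have "(\<integral>\<omega>\<in>(\<Union>i. A i). Y \<omega> \<partial>M) = (\<Sum>i. (\<integral>\<omega>\<in>A i. Y \<omega> \<partial>M))"
      by (intro lebesgue_integral_countable_add si sets.countable_UN)
         (use AM union(1) in \<open>auto simp: disjoint_family_on_def\<close>)
    then show ?case using union(3) by simp
  qed
qed

text \<open>The noise in \<open>A - P\<close> is independent of everything that depends on the noise
  in \<open>P\<close>, so conditioning on it adds nothing. With \<open>P\<close> a time slab this
  shows that conditioning an adapted coefficient on the noise in \<open>A\<close> keeps it adapted,
  which the localized stochastic integral needs.\<close>

lemma cexp_restrict:
  assumes A: "A \<in> sets borel" and P: "P \<in> sets borel"
    and X: "X \<in> borel_measurable (NA P)" and Xi: "integrable M X"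
  shows "AE \<omega> in M. cexp A X \<omega> = cexp (A \<inter> P) X \<omega>"
proof -
  have [measurable]: "X \<in> borel_measurable M" by (rule NA_measurable_M[OF X])
  define Y where "Y \<omega> = X \<omega> - cexp (A \<inter> P) X \<omega>" for \<omega>
  \<comment> \<open>A generating system for the noise in \<open>A\<close>: on
    \<open>B1 \<inter> B2\<close> the integral of \<open>Y\<close> factorizes, since
    \<open>Y\<close> and \<open>B1\<close> depend on the noise in \<open>P\<close> and
    \<open>B2\<close> on the noise outside. The factor with \<open>B1\<close> vanishes by the
    definition of the conditional expectation.\<close>
  define G where "G = {B1 \<inter> B2 | B1 B2. B1 \<in> sets (NA (A \<inter> P)) \<and> B2 \<in> sets (NA (A - P))}"
  have sM: "sets (NA S) \<subseteq> sets M" for S using NA_subalgebra by (simp add: subalgebra_def)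
  have GM: "G \<subseteq> sets M" unfolding G_def using sM by auto
  have Gi: "Int_stable G"
  proof (rule Int_stableI)
    fix a b assume "a \<in> G" "b \<in> G"
    then obtain a1 a2 b1 b2 where "a = a1 \<inter> a2" "b = b1 \<inter> b2" "a1 \<in> sets (NA (A \<inter> P))" "b1 \<in> sets (NA (A \<inter> P))"
      "a2 \<in> sets (NA (A - P))" "b2 \<in> sets (NA (A - P))" unfolding G_def by blast
    moreover from this have "a \<inter> b = (a1 \<inter> b1) \<inter> (a2 \<inter> b2)" by auto
    ultimately show "a \<inter> b \<in> G" unfolding G_def mem_Collect_eq
      by (intro exI[of _ "a1 \<inter> b1"] exI[of _ "a2 \<inter> b2"] conjI sets.Int)
  qed
  have Ym: "Y \<in> borel_measurable (NA P)"
    unfolding Y_def using NA_measurable_mono[OF _ cexp_measurable, of "A \<inter> P" P] X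
    by (intro borel_measurable_diff) auto
  have Yi: "integrable M Y" unfolding Y_def using Xi cexp_integrable by auto
  have Y0: "expectation Y = 0" unfolding Y_def
    using Xi cexp_integrable[OF Xi] cexp_mult(2)[of "\<lambda>_. 1" "A \<inter> P" X] by simp
  have z: "(\<integral>\<omega>\<in>B. Y \<omega> \<partial>M) = 0" if B: "B \<in> G" for B
  proof -
    from B obtain B1 B2 where B12: "B = B1 \<inter> B2" "B1 \<in> sets (NA (A \<inter> P))" "B2 \<in> sets (NA (A - P))"
      unfolding G_def by blast
    have [measurable]: "B1 \<in> sets M" "B2 \<in> sets M" using B12 sM by auto
    have i1: "indicator B1 \<in> borel_measurable (NA (A \<inter> P))" using B12 by simp
    have b1: "B1 \<in> sets (NA P)" using B12 NA_mono[of "A \<inter> P" P] by auto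
    have "(\<integral>\<omega>\<in>B. Y \<omega> \<partial>M) = expectation (\<lambda>\<omega>. (indicator B1 \<omega> * Y \<omega>) * indicator B2 \<omega>)"
      unfolding set_lebesgue_integral_def B12 by (intro Bochner_Integration.integral_cong) (auto simp: indicator_def)
    also have "\<dots> = expectation (\<lambda>\<omega>. indicator B1 \<omega> * Y \<omega>) * expectation (indicator B2)"
    proof (rule indep_NA_mult(2)[of P "A - P"])
      show "(\<lambda>\<omega>. indicator B1 \<omega> * Y \<omega>) \<in> borel_measurable (NA P)" using Ym b1 by measurable
      show "indicator B2 \<in> borel_measurable (NA (A - P))" using B12 by simp
      show "integrable M (\<lambda>\<omega>. indicator B1 \<omega> * Y \<omega>)" using integrable_mult_indicator[of B1 M Y] Yi by simp
      show "integrable M (indicat_real B2)" by (rule integrable_const_bound[of _ 1]) auto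
    qed auto
    also have "expectation (\<lambda>\<omega>. indicator B1 \<omega> * Y \<omega>) = 0"
    proof -
      have iX: "integrable M (\<lambda>\<omega>. indicator B1 \<omega> * X \<omega>)" using integrable_mult_indicator[of B1 M X] Xi by simp
      show ?thesis unfolding Y_def right_diff_distrib
        using iX cexp_mult[OF i1 _ iX] by simp
    qed
    finally show ?thesis by simp
  qed
  define F where "F = sigma (space M) G"
  have GP: "G \<subseteq> Pow (space M)" using GM sets.sets_into_space by auto
  have sF: "sets F = sigma_sets (space M) G" unfolding F_def using GP by simp
  have spF: "space F = space M" by (simp add: F_def space_measure_of_conv)
  have subF: "subalgebra M F" unfolding subalgebra_def using GM sF spF by (simp add: sets.sigma_sets_subset)
  have spNA: "space M \<in> sets (NA S)" for S using sets.top[of "NA S"] by simp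
  have g1: "sets (NA (A \<inter> P)) \<subseteq> G"
  proof
    fix B assume B: "B \<in> sets (NA (A \<inter> P))"
    then have "B = B \<inter> space M" using sets.sets_into_space[OF B] by auto
    then show "B \<in> G" using B spNA unfolding G_def by blast
  qed
  have g2: "sets (NA (A - P)) \<subseteq> G"
  proof
    fix B assume B: "B \<in> sets (NA (A - P))"
    then have "B = space M \<inter> B" using sets.sets_into_space[OF B] by auto
    then show "B \<in> G" using B spNA unfolding G_def by blast
  qed
  have gF: "G \<subseteq> sets F" unfolding sF by blast
  have nF: "null_sets M \<subseteq> sets F" using g1 gF null_sets_NA by blast
  \<comment> \<open>The generators of \<open>NA A\<close> need not respect the cut along
    \<open>P\<close>. They lie in the sigma-algebra of \<open>G\<close> because \<open>W C\<close>
    is almost surely the sum of its two pieces and null sets are included.\<close>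
  have WF: "W C \<in> borel_measurable F" if C: "C \<in> noise_sets" "C \<subseteq> A" for C
  proof (rule measurable_AE_subalgebra[OF subF nF])
    have "W (C \<inter> P) \<in> borel_measurable (NA (A \<inter> P))" "W (C - P) \<in> borel_measurable (NA (A - P))"
      using C P by (auto intro!: W_NA_measurable noise_sets_Int noise_sets_Diff)
    moreover have "subalgebra F (NA (A \<inter> P))" "subalgebra F (NA (A - P))"
      using g1 g2 gF spF by (auto simp: subalgebra_def)
    ultimately have "W (C \<inter> P) \<in> borel_measurable F" "W (C - P) \<in> borel_measurable F"
      using measurable_from_subalg by blast+
    then show "(\<lambda>\<omega>. W (C \<inter> P) \<omega> + W (C - P) \<omega>) \<in> borel_measurable F" by measurable
    show "W C \<in> borel_measurable M" using C by (simp add: W_measurable)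
    show "AE \<omega> in M. W (C \<inter> P) \<omega> + W (C - P) \<omega> = W C \<omega>"
      using W_Int_Diff[OF C(1) P] by eventually_elim simp
  qed
  have NAF: "sets (NA A) \<subseteq> sigma_sets (space M) G"
  proof -
    have "{W C -` B \<inter> space M | C B. C \<in> noise_sets \<and> C \<subseteq> A \<and> B \<in> sets borel} \<union> null_sets M \<subseteq> sets F"
      using measurable_sets[OF WF] spF nF by auto
    then have "sigma_sets (space F) ({W C -` B \<inter> space M | C B. C \<in> noise_sets \<and> C \<subseteq> A \<and> B \<in> sets borel} \<union> null_sets M) \<subseteq> sets F"
      by (rule sets.sigma_sets_subset)
    then show ?thesis unfolding sets_NA spF sF .
  qed
  have "AE \<omega> in M. real_cond_exp M (NA A) X \<omega> = cexp (A \<inter> P) X \<omega>"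
  proof (rule sigma_finite_subalgebra.real_cond_exp_charact[OF NA_sigma_finite])
    fix B assume B: "B \<in> sets (NA A)"
    have "(\<integral>\<omega>\<in>B. Y \<omega> \<partial>M) = 0"
      by (rule set_integral_zero_generated[OF Yi Y0 GM Gi z]) (use B NAF in auto)
    moreover have "(\<integral>\<omega>\<in>B. Y \<omega> \<partial>M) = (\<integral>\<omega>\<in>B. X \<omega> \<partial>M) - (\<integral>\<omega>\<in>B. cexp (A \<inter> P) X \<omega> \<partial>M)"
      unfolding Y_def
    proof (rule set_integral_diff)
      have "B \<in> sets M" using B sM by auto
      then show "set_integrable M B X" "set_integrable M B (cexp (A \<inter> P) X)"
        unfolding set_integrable_def using integrable_mult_indicator Xi cexp_integrable by blast+
    qed
    ultimately show "(\<integral>\<omega>\<in>B. X \<omega> \<partial>M) = (\<integral>\<omega>\<in>B. cexp (A \<inter> P) X \<omega> \<partial>M)" by simp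
  next
    show "cexp (A \<inter> P) X \<in> borel_measurable (NA A)"
      using NA_measurable_mono[OF _ cexp_measurable, of "A \<inter> P" A] by simp
  qed (use Xi cexp_integrable in auto)
  then show ?thesis by (simp add: cexp_def)
qed

subsection \<open>Elementary stochastic integrals\<close>

abbreviation past :: "real \<Rightarrow> (real \<times> real) set" where "past a \<equiv> {0..a} \<times> UNIV"

text \<open>Arbitrary sets after time \<open>a\<close> take the place of the rectangles in simple
  integrands, because localization intersects these rectangles with a sector.\<close>

definition future_set :: "real \<Rightarrow> (real \<times> real) set \<Rightarrow> bool" where
  "future_set a C \<longleftrightarrow> C \<in> noise_sets \<and> C \<subseteq> {a<..} \<times> UNIV"

lemma elementary_square_integrable:
  assumes [measurable]: "X \<in> borel_measurable M" and K: "\<And>\<omega>. \<omega> \<in> space M \<Longrightarrow> \<bar>X \<omega>\<bar> \<le> K" and C: "C \<in> noise_sets"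
  shows "integrable M (\<lambda>\<omega>. (X \<omega> * W C \<omega>)\<^sup>2)"
proof (rule Bochner_Integration.integrable_bound)
  have [measurable]: "W C \<in> borel_measurable M" using C by (rule W_measurable)
  show "(\<lambda>\<omega>. (X \<omega> * W C \<omega>)\<^sup>2) \<in> borel_measurable M" by measurable
  show "integrable M (\<lambda>\<omega>. K\<^sup>2 * (W C \<omega>)\<^sup>2)" using W_square_integrable[OF C] by simp
  show "AE \<omega> in M. norm ((X \<omega> * W C \<omega>)\<^sup>2) \<le> norm (K\<^sup>2 * (W C \<omega>)\<^sup>2)"
  proof (rule AE_I2)
    fix \<omega> assume "\<omega> \<in> space M"
    then have "\<bar>X \<omega>\<bar>\<^sup>2 \<le> K\<^sup>2" using K by (intro power_mono) auto
    then show "norm ((X \<omega> * W C \<omega>)\<^sup>2) \<le> norm (K\<^sup>2 * (W C \<omega>)\<^sup>2)"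
      by (simp add: power_mult_distrib mult_right_mono)
  qed
qed

lemma bounded_integrable:
  fixes X :: "'a \<Rightarrow> real"
  assumes "X \<in> borel_measurable M" "\<And>\<omega>. \<omega> \<in> space M \<Longrightarrow> \<bar>X \<omega>\<bar> \<le> K"
  shows "integrable M X"
  using assms by (intro integrable_const_bound[of _ K]) auto

text \<open>\<open>C\<close> is cut at time \<open>b\<close>. The part before \<open>b\<close> joins
  \<open>X\<close> and \<open>Y\<close> in the past of \<open>b\<close>, where \<open>W D\<close> is
  independent with mean zero; only the part after \<open>b\<close> correlates with
  \<open>W D\<close>, and the product of those two noises is independent of \<open>X\<close> and
  \<open>Y\<close>.\<close>

lemma elementary_pair:
  assumes ab: "a \<le> b"
    and X: "X \<in> borel_measurable (NA (past a))" "\<And>\<omega>. \<omega> \<in> space M \<Longrightarrow> \<bar>X \<omega>\<bar> \<le> K"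
    and Y: "Y \<in> borel_measurable (NA (past b))" "\<And>\<omega>. \<omega> \<in> space M \<Longrightarrow> \<bar>Y \<omega>\<bar> \<le> L"
    and C: "future_set a C" and D: "future_set b D"
  shows "expectation (\<lambda>\<omega>. (X \<omega> * W C \<omega>) * (Y \<omega> * W D \<omega>)) =
    expectation (\<lambda>\<omega>. X \<omega> * Y \<omega>) * measure lborel (C \<inter> D)"
proof -
  have Cn: "C \<in> noise_sets" and Dn: "D \<in> noise_sets" using C D by (auto simp: future_set_def)
  have [measurable]: "past b \<in> sets borel" by (rule borel_closed) (auto intro!: closed_Times)
  define C1 where "C1 = C \<inter> past b"
  define C2 where "C2 = C - past b"
  have C1: "C1 \<in> noise_sets" and C2: "C2 \<in> noise_sets"
    unfolding C1_def C2_def by (auto intro!: noise_sets_Int noise_sets_Diff Cn)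
  have disj: "past b \<inter> {b<..} \<times> UNIV = {}" by auto
  have C2s: "C2 \<subseteq> {b<..} \<times> UNIV" using C2 by (auto simp: C2_def noise_sets_def)
  have Ds: "D \<subseteq> {b<..} \<times> UNIV" using D by (auto simp: future_set_def)
  have Xb: "X \<in> borel_measurable (NA (past b))" using ab by (intro NA_measurable_mono[OF _ X(1)]) auto
  note [measurable] = NA_measurable_M[OF Xb] NA_measurable_M[OF Y(1)] W_measurable[OF Cn] W_measurable[OF Dn]
    W_measurable[OF C1] W_measurable[OF C2]
  have XY: "(\<lambda>\<omega>. X \<omega> * Y \<omega>) \<in> borel_measurable (NA (past b))"
    by (intro borel_measurable_times Xb Y(1))
  note XYM = NA_measurable_M[OF XY]
  have bXY: "\<bar>X \<omega> * Y \<omega>\<bar> \<le> K * L" if "\<omega> \<in> space M" for \<omega>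
    unfolding abs_mult using X(2)[OF that] Y(2)[OF that] by (intro mult_mono) auto
  have s1: "integrable M (\<lambda>\<omega>. ((X \<omega> * Y \<omega>) * W C1 \<omega>)\<^sup>2)"
    by (rule elementary_square_integrable[OF XYM bXY C1])
  have i1: "integrable M (\<lambda>\<omega>. (X \<omega> * Y \<omega>) * W C1 \<omega>)"
    by (rule square_integrable_imp_integrable'[OF borel_measurable_times[OF XYM W_measurable[OF C1]] s1])
  have W2D: "integrable M (\<lambda>\<omega>. W C2 \<omega> * W D \<omega>)" by (rule W_mult_integrable[OF C2 Dn])
  have e1: "integrable M (\<lambda>\<omega>. ((X \<omega> * Y \<omega>) * W C1 \<omega>) * W D \<omega>)"
     "expectation (\<lambda>\<omega>. ((X \<omega> * Y \<omega>) * W C1 \<omega>) * W D \<omega>) = 0"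
  proof -
    have "W C1 \<in> borel_measurable (NA (past b))" by (rule W_NA_measurable[OF C1]) (auto simp: C1_def)
    then have m: "(\<lambda>\<omega>. (X \<omega> * Y \<omega>) * W C1 \<omega>) \<in> borel_measurable (NA (past b))"
      by (intro borel_measurable_times XY)
    show "integrable M (\<lambda>\<omega>. ((X \<omega> * Y \<omega>) * W C1 \<omega>) * W D \<omega>)"
     "expectation (\<lambda>\<omega>. ((X \<omega> * Y \<omega>) * W C1 \<omega>) * W D \<omega>) = 0"
      using indep_NA_mult[OF disj m W_NA_measurable[OF Dn Ds] i1 W_integrable[OF Dn]] W_mean[OF Dn] by auto
  qed
  have e2: "integrable M (\<lambda>\<omega>. (X \<omega> * Y \<omega>) * (W C2 \<omega> * W D \<omega>))"
     "expectation (\<lambda>\<omega>. (X \<omega> * Y \<omega>) * (W C2 \<omega> * W D \<omega>)) = expectation (\<lambda>\<omega>. X \<omega> * Y \<omega>) * measure lborel (C \<inter> D)"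
  proof -
    have m: "(\<lambda>\<omega>. W C2 \<omega> * W D \<omega>) \<in> borel_measurable (NA ({b<..} \<times> UNIV))"
      by (intro borel_measurable_times W_NA_measurable[OF C2 C2s] W_NA_measurable[OF Dn Ds])
    have "integrable M (\<lambda>\<omega>. X \<omega> * Y \<omega>)" by (rule bounded_integrable[OF XYM bXY])
    note r = indep_NA_mult[OF disj XY m this W2D]
    have "C2 \<inter> D = C \<inter> D" using Ds by (auto simp: C2_def)
    then show "integrable M (\<lambda>\<omega>. (X \<omega> * Y \<omega>) * (W C2 \<omega> * W D \<omega>))"
     "expectation (\<lambda>\<omega>. (X \<omega> * Y \<omega>) * (W C2 \<omega> * W D \<omega>)) = expectation (\<lambda>\<omega>. X \<omega> * Y \<omega>) * measure lborel (C \<inter> D)"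
      using r W_cov[OF C2 Dn] by auto
  qed
  have "expectation (\<lambda>\<omega>. (X \<omega> * W C \<omega>) * (Y \<omega> * W D \<omega>)) =
      expectation (\<lambda>\<omega>. ((X \<omega> * Y \<omega>) * W C1 \<omega>) * W D \<omega> + (X \<omega> * Y \<omega>) * (W C2 \<omega> * W D \<omega>))"
    using W_Int_Diff[OF Cn, of "past b"]
    by (intro integral_cong_AE) (auto elim!: eventually_mono simp: algebra_simps C1_def[symmetric] C2_def[symmetric])
  also have "\<dots> = expectation (\<lambda>\<omega>. X \<omega> * Y \<omega>) * measure lborel (C \<inter> D)"
    using e1 e2 by simp
  finally show ?thesis .
qed

text \<open>The index type is left free because the localized integral below is indexed by pairs of
  a number and a boolean.\<close>

definition elementary :: "'i set \<Rightarrow> ('i \<Rightarrow> real) \<Rightarrow> ('i \<Rightarrow> (real \<times> real) set) \<Rightarrow> ('i \<Rightarrow> 'a \<Rightarrow> real) \<Rightarrow> bool" where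
  "elementary I a C X \<longleftrightarrow> finite I \<and> (\<forall>i\<in>I. future_set (a i) (C i) \<and> X i \<in> borel_measurable (NA (past (a i))) \<and>
     (\<exists>K. \<forall>\<omega>\<in>space M. \<bar>X i \<omega>\<bar> \<le> K))"

lemma elementary_sum_square_integrable:
  assumes "elementary I a C X"
  shows "(\<lambda>\<omega>. \<Sum>i\<in>I. X i \<omega> * W (C i) \<omega>) \<in> borel_measurable M"
    "integrable M (\<lambda>\<omega>. (\<Sum>i\<in>I. X i \<omega> * W (C i) \<omega>)\<^sup>2)"
proof -
  have *: "J \<subseteq> I \<Longrightarrow> (\<lambda>\<omega>. \<Sum>i\<in>J. X i \<omega> * W (C i) \<omega>) \<in> borel_measurable M \<and> integrable M (\<lambda>\<omega>. (\<Sum>i\<in>J. X i \<omega> * W (C i) \<omega>)\<^sup>2)" for J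
  proof (induction J rule: infinite_finite_induct)
    case (insert i J)
    then have i: "i \<in> I" by auto
    then obtain K where C: "future_set (a i) (C i)" and X: "X i \<in> borel_measurable M"
      and K: "\<And>\<omega>. \<omega> \<in> space M \<Longrightarrow> \<bar>X i \<omega>\<bar> \<le> K"
      using assms NA_measurable_M unfolding elementary_def by metis
    have m: "(\<lambda>\<omega>. X i \<omega> * W (C i) \<omega>) \<in> borel_measurable M"
      using X C by (auto simp: future_set_def intro!: borel_measurable_times W_measurable)
    have "integrable M (\<lambda>\<omega>. (X i \<omega> * W (C i) \<omega>)\<^sup>2)"
      by (rule elementary_square_integrable[OF X K]) (use C in \<open>auto simp: future_set_def\<close>)
    then show ?case using insert m by (auto intro!: square_integrable_add)
  qed auto
  then show "(\<lambda>\<omega>. \<Sum>i\<in>I. X i \<omega> * W (C i) \<omega>) \<in> borel_measurable M"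
    "integrable M (\<lambda>\<omega>. (\<Sum>i\<in>I. X i \<omega> * W (C i) \<omega>)\<^sup>2)" by auto
qed

text \<open>Each pair of terms is compared at the later of its two starting times, so the sets
  \<open>C i\<close> may overlap arbitrarily. The second form uses iterated nonnegative integrals,
  so that it yields square integrability on the product space instead of presupposing it.\<close>

theorem elementary_isometry:
  assumes E: "elementary I a C X"
  shows "expectation (\<lambda>\<omega>. (\<Sum>i\<in>I. X i \<omega> * W (C i) \<omega>)\<^sup>2) =
      (\<Sum>i\<in>I. \<Sum>j\<in>I. expectation (\<lambda>\<omega>. X i \<omega> * X j \<omega>) * measure lborel (C i \<inter> C j))"
    "(\<integral>\<^sup>+\<omega>. ennreal ((\<Sum>i\<in>I. X i \<omega> * W (C i) \<omega>)\<^sup>2) \<partial>M) =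
      (\<integral>\<^sup>+z. (\<integral>\<^sup>+\<omega>. ennreal ((\<Sum>i\<in>I. X i \<omega> * indicator (C i) z)\<^sup>2) \<partial>M) \<partial>lborel)"
proof -
  obtain K where K: "\<And>i \<omega>. i \<in> I \<Longrightarrow> \<omega> \<in> space M \<Longrightarrow> \<bar>X i \<omega>\<bar> \<le> K i"
    using E unfolding elementary_def by metis
  have C: "\<And>i. i \<in> I \<Longrightarrow> future_set (a i) (C i)" and X: "\<And>i. i \<in> I \<Longrightarrow> X i \<in> borel_measurable (NA (past (a i)))"
    using E by (auto simp: elementary_def)
  have Cn: "\<And>i. i \<in> I \<Longrightarrow> C i \<in> noise_sets" using C by (auto simp: future_set_def)
  have XM: "\<And>i. i \<in> I \<Longrightarrow> X i \<in> borel_measurable M" using X NA_measurable_M by blast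
  have sq: "integrable M (\<lambda>\<omega>. (X i \<omega> * W (C i) \<omega>)\<^sup>2)" if "i \<in> I" for i
    by (rule elementary_square_integrable[OF XM K Cn]) (use that in auto)
  have pi: "integrable M (\<lambda>\<omega>. (X i \<omega> * W (C i) \<omega>) * (X j \<omega> * W (C j) \<omega>))" if "i \<in> I" "j \<in> I" for i j
    using that by (intro square_integrable_mult sq borel_measurable_times XM W_measurable Cn)
  have pe: "expectation (\<lambda>\<omega>. (X i \<omega> * W (C i) \<omega>) * (X j \<omega> * W (C j) \<omega>)) =
      expectation (\<lambda>\<omega>. X i \<omega> * X j \<omega>) * measure lborel (C i \<inter> C j)" if ij: "i \<in> I" "j \<in> I" for i j
  proof (cases "a i \<le> a j")
    case True
    then show ?thesis by (rule elementary_pair[OF _ X K X K C C]) (use ij in auto)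
  next
    case False
    then have "a j \<le> a i" by simp
    then have "expectation (\<lambda>\<omega>. (X j \<omega> * W (C j) \<omega>) * (X i \<omega> * W (C i) \<omega>)) =
      expectation (\<lambda>\<omega>. X j \<omega> * X i \<omega>) * measure lborel (C j \<inter> C i)"
      by (rule elementary_pair[OF _ X K X K C C]) (use ij in auto)
    then show ?thesis by (simp add: mult.commute Int_commute)
  qed
  show 1: "expectation (\<lambda>\<omega>. (\<Sum>i\<in>I. X i \<omega> * W (C i) \<omega>)\<^sup>2) =
      (\<Sum>i\<in>I. \<Sum>j\<in>I. expectation (\<lambda>\<omega>. X i \<omega> * X j \<omega>) * measure lborel (C i \<inter> C j))"
    unfolding power2_eq_square sum_product
    using pi pe by (subst Bochner_Integration.integral_sum) (auto intro!: Bochner_Integration.integrable_sum sum.cong)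
  have XX: "integrable M (\<lambda>\<omega>. X i \<omega> * X j \<omega>)" if "i \<in> I" "j \<in> I" for i j
  proof (rule bounded_integrable[of _ "K i * K j"])
    show "(\<lambda>\<omega>. X i \<omega> * X j \<omega>) \<in> borel_measurable M" using XM that by measurable
    show "\<bar>X i \<omega> * X j \<omega>\<bar> \<le> K i * K j" if w: "\<omega> \<in> space M" for \<omega>
      unfolding abs_mult using K[OF \<open>i \<in> I\<close> w] K[OF \<open>j \<in> I\<close> w] by (intro mult_mono) auto
  qed
  define q where "q z = (\<Sum>i\<in>I. \<Sum>j\<in>I. expectation (\<lambda>\<omega>. X i \<omega> * X j \<omega>) * indicat_real (C i \<inter> C j) z)" for z
  have inner: "(\<integral>\<^sup>+\<omega>. ennreal ((\<Sum>i\<in>I. X i \<omega> * indicator (C i) z)\<^sup>2) \<partial>M) = ennreal (q z) \<and> q z \<ge> 0" for z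
  proof -
    have eq: "(\<Sum>i\<in>I. X i \<omega> * indicator (C i) z)\<^sup>2 = (\<Sum>i\<in>I. \<Sum>j\<in>I. X i \<omega> * X j \<omega> * indicat_real (C i \<inter> C j) z)" for \<omega>
      unfolding power2_eq_square sum_product by (intro sum.cong refl) (auto simp: indicator_def)
    have i: "integrable M (\<lambda>\<omega>. (\<Sum>i\<in>I. X i \<omega> * indicator (C i) z)\<^sup>2)"
      unfolding eq using XX by (auto intro!: Bochner_Integration.integrable_sum)
    have e: "expectation (\<lambda>\<omega>. (\<Sum>i\<in>I. X i \<omega> * indicator (C i) z)\<^sup>2) = q z"
      unfolding eq q_def using XX
      by (subst Bochner_Integration.integral_sum) (auto intro!: Bochner_Integration.integrable_sum sum.cong)
    have "q z \<ge> 0" unfolding e[symmetric] by simp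
    then show ?thesis using nn_integral_eq_integral[OF i] e by simp
  qed
  have CC: "integrable lborel (indicat_real (C i \<inter> C j))" if "i \<in> I" "j \<in> I" for i j
    using noise_sets_fmeasurable[OF noise_sets_Int[OF Cn[OF that(1)] noise_sets_borel[OF Cn[OF that(2)]]]]
    by (auto simp: fmeasurable_def)
  have qi: "integrable lborel q" "integral\<^sup>L lborel q =
      (\<Sum>i\<in>I. \<Sum>j\<in>I. expectation (\<lambda>\<omega>. X i \<omega> * X j \<omega>) * measure lborel (C i \<inter> C j))"
    unfolding q_def using CC
    by (auto intro!: Bochner_Integration.integrable_sum simp: Bochner_Integration.integral_sum)
  have "(\<integral>\<^sup>+z. (\<integral>\<^sup>+\<omega>. ennreal ((\<Sum>i\<in>I. X i \<omega> * indicator (C i) z)\<^sup>2) \<partial>M) \<partial>lborel) = (\<integral>\<^sup>+z. ennreal (q z) \<partial>lborel)"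
    using inner by simp
  also have "\<dots> = ennreal (integral\<^sup>L lborel q)"
    using inner by (intro nn_integral_eq_integral qi) auto
  also have "\<dots> = (\<integral>\<^sup>+\<omega>. ennreal ((\<Sum>i\<in>I. X i \<omega> * W (C i) \<omega>)\<^sup>2) \<partial>M)"
    unfolding qi(2) 1[symmetric] using elementary_sum_square_integrable(2)[OF E]
    by (intro nn_integral_eq_integral[symmetric]) auto
  finally show "(\<integral>\<^sup>+\<omega>. ennreal ((\<Sum>i\<in>I. X i \<omega> * W (C i) \<omega>)\<^sup>2) \<partial>M) =
      (\<integral>\<^sup>+z. (\<integral>\<^sup>+\<omega>. ennreal ((\<Sum>i\<in>I. X i \<omega> * indicator (C i) z)\<^sup>2) \<partial>M) \<partial>lborel)" by simp
qed

text \<open>The Cameron--Martin formula for elementary integrals: weighting with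
  \<open>exp (c * W T)\<close> adds the drift \<open>c * indicator T\<close> to the noise.\<close>

lemma exp_W_integrable: "T \<in> noise_sets \<Longrightarrow> has_bochner_integral M (\<lambda>\<omega>. exp (c * W T \<omega>)) (exp (c\<^sup>2 * measure lborel T / 2))"
  using centered_gaussian_exp_moments(4)[OF gaussian_W, of T c] by (simp add: W_var)

lemma W_exp_W: "T \<in> noise_sets \<Longrightarrow> has_bochner_integral M (\<lambda>\<omega>. W T \<omega> * exp (c * W T \<omega>))
    (c * measure lborel T * exp (c\<^sup>2 * measure lborel T / 2))"
  using centered_gaussian_exp_moments(5)[OF gaussian_W, of T c] by (simp add: W_var)

lemma exp_W_measurable:
  "T \<in> noise_sets \<Longrightarrow> T \<subseteq> S \<Longrightarrow> (\<lambda>\<omega>. exp (c * W T \<omega>)) \<in> borel_measurable (NA S)"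
  by (rule measurable_compose[OF _ borel_measurable_exp])
     (intro borel_measurable_times W_NA_measurable borel_measurable_const)

lemma exp_W_measurable_M: "T \<in> noise_sets \<Longrightarrow> (\<lambda>\<omega>. exp (c * W T \<omega>)) \<in> borel_measurable M"
  by (rule measurable_compose[OF _ borel_measurable_exp])
     (intro borel_measurable_times W_measurable borel_measurable_const)

lemma exp_W_square_integrable:
  assumes "T \<in> noise_sets"
  shows "integrable M (\<lambda>\<omega>. (exp (c * W T \<omega>))\<^sup>2)" "expectation (\<lambda>\<omega>. (exp (c * W T \<omega>))\<^sup>2) = exp (2 * c\<^sup>2 * measure lborel T)"
proof -
  have "(\<lambda>\<omega>. (exp (c * W T \<omega>))\<^sup>2) = (\<lambda>\<omega>. exp ((2 * c) * W T \<omega>))"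
    by (simp add: power2_eq_square exp_add[symmetric] fun_eq_iff)
  then show "integrable M (\<lambda>\<omega>. (exp (c * W T \<omega>))\<^sup>2)" "expectation (\<lambda>\<omega>. (exp (c * W T \<omega>))\<^sup>2) = exp (2 * c\<^sup>2 * measure lborel T)"
    using exp_W_integrable[OF assms, of "2 * c"] by (auto simp: has_bochner_integral_iff power2_eq_square)
qed

text \<open>\<open>C\<close> and \<open>T\<close> are cut along each other. The part of the weight
  off \<open>C\<close> goes with \<open>X\<close>, which depends on the noise before
  \<open>C\<close> begins; this product \<open>G\<close> is independent of what lives on
  \<open>C\<close>. On \<open>C\<close> the noise off \<open>T\<close> contributes nothing, and on
  \<open>C \<inter> T\<close> the mean of \<open>W * exp (c * W)\<close> produces the factor
  \<open>c * measure lborel (C \<inter> T)\<close>.\<close>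

lemma elementary_tilt:
  assumes X: "X \<in> borel_measurable (NA (past a))" "\<And>\<omega>. \<omega> \<in> space M \<Longrightarrow> \<bar>X \<omega>\<bar> \<le> K"
    and C: "future_set a C" and T: "T \<in> noise_sets"
  shows "expectation (\<lambda>\<omega>. (X \<omega> * W C \<omega>) * exp (c * W T \<omega>)) =
    c * measure lborel (C \<inter> T) * expectation (\<lambda>\<omega>. X \<omega> * exp (c * W T \<omega>))"
proof -
  have Cn: "C \<in> noise_sets" and Cf: "C \<subseteq> {a<..} \<times> UNIV" using C by (auto simp: future_set_def)
  have Cb: "C \<in> sets borel" and Tb: "T \<in> sets borel" using Cn T noise_sets_borel by auto
  define T1 where "T1 = T - C"
  define T2 where "T2 = T \<inter> C"
  define C1 where "C1 = C - T"
  have n: "T1 \<in> noise_sets" "T2 \<in> noise_sets" "C1 \<in> noise_sets" "C \<inter> T \<in> noise_sets"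
    unfolding T1_def T2_def C1_def by (auto intro!: noise_sets_Int noise_sets_Diff T Cn Cb Tb)
  have CT: "C \<inter> T = T2" by (auto simp: T2_def)
  let ?m = "measure lborel T2"
  have XM: "X \<in> borel_measurable M" by (rule NA_measurable_M[OF X(1)])
  define G where "G \<omega> = X \<omega> * exp (c * W T1 \<omega>)" for \<omega>
  define H where "H \<omega> = W C1 \<omega> * exp (c * W T2 \<omega>) + W T2 \<omega> * exp (c * W T2 \<omega>)" for \<omega>
  have G: "G \<in> borel_measurable (NA (- C))" unfolding G_def
    using Cf by (intro borel_measurable_times exp_W_measurable n NA_measurable_mono[OF _ X(1)]) (auto simp: T1_def)
  have Gi: "integrable M G" unfolding G_def
  proof (rule square_integrable_mult)
    show "integrable M (\<lambda>\<omega>. (X \<omega>)\<^sup>2)"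
    proof (rule bounded_integrable[of _ "K\<^sup>2"])
      show "(\<lambda>\<omega>. (X \<omega>)\<^sup>2) \<in> borel_measurable M" using XM by measurable
      show "\<bar>(X \<omega>)\<^sup>2\<bar> \<le> K\<^sup>2" if "\<omega> \<in> space M" for \<omega>
        using power_mono[OF X(2)[OF that], of 2] by simp
    qed
  qed (intro XM exp_W_measurable_M exp_W_square_integrable n)+
  have e2: "(\<lambda>\<omega>. exp (c * W T2 \<omega>)) \<in> borel_measurable (NA T2)" by (intro exp_W_measurable n) auto
  have e2i: "integrable M (\<lambda>\<omega>. exp (c * W T2 \<omega>))" "expectation (\<lambda>\<omega>. exp (c * W T2 \<omega>)) = exp (c\<^sup>2 * ?m / 2)"
    using exp_W_integrable[OF n(2), of c] by (auto simp: has_bochner_integral_iff)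
  have h2: "integrable M (\<lambda>\<omega>. W T2 \<omega> * exp (c * W T2 \<omega>))"
    "expectation (\<lambda>\<omega>. W T2 \<omega> * exp (c * W T2 \<omega>)) = c * ?m * exp (c\<^sup>2 * ?m / 2)"
    using W_exp_W[OF n(2), of c] by (auto simp: has_bochner_integral_iff)
  have h1: "integrable M (\<lambda>\<omega>. W C1 \<omega> * exp (c * W T2 \<omega>))" "expectation (\<lambda>\<omega>. W C1 \<omega> * exp (c * W T2 \<omega>)) = 0"
    using indep_NA_mult[OF _ W_NA_measurable[OF n(3) order_refl] e2 W_integrable[OF n(3)] e2i(1)] W_mean[OF n(3)]
    by (auto simp: C1_def T2_def)
  have Hm: "H \<in> borel_measurable (NA C)" unfolding H_def
    by (intro borel_measurable_add borel_measurable_times exp_W_measurable W_NA_measurable n) (auto simp: C1_def T2_def)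
  have Hi: "integrable M H" "expectation H = c * ?m * exp (c\<^sup>2 * ?m / 2)"
    unfolding H_def using h1 h2 by auto
  have aeT: "AE \<omega> in M. W T \<omega> = W T2 \<omega> + W T1 \<omega>"
    using W_Int_Diff[OF T Cb] by (simp add: T1_def T2_def)
  have aeC: "AE \<omega> in M. W C \<omega> = W T2 \<omega> + W C1 \<omega>"
    using W_Int_Diff[OF Cn Tb] by (simp add: C1_def CT)
  have m1: "(\<lambda>\<omega>. (X \<omega> * W C \<omega>) * exp (c * W T \<omega>)) \<in> borel_measurable M"
    by (intro borel_measurable_times XM W_measurable Cn exp_W_measurable_M T)
  have m2: "(\<lambda>\<omega>. X \<omega> * exp (c * W T \<omega>)) \<in> borel_measurable M"
    by (intro borel_measurable_times XM exp_W_measurable_M T)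
  have "expectation (\<lambda>\<omega>. (X \<omega> * W C \<omega>) * exp (c * W T \<omega>)) = expectation (\<lambda>\<omega>. G \<omega> * H \<omega>)"
  proof (rule integral_cong_AE[OF m1])
    show "(\<lambda>\<omega>. G \<omega> * H \<omega>) \<in> borel_measurable M"
      by (intro borel_measurable_times NA_measurable_M[OF G] NA_measurable_M[OF Hm])
    show "AE \<omega> in M. X \<omega> * W C \<omega> * exp (c * W T \<omega>) = G \<omega> * H \<omega>"
      using aeT aeC by eventually_elim (simp add: G_def H_def distrib_left exp_add algebra_simps)
  qed
  also have "\<dots> = expectation G * expectation H"
    by (rule indep_NA_mult(2)[OF _ G Hm Gi Hi(1)]) auto
  finally have 1: "expectation (\<lambda>\<omega>. (X \<omega> * W C \<omega>) * exp (c * W T \<omega>)) = expectation G * expectation H" .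
  have "expectation (\<lambda>\<omega>. X \<omega> * exp (c * W T \<omega>)) = expectation (\<lambda>\<omega>. G \<omega> * exp (c * W T2 \<omega>))"
  proof (rule integral_cong_AE[OF m2])
    show "(\<lambda>\<omega>. G \<omega> * exp (c * W T2 \<omega>)) \<in> borel_measurable M"
      by (intro borel_measurable_times NA_measurable_M[OF G] exp_W_measurable_M n)
    show "AE \<omega> in M. X \<omega> * exp (c * W T \<omega>) = G \<omega> * exp (c * W T2 \<omega>)"
      using aeT by eventually_elim (simp add: G_def distrib_left exp_add algebra_simps)
  qed
  also have "\<dots> = expectation G * exp (c\<^sup>2 * ?m / 2)"
    using indep_NA_mult(2)[OF _ G NA_measurable_mono[OF _ e2] Gi e2i(1), of C] e2i(2) by (auto simp: T2_def)
  finally show ?thesis unfolding 1 Hi(2) CT by simp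
qed

subsection \<open>Approximation of Walsh integrals\<close>

lemma walsh_simple_elementary:
  assumes es: "walsh_simple M W es"
  obtains N a C X where "elementary {..<N::nat} a C X"
    "\<And>s y \<omega>. simple_integrand es s y \<omega> = (\<Sum>i<N. X i \<omega> * indicator (C i) (s, y))"
    "\<And>\<omega>. simple_integral W es \<omega> = (\<Sum>i<N. X i \<omega> * W (C i) \<omega>)"
proof
  define N where "N = length es"
  define a where "a i = fst (es ! i)" for i
  define C where "C i = {fst (es ! i)<..fst (snd (es ! i))} \<times> fst (snd (snd (es ! i)))" for i
  define X where "X i = snd (snd (snd (es ! i)))" for i
  have "future_set (a i) (C i) \<and> X i \<in> borel_measurable (NA (past (a i))) \<and>
     (\<exists>K. \<forall>\<omega>\<in>space M. \<bar>X i \<omega>\<bar> \<le> K)" if i: "i < N" for i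
  proof -
    obtain a' b A X' where e: "es ! i = (a', b, A, X')" by (cases "es ! i") auto
    have "(a', b, A, X') \<in> set es" using i e unfolding N_def by (metis nth_mem)
    then have p: "0 \<le> a'" "a' < b" "A \<in> sets borel" "emeasure lborel A < \<infinity>"
        "X' \<in> borel_measurable (noise_filtration M W a')" "\<exists>K. \<forall>\<omega>\<in>space M. \<bar>X' \<omega>\<bar> \<le> K"
      using es unfolding walsh_simple_def by auto
    have "{a'<..b} \<times> A \<in> sets (borel \<Otimes>\<^sub>M borel)" using p by auto
    moreover have "emeasure lborel ({a'<..b} \<times> A) = emeasure lborel {a'<..b} * emeasure lborel A"
      unfolding lborel_prod[symmetric] using p by (intro lborel.emeasure_pair_measure_Times) auto
    moreover have "\<dots> < \<infinity>" using p by (simp add: ennreal_mult_less_top)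
    ultimately have "{a'<..b} \<times> A \<in> noise_sets"
      using p unfolding noise_sets_def borel_prod by auto
    then have "future_set a' ({a'<..b} \<times> A)" by (auto simp: future_set_def)
    then show ?thesis using p e by (simp add: a_def C_def X_def noise_filtration_eq)
  qed
  then show "elementary {..<N} a C X" by (auto simp: elementary_def)
  show "simple_integrand es s y \<omega> = (\<Sum>i<N. X i \<omega> * indicator (C i) (s, y))" for s y \<omega>
    unfolding simple_integrand_def sum_list_sum_nth N_def
    by (auto simp: X_def C_def indicator_def atLeast0LessThan case_prod_beta intro!: sum.cong)
  show "simple_integral W es \<omega> = (\<Sum>i<N. X i \<omega> * W (C i) \<omega>)" for \<omega>
    unfolding simple_integral_def sum_list_sum_nth N_def
    by (auto simp: X_def C_def atLeast0LessThan case_prod_beta intro!: sum.cong)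
qed

definition integrand :: "nat \<Rightarrow> (nat \<Rightarrow> (real \<times> real) set) \<Rightarrow> (nat \<Rightarrow> 'a \<Rightarrow> real) \<Rightarrow> real \<times> real \<Rightarrow> 'a \<Rightarrow> real" where
  "integrand N C X z \<omega> = (\<Sum>i<N. X i \<omega> * indicator (C i) z)"

definition integral_of :: "nat \<Rightarrow> (nat \<Rightarrow> (real \<times> real) set) \<Rightarrow> (nat \<Rightarrow> 'a \<Rightarrow> real) \<Rightarrow> 'a \<Rightarrow> real" where
  "integral_of N C X \<omega> = (\<Sum>i<N. X i \<omega> * W (C i) \<omega>)"

lemma integrand_measurable:
  assumes E: "elementary {..<N} a C X"
  shows "(\<lambda>(z, \<omega>). integrand N C X z \<omega>) \<in> borel_measurable (lborel \<Otimes>\<^sub>M M)"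
    "integrand N C X z \<in> borel_measurable M"
proof -
  have XM: "X i \<in> borel_measurable M" if "i < N" for i
    using E that NA_measurable_M by (auto simp: elementary_def)
  have CM: "C i \<in> sets borel" if "i < N" for i
    using E that noise_sets_borel by (auto simp: elementary_def future_set_def)
  have "(\<lambda>p. \<Sum>i<N. X i (snd p) * indicator (C i) (fst p)) \<in> borel_measurable (lborel \<Otimes>\<^sub>M M)"
  proof (intro borel_measurable_sum borel_measurable_times)
    fix i assume i: "i \<in> {..<N}"
    show "(\<lambda>p. X i (snd p)) \<in> borel_measurable (lborel \<Otimes>\<^sub>M M)"
      using XM[of i] i by (intro measurable_compose[OF measurable_snd]) auto
    show "(\<lambda>p. indicat_real (C i) (fst p)) \<in> borel_measurable (lborel \<Otimes>\<^sub>M M)"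
      using CM[of i] i by (intro measurable_compose[OF measurable_fst] borel_measurable_indicator) auto
  qed
  then show "(\<lambda>(z, \<omega>). integrand N C X z \<omega>) \<in> borel_measurable (lborel \<Otimes>\<^sub>M M)"
    by (simp add: integrand_def case_prod_beta')
  show "integrand N C X z \<in> borel_measurable M"
    unfolding integrand_def using XM by (intro borel_measurable_sum borel_measurable_times) auto
qed

text \<open>The integrand is measurable only for the completed product measure. It is replaced by a
  version \<open>f'\<close> that is measurable for the product itself, so that integrals can be
  iterated; the price is agreement almost everywhere only.\<close>

lemma has_walsh_integralE:
  assumes I: "has_walsh_integral M W f I"
  obtains N a C X f' where "\<And>n. elementary {..<N n :: nat} (a n) (C n) (X n)"
    "(\<lambda>(z, \<omega>). f' z \<omega>) \<in> borel_measurable (lborel \<Otimes>\<^sub>M M)"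
    "AE z in lborel. AE \<omega> in M. f' z \<omega> = f (fst z) (snd z) \<omega>"
    "(\<lambda>n. \<integral>\<^sup>+z. (\<integral>\<^sup>+\<omega>. ennreal ((integrand (N n) (C n) (X n) z \<omega> - f' z \<omega>)\<^sup>2) \<partial>M) \<partial>lborel) \<longlonglongrightarrow> 0"
    "(\<lambda>n. \<integral>\<^sup>+\<omega>. ennreal ((integral_of (N n) (C n) (X n) \<omega> - I \<omega>)\<^sup>2) \<partial>M) \<longlonglongrightarrow> 0"
    "I \<in> borel_measurable M"
proof -
  from I obtain es where fm: "(\<lambda>((s, y), \<omega>). f s y \<omega>) \<in> borel_measurable (completion (lborel \<Otimes>\<^sub>M M))"
    and Im: "I \<in> borel_measurable M" and es: "\<And>n. walsh_simple M W (es n)"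
    and l1: "(\<lambda>n. \<integral>\<^sup>+((s, y), \<omega>). ennreal ((simple_integrand (es n) s y \<omega> - f s y \<omega>)\<^sup>2)
               \<partial>completion (lborel \<Otimes>\<^sub>M M)) \<longlonglongrightarrow> 0"
    and l2: "(\<lambda>n. \<integral>\<^sup>+\<omega>. ennreal ((simple_integral W (es n) \<omega> - I \<omega>)\<^sup>2) \<partial>M) \<longlonglongrightarrow> 0"
    unfolding has_walsh_integral_def by auto
  have ex: "\<exists>p :: nat \<times> (nat \<Rightarrow> real) \<times> (nat \<Rightarrow> (real \<times> real) set) \<times> (nat \<Rightarrow> 'a \<Rightarrow> real).
     case p of (N, a, C, X) \<Rightarrow> elementary {..<N} a C X \<and>
      (\<forall>s y \<omega>. simple_integrand (es n) s y \<omega> = integrand N C X (s, y) \<omega>) \<and>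
      (\<forall>\<omega>. simple_integral W (es n) \<omega> = integral_of N C X \<omega>)" for n
  proof (rule walsh_simple_elementary[OF es[of n]])
    fix N a C X
    assume "elementary {..<N::nat} a C X"
      "\<And>s y \<omega>. simple_integrand (es n) s y \<omega> = (\<Sum>i<N. X i \<omega> * indicator (C i) (s, y))"
      "\<And>\<omega>. simple_integral W (es n) \<omega> = (\<Sum>i<N. X i \<omega> * W (C i) \<omega>)"
    then show ?thesis by (intro exI[of _ "(N, a, C, X)"]) (simp add: integrand_def integral_of_def)
  qed
  define p where "p n = (SOME p :: nat \<times> (nat \<Rightarrow> real) \<times> (nat \<Rightarrow> (real \<times> real) set) \<times> (nat \<Rightarrow> 'a \<Rightarrow> real).
     case p of (N, a, C, X) \<Rightarrow> elementary {..<N} a C X \<and>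
      (\<forall>s y \<omega>. simple_integrand (es n) s y \<omega> = integrand N C X (s, y) \<omega>) \<and>
      (\<forall>\<omega>. simple_integral W (es n) \<omega> = integral_of N C X \<omega>))" for n
  have p: "\<And>n. case p n of (N, a, C, X) \<Rightarrow> elementary {..<N::nat} a C X \<and>
      (\<forall>s y \<omega>. simple_integrand (es n) s y \<omega> = integrand N C X (s, y) \<omega>) \<and>
      (\<forall>\<omega>. simple_integral W (es n) \<omega> = integral_of N C X \<omega>)"
    unfolding p_def by (rule someI_ex[OF ex])
  define N where "N n = fst (p n)" for n
  define a where "a n = fst (snd (p n))" for n
  define C where "C n = fst (snd (snd (p n)))" for n
  define X where "X n = snd (snd (snd (p n)))" for n
  have E: "\<And>n. elementary {..<N n :: nat} (a n) (C n) (X n)"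
    and si: "\<And>n s y \<omega>. simple_integrand (es n) s y \<omega> = integrand (N n) (C n) (X n) (s, y) \<omega>"
    and sI: "\<And>n \<omega>. simple_integral W (es n) \<omega> = integral_of (N n) (C n) (X n) \<omega>"
    using p by (simp_all add: case_prod_beta' N_def a_def C_def X_def)
  obtain f0 where f0: "f0 \<in> borel_measurable (lborel \<Otimes>\<^sub>M M)"
    "AE p in lborel \<Otimes>\<^sub>M M. (\<lambda>((s, y), \<omega>). f s y \<omega>) p = f0 p"
    using completion_ex_borel_measurable_real[OF fm] by auto
  interpret PP: pair_sigma_finite "lborel :: (real \<times> real) measure" M
    by (intro pair_sigma_finite.intro lborel.sigma_finite_measure_axioms sigma_finite_measure_axioms)
  define f' where "f' z \<omega> = f0 (z, \<omega>)" for z \<omega>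
  have f'm: "(\<lambda>(z, \<omega>). f' z \<omega>) \<in> borel_measurable (lborel \<Otimes>\<^sub>M M)"
    using f0 by (simp add: f'_def)
  have ae: "AE z in lborel. AE \<omega> in M. f' z \<omega> = f (fst z) (snd z) \<omega>"
    using PP.AE_pair[OF f0(2)] unfolding f'_def by (auto elim!: eventually_mono split: prod.splits)
  have "(\<integral>\<^sup>+((s, y), \<omega>). ennreal ((simple_integrand (es n) s y \<omega> - f s y \<omega>)\<^sup>2) \<partial>completion (lborel \<Otimes>\<^sub>M M)) =
    (\<integral>\<^sup>+z. (\<integral>\<^sup>+\<omega>. ennreal ((integrand (N n) (C n) (X n) z \<omega> - f' z \<omega>)\<^sup>2) \<partial>M) \<partial>lborel)" for n
  proof -
    have "(\<integral>\<^sup>+((s, y), \<omega>). ennreal ((simple_integrand (es n) s y \<omega> - f s y \<omega>)\<^sup>2) \<partial>completion (lborel \<Otimes>\<^sub>M M)) =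
      (\<integral>\<^sup>+((s, y), \<omega>). ennreal ((simple_integrand (es n) s y \<omega> - f s y \<omega>)\<^sup>2) \<partial>(lborel \<Otimes>\<^sub>M M))"
      by (rule nn_integral_completion)
    also have "\<dots> = (\<integral>\<^sup>+p. ennreal ((integrand (N n) (C n) (X n) (fst p) (snd p) - f' (fst p) (snd p))\<^sup>2) \<partial>(lborel \<Otimes>\<^sub>M M))"
      using f0(2) by (intro nn_integral_cong_AE) (auto elim!: eventually_mono simp: si f'_def split: prod.splits)
    also have "\<dots> = (\<integral>\<^sup>+z. (\<integral>\<^sup>+\<omega>. ennreal ((integrand (N n) (C n) (X n) z \<omega> - f' z \<omega>)\<^sup>2) \<partial>M) \<partial>lborel)"
    proof (subst nn_integral_fst[symmetric])
      have "(\<lambda>p. integrand (N n) (C n) (X n) (fst p) (snd p)) \<in> borel_measurable (lborel \<Otimes>\<^sub>M M)"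
        "(\<lambda>p. f' (fst p) (snd p)) \<in> borel_measurable (lborel \<Otimes>\<^sub>M M)"
        using integrand_measurable(1)[OF E[of n]] f'm by (simp_all add: case_prod_beta')
      then show "(\<lambda>p. ennreal ((integrand (N n) (C n) (X n) (fst p) (snd p) - f' (fst p) (snd p))\<^sup>2)) \<in> borel_measurable (lborel \<Otimes>\<^sub>M M)"
        by measurable
    qed simp
    finally show ?thesis .
  qed
  with l1 have l1': "(\<lambda>n. \<integral>\<^sup>+z. (\<integral>\<^sup>+\<omega>. ennreal ((integrand (N n) (C n) (X n) z \<omega> - f' z \<omega>)\<^sup>2) \<partial>M) \<partial>lborel) \<longlonglongrightarrow> 0"
    by simp
  show ?thesis
    by (rule that[of N a C X f', OF E f'm ae l1' _ Im]) (use l2 in \<open>simp add: sI\<close>)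
qed

end

section \<open>Mean-square estimates and limits\<close>

lemma nn_integral_square_add_le:
  fixes u v :: "'b \<Rightarrow> real"
  assumes [measurable]: "u \<in> borel_measurable N" "v \<in> borel_measurable N"
  shows "(\<integral>\<^sup>+x. ennreal ((u x + v x)\<^sup>2) \<partial>N) \<le> 2 * (\<integral>\<^sup>+x. ennreal ((u x)\<^sup>2) \<partial>N) + 2 * (\<integral>\<^sup>+x. ennreal ((v x)\<^sup>2) \<partial>N)"
proof -
  have "(\<integral>\<^sup>+x. ennreal ((u x + v x)\<^sup>2) \<partial>N) \<le> (\<integral>\<^sup>+x. 2 * ennreal ((u x)\<^sup>2) + 2 * ennreal ((v x)\<^sup>2) \<partial>N)"
  proof (rule nn_integral_mono)
    fix x
    have "(u x + v x)\<^sup>2 \<le> 2 * (u x)\<^sup>2 + 2 * (v x)\<^sup>2"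
      using sum_squares_bound[of "u x" "v x"] by (simp add: power2_sum)
    then have "ennreal ((u x + v x)\<^sup>2) \<le> ennreal (2 * (u x)\<^sup>2 + 2 * (v x)\<^sup>2)" by (rule ennreal_leI)
    also have "\<dots> = 2 * ennreal ((u x)\<^sup>2) + 2 * ennreal ((v x)\<^sup>2)"
      by (subst ennreal_plus) (auto simp: ennreal_mult)
    finally show "ennreal ((u x + v x)\<^sup>2) \<le> 2 * ennreal ((u x)\<^sup>2) + 2 * ennreal ((v x)\<^sup>2)" .
  qed
  also have "\<dots> = 2 * (\<integral>\<^sup>+x. ennreal ((u x)\<^sup>2) \<partial>N) + 2 * (\<integral>\<^sup>+x. ennreal ((v x)\<^sup>2) \<partial>N)"
    by (subst nn_integral_add) (auto simp: nn_integral_cmult)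
  finally show ?thesis .
qed

text \<open>Square integrability of the limit is a conclusion, since
  \<open>has_walsh_integral\<close> asserts only that the squared distances tend to zero: one
  approximant at squared distance below 1 suffices. Convergence against \<open>h\<close> is the
  Cauchy--Schwarz inequality.\<close>

lemma L2_limit:
  fixes g :: "nat \<Rightarrow> 'b \<Rightarrow> real" and f h :: "'b \<Rightarrow> real"
  assumes [measurable]: "\<And>n. g n \<in> borel_measurable N" "f \<in> borel_measurable N" "h \<in> borel_measurable N"
    and g: "\<And>n. integrable N (\<lambda>x. (g n x)\<^sup>2)" and h: "integrable N (\<lambda>x. (h x)\<^sup>2)"
    and lim: "(\<lambda>n. \<integral>\<^sup>+x. ennreal ((g n x - f x)\<^sup>2) \<partial>N) \<longlonglongrightarrow> 0"
  shows "integrable N (\<lambda>x. (f x)\<^sup>2)" "(\<lambda>n. \<integral>x. g n x * h x \<partial>N) \<longlonglongrightarrow> (\<integral>x. f x * h x \<partial>N)"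
proof -
  let ?d = "\<lambda>n. \<integral>\<^sup>+x. ennreal ((g n x - f x)\<^sup>2) \<partial>N"
  have "eventually (\<lambda>n. ?d n < 1) sequentially"
    using lim by (rule order_tendstoD) simp
  then obtain n0 where n0: "?d n0 < 1" by (auto simp: eventually_sequentially)
  have d0: "integrable N (\<lambda>x. (g n0 x - f x)\<^sup>2)"
    using n0 by (intro nn_integral_square_finite_imp_integrable) (auto intro: less_trans)
  have "integrable N (\<lambda>x. (g n0 x - (g n0 x - f x))\<^sup>2)"
    by (rule square_integrable_diff[OF _ _ g d0]) measurable
  then show f: "integrable N (\<lambda>x. (f x)\<^sup>2)" by simp
  have gf: "integrable N (\<lambda>x. (g n x - f x)\<^sup>2)" for n
    by (intro square_integrable_diff g f) measurable
  have d: "?d n = ennreal (\<integral>x. (g n x - f x)\<^sup>2 \<partial>N)" for n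
    by (rule nn_integral_eq_integral[OF gf]) simp
  have l: "(\<lambda>n. \<integral>x. (g n x - f x)\<^sup>2 \<partial>N) \<longlonglongrightarrow> 0"
    using lim unfolding d by (subst (asm) ennreal_0[symmetric], subst (asm) tendsto_ennreal_iff) auto
  have b: "\<bar>(\<integral>x. g n x * h x \<partial>N) - (\<integral>x. f x * h x \<partial>N)\<bar> \<le> sqrt (\<integral>x. (g n x - f x)\<^sup>2 \<partial>N) * sqrt (\<integral>x. (h x)\<^sup>2 \<partial>N)" for n
  proof -
    have "(\<integral>x. g n x * h x \<partial>N) - (\<integral>x. f x * h x \<partial>N) = (\<integral>x. g n x * h x - f x * h x \<partial>N)"
      by (rule Bochner_Integration.integral_diff[symmetric]) (intro square_integrable_mult g f h; measurable)+
    also have "\<dots> = (\<integral>x. (g n x - f x) * h x \<partial>N)" by (simp add: left_diff_distrib)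
    finally have "\<bar>(\<integral>x. g n x * h x \<partial>N) - (\<integral>x. f x * h x \<partial>N)\<bar> \<le> (\<integral>x. \<bar>(g n x - f x) * h x\<bar> \<partial>N)"
      by (simp add: integral_abs_bound)
    also have "\<dots> \<le> sqrt (\<integral>x. (g n x - f x)\<^sup>2 \<partial>N) * sqrt (\<integral>x. (h x)\<^sup>2 \<partial>N)"
      by (rule Cauchy_Schwarz_integral) (auto intro: gf h)
    finally show ?thesis .
  qed
  have "(\<lambda>n. sqrt (\<integral>x. (g n x - f x)\<^sup>2 \<partial>N) * sqrt (\<integral>x. (h x)\<^sup>2 \<partial>N)) \<longlonglongrightarrow> sqrt 0 * sqrt (\<integral>x. (h x)\<^sup>2 \<partial>N)"
    by (rule tendsto_mult[OF tendsto_real_sqrt[OF l] tendsto_const])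
  then have l': "(\<lambda>n. sqrt (\<integral>x. (g n x - f x)\<^sup>2 \<partial>N) * sqrt (\<integral>x. (h x)\<^sup>2 \<partial>N)) \<longlonglongrightarrow> 0"
    by simp
  have "(\<lambda>n. (\<integral>x. g n x * h x \<partial>N) - (\<integral>x. f x * h x \<partial>N)) \<longlonglongrightarrow> 0"
    by (rule Lim_null_comparison[OF _ l']) (simp add: b)
  then show "(\<lambda>n. \<integral>x. g n x * h x \<partial>N) \<longlonglongrightarrow> (\<integral>x. f x * h x \<partial>N)"
    by (simp add: LIM_zero_iff)
qed

section \<open>Tilting and localization of Walsh integrals\<close>

context white_noise_space
begin

lemma cexp_best_approx_nn:
  assumes [measurable]: "X \<in> borel_measurable M" and X: "integrable M (\<lambda>\<omega>. (X \<omega>)\<^sup>2)"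
    and Z: "Z \<in> borel_measurable (NA S)" and Z2: "integrable M (\<lambda>\<omega>. (Z \<omega>)\<^sup>2)"
  shows "(\<integral>\<^sup>+\<omega>. ennreal ((X \<omega> - cexp S X \<omega>)\<^sup>2) \<partial>M) \<le> (\<integral>\<^sup>+\<omega>. ennreal ((X \<omega> - Z \<omega>)\<^sup>2) \<partial>M)"
proof -
  have [measurable]: "Z \<in> borel_measurable M" by (rule NA_measurable_M[OF Z])
  have "(\<integral>\<^sup>+\<omega>. ennreal ((X \<omega> - cexp S X \<omega>)\<^sup>2) \<partial>M) = ennreal (expectation (\<lambda>\<omega>. (X \<omega> - cexp S X \<omega>)\<^sup>2))"
    by (intro nn_integral_eq_integral square_integrable_diff cexp_square_integrable X AE_I2) auto
  also have "\<dots> \<le> ennreal (expectation (\<lambda>\<omega>. (X \<omega> - Z \<omega>)\<^sup>2))"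
    by (intro ennreal_leI cexp_best_approx assms)
  also have "\<dots> = (\<integral>\<^sup>+\<omega>. ennreal ((X \<omega> - Z \<omega>)\<^sup>2) \<partial>M)"
    by (intro nn_integral_eq_integral[symmetric] square_integrable_diff X Z2 AE_I2) auto
  finally show ?thesis .
qed

text \<open>\<open>elementary_tilt\<close>, summed over the terms and rewritten as an integral over
  the product space. The function \<open>indicator T z * exp (c * W T \<omega>)\<close> is square
  integrable there because \<open>T\<close> has finite measure, so both sides of the identity are
  continuous under mean-square limits.\<close>

lemma integrand_tilt:
  assumes E: "elementary {..<N} a C X" and T: "T \<in> noise_sets"
  defines "P \<equiv> lborel \<Otimes>\<^sub>M M"
  shows "integrable P (\<lambda>p. (integrand N C X (fst p) (snd p))\<^sup>2)"
    "integrable P (\<lambda>p. (indicator T (fst p) * exp (c * W T (snd p)))\<^sup>2)"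
    "(\<integral>p. integrand N C X (fst p) (snd p) * (indicator T (fst p) * exp (c * W T (snd p))) \<partial>P) * c =
      expectation (\<lambda>\<omega>. integral_of N C X \<omega> * exp (c * W T \<omega>))"
proof -
  interpret PP: pair_sigma_finite "lborel :: (real \<times> real) measure" M
    by (intro pair_sigma_finite.intro lborel.sigma_finite_measure_axioms sigma_finite_measure_axioms)
  define \<Phi> where "\<Phi> \<omega> = exp (c * W T \<omega>)" for \<omega>
  have \<Phi>[measurable]: "\<Phi> \<in> borel_measurable M" unfolding \<Phi>_def by (rule exp_W_measurable_M[OF T])
  have \<Phi>2: "integrable M (\<lambda>\<omega>. (\<Phi> \<omega>)\<^sup>2)" unfolding \<Phi>_def by (rule exp_W_square_integrable[OF T])
  have [measurable]: "T \<in> sets borel" using T by (rule noise_sets_borel)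
  have gm: "(\<lambda>p. integrand N C X (fst p) (snd p)) \<in> borel_measurable P"
    using integrand_measurable(1)[OF E] by (simp add: case_prod_beta' P_def)
  have hm: "(\<lambda>p. indicator T (fst p) * \<Phi> (snd p)) \<in> borel_measurable P" unfolding P_def by measurable
  show g2: "integrable P (\<lambda>p. (integrand N C X (fst p) (snd p))\<^sup>2)"
  proof (rule nn_integral_square_finite_imp_integrable[OF gm])
    have "(\<integral>\<^sup>+p. ennreal ((integrand N C X (fst p) (snd p))\<^sup>2) \<partial>P) =
      (\<integral>\<^sup>+z. (\<integral>\<^sup>+\<omega>. ennreal ((integrand N C X z \<omega>)\<^sup>2) \<partial>M) \<partial>lborel)"
      using gm unfolding P_def by (subst nn_integral_fst[symmetric]) auto
    also have "\<dots> = (\<integral>\<^sup>+\<omega>. ennreal ((\<Sum>i<N. X i \<omega> * W (C i) \<omega>)\<^sup>2) \<partial>M)"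
      unfolding integrand_def by (rule elementary_isometry(2)[OF E, symmetric])
    also have "\<dots> < \<infinity>"
      using elementary_sum_square_integrable(2)[OF E] by (simp add: nn_integral_eq_integral)
    finally show "(\<integral>\<^sup>+p. ennreal ((integrand N C X (fst p) (snd p))\<^sup>2) \<partial>P) < \<infinity>" .
  qed
  have h2: "integrable P (\<lambda>p. (indicator T (fst p) * \<Phi> (snd p))\<^sup>2)"
  proof (rule nn_integral_square_finite_imp_integrable[OF hm])
    have "(\<integral>\<^sup>+p. ennreal ((indicator T (fst p) * \<Phi> (snd p))\<^sup>2) \<partial>P) =
      (\<integral>\<^sup>+z. (\<integral>\<^sup>+\<omega>. indicator T z * ennreal ((\<Phi> \<omega>)\<^sup>2) \<partial>M) \<partial>lborel)"
      using hm unfolding P_def by (subst nn_integral_fst[symmetric]) (auto intro!: nn_integral_cong simp: indicator_def)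
    also have "\<dots> = (\<integral>\<^sup>+z. indicator T z * ennreal (expectation (\<lambda>\<omega>. (\<Phi> \<omega>)\<^sup>2)) \<partial>lborel)"
      using \<Phi>2 by (intro nn_integral_cong) (simp add: nn_integral_cmult nn_integral_eq_integral)
    also have "\<dots> = emeasure lborel T * ennreal (expectation (\<lambda>\<omega>. (\<Phi> \<omega>)\<^sup>2))"
      by (simp add: nn_integral_multc)
    also have "\<dots> < \<infinity>" using T by (simp add: noise_sets_def ennreal_mult_less_top)
    finally show "(\<integral>\<^sup>+p. ennreal ((indicator T (fst p) * \<Phi> (snd p))\<^sup>2) \<partial>P) < \<infinity>" .
  qed
  then show "integrable P (\<lambda>p. (indicator T (fst p) * exp (c * W T (snd p)))\<^sup>2)" by (simp add: \<Phi>_def)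
  have gh: "integrable P (\<lambda>p. integrand N C X (fst p) (snd p) * (indicator T (fst p) * \<Phi> (snd p)))"
    by (rule square_integrable_mult[OF gm hm g2 h2])
  have XM: "X i \<in> borel_measurable M" if "i < N" for i
    using E that NA_measurable_M by (auto simp: elementary_def)
  have Cn: "C i \<in> noise_sets" if "i < N" for i
    using E that by (auto simp: elementary_def future_set_def)
  obtain K where K: "\<And>i \<omega>. i < N \<Longrightarrow> \<omega> \<in> space M \<Longrightarrow> \<bar>X i \<omega>\<bar> \<le> K i"
    using E unfolding elementary_def by (metis lessThan_iff)
  have X2: "integrable M (\<lambda>\<omega>. (X i \<omega>)\<^sup>2)" if i: "i < N" for i
  proof (rule bounded_integrable[of _ "(K i)\<^sup>2"])
    show "(\<lambda>\<omega>. (X i \<omega>)\<^sup>2) \<in> borel_measurable M" using XM[OF i] by measurable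
    show "\<bar>(X i \<omega>)\<^sup>2\<bar> \<le> (K i)\<^sup>2" if "\<omega> \<in> space M" for \<omega>
      using power_mono[OF K[OF i that], of 2] by simp
  qed
  have X\<Phi>: "integrable M (\<lambda>\<omega>. X i \<omega> * \<Phi> \<omega>)" if "i < N" for i
    by (rule square_integrable_mult[OF XM[OF that] \<Phi> X2[OF that] \<Phi>2])
  have XW\<Phi>: "integrable M (\<lambda>\<omega>. X i \<omega> * W (C i) \<omega> * \<Phi> \<omega>)" if i: "i < N" for i
    by (intro square_integrable_mult \<Phi> \<Phi>2 borel_measurable_times XM i W_measurable Cn
      elementary_square_integrable[OF XM[OF i] K[OF i] Cn[OF i]])
  have "(\<integral>p. integrand N C X (fst p) (snd p) * (indicator T (fst p) * \<Phi> (snd p)) \<partial>P) =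
      (\<integral>z. (\<integral>\<omega>. integrand N C X z \<omega> * (indicator T z * \<Phi> \<omega>) \<partial>M) \<partial>lborel)"
    using PP.integral_fst'[OF gh[unfolded P_def]] unfolding P_def by simp
  also have "\<dots> = (\<integral>z. (\<Sum>i<N. indicator (C i \<inter> T) z * expectation (\<lambda>\<omega>. X i \<omega> * \<Phi> \<omega>)) \<partial>lborel)"
  proof (intro Bochner_Integration.integral_cong refl)
    fix z
    have "(\<integral>\<omega>. integrand N C X z \<omega> * (indicator T z * \<Phi> \<omega>) \<partial>M) =
        (\<integral>\<omega>. (\<Sum>i<N. indicator (C i \<inter> T) z * (X i \<omega> * \<Phi> \<omega>)) \<partial>M)"
      unfolding integrand_def sum_distrib_right
      by (intro Bochner_Integration.integral_cong refl sum.cong) (auto simp: indicator_def)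
    also have "\<dots> = (\<Sum>i<N. indicator (C i \<inter> T) z * expectation (\<lambda>\<omega>. X i \<omega> * \<Phi> \<omega>))"
      using X\<Phi> by (subst Bochner_Integration.integral_sum) auto
    finally show "(\<integral>\<omega>. integrand N C X z \<omega> * (indicator T z * \<Phi> \<omega>) \<partial>M) =
       (\<Sum>i<N. indicator (C i \<inter> T) z * expectation (\<lambda>\<omega>. X i \<omega> * \<Phi> \<omega>))" .
  qed
  also have "\<dots> = (\<Sum>i<N. measure lborel (C i \<inter> T) * expectation (\<lambda>\<omega>. X i \<omega> * \<Phi> \<omega>))"
  proof -
    have i: "integrable lborel (indicat_real (C i \<inter> T))" if "i < N" for i
      using noise_sets_fmeasurable[OF noise_sets_Int[OF Cn[OF that] noise_sets_borel[OF T]]]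
      by (auto simp: fmeasurable_def)
    show ?thesis using i by (subst Bochner_Integration.integral_sum) auto
  qed
  finally have 1: "(\<integral>p. integrand N C X (fst p) (snd p) * (indicator T (fst p) * \<Phi> (snd p)) \<partial>P) =
      (\<Sum>i<N. measure lborel (C i \<inter> T) * expectation (\<lambda>\<omega>. X i \<omega> * \<Phi> \<omega>))" .
  have "expectation (\<lambda>\<omega>. integral_of N C X \<omega> * \<Phi> \<omega>) = (\<Sum>i<N. expectation (\<lambda>\<omega>. X i \<omega> * W (C i) \<omega> * \<Phi> \<omega>))"
    unfolding integral_of_def sum_distrib_right using XW\<Phi> by (subst Bochner_Integration.integral_sum) auto
  also have "\<dots> = (\<Sum>i<N. c * measure lborel (C i \<inter> T) * expectation (\<lambda>\<omega>. X i \<omega> * \<Phi> \<omega>))"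
  proof (intro sum.cong refl)
    fix i assume "i \<in> {..<N}"
    then have i: "i < N" by simp
    show "expectation (\<lambda>\<omega>. X i \<omega> * W (C i) \<omega> * \<Phi> \<omega>) = c * measure lborel (C i \<inter> T) * expectation (\<lambda>\<omega>. X i \<omega> * \<Phi> \<omega>)"
      unfolding \<Phi>_def
      by (rule elementary_tilt[OF _ K[OF i] _ T, where a="a i"]) (use E i in \<open>auto simp: elementary_def\<close>)
  qed
  finally show "(\<integral>p. integrand N C X (fst p) (snd p) * (indicator T (fst p) * exp (c * W T (snd p))) \<partial>P) * c =
      expectation (\<lambda>\<omega>. integral_of N C X \<omega> * exp (c * W T \<omega>))"
    using 1 by (simp add: \<Phi>_def sum_distrib_left sum_distrib_right mult_ac)
qed

text \<open>The function \<open>F\<close> is computed from the jointly measurable version of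
  \<open>f\<close>, for which Fubini's theorem applies. Hence it agrees with the drift term of the
  Cameron--Martin formula only almost everywhere.\<close>

theorem walsh_integral_tilt:
  assumes I: "has_walsh_integral M W f I" and T: "T \<in> noise_sets"
    and fz: "\<And>z. f (fst z) (snd z) \<in> borel_measurable M"
  obtains F where "integrable M (\<lambda>\<omega>. (I \<omega>)\<^sup>2)" "integrable lborel F"
    "AE z in lborel. F z = c * indicator T z * expectation (\<lambda>\<omega>. f (fst z) (snd z) \<omega> * exp (c * W T \<omega>))"
    "expectation (\<lambda>\<omega>. I \<omega> * exp (c * W T \<omega>)) = integral\<^sup>L lborel F"
proof (rule has_walsh_integralE[OF I])
  fix N a C X f'
  assume E: "\<And>n. elementary {..<N n :: nat} (a n) (C n) (X n)"
    and f': "(\<lambda>(z, \<omega>). f' z \<omega>) \<in> borel_measurable (lborel \<Otimes>\<^sub>M M)"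
    and ff': "AE z in lborel. AE \<omega> in M. f' z \<omega> = f (fst z) (snd z) \<omega>"
    and l1: "(\<lambda>n. \<integral>\<^sup>+z. (\<integral>\<^sup>+\<omega>. ennreal ((integrand (N n) (C n) (X n) z \<omega> - f' z \<omega>)\<^sup>2) \<partial>M) \<partial>lborel) \<longlonglongrightarrow> 0"
    and l2: "(\<lambda>n. \<integral>\<^sup>+\<omega>. ennreal ((integral_of (N n) (C n) (X n) \<omega> - I \<omega>)\<^sup>2) \<partial>M) \<longlonglongrightarrow> 0"
    and Im: "I \<in> borel_measurable M"
  interpret PP: pair_sigma_finite "lborel :: (real \<times> real) measure" M
    by (intro pair_sigma_finite.intro lborel.sigma_finite_measure_axioms sigma_finite_measure_axioms)
  let ?P = "lborel \<Otimes>\<^sub>M M :: ((real \<times> real) \<times> 'a) measure"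
  let ?g = "\<lambda>n p. integrand (N n) (C n) (X n) (fst p) (snd p)"
  let ?f = "\<lambda>p. f' (fst p) (snd p)"
  let ?h = "\<lambda>p. indicator T (fst p) * exp (c * W T (snd p))"
  have Tb: "T \<in> sets borel" using T by (rule noise_sets_borel)
  have gm: "?g n \<in> borel_measurable ?P" for n
    using integrand_measurable(1)[OF E[of n]] by (simp add: case_prod_beta')
  have fm: "?f \<in> borel_measurable ?P" using f' by (simp add: case_prod_beta')
  have hm: "?h \<in> borel_measurable ?P"
    using Tb exp_W_measurable_M[OF T, of c]
    by (intro borel_measurable_times measurable_compose[OF measurable_fst] measurable_compose[OF measurable_snd] borel_measurable_indicator) auto
  have "(\<integral>\<^sup>+z. (\<integral>\<^sup>+\<omega>. ennreal ((integrand (N n) (C n) (X n) z \<omega> - f' z \<omega>)\<^sup>2) \<partial>M) \<partial>lborel) =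
      (\<integral>\<^sup>+p. ennreal ((?g n p - ?f p)\<^sup>2) \<partial>?P)" for n
  proof -
    have "(\<lambda>p. ennreal ((?g n p - ?f p)\<^sup>2)) \<in> borel_measurable ?P" using gm[of n] fm by measurable
    then show ?thesis by (subst nn_integral_fst[symmetric]) auto
  qed
  then have l1': "(\<lambda>n. \<integral>\<^sup>+p. ennreal ((?g n p - ?f p)\<^sup>2) \<partial>?P) \<longlonglongrightarrow> 0" using l1 by simp
  note L1 = L2_limit[OF gm fm hm integrand_tilt(1)[OF E T] integrand_tilt(2)[OF E[of 0] T] l1']
  have Jm: "integral_of (N n) (C n) (X n) \<in> borel_measurable M"
    and J2: "integrable M (\<lambda>\<omega>. (integral_of (N n) (C n) (X n) \<omega>)\<^sup>2)" for n
    using elementary_sum_square_integrable[OF E[of n]] unfolding integral_of_def by auto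
  note L2 = L2_limit[OF Jm Im exp_W_measurable_M[OF T, of c] J2 exp_W_square_integrable(1)[OF T] l2]
  have "(\<lambda>n. (\<integral>p. ?g n p * ?h p \<partial>?P) * c) \<longlonglongrightarrow> (\<integral>p. ?f p * ?h p \<partial>?P) * c"
    by (rule tendsto_mult[OF L1(2) tendsto_const])
  then have "(\<lambda>n. expectation (\<lambda>\<omega>. integral_of (N n) (C n) (X n) \<omega> * exp (c * W T \<omega>))) \<longlonglongrightarrow> (\<integral>p. ?f p * ?h p \<partial>?P) * c"
    unfolding integrand_tilt(3)[OF E T] .
  then have eq: "expectation (\<lambda>\<omega>. I \<omega> * exp (c * W T \<omega>)) = (\<integral>p. ?f p * ?h p \<partial>?P) * c"
    using L2(2) by (rule LIMSEQ_unique[symmetric])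
  have fh: "integrable ?P (\<lambda>p. ?f p * ?h p)"
    by (rule square_integrable_mult[OF fm hm L1(1) integrand_tilt(2)[OF E[of 0] T]])
  define F where "F z = (\<integral>\<omega>. f' z \<omega> * (indicator T z * exp (c * W T \<omega>)) \<partial>M) * c" for z
  have "integrable lborel F" unfolding F_def using PP.integrable_fst'[OF fh] by simp
  moreover have "AE z in lborel. F z = c * indicator T z * expectation (\<lambda>\<omega>. f (fst z) (snd z) \<omega> * exp (c * W T \<omega>))"
    using ff'
  proof eventually_elim
    case (elim z)
    have "(\<integral>\<omega>. f' z \<omega> * (indicator T z * exp (c * W T \<omega>)) \<partial>M) =
        (\<integral>\<omega>. indicator T z * (f (fst z) (snd z) \<omega> * exp (c * W T \<omega>)) \<partial>M)"
    proof (rule integral_cong_AE)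
      have "f' z \<in> borel_measurable M"
        using measurable_Pair2[OF f', of z] by simp
      then show "(\<lambda>\<omega>. f' z \<omega> * (indicator T z * exp (c * W T \<omega>))) \<in> borel_measurable M"
        by (intro borel_measurable_times exp_W_measurable_M T borel_measurable_const)
      show "AE \<omega> in M. f' z \<omega> * (indicator T z * exp (c * W T \<omega>)) = indicator T z * (f (fst z) (snd z) \<omega> * exp (c * W T \<omega>))"
        using elim by eventually_elim simp
      show "(\<lambda>\<omega>. indicator T z * (f (fst z) (snd z) \<omega> * exp (c * W T \<omega>))) \<in> borel_measurable M"
        by (intro borel_measurable_times exp_W_measurable_M T borel_measurable_const fz)
    qed
    then show ?case by (simp add: F_def)
  qed
  moreover have "expectation (\<lambda>\<omega>. I \<omega> * exp (c * W T \<omega>)) = integral\<^sup>L lborel F"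
    unfolding eq F_def using PP.integral_fst'[OF fh] by simp
  ultimately show ?thesis using that L2(1) by blast
qed

lemma cexp_linear:
  assumes fin: "finite I" and X: "\<And>i. i \<in> I \<Longrightarrow> integrable M (X i)"
  shows "AE \<omega> in M. cexp A (\<lambda>\<omega>. \<Sum>i\<in>I. X i \<omega> * c i) \<omega> = (\<Sum>i\<in>I. cexp A (X i) \<omega> * c i)"
proof -
  \<comment> \<open>Extension by 0 makes the family integrable at every index.\<close>
  define Y where "Y i \<omega> = (if i \<in> I then c i * X i \<omega> else 0)" for i \<omega>
  have "integrable M (Y i)" for i by (cases "i \<in> I") (auto simp: Y_def[abs_def] X)
  then have "AE \<omega> in M. real_cond_exp M (NA A) (\<lambda>\<omega>. \<Sum>i\<in>I. Y i \<omega>) \<omega> = (\<Sum>i\<in>I. real_cond_exp M (NA A) (Y i) \<omega>)"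
    by (rule sigma_finite_subalgebra.real_cond_exp_sum[OF NA_sigma_finite])
  moreover have "AE \<omega> in M. \<forall>i\<in>I. real_cond_exp M (NA A) (Y i) \<omega> = c i * real_cond_exp M (NA A) (X i) \<omega>"
  proof (rule AE_finite_allI[OF fin])
    fix i assume "i \<in> I"
    then show "AE \<omega> in M. real_cond_exp M (NA A) (Y i) \<omega> = c i * real_cond_exp M (NA A) (X i) \<omega>"
      using sigma_finite_subalgebra.real_cond_exp_cmult[OF NA_sigma_finite X, of i A "c i"]
      by (simp add: Y_def[abs_def])
  qed
  moreover have "(\<lambda>\<omega>. \<Sum>i\<in>I. Y i \<omega>) = (\<lambda>\<omega>. \<Sum>i\<in>I. X i \<omega> * c i)"
    by (auto simp: Y_def mult.commute intro!: sum.cong)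
  ultimately show ?thesis
    unfolding cexp_def by (auto elim!: eventually_elim2 intro!: sum.cong simp: mult.commute)
qed

lemma cexp_bounded:
  assumes X: "X \<in> borel_measurable M" and K: "\<And>\<omega>. \<omega> \<in> space M \<Longrightarrow> \<bar>X \<omega>\<bar> \<le> K"
  shows "AE \<omega> in M. \<bar>cexp A X \<omega>\<bar> \<le> K"
proof -
  have i: "integrable M X" by (rule bounded_integrable[OF X K])
  have "AE \<omega> in M. cexp A X \<omega> \<ge> - K" unfolding cexp_def
    by (rule sigma_finite_subalgebra.real_cond_exp_ge_c[OF NA_sigma_finite i]) (use K in \<open>auto simp: abs_le_iff intro!: AE_I2\<close>, force)
  moreover have "AE \<omega> in M. cexp A X \<omega> \<le> K" unfolding cexp_def
    by (rule sigma_finite_subalgebra.real_cond_exp_le_c[OF NA_sigma_finite i]) (use K in \<open>auto simp: abs_le_iff intro!: AE_I2\<close>)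
  ultimately show ?thesis by eventually_elim auto
qed

text \<open>\<open>Z\<close> is the conditional expectation on the noise in \<open>A\<close>, which replaces the coefficients by
  their conditional expectations and the noise by its restriction to \<open>A\<close>.\<close>

lemma elementary_localization:
  assumes E: "elementary {..<N} a C X" and A: "A \<in> sets borel"
  obtains Z where "Z \<in> borel_measurable (NA A)" "integrable M (\<lambda>\<omega>. (Z \<omega>)\<^sup>2)"
    "(\<integral>\<^sup>+\<omega>. ennreal ((integral_of N C X \<omega> - Z \<omega>)\<^sup>2) \<partial>M) =
      (\<integral>\<^sup>+z. indicator A z * (\<integral>\<^sup>+\<omega>. ennreal ((integrand N C X z \<omega> - cexp A (integrand N C X z) \<omega>)\<^sup>2) \<partial>M) +
         indicator (- A) z * (\<integral>\<^sup>+\<omega>. ennreal ((integrand N C X z \<omega>)\<^sup>2) \<partial>M) \<partial>lborel)"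
proof -
  obtain K where K: "\<And>i \<omega>. i < N \<Longrightarrow> \<omega> \<in> space M \<Longrightarrow> \<bar>X i \<omega>\<bar> \<le> K i"
    using E unfolding elementary_def by (metis lessThan_iff)
  have C: "\<And>i. i < N \<Longrightarrow> future_set (a i) (C i)" and X: "\<And>i. i < N \<Longrightarrow> X i \<in> borel_measurable (NA (past (a i)))"
    using E by (auto simp: elementary_def)
  have XM: "\<And>i. i < N \<Longrightarrow> X i \<in> borel_measurable M" using X NA_measurable_M by blast
  have Xi: "\<And>i. i < N \<Longrightarrow> integrable M (X i)" using bounded_integrable[OF XM K] by blast
  have Cn: "\<And>i. i < N \<Longrightarrow> C i \<in> noise_sets" using C by (auto simp: future_set_def)
  have CA: "\<And>i. i < N \<Longrightarrow> C i \<inter> A \<in> noise_sets" "\<And>i. i < N \<Longrightarrow> C i - A \<in> noise_sets"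
    using Cn A noise_sets_Int noise_sets_Diff by auto
  have pb: "past b \<in> sets borel" for b :: real by (rule borel_closed) (auto intro!: closed_Times)
  \<comment> \<open>Conditioning on the noise in \<open>A\<close> up to time \<open>a i\<close>
    makes the coefficient adapted; by \<open>cexp_restrict\<close> it is almost surely
    \<open>cexp A (X i)\<close>. The truncation changes it on a null set only and provides the bound
    at every point that \<open>elementary\<close> demands.\<close>
  define R where "R i \<omega> = max (- K i) (min (K i) (cexp (A \<inter> past (a i)) (X i) \<omega>))" for i \<omega>
  have Rm: "R i \<in> borel_measurable (NA (A \<inter> past (a i)))" for i
    unfolding R_def by (intro borel_measurable_max borel_measurable_min borel_measurable_const cexp_measurable)
  have RA: "R i \<in> borel_measurable (NA A)" and Rp: "R i \<in> borel_measurable (NA (past (a i)))" for i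
    using NA_measurable_mono[OF _ Rm] by auto
  have Rb: "\<bar>R i \<omega>\<bar> \<le> K i" if "i < N" "\<omega> \<in> space M" for i \<omega>
    using K[OF that] by (auto simp: R_def abs_le_iff)
  have Rc: "AE \<omega> in M. R i \<omega> = cexp A (X i) \<omega>" if i: "i < N" for i
  proof -
    have "AE \<omega> in M. \<bar>cexp (A \<inter> past (a i)) (X i) \<omega>\<bar> \<le> K i"
      by (rule cexp_bounded[OF XM[OF i]]) (rule K[OF i])
    then show ?thesis using cexp_restrict[OF A pb X[OF i] Xi[OF i]]
      by eventually_elim (auto simp: R_def abs_le_iff)
  qed
  define Z where "Z \<omega> = (\<Sum>i<N. R i \<omega> * W (C i \<inter> A) \<omega>)" for \<omega>
  \<comment> \<open>The error is itself an elementary integral. The boolean splits each set: inside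
    \<open>A\<close> (\<open>True\<close>) the coefficient is the error \<open>X - R\<close>,
    outside \<open>A\<close> it is all of \<open>X\<close>, because \<open>Z\<close> has no noise
    there.\<close>
  define I where "I = {..<N} \<times> (UNIV :: bool set)"
  define a' where "a' p = a (fst p)" for p :: "nat \<times> bool"
  define C' where "C' p = (if snd p then C (fst p) \<inter> A else C (fst p) - A)" for p
  define X' where "X' p \<omega> = (if snd p then X (fst p) \<omega> - R (fst p) \<omega> else X (fst p) \<omega>)" for p \<omega>
  have E': "elementary I a' C' X'"
    unfolding elementary_def
  proof (intro conjI ballI)
    show "finite I" by (simp add: I_def)
    fix p assume p: "p \<in> I"
    obtain i b where ib: "p = (i, b)" "i < N" using p by (auto simp: I_def)
    show "future_set (a' p) (C' p)" using C[OF ib(2)] CA[OF ib(2)] ib by (auto simp: future_set_def C'_def a'_def)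
    have "(\<lambda>\<omega>. X i \<omega> - R i \<omega>) \<in> borel_measurable (NA (past (a i)))" by (intro borel_measurable_diff X ib Rp)
    then show "X' p \<in> borel_measurable (NA (past (a' p)))" using X[OF ib(2)] ib by (cases b) (auto simp: X'_def[abs_def] a'_def)
    have "\<bar>X' p \<omega>\<bar> \<le> 2 * K i" if "\<omega> \<in> space M" for \<omega>
      using K[OF ib(2) that] Rb[OF ib(2) that] ib by (cases b) (auto simp: X'_def)
    then show "\<exists>K. \<forall>\<omega>\<in>space M. \<bar>X' p \<omega>\<bar> \<le> K" by blast
  qed
  have sI: "(\<Sum>p\<in>I. f p) = (\<Sum>i<N. f (i, True) + f (i, False))" for f :: "nat \<times> bool \<Rightarrow> real"
    unfolding I_def by (subst sum.cartesian_product') (simp add: UNIV_bool add.commute)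
  have EZ: "elementary {..<N} a (\<lambda>i. C i \<inter> A) R"
    unfolding elementary_def using C CA Rp Rb by (auto simp: future_set_def) blast
  show ?thesis
  proof (rule that[of Z])
    have "W (C i \<inter> A) \<in> borel_measurable (NA A)" if "i < N" for i
      by (rule W_NA_measurable[OF CA(1)[OF that]]) auto
    then show "Z \<in> borel_measurable (NA A)" unfolding Z_def
      by (intro borel_measurable_sum borel_measurable_times RA) auto
    show "integrable M (\<lambda>\<omega>. (Z \<omega>)\<^sup>2)" unfolding Z_def by (rule elementary_sum_square_integrable(2)[OF EZ])
    have "AE \<omega> in M. \<forall>i\<in>{..<N}. W (C i) \<omega> = W (C i \<inter> A) \<omega> + W (C i - A) \<omega>"
      by (rule AE_finite_allI) (use W_Int_Diff Cn A in auto)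
    then have "AE \<omega> in M. integral_of N C X \<omega> - Z \<omega> = (\<Sum>p\<in>I. X' p \<omega> * W (C' p) \<omega>)"
    proof eventually_elim
      case (elim \<omega>)
      have "integral_of N C X \<omega> = (\<Sum>i<N. X i \<omega> * (W (C i \<inter> A) \<omega> + W (C i - A) \<omega>))"
        unfolding integral_of_def using elim by (intro sum.cong) auto
      then show ?case
        unfolding sI Z_def by (simp add: X'_def C'_def sum_subtractf[symmetric] algebra_simps)
    qed
    then have "(\<integral>\<^sup>+\<omega>. ennreal ((integral_of N C X \<omega> - Z \<omega>)\<^sup>2) \<partial>M) = (\<integral>\<^sup>+\<omega>. ennreal ((\<Sum>p\<in>I. X' p \<omega> * W (C' p) \<omega>)\<^sup>2) \<partial>M)"
      by (intro nn_integral_cong_AE) (auto elim!: eventually_mono)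
    also have "\<dots> = (\<integral>\<^sup>+z. (\<integral>\<^sup>+\<omega>. ennreal ((\<Sum>p\<in>I. X' p \<omega> * indicator (C' p) z)\<^sup>2) \<partial>M) \<partial>lborel)"
      by (rule elementary_isometry(2)[OF E'])
    also have "\<dots> = (\<integral>\<^sup>+z. indicator A z * (\<integral>\<^sup>+\<omega>. ennreal ((integrand N C X z \<omega> - cexp A (integrand N C X z) \<omega>)\<^sup>2) \<partial>M) +
         indicator (- A) z * (\<integral>\<^sup>+\<omega>. ennreal ((integrand N C X z \<omega>)\<^sup>2) \<partial>M) \<partial>lborel)"
    proof (intro nn_integral_cong)
      fix z
      show "(\<integral>\<^sup>+\<omega>. ennreal ((\<Sum>p\<in>I. X' p \<omega> * indicator (C' p) z)\<^sup>2) \<partial>M) =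
        indicator A z * (\<integral>\<^sup>+\<omega>. ennreal ((integrand N C X z \<omega> - cexp A (integrand N C X z) \<omega>)\<^sup>2) \<partial>M) +
         indicator (- A) z * (\<integral>\<^sup>+\<omega>. ennreal ((integrand N C X z \<omega>)\<^sup>2) \<partial>M)"
      proof (cases "z \<in> A")
        case True
        have "AE \<omega> in M. \<forall>i\<in>{..<N}. R i \<omega> = cexp A (X i) \<omega>"
          by (rule AE_finite_allI) (use Rc in auto)
        moreover have "AE \<omega> in M. cexp A (integrand N C X z) \<omega> = (\<Sum>i<N. cexp A (X i) \<omega> * indicator (C i) z)"
          unfolding integrand_def by (rule cexp_linear) (auto intro: Xi)
        ultimately have "AE \<omega> in M. (\<Sum>p\<in>I. X' p \<omega> * indicator (C' p) z) = integrand N C X z \<omega> - cexp A (integrand N C X z) \<omega>"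
        proof eventually_elim
          case (elim \<omega>)
          have "(\<Sum>p\<in>I. X' p \<omega> * indicator (C' p) z) = (\<Sum>i<N. (X i \<omega> - R i \<omega>) * indicator (C i) z)"
            unfolding sI using True by (intro sum.cong) (auto simp: X'_def C'_def indicator_def)
          also have "\<dots> = (\<Sum>i<N. X i \<omega> * indicator (C i) z) - (\<Sum>i<N. cexp A (X i) \<omega> * indicator (C i) z)"
            unfolding sum_subtractf[symmetric] using elim(1) by (intro sum.cong) (auto simp: left_diff_distrib)
          finally show ?case using elim(2) by (simp add: integrand_def)
        qed
        then have "(\<integral>\<^sup>+\<omega>. ennreal ((\<Sum>p\<in>I. X' p \<omega> * indicator (C' p) z)\<^sup>2) \<partial>M) =
            (\<integral>\<^sup>+\<omega>. ennreal ((integrand N C X z \<omega> - cexp A (integrand N C X z) \<omega>)\<^sup>2) \<partial>M)"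
          by (intro nn_integral_cong_AE) (auto elim!: eventually_mono)
        then show ?thesis using True by simp
      next
        case False
        have "(\<Sum>p\<in>I. X' p \<omega> * indicator (C' p) z) = integrand N C X z \<omega>" for \<omega>
          unfolding sI integrand_def using False by (intro sum.cong) (auto simp: X'_def C'_def indicator_def)
        then show ?thesis using False by simp
      qed
    qed
    finally show "(\<integral>\<^sup>+\<omega>. ennreal ((integral_of N C X \<omega> - Z \<omega>)\<^sup>2) \<partial>M) =
      (\<integral>\<^sup>+z. indicator A z * (\<integral>\<^sup>+\<omega>. ennreal ((integrand N C X z \<omega> - cexp A (integrand N C X z) \<omega>)\<^sup>2) \<partial>M) +
         indicator (- A) z * (\<integral>\<^sup>+\<omega>. ennreal ((integrand N C X z \<omega>)\<^sup>2) \<partial>M) \<partial>lborel)" .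
  qed
qed

lemma integrand_square_integrable:
  assumes E: "elementary {..<N} a C X"
  shows "integrable M (\<lambda>\<omega>. (integrand N C X z \<omega>)\<^sup>2)"
proof -
  obtain K where K: "\<And>i \<omega>. i < N \<Longrightarrow> \<omega> \<in> space M \<Longrightarrow> \<bar>X i \<omega>\<bar> \<le> K i"
    using E unfolding elementary_def by (metis lessThan_iff)
  have b: "\<bar>integrand N C X z \<omega>\<bar> \<le> (\<Sum>i<N. K i)" if w: "\<omega> \<in> space M" for \<omega>
  proof -
    have "\<bar>integrand N C X z \<omega>\<bar> \<le> (\<Sum>i<N. \<bar>X i \<omega> * indicator (C i) z\<bar>)" unfolding integrand_def by (rule sum_abs)
    also have "\<dots> \<le> (\<Sum>i<N. K i)"
    proof (rule sum_mono)
      fix i assume "i \<in> {..<N}"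
      then show "\<bar>X i \<omega> * indicator (C i) z\<bar> \<le> K i" using K[OF _ w, of i] by (auto simp: indicator_def)
    qed
    finally show ?thesis .
  qed
  show ?thesis
  proof (rule bounded_integrable[of _ "(\<Sum>i<N. K i)\<^sup>2"])
    show "(\<lambda>\<omega>. (integrand N C X z \<omega>)\<^sup>2) \<in> borel_measurable M" by (intro borel_measurable_power integrand_measurable[OF E])
    show "\<bar>(integrand N C X z \<omega>)\<^sup>2\<bar> \<le> (\<Sum>i<N. K i)\<^sup>2" if "\<omega> \<in> space M" for \<omega>
      using power_mono[OF b[OF that], of 2] by simp
  qed
qed

text \<open>The estimate is exact for elementary integrals. The factor 4 arises from using
  \<open>(p + q)\<^sup>2 \<le> 2 * p\<^sup>2 + 2 * q\<^sup>2\<close> twice, to pass from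
  \<open>I\<close> to an elementary integral and from \<open>f\<close> to its integrand; it only
  affects the exponential rate of the Volterra argument. The majorants \<open>Ub\<close> and
  \<open>Qb\<close> are there because the quantities they bound are not known to be measurable in
  \<open>z\<close>.\<close>

theorem walsh_integral_localization:
  assumes I: "has_walsh_integral M W f I" and A: "A \<in> sets borel"
    and fz: "\<And>z. f (fst z) (snd z) \<in> borel_measurable M" "\<And>z. integrable M (\<lambda>\<omega>. (f (fst z) (snd z) \<omega>)\<^sup>2)"
    and Ub[measurable]: "Ub \<in> borel_measurable lborel" and Qb[measurable]: "Qb \<in> borel_measurable lborel"
    and U: "\<And>z. (\<integral>\<^sup>+\<omega>. ennreal ((f (fst z) (snd z) \<omega> - cexp A (f (fst z) (snd z)) \<omega>)\<^sup>2) \<partial>M) \<le> Ub z"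
    and Q: "\<And>z. (\<integral>\<^sup>+\<omega>. ennreal ((f (fst z) (snd z) \<omega>)\<^sup>2) \<partial>M) \<le> Qb z"
    and I2: "integrable M (\<lambda>\<omega>. (I \<omega>)\<^sup>2)"
  shows "(\<integral>\<^sup>+\<omega>. ennreal ((I \<omega> - cexp A I \<omega>)\<^sup>2) \<partial>M) \<le> 4 * (\<integral>\<^sup>+z. indicator A z * Ub z + indicator (- A) z * Qb z \<partial>lborel)"
proof (rule has_walsh_integralE[OF I])
  fix N a C X f'
  assume E: "\<And>n. elementary {..<N n :: nat} (a n) (C n) (X n)"
    and f': "(\<lambda>(z, \<omega>). f' z \<omega>) \<in> borel_measurable (lborel \<Otimes>\<^sub>M M)"
    and ff': "AE z in lborel. AE \<omega> in M. f' z \<omega> = f (fst z) (snd z) \<omega>"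
    and l1: "(\<lambda>n. \<integral>\<^sup>+z. (\<integral>\<^sup>+\<omega>. ennreal ((integrand (N n) (C n) (X n) z \<omega> - f' z \<omega>)\<^sup>2) \<partial>M) \<partial>lborel) \<longlonglongrightarrow> 0"
    and l2: "(\<lambda>n. \<integral>\<^sup>+\<omega>. ennreal ((integral_of (N n) (C n) (X n) \<omega> - I \<omega>)\<^sup>2) \<partial>M) \<longlonglongrightarrow> 0"
    and Im: "I \<in> borel_measurable M"
  have [measurable]: "A \<in> sets lborel" using A by simp
  define R where "R = (\<integral>\<^sup>+z. indicator A z * Ub z + indicator (- A) z * Qb z \<partial>lborel)"
  define d where "d n z = (\<integral>\<^sup>+\<omega>. ennreal ((integrand (N n) (C n) (X n) z \<omega> - f' z \<omega>)\<^sup>2) \<partial>M)" for n z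
  define D where "D n = (\<integral>\<^sup>+z. d n z \<partial>lborel)" for n
  define J where "J n = (\<integral>\<^sup>+\<omega>. ennreal ((integral_of (N n) (C n) (X n) \<omega> - I \<omega>)\<^sup>2) \<partial>M)" for n
  have dm: "d n \<in> borel_measurable lborel" for n
  proof -
    have "(\<lambda>p. integrand (N n) (C n) (X n) (fst p) (snd p)) \<in> borel_measurable (lborel \<Otimes>\<^sub>M M)"
      using integrand_measurable(1)[OF E[of n]] by (simp add: case_prod_beta')
    moreover have "(\<lambda>p. f' (fst p) (snd p)) \<in> borel_measurable (lborel \<Otimes>\<^sub>M M)"
      using f' by (simp add: case_prod_beta')
    ultimately have "(\<lambda>(z, \<omega>). ennreal ((integrand (N n) (C n) (X n) z \<omega> - f' z \<omega>)\<^sup>2)) \<in> borel_measurable (lborel \<Otimes>\<^sub>M M)"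
      unfolding case_prod_beta' by measurable
    then show ?thesis unfolding d_def by (rule borel_measurable_nn_integral)
  qed
  have main: "(\<integral>\<^sup>+\<omega>. ennreal ((I \<omega> - cexp A I \<omega>)\<^sup>2) \<partial>M) \<le> 2 * J n + 2 * (2 * R + 2 * D n)" for n
  proof (rule elementary_localization[OF E[of n] A])
    let ?J = "integral_of (N n) (C n) (X n)" and ?g = "integrand (N n) (C n) (X n)"
    fix Z assume Z: "Z \<in> borel_measurable (NA A)" "integrable M (\<lambda>\<omega>. (Z \<omega>)\<^sup>2)"
      and iso: "(\<integral>\<^sup>+\<omega>. ennreal ((?J \<omega> - Z \<omega>)\<^sup>2) \<partial>M) =
      (\<integral>\<^sup>+z. indicator A z * (\<integral>\<^sup>+\<omega>. ennreal ((?g z \<omega> - cexp A (?g z) \<omega>)\<^sup>2) \<partial>M) +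
         indicator (- A) z * (\<integral>\<^sup>+\<omega>. ennreal ((?g z \<omega>)\<^sup>2) \<partial>M) \<partial>lborel)"
    have Jm: "?J \<in> borel_measurable M"
      using elementary_sum_square_integrable(1)[OF E[of n]] unfolding integral_of_def .
    have ZM: "Z \<in> borel_measurable M" by (rule NA_measurable_M[OF Z(1)])
    have "(\<integral>\<^sup>+\<omega>. ennreal ((I \<omega> - cexp A I \<omega>)\<^sup>2) \<partial>M) \<le> (\<integral>\<^sup>+\<omega>. ennreal ((I \<omega> - Z \<omega>)\<^sup>2) \<partial>M)"
      by (rule cexp_best_approx_nn[OF Im I2 Z])
    also have "\<dots> = (\<integral>\<^sup>+\<omega>. ennreal (((I \<omega> - ?J \<omega>) + (?J \<omega> - Z \<omega>))\<^sup>2) \<partial>M)" by simp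
    also have "\<dots> \<le> 2 * (\<integral>\<^sup>+\<omega>. ennreal ((I \<omega> - ?J \<omega>)\<^sup>2) \<partial>M) + 2 * (\<integral>\<^sup>+\<omega>. ennreal ((?J \<omega> - Z \<omega>)\<^sup>2) \<partial>M)"
      by (rule nn_integral_square_add_le) (intro borel_measurable_diff Im Jm ZM)+
    also have "(\<integral>\<^sup>+\<omega>. ennreal ((I \<omega> - ?J \<omega>)\<^sup>2) \<partial>M) = J n" by (simp add: J_def power2_commute)
    finally have 1: "(\<integral>\<^sup>+\<omega>. ennreal ((I \<omega> - cexp A I \<omega>)\<^sup>2) \<partial>M) \<le> 2 * J n + 2 * (\<integral>\<^sup>+\<omega>. ennreal ((?J \<omega> - Z \<omega>)\<^sup>2) \<partial>M)" .
    have "(\<integral>\<^sup>+\<omega>. ennreal ((?J \<omega> - Z \<omega>)\<^sup>2) \<partial>M) \<le>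
        (\<integral>\<^sup>+z. 2 * (indicator A z * Ub z + indicator (- A) z * Qb z) + 2 * d n z \<partial>lborel)"
      unfolding iso
    proof (rule nn_integral_mono_AE)
      show "AE z in lborel. indicator A z * (\<integral>\<^sup>+\<omega>. ennreal ((?g z \<omega> - cexp A (?g z) \<omega>)\<^sup>2) \<partial>M) +
         indicator (- A) z * (\<integral>\<^sup>+\<omega>. ennreal ((?g z \<omega>)\<^sup>2) \<partial>M) \<le>
        2 * (indicator A z * Ub z + indicator (- A) z * Qb z) + 2 * d n z"
        using ff'
      proof eventually_elim
        case (elim z)
        let ?F = "f (fst z) (snd z)"
        have gm: "?g z \<in> borel_measurable M" by (rule integrand_measurable(2)[OF E])
        have g2: "integrable M (\<lambda>\<omega>. (?g z \<omega>)\<^sup>2)" by (rule integrand_square_integrable[OF E])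
        have dz: "d n z = (\<integral>\<^sup>+\<omega>. ennreal ((?g z \<omega> - ?F \<omega>)\<^sup>2) \<partial>M)"
          unfolding d_def using elim by (intro nn_integral_cong_AE) (auto elim!: eventually_mono)
        show ?case
        proof (cases "z \<in> A")
          case True
          have "(\<integral>\<^sup>+\<omega>. ennreal ((?g z \<omega> - cexp A (?g z) \<omega>)\<^sup>2) \<partial>M) \<le> (\<integral>\<^sup>+\<omega>. ennreal ((?g z \<omega> - cexp A ?F \<omega>)\<^sup>2) \<partial>M)"
            by (rule cexp_best_approx_nn[OF gm g2 cexp_measurable cexp_square_integrable[OF fz]])
          also have "\<dots> = (\<integral>\<^sup>+\<omega>. ennreal (((?F \<omega> - cexp A ?F \<omega>) + (?g z \<omega> - ?F \<omega>))\<^sup>2) \<partial>M)" by simp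
          also have "\<dots> \<le> 2 * (\<integral>\<^sup>+\<omega>. ennreal ((?F \<omega> - cexp A ?F \<omega>)\<^sup>2) \<partial>M) + 2 * (\<integral>\<^sup>+\<omega>. ennreal ((?g z \<omega> - ?F \<omega>)\<^sup>2) \<partial>M)"
            by (rule nn_integral_square_add_le) (intro borel_measurable_diff fz cexp_measurable_M gm)+
          also have "\<dots> \<le> 2 * Ub z + 2 * d n z" unfolding dz by (intro add_mono mult_left_mono U) auto
          finally show ?thesis using True by simp
        next
          case False
          have "(\<integral>\<^sup>+\<omega>. ennreal ((?g z \<omega>)\<^sup>2) \<partial>M) = (\<integral>\<^sup>+\<omega>. ennreal ((?F \<omega> + (?g z \<omega> - ?F \<omega>))\<^sup>2) \<partial>M)" by simp
          also have "\<dots> \<le> 2 * (\<integral>\<^sup>+\<omega>. ennreal ((?F \<omega>)\<^sup>2) \<partial>M) + 2 * (\<integral>\<^sup>+\<omega>. ennreal ((?g z \<omega> - ?F \<omega>)\<^sup>2) \<partial>M)"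
            by (rule nn_integral_square_add_le) (intro borel_measurable_diff fz gm)+
          also have "\<dots> \<le> 2 * Qb z + 2 * d n z" unfolding dz by (intro add_mono mult_left_mono Q) auto
          finally show ?thesis using False by simp
        qed
      qed
    qed
    also have "\<dots> = 2 * R + 2 * D n"
    proof -
      have m: "(\<lambda>z. indicator A z * Ub z + indicator (- A) z * Qb z) \<in> borel_measurable lborel" by measurable
      show ?thesis unfolding R_def D_def nn_integral_cmult[OF m, symmetric] nn_integral_cmult[OF dm, symmetric]
        by (rule nn_integral_add) (use m dm[of n] in measurable)
    qed
    finally have 2: "(\<integral>\<^sup>+\<omega>. ennreal ((?J \<omega> - Z \<omega>)\<^sup>2) \<partial>M) \<le> 2 * R + 2 * D n" .
    show ?thesis by (rule order_trans[OF 1]) (intro add_mono mult_left_mono 2 order_refl; simp)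
  qed
  have "(\<lambda>n. 2 * J n + 2 * (2 * R + 2 * D n)) \<longlonglongrightarrow> 2 * 0 + 2 * (2 * R + 2 * 0)"
    by (intro tendsto_add ennreal_tendsto_cmult tendsto_const
      l1[folded d_def, folded D_def] l2[folded J_def]) auto
  then have "(\<integral>\<^sup>+\<omega>. ennreal ((I \<omega> - cexp A I \<omega>)\<^sup>2) \<partial>M) \<le> 2 * 0 + 2 * (2 * R + 2 * 0)"
    by (rule tendsto_lowerbound) (simp_all only: main eventually_True trivial_limit_sequentially not_False_eq_True)
  also have "\<dots> = 4 * R" by (simp add: mult.assoc[symmetric])
  finally show ?thesis unfolding R_def .
qed

end

subsection \<open>The heat kernel\<close>

lemma heat_kernel_pos: "0 < s \<Longrightarrow> 0 < heat_kernel s y"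
  by (simp add: heat_kernel_def)

lemma heat_kernel_measurable [measurable]:
  assumes [measurable]: "f \<in> borel_measurable N" "g \<in> borel_measurable N"
  shows "(\<lambda>z. heat_kernel (f z) (g z)) \<in> borel_measurable N"
  unfolding heat_kernel_def by measurable

lemma heat_kernel_minus: "heat_kernel s (- y) = heat_kernel s y"
  by (simp add: heat_kernel_def)

lemma nn_integral_heat_kernel:
  assumes "0 < s"
  shows "(\<integral>\<^sup>+y. ennreal (heat_kernel s (y - m)) \<partial>lborel) = 1"
proof -
  have "(\<integral>\<^sup>+y. ennreal (heat_kernel s (y - m)) \<partial>lborel) = (\<integral>\<^sup>+y. ennreal (normal_density m (sqrt s) y) \<partial>lborel)"
    using assms by (intro nn_integral_cong) (simp add: heat_kernel_def normal_density_def)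
  also have "\<dots> = 1"
    using assms by (subst nn_integral_eq_integral) auto
  finally show ?thesis .
qed

text \<open>The bridge decomposition: the density of a Brownian path at an intermediate time and at
  its end is the density of the end times that of the bridge, which is normal with interpolated mean
  and variance \<open>a * b / (a + b)\<close>.\<close>

lemma heat_kernel_product:
  assumes "0 < a" "0 < b"
  shows "heat_kernel a (x - y) * heat_kernel b (y - z) =
    heat_kernel (a + b) (x - z) * heat_kernel (a * b / (a + b)) (y - (b * x + a * z) / (a + b))"
proof -
  have e: "- (x - y)\<^sup>2 / (2 * a) + - (y - z)\<^sup>2 / (2 * b) =
     - (x - z)\<^sup>2 / (2 * (a + b)) + - (y - (b * x + a * z) / (a + b))\<^sup>2 / (2 * (a * b / (a + b)))"
  proof -
    have "a + b \<noteq> 0" using assms by simp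
    then have "y - (b * x + a * z) / (a + b) = (b * (y - x) + a * (y - z)) / (a + b)"
      by (simp add: field_simps)
    then have "(y - (b * x + a * z) / (a + b))\<^sup>2 / (2 * (a * b / (a + b))) = (b * (y - x) + a * (y - z))\<^sup>2 / (2 * a * b * (a + b))"
      using assms by (simp add: power_divide power2_eq_square)
    then have "(x - z)\<^sup>2 / (2 * (a + b)) + (y - (b * x + a * z) / (a + b))\<^sup>2 / (2 * (a * b / (a + b))) =
       (a * b * (x - z)\<^sup>2 + (b * (y - x) + a * (y - z))\<^sup>2) / (2 * a * b * (a + b))"
      using assms by (simp add: add_divide_distrib)
    also have "a * b * (x - z)\<^sup>2 + (b * (y - x) + a * (y - z))\<^sup>2 = (a + b) * (b * (x - y)\<^sup>2 + a * (y - z)\<^sup>2)"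
      by (simp add: power2_eq_square algebra_simps)
    also have "(a + b) * (b * (x - y)\<^sup>2 + a * (y - z)\<^sup>2) / (2 * a * b * (a + b)) = (b * (x - y)\<^sup>2 + a * (y - z)\<^sup>2) / (2 * a * b)"
      using \<open>a + b \<noteq> 0\<close> by simp
    also have "\<dots> = (x - y)\<^sup>2 / (2 * a) + (y - z)\<^sup>2 / (2 * b)"
      using assms by (simp add: add_divide_distrib)
    finally show ?thesis by simp
  qed
  have s: "sqrt (2 * pi * a) * sqrt (2 * pi * b) = sqrt (2 * pi * (a + b)) * sqrt (2 * pi * (a * b / (a + b)))"
    using assms by (simp add: real_sqrt_mult[symmetric])
  show ?thesis unfolding heat_kernel_def
    using e s by (simp add: exp_add[symmetric] mult_exp_exp)
qed

lemma heat_kernel_convolution: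
  assumes "0 < a" "0 < b"
  shows "(\<integral>\<^sup>+y. ennreal (heat_kernel a (x - y) * heat_kernel b (y - z)) \<partial>lborel) = ennreal (heat_kernel (a + b) (x - z))"
proof -
  have "a * b / (a + b) > 0" using assms by simp
  then show ?thesis unfolding heat_kernel_product[OF assms]
    using assms heat_kernel_pos[of "a + b" "x - z"]
    by (simp add: ennreal_mult' nn_integral_cmult nn_integral_heat_kernel less_imp_le)
qed

lemma heat_kernel_square:
  assumes "0 < a"
  shows "(heat_kernel a y)\<^sup>2 = heat_kernel (a / 2) y / (2 * sqrt (pi * a))"
proof -
  have "sqrt (2 * pi * a) * sqrt (2 * pi * a) = 2 * (sqrt (pi * a) * sqrt (pi * a))"
    using assms by simp
  moreover have "(exp (- y\<^sup>2 / (2 * a)))\<^sup>2 = exp (- y\<^sup>2 / (2 * (a / 2)))"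
    using assms by (simp add: power2_eq_square exp_add[symmetric] add_divide_distrib[symmetric])
  ultimately show ?thesis using assms
    by (simp add: heat_kernel_def power_mult_distrib power_divide)
qed

text \<open>Squares of heat kernels are multiples of heat kernels at half the time, so the semigroup
  property applies. Second moments of the mild equation propagate through this identity.\<close>

lemma heat_kernel_square_convolution:
  assumes "0 < a" "0 < b"
  shows "(\<integral>\<^sup>+y. ennreal ((heat_kernel a (x - y))\<^sup>2 * (heat_kernel b (y - z))\<^sup>2) \<partial>lborel) =
     ennreal (sqrt ((a + b) / (4 * pi * a * b)) * (heat_kernel (a + b) (x - z))\<^sup>2)"
proof -
  have eq: "(heat_kernel a (x - y))\<^sup>2 * (heat_kernel b (y - z))\<^sup>2 =
     1 / (2 * sqrt (pi * a)) * (1 / (2 * sqrt (pi * b))) * (heat_kernel (a / 2) (x - y) * heat_kernel (b / 2) (y - z))" for y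
    using assms by (simp add: heat_kernel_square)
  have "(\<integral>\<^sup>+y. ennreal ((heat_kernel a (x - y))\<^sup>2 * (heat_kernel b (y - z))\<^sup>2) \<partial>lborel) =
     ennreal (1 / (2 * sqrt (pi * a)) * (1 / (2 * sqrt (pi * b)))) *
       (\<integral>\<^sup>+y. ennreal (heat_kernel (a / 2) (x - y) * heat_kernel (b / 2) (y - z)) \<partial>lborel)"
    unfolding eq using assms by (subst nn_integral_cmult[symmetric]) (auto simp: ennreal_mult'[symmetric])
  also have "\<dots> = ennreal (1 / (2 * sqrt (pi * a)) * (1 / (2 * sqrt (pi * b))) * heat_kernel ((a + b) / 2) (x - z))"
    using assms by (subst heat_kernel_convolution) (auto simp: ennreal_mult'[symmetric] add_divide_distrib)
  also have "heat_kernel ((a + b) / 2) (x - z) = (heat_kernel (a + b) (x - z))\<^sup>2 * (2 * sqrt (pi * (a + b)))"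
    using assms by (simp add: heat_kernel_square)
  also have "1 / (2 * sqrt (pi * a)) * (1 / (2 * sqrt (pi * b))) * ((heat_kernel (a + b) (x - z))\<^sup>2 * (2 * sqrt (pi * (a + b)))) =
     sqrt ((a + b) / (4 * pi * a * b)) * (heat_kernel (a + b) (x - z))\<^sup>2"
    unfolding real_sqrt_mult real_sqrt_divide real_sqrt_four using assms by (simp add: divide_simps)
  finally show ?thesis .
qed

subsection \<open>A Volterra inequality with a bridge kernel\<close>

text \<open>The factor by which the integral of \<open>(heat_kernel (s - r) (y - z))\<^sup>2 *
  (heat_kernel r z)\<^sup>2\<close> over \<open>z\<close> exceeds
  \<open>(heat_kernel s y)\<^sup>2\<close>; see
  \<open>heat_kernel_square_convolution\<close>.\<close>

definition bridge_kernel :: "real \<Rightarrow> real \<Rightarrow> real" where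
  "bridge_kernel s r = sqrt (s / (4 * pi * r * (s - r)))"

lemma bridge_kernel_nonneg: "0 < r \<Longrightarrow> r < s \<Longrightarrow> 0 \<le> bridge_kernel s r"
  by (simp add: bridge_kernel_def)

lemma bridge_kernel_measurable [measurable]: "bridge_kernel s \<in> borel_measurable borel"
  unfolding bridge_kernel_def by measurable

lemma nn_integral_inverse_sqrt_exp:
  assumes q: "0 < q"
  shows "(\<integral>\<^sup>+r. ennreal (indicator {0<..} r * (exp (- q * r) / sqrt r)) \<partial>lborel) = ennreal (sqrt (pi / q))"
proof -
  have "ennreal (sqrt pi) = (\<integral>\<^sup>+t. ennreal (indicator {0..} t * t powr (1/2 - 1) / exp t) \<partial>lborel)"
    using Gamma_conv_nn_integral_real[of "1/2"] by (simp add: Gamma_one_half_real)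
  also have "\<dots> = (\<integral>\<^sup>+t. ennreal (indicator {0<..} t * (exp (- t) / sqrt t)) \<partial>lborel)"
    by (intro nn_integral_cong)
       (auto simp: indicator_def powr_minus powr_half_sqrt exp_minus field_simps split: if_splits)
  also have "\<dots> = \<bar>q\<bar> * (\<integral>\<^sup>+t. ennreal (indicator {0<..} (0 + q * t) * (exp (- (0 + q * t)) / sqrt (0 + q * t))) \<partial>lborel)"
    using q by (intro nn_integral_real_affine) auto
  also have "\<dots> = ennreal q * (\<integral>\<^sup>+t. ennreal (1 / sqrt q) * ennreal (indicator {0<..} t * (exp (- q * t) / sqrt t)) \<partial>lborel)"
    using q by (intro arg_cong2[where f="(*)"] nn_integral_cong)
      (auto simp: indicator_def zero_less_mult_iff real_sqrt_mult ennreal_mult'[symmetric])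
  also have "\<dots> = ennreal (sqrt q) * (\<integral>\<^sup>+t. ennreal (indicator {0<..} t * (exp (- q * t) / sqrt t)) \<partial>lborel)"
    using q by (subst nn_integral_cmult) (auto simp: mult.assoc[symmetric] ennreal_mult[symmetric] real_div_sqrt)
  finally have e: "ennreal (sqrt pi) = ennreal (sqrt q) * (\<integral>\<^sup>+t. ennreal (indicator {0<..} t * (exp (- q * t) / sqrt t)) \<partial>lborel)" .
  have "ennreal (sqrt (pi / q)) = ennreal (1 / sqrt q) * ennreal (sqrt pi)"
    using q by (simp add: ennreal_mult[symmetric] real_sqrt_divide)
  also have "\<dots> = (ennreal (1 / sqrt q) * ennreal (sqrt q)) * (\<integral>\<^sup>+t. ennreal (indicator {0<..} t * (exp (- q * t) / sqrt t)) \<partial>lborel)"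
    unfolding e by (simp only: mult.assoc)
  also have "ennreal (1 / sqrt q) * ennreal (sqrt q) = 1"
    using q by (simp add: ennreal_mult[symmetric])
  finally show ?thesis by simp
qed

text \<open>The kernel has an inverse square root singularity at each end. On either half of the
  interval the distance to the far end is at least \<open>s / 2\<close>, which leaves only the near
  singularity; on the second half \<open>exp (- q * r)\<close> is at most
  \<open>exp (- q * (s - r))\<close>.\<close>

lemma bridge_kernel_exp_bound:
  assumes q: "0 < q" and r: "0 < r" "r < s"
  shows "bridge_kernel s r * exp (- q * r) \<le>
     1 / sqrt (2 * pi) * (exp (- q * r) / sqrt r) + 1 / sqrt (2 * pi) * (exp (- q * (s - r)) / sqrt (s - r))"
proof -
  have k: "bridge_kernel s r \<le> 1 / sqrt (2 * pi) * (1 / sqrt u)" if u: "0 < u" "u = r \<and> 2 * r \<le> s \<or> u = s - r \<and> 2 * (s - r) \<le> s" for u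
  proof -
    have "s / (4 * pi * r * (s - r)) \<le> 1 / (2 * pi * u)"
      using r u by (auto simp: field_simps)
    then have "bridge_kernel s r \<le> sqrt (1 / (2 * pi * u))"
      unfolding bridge_kernel_def by (rule real_sqrt_le_mono)
    then show ?thesis by (simp add: real_sqrt_divide real_sqrt_mult)
  qed
  show ?thesis
  proof (cases "2 * r \<le> s")
    case True
    have "bridge_kernel s r * exp (- q * r) \<le> 1 / sqrt (2 * pi) * (1 / sqrt r) * exp (- q * r)"
      using k[of r] r True by (intro mult_right_mono) auto
    moreover have "0 \<le> 1 / sqrt (2 * pi) * (exp (- q * (s - r)) / sqrt (s - r))" using r by simp
    ultimately show ?thesis by simp
  next
    case False
    have "bridge_kernel s r * exp (- q * r) \<le> 1 / sqrt (2 * pi) * (1 / sqrt (s - r)) * exp (- q * (s - r))"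
      using k[of "s - r"] r False q by (intro mult_mono) auto
    moreover have "0 \<le> 1 / sqrt (2 * pi) * (exp (- q * r) / sqrt r)" using r by simp
    ultimately show ?thesis by simp
  qed
qed

lemma nn_integral_bridge_kernel_exp:
  assumes q: "0 < q"
  shows "(\<integral>\<^sup>+r. ennreal (indicator {0<..<s} r * (bridge_kernel s r * exp (- q * r))) \<partial>lborel) \<le> ennreal (sqrt (2 / q))"
proof -
  let ?h = "\<lambda>r. indicator {0<..} r * (exp (- q * r) / sqrt r)"
  have "(\<integral>\<^sup>+r. ennreal (indicator {0<..<s} r * (bridge_kernel s r * exp (- q * r))) \<partial>lborel) \<le>
      (\<integral>\<^sup>+r. ennreal (1 / sqrt (2 * pi)) * ennreal (?h r) + ennreal (1 / sqrt (2 * pi)) * ennreal (?h (s - r)) \<partial>lborel)"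
  proof (rule nn_integral_mono)
    fix r
    have "indicator {0<..<s} r * (bridge_kernel s r * exp (- q * r)) \<le> 1 / sqrt (2 * pi) * ?h r + 1 / sqrt (2 * pi) * ?h (s - r)"
      using bridge_kernel_exp_bound[OF q, of r s] by (auto simp: indicator_def)
    moreover have "ennreal (1 / sqrt (2 * pi)) * ennreal (?h r) + ennreal (1 / sqrt (2 * pi)) * ennreal (?h (s - r)) =
        ennreal (1 / sqrt (2 * pi) * ?h r + 1 / sqrt (2 * pi) * ?h (s - r))"
      by (subst ennreal_plus) (auto simp: ennreal_mult'[symmetric] indicator_def)
    ultimately show "ennreal (indicator {0<..<s} r * (bridge_kernel s r * exp (- q * r))) \<le>
      ennreal (1 / sqrt (2 * pi)) * ennreal (?h r) + ennreal (1 / sqrt (2 * pi)) * ennreal (?h (s - r))"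
      by (simp only: ennreal_leI)
  qed
  also have "\<dots> = ennreal (1 / sqrt (2 * pi)) * (\<integral>\<^sup>+r. ennreal (?h r) \<partial>lborel) +
      ennreal (1 / sqrt (2 * pi)) * (\<integral>\<^sup>+r. ennreal (?h (s - r)) \<partial>lborel)"
    by (subst nn_integral_add) (auto simp: nn_integral_cmult)
  also have "(\<integral>\<^sup>+r. ennreal (?h (s - r)) \<partial>lborel) = (\<integral>\<^sup>+r. ennreal (?h r) \<partial>lborel)"
    using nn_integral_real_affine[of "\<lambda>r. ennreal (?h r)" "-1" s] by simp
  also have "(\<integral>\<^sup>+r. ennreal (?h r) \<partial>lborel) = ennreal (sqrt (pi / q))"
    by (rule nn_integral_inverse_sqrt_exp[OF q])
  also have "ennreal (1 / sqrt (2 * pi)) * ennreal (sqrt (pi / q)) + ennreal (1 / sqrt (2 * pi)) * ennreal (sqrt (pi / q)) =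
      ennreal (2 * (1 / sqrt (2 * pi) * sqrt (pi / q)))"
    using q by (simp add: ennreal_mult'[symmetric] ennreal_plus[symmetric] del: ennreal_plus)
  also have "2 * (1 / sqrt (2 * pi) * sqrt (pi / q)) = sqrt (2 / q)"
    using q by (simp add: real_sqrt_divide real_sqrt_mult field_simps)
  finally show ?thesis .
qed

text \<open>The bridge kernel is symmetric under \<open>r \<mapsto> s - r\<close>, which turns
  growth into decay at the cost of the factor \<open>exp (q * s)\<close>. Large \<open>q\<close>
  makes the remaining factor small, and the contraction below rests on this.\<close>

lemma nn_integral_bridge_kernel_exp':
  assumes q: "0 < q"
  shows "(\<integral>\<^sup>+r. ennreal (indicator {0<..<s} r * (bridge_kernel s r * exp (q * r))) \<partial>lborel) \<le> ennreal (sqrt (2 / q) * exp (q * s))"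
proof -
  have "(\<integral>\<^sup>+r. ennreal (indicator {0<..<s} r * (bridge_kernel s r * exp (q * r))) \<partial>lborel) =
     ennreal \<bar>-1\<bar> * (\<integral>\<^sup>+r. ennreal (indicator {0<..<s} (s + -1 * r) * (bridge_kernel s (s + -1 * r) * exp (q * (s + -1 * r)))) \<partial>lborel)"
    by (intro nn_integral_real_affine) auto
  also have "\<dots> = (\<integral>\<^sup>+r. ennreal (exp (q * s)) * ennreal (indicator {0<..<s} r * (bridge_kernel s r * exp (- q * r))) \<partial>lborel)"
    by (auto intro!: nn_integral_cong simp: indicator_def bridge_kernel_def ennreal_mult'[symmetric] right_diff_distrib
        exp_diff exp_minus field_simps)
  also have "\<dots> = ennreal (exp (q * s)) * (\<integral>\<^sup>+r. ennreal (indicator {0<..<s} r * (bridge_kernel s r * exp (- q * r))) \<partial>lborel)"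
    by (rule nn_integral_cmult) auto
  also have "\<dots> \<le> ennreal (exp (q * s)) * ennreal (sqrt (2 / q))"
    by (intro mult_left_mono nn_integral_bridge_kernel_exp q) auto
  also have "\<dots> = ennreal (sqrt (2 / q) * exp (q * s))" using q by (simp add: ennreal_mult[symmetric] mult.commute)
  finally show ?thesis .
qed

subsection \<open>Decay of the localization error\<close>

text \<open>\<open>C0\<close> is meant as the constant in the second moment bound for
  \<open>u\<close>. The distance from the segment grows linearly in \<open>r\<close>, while the
  bridge to \<open>(t, x)\<close> fluctuates by at most the order of \<open>sqrt r\<close>; leaving
  \<open>A\<close> is therefore unlikely only after a time of order
  \<open>1 / c\<^sup>2\<close>.\<close>

locale localization_region =
  fixes t x c C0 :: real and A :: "(real \<times> real) set"
  assumes t: "0 < t" and c: "0 < c" and C0: "0 \<le> C0" and A[measurable]: "A \<in> sets borel"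
    and far: "\<And>r z. 0 < r \<Longrightarrow> r < t \<Longrightarrow> (r, z) \<notin> A \<Longrightarrow> c * r \<le> \<bar>z - r * x / t\<bar>"
begin

definition source :: "(real \<times> real \<Rightarrow> ennreal) \<Rightarrow> real \<times> real \<Rightarrow> ennreal" where
  "source U w = indicator A w * U w + indicator (- A) w * ennreal (C0 * (heat_kernel (fst w) (snd w))\<^sup>2)"

text \<open>The right-hand side of \<open>walsh_integral_localization\<close> for the mild equation:
  if \<open>U\<close> bounds the mean-square localization error of \<open>u\<close> at all earlier
  points, then \<open>error_map U\<close> bounds it at \<open>p\<close>. Off \<open>A\<close> no
  noise is kept, so \<open>source\<close> charges the entire second moment there.\<close>

definition error_map :: "(real \<times> real \<Rightarrow> ennreal) \<Rightarrow> real \<times> real \<Rightarrow> ennreal" where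
  "error_map U p = 4 * (\<integral>\<^sup>+w. ennreal (indicator {0<..<fst p} (fst w) * (heat_kernel (fst p - fst w) (snd p - snd w))\<^sup>2) *
      source U w \<partial>lborel)"

lemma source_measurable [measurable]:
  assumes [measurable]: "U \<in> borel_measurable borel"
  shows "source U \<in> borel_measurable borel"
proof -
  note [measurable] = borel_measurable_fst_snd
  show ?thesis unfolding source_def[abs_def] by measurable
qed

lemma kernel_measurable:
  "(\<lambda>q :: (real \<times> real) \<times> (real \<times> real). ennreal (indicator {0<..<fst (fst q)} (fst (snd q)) *
     (heat_kernel (fst (fst q) - fst (snd q)) (snd (fst q) - snd (snd q)))\<^sup>2)) \<in> borel_measurable borel"
proof -
  have [measurable]: "(\<lambda>q :: (real \<times> real) \<times> (real \<times> real). fst (fst q)) \<in> borel_measurable borel"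
    "(\<lambda>q :: (real \<times> real) \<times> (real \<times> real). snd (fst q)) \<in> borel_measurable borel"
    "(\<lambda>q :: (real \<times> real) \<times> (real \<times> real). fst (snd q)) \<in> borel_measurable borel"
    "(\<lambda>q :: (real \<times> real) \<times> (real \<times> real). snd (snd q)) \<in> borel_measurable borel"
    by (auto intro!: borel_measurable_continuous_onI continuous_intros)
  have "(\<lambda>q :: (real \<times> real) \<times> (real \<times> real). indicator {0<..<fst (fst q)} (fst (snd q)) :: real) =
     (\<lambda>q. if 0 < fst (snd q) \<and> fst (snd q) < fst (fst q) then 1 else 0)"
    by (auto simp: indicator_def)
  then have [measurable]: "(\<lambda>q :: (real \<times> real) \<times> (real \<times> real). indicator {0<..<fst (fst q)} (fst (snd q)) :: real) \<in> borel_measurable borel"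
    by simp
  show ?thesis by measurable
qed

lemma error_map_measurable [measurable]:
  assumes U: "U \<in> borel_measurable borel"
  shows "error_map U \<in> borel_measurable borel"
proof -
  have "(\<lambda>q :: (real \<times> real) \<times> (real \<times> real). ennreal (indicator {0<..<fst (fst q)} (fst (snd q)) *
     (heat_kernel (fst (fst q) - fst (snd q)) (snd (fst q) - snd (snd q)))\<^sup>2) * source U (snd q)) \<in> borel_measurable (borel \<Otimes>\<^sub>M lborel)"
  proof (intro borel_measurable_times_ennreal)
    show "(\<lambda>q :: (real \<times> real) \<times> (real \<times> real). ennreal (indicator {0<..<fst (fst q)} (fst (snd q)) *
     (heat_kernel (fst (fst q) - fst (snd q)) (snd (fst q) - snd (snd q)))\<^sup>2)) \<in> borel_measurable (borel \<Otimes>\<^sub>M lborel)"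
      using kernel_measurable by (simp add: borel_prod measurable_cong_sets[OF sets_pair_measure_cong[OF refl sets_lborel] refl])
    show "(\<lambda>q. source U (snd q)) \<in> borel_measurable (borel \<Otimes>\<^sub>M lborel)"
      using source_measurable[OF U] by measurable
  qed
  then show ?thesis unfolding error_map_def[abs_def]
    by (intro borel_measurable_times_ennreal borel_measurable_const lborel.borel_measurable_nn_integral)
      (simp add: case_prod_beta')
qed

text \<open>The iteration controls this average against the squared kernel to the target, not
  \<open>U\<close> pointwise: \<open>A\<close> surrounds only the segment to \<open>(t, x)\<close>,
  and the error of \<open>u r z\<close> need not be small for \<open>z\<close> away from it.\<close>

definition weighted :: "(real \<times> real \<Rightarrow> ennreal) \<Rightarrow> real \<Rightarrow> ennreal" where
  "weighted U r = (\<integral>\<^sup>+z. ennreal ((heat_kernel (t - r) (x - z))\<^sup>2) * U (r, z) \<partial>lborel)"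

lemma heat_kernel_bridge_square:
  assumes r: "0 < r" "r < t"
  shows "(heat_kernel (t - r) (x - z))\<^sup>2 * (heat_kernel r z)\<^sup>2 =
    (heat_kernel t x)\<^sup>2 * (heat_kernel (r * (t - r) / t) (z - r * x / t))\<^sup>2"
proof -
  have "heat_kernel (t - r) (x - z) * heat_kernel r (z - 0) =
    heat_kernel (t - r + r) (x - 0) * heat_kernel ((t - r) * r / (t - r + r)) (z - (r * x + (t - r) * 0) / (t - r + r))"
    using r by (intro heat_kernel_product) auto
  then have "heat_kernel (t - r) (x - z) * heat_kernel r z = heat_kernel t x * heat_kernel (r * (t - r) / t) (z - r * x / t)"
    by (simp add: mult.commute)
  then show ?thesis by (simp only: power_mult_distrib[symmetric])
qed

lemma weighted_initial:
  assumes r: "0 < r" "r < t"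
  shows "weighted (\<lambda>w. ennreal (C0 * (heat_kernel (fst w) (snd w))\<^sup>2)) r = ennreal (bridge_kernel t r * (heat_kernel t x)\<^sup>2 * C0)"
proof -
  have "weighted (\<lambda>w. ennreal (C0 * (heat_kernel (fst w) (snd w))\<^sup>2)) r =
     (\<integral>\<^sup>+z. ennreal C0 * ennreal ((heat_kernel (t - r) (x - z))\<^sup>2 * (heat_kernel r (z - 0))\<^sup>2) \<partial>lborel)"
    unfolding weighted_def using C0
    by (intro nn_integral_cong) (simp add: ennreal_mult'[symmetric] mult_ac)
  also have "\<dots> = ennreal C0 * ennreal (sqrt ((t - r + r) / (4 * pi * (t - r) * r)) * (heat_kernel (t - r + r) (x - 0))\<^sup>2)"
  proof -
    have "(\<integral>\<^sup>+z. ennreal C0 * ennreal ((heat_kernel (t - r) (x - z))\<^sup>2 * (heat_kernel r (z - 0))\<^sup>2) \<partial>lborel) =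
       ennreal C0 * (\<integral>\<^sup>+z. ennreal ((heat_kernel (t - r) (x - z))\<^sup>2 * (heat_kernel r (z - 0))\<^sup>2) \<partial>lborel)"
      by (rule nn_integral_cmult) measurable
    also have "(\<integral>\<^sup>+z. ennreal ((heat_kernel (t - r) (x - z))\<^sup>2 * (heat_kernel r (z - 0))\<^sup>2) \<partial>lborel) =
       ennreal (sqrt ((t - r + r) / (4 * pi * (t - r) * r)) * (heat_kernel (t - r + r) (x - 0))\<^sup>2)"
      using r by (intro heat_kernel_square_convolution) auto
    finally show ?thesis .
  qed
  finally show ?thesis using C0 by (simp add: ennreal_mult'[symmetric] bridge_kernel_def mult_ac)
qed

text \<open>Off \<open>A\<close> the bridge has to deviate by \<open>c * r\<close>. Squaring its
  density doubles the Gaussian exponent: one half becomes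
  \<open>exp (- (c\<^sup>2 / 2) * r)\<close>, since the variance \<open>v\<close> of the bridge is
  at most \<open>r\<close>, and the other half is kept as a density that integrates to 1.\<close>

lemma weighted_far:
  assumes r: "0 < r" "r < t"
  shows "weighted (\<lambda>w. indicator (- A) w * ennreal (C0 * (heat_kernel (fst w) (snd w))\<^sup>2)) r \<le>
    ennreal (bridge_kernel t r * (heat_kernel t x)\<^sup>2 * (sqrt 2 * C0 * exp (- (c\<^sup>2 / 2) * r)))"
proof -
  define v where "v = r * (t - r) / t"
  have v: "v > 0" "v \<le> r" using r t by (auto simp: v_def field_simps)
  define B where "B = sqrt 2 / (2 * sqrt (pi * v)) * exp (- (c\<^sup>2 / 2) * r)"
  have B0: "B \<ge> 0" using v by (simp add: B_def)
  have pt: "(heat_kernel v y)\<^sup>2 \<le> B * heat_kernel v y" if y: "c * r \<le> \<bar>y\<bar>" for y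
  proof -
    have "c\<^sup>2 * r * v \<le> c\<^sup>2 * r * r" using v r by (intro mult_left_mono) auto
    also have "\<dots> = (c * r)\<^sup>2" by (simp add: power2_eq_square)
    also have "\<dots> \<le> \<bar>y\<bar>\<^sup>2" using y c r by (intro power_mono) auto
    finally have "c\<^sup>2 * r * v \<le> y\<^sup>2" by simp
    then have "- y\<^sup>2 / v \<le> - y\<^sup>2 / (2 * v) + (- (c\<^sup>2 / 2) * r)"
      using v by (simp add: field_simps)
    then have "exp (- y\<^sup>2 / v) \<le> exp (- y\<^sup>2 / (2 * v)) * exp (- (c\<^sup>2 / 2) * r)"
      by (simp add: exp_add[symmetric])
    then have "1 / (2 * pi * v) * exp (- y\<^sup>2 / v) \<le> 1 / (2 * pi * v) * (exp (- y\<^sup>2 / (2 * v)) * exp (- (c\<^sup>2 / 2) * r))"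
      using v by (intro mult_left_mono) auto
    moreover have "(heat_kernel v y)\<^sup>2 = 1 / (2 * pi * v) * exp (- y\<^sup>2 / v)"
      using v by (simp add: heat_kernel_def power_mult_distrib power_divide power2_eq_square[of "exp _"] exp_add[symmetric])
    moreover have "B * heat_kernel v y = 1 / (2 * pi * v) * (exp (- y\<^sup>2 / (2 * v)) * exp (- (c\<^sup>2 / 2) * r))"
      using v by (simp add: B_def heat_kernel_def real_sqrt_mult field_simps)
    ultimately show ?thesis by simp
  qed
  have "weighted (\<lambda>w. indicator (- A) w * ennreal (C0 * (heat_kernel (fst w) (snd w))\<^sup>2)) r \<le>
     (\<integral>\<^sup>+z. ennreal (C0 * (heat_kernel t x)\<^sup>2 * B) * ennreal (heat_kernel v (z - r * x / t)) \<partial>lborel)"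
    unfolding weighted_def
  proof (rule nn_integral_mono)
    fix z
    show "ennreal ((heat_kernel (t - r) (x - z))\<^sup>2) * (indicator (- A) (r, z) * ennreal (C0 * (heat_kernel (fst (r, z)) (snd (r, z)))\<^sup>2))
      \<le> ennreal (C0 * (heat_kernel t x)\<^sup>2 * B) * ennreal (heat_kernel v (z - r * x / t))"
    proof (cases "(r, z) \<in> A")
      case False
      have "ennreal ((heat_kernel (t - r) (x - z))\<^sup>2) * ennreal (C0 * (heat_kernel r z)\<^sup>2) =
          ennreal (C0 * ((heat_kernel (t - r) (x - z))\<^sup>2 * (heat_kernel r z)\<^sup>2))"
        using C0 by (simp add: ennreal_mult'[symmetric] mult_ac)
      also have "\<dots> = ennreal (C0 * (heat_kernel t x)\<^sup>2 * (heat_kernel v (z - r * x / t))\<^sup>2)"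
        using heat_kernel_bridge_square[OF r, of z] by (simp add: v_def mult.assoc)
      also have "\<dots> \<le> ennreal (C0 * (heat_kernel t x)\<^sup>2 * (B * heat_kernel v (z - r * x / t)))"
        using C0 pt far[OF r False] by (intro ennreal_leI mult_left_mono) auto
      also have "\<dots> = ennreal (C0 * (heat_kernel t x)\<^sup>2 * B) * ennreal (heat_kernel v (z - r * x / t))"
        using C0 B0 by (subst ennreal_mult'[symmetric]) (auto simp: mult_ac)
      finally show ?thesis using False by simp
    qed simp
  qed
  also have "\<dots> = ennreal (C0 * (heat_kernel t x)\<^sup>2 * B)"
    using v by (simp add: nn_integral_cmult nn_integral_heat_kernel)
  also have "B = bridge_kernel t r * (sqrt 2 * exp (- (c\<^sup>2 / 2) * r))"
  proof -
    have "1 / (2 * sqrt (pi * v)) = sqrt (1 / (4 * pi * v))" using v by (simp add: real_sqrt_divide real_sqrt_mult)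
    also have "1 / (4 * pi * v) = t / (4 * pi * r * (t - r))" using r t by (simp add: v_def)
    finally have "1 / (2 * sqrt (pi * v)) = bridge_kernel t r" by (simp add: bridge_kernel_def)
    then show ?thesis unfolding B_def by (metis mult.assoc mult.commute times_divide_eq_right mult_1_right)
  qed
  finally show ?thesis by (simp add: mult_ac)
qed

lemma weighted_source:
  assumes [measurable]: "U \<in> borel_measurable borel" and r: "0 < r" "r < t" and b: "0 \<le> b"
    and U: "weighted U r \<le> ennreal (bridge_kernel t r * (heat_kernel t x)\<^sup>2 * b)"
  shows "weighted (source U) r \<le> ennreal (bridge_kernel t r * (heat_kernel t x)\<^sup>2 * (b + sqrt 2 * C0 * exp (- (c\<^sup>2 / 2) * r)))"
proof -
  have [measurable]: "(\<lambda>z::real. (r, z)) \<in> borel_measurable borel"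
    by (auto intro!: borel_measurable_continuous_onI continuous_intros)
  have [measurable]: "(\<lambda>z. indicator A (r, z) :: ennreal) \<in> borel_measurable borel"
    "(\<lambda>z. indicator (- A) (r, z) :: ennreal) \<in> borel_measurable borel"
    by (rule measurable_compose[OF \<open>(\<lambda>z::real. (r, z)) \<in> borel_measurable borel\<close>], measurable)+
  have [measurable]: "(\<lambda>z. U (r, z)) \<in> borel_measurable borel"
    by (rule measurable_compose[OF \<open>(\<lambda>z::real. (r, z)) \<in> borel_measurable borel\<close>], measurable)
  have "weighted (source U) r = (\<integral>\<^sup>+z. ennreal ((heat_kernel (t - r) (x - z))\<^sup>2) * (indicator A (r, z) * U (r, z)) +
      ennreal ((heat_kernel (t - r) (x - z))\<^sup>2) * (indicator (- A) (r, z) * ennreal (C0 * (heat_kernel r z)\<^sup>2)) \<partial>lborel)"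
    unfolding weighted_def source_def by (simp add: distrib_left)
  also have "\<dots> = (\<integral>\<^sup>+z. ennreal ((heat_kernel (t - r) (x - z))\<^sup>2) * (indicator A (r, z) * U (r, z)) \<partial>lborel) +
      weighted (\<lambda>w. indicator (- A) w * ennreal (C0 * (heat_kernel (fst w) (snd w))\<^sup>2)) r"
    unfolding weighted_def by (subst nn_integral_add) auto
  also have "\<dots> \<le> weighted U r + ennreal (bridge_kernel t r * (heat_kernel t x)\<^sup>2 * (sqrt 2 * C0 * exp (- (c\<^sup>2 / 2) * r)))"
    unfolding weighted_def[of U]
    by (intro add_mono weighted_far r nn_integral_mono mult_left_mono) (auto simp: indicator_def)
  also have "\<dots> \<le> ennreal (bridge_kernel t r * (heat_kernel t x)\<^sup>2 * b) +
      ennreal (bridge_kernel t r * (heat_kernel t x)\<^sup>2 * (sqrt 2 * C0 * exp (- (c\<^sup>2 / 2) * r)))"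
    by (intro add_mono U order_refl)
  also have "\<dots> = ennreal (bridge_kernel t r * (heat_kernel t x)\<^sup>2 * (b + sqrt 2 * C0 * exp (- (c\<^sup>2 / 2) * r)))"
    using b C0 bridge_kernel_nonneg[OF r] by (subst ennreal_plus[symmetric]) (auto simp: distrib_left)
  finally show ?thesis .
qed

text \<open>The fixed point of the map \<open>b \<mapsto> (b + \<beta>) / 2\<close> by which one
  iteration changes the bound. Half of it is 4 times the integral bound for the source off
  \<open>A\<close>, where the decay at rate \<open>c\<^sup>2 / 2\<close> against the bridge kernel
  gives \<open>2 / c\<close>.\<close>

definition \<beta> :: real where "\<beta> = 16 * sqrt 2 * C0 / c"

text \<open>The rate 128 is large enough to make the Volterra operator a contraction with factor 1/2.\<close>

lemma volterra_step:
  assumes b: "0 \<le> b"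
  shows "4 * (\<integral>\<^sup>+r. ennreal (indicator {0<..<s} r * (bridge_kernel s r * (b * exp (128 * r) + sqrt 2 * C0 * exp (- (c\<^sup>2 / 2) * r)))) \<partial>lborel)
    \<le> ennreal ((b + \<beta>) / 2 * exp (128 * \<bar>s\<bar>))"
proof -
  have "(\<integral>\<^sup>+r. ennreal (indicator {0<..<s} r * (bridge_kernel s r * (b * exp (128 * r) + sqrt 2 * C0 * exp (- (c\<^sup>2 / 2) * r)))) \<partial>lborel) =
     (\<integral>\<^sup>+r. ennreal b * ennreal (indicator {0<..<s} r * (bridge_kernel s r * exp (128 * r))) +
       ennreal (sqrt 2 * C0) * ennreal (indicator {0<..<s} r * (bridge_kernel s r * exp (- (c\<^sup>2 / 2) * r))) \<partial>lborel)"
    using b C0 bridge_kernel_nonneg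
    by (intro nn_integral_cong) (auto simp: indicator_def ennreal_mult'[symmetric] ennreal_plus[symmetric] distrib_left mult_ac simp del: ennreal_plus)
  also have "\<dots> = ennreal b * (\<integral>\<^sup>+r. ennreal (indicator {0<..<s} r * (bridge_kernel s r * exp (128 * r))) \<partial>lborel) +
       ennreal (sqrt 2 * C0) * (\<integral>\<^sup>+r. ennreal (indicator {0<..<s} r * (bridge_kernel s r * exp (- (c\<^sup>2 / 2) * r))) \<partial>lborel)"
    by (subst nn_integral_add) (auto simp: nn_integral_cmult)
  also have "\<dots> \<le> ennreal b * ennreal (sqrt (2 / 128) * exp (128 * s)) + ennreal (sqrt 2 * C0) * ennreal (sqrt (2 / (c\<^sup>2 / 2)))"
    using c by (intro add_mono mult_left_mono nn_integral_bridge_kernel_exp nn_integral_bridge_kernel_exp') auto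
  also have "sqrt (2 / 128) = 1 / (8::real)" by (rule real_sqrt_unique) (auto simp: power2_eq_square)
  also have "sqrt (2 / (c\<^sup>2 / 2)) = 2 / c" using c by (intro real_sqrt_unique) (auto simp: power2_eq_square field_simps)
  also have "ennreal b * ennreal (1 / 8 * exp (128 * s)) + ennreal (sqrt 2 * C0) * ennreal (2 / c) =
     ennreal (b / 8 * exp (128 * s) + \<beta> / 8)"
    using b c C0 by (simp add: ennreal_mult'[symmetric] ennreal_plus[symmetric] \<beta>_def field_simps del: ennreal_plus)
  also have "\<dots> \<le> ennreal ((b + \<beta>) / 8 * exp (128 * \<bar>s\<bar>))"
  proof (rule ennreal_leI)
    have "b / 8 * exp (128 * s) \<le> b / 8 * exp (128 * \<bar>s\<bar>)" using b by (intro mult_left_mono) auto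
    moreover have "\<beta> / 8 * 1 \<le> \<beta> / 8 * exp (128 * \<bar>s\<bar>)" using c C0 by (intro mult_left_mono) (auto simp: \<beta>_def)
    ultimately show "b / 8 * exp (128 * s) + \<beta> / 8 \<le> (b + \<beta>) / 8 * exp (128 * \<bar>s\<bar>)"
      by (simp add: add_divide_distrib distrib_right)
  qed
  finally have "4 * (\<integral>\<^sup>+r. ennreal (indicator {0<..<s} r * (bridge_kernel s r * (b * exp (128 * r) + sqrt 2 * C0 * exp (- (c\<^sup>2 / 2) * r)))) \<partial>lborel)
    \<le> 4 * ennreal ((b + \<beta>) / 8 * exp (128 * \<bar>s\<bar>))" by (rule mult_left_mono) simp
  also have "\<dots> = ennreal (4 * ((b + \<beta>) / 8 * exp (128 * \<bar>s\<bar>)))" by (subst ennreal_mult') auto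
  finally show ?thesis by simp
qed

lemma nn_integral_pair: "f \<in> borel_measurable borel \<Longrightarrow> (\<integral>\<^sup>+w. f w \<partial>(lborel :: (real \<times> real) measure)) = (\<integral>\<^sup>+r. \<integral>\<^sup>+z. f (r, z) \<partial>lborel \<partial>lborel)"
  unfolding lborel_prod[symmetric] by (rule lborel.nn_integral_fst[symmetric]) (simp add: lborel_prod)

text \<open>Shared by two situations: at the target itself \<open>\<kappa>\<close> and
  \<open>K\<close> are 1 and \<open>s = t\<close>; at an intermediate time \<open>\<kappa>\<close>
  comes from integrating out the spatial point and \<open>K\<close> is
  \<open>bridge_kernel t s\<close>.\<close>

lemma time_integral_bound:
  assumes [measurable]: "U \<in> borel_measurable borel" and b: "0 \<le> b"
    and U: "\<And>r. 0 < r \<Longrightarrow> r < t \<Longrightarrow> weighted U r \<le> ennreal (bridge_kernel t r * (heat_kernel t x)\<^sup>2 * (b * exp (128 * r)))"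
    and s: "0 < s" "s \<le> t" and \<kappa>: "\<And>r. 0 < r \<Longrightarrow> r < s \<Longrightarrow> 0 \<le> \<kappa> r \<and> \<kappa> r * bridge_kernel t r = K * bridge_kernel s r"
    and K: "0 \<le> K"
  shows "4 * (\<integral>\<^sup>+r. ennreal (indicator {0<..<s} r * \<kappa> r) * weighted (source U) r \<partial>lborel) \<le>
    ennreal (K * (heat_kernel t x)\<^sup>2 * ((b + \<beta>) / 2 * exp (128 * s)))"
proof -
  have "(\<integral>\<^sup>+r. ennreal (indicator {0<..<s} r * \<kappa> r) * weighted (source U) r \<partial>lborel) \<le>
     (\<integral>\<^sup>+r. ennreal (K * (heat_kernel t x)\<^sup>2) * ennreal (indicator {0<..<s} r * (bridge_kernel s r * (b * exp (128 * r) + sqrt 2 * C0 * exp (- (c\<^sup>2 / 2) * r)))) \<partial>lborel)"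
  proof (rule nn_integral_mono)
    fix r
    show "ennreal (indicator {0<..<s} r * \<kappa> r) * weighted (source U) r \<le>
      ennreal (K * (heat_kernel t x)\<^sup>2) * ennreal (indicator {0<..<s} r * (bridge_kernel s r * (b * exp (128 * r) + sqrt 2 * C0 * exp (- (c\<^sup>2 / 2) * r))))"
    proof (cases "0 < r \<and> r < s")
      case True
      then have r: "0 < r" "r < t" using s by auto
      have k: "0 \<le> \<kappa> r" "\<kappa> r * bridge_kernel t r = K * bridge_kernel s r" using \<kappa> True by auto
      have "ennreal (\<kappa> r) * weighted (source U) r \<le> ennreal (\<kappa> r) *
          ennreal (bridge_kernel t r * (heat_kernel t x)\<^sup>2 * (b * exp (128 * r) + sqrt 2 * C0 * exp (- (c\<^sup>2 / 2) * r)))"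
        using b by (intro mult_left_mono weighted_source r U) auto
      also have "\<dots> = ennreal ((\<kappa> r * bridge_kernel t r) * (heat_kernel t x)\<^sup>2 * (b * exp (128 * r) + sqrt 2 * C0 * exp (- (c\<^sup>2 / 2) * r)))"
        unfolding mult.assoc by (rule ennreal_mult'[symmetric, OF k(1)])
      also have "\<dots> = ennreal (K * (heat_kernel t x)\<^sup>2) * ennreal (bridge_kernel s r * (b * exp (128 * r) + sqrt 2 * C0 * exp (- (c\<^sup>2 / 2) * r)))"
        unfolding k using K by (subst ennreal_mult'[symmetric]) (auto simp: mult_ac)
      finally show ?thesis using True by simp
    qed auto
  qed
  also have "\<dots> = ennreal (K * (heat_kernel t x)\<^sup>2) * (\<integral>\<^sup>+r. ennreal (indicator {0<..<s} r * (bridge_kernel s r * (b * exp (128 * r) + sqrt 2 * C0 * exp (- (c\<^sup>2 / 2) * r)))) \<partial>lborel)"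
    by (rule nn_integral_cmult) measurable
  finally have "4 * (\<integral>\<^sup>+r. ennreal (indicator {0<..<s} r * \<kappa> r) * weighted (source U) r \<partial>lborel) \<le>
      4 * (ennreal (K * (heat_kernel t x)\<^sup>2) * (\<integral>\<^sup>+r. ennreal (indicator {0<..<s} r * (bridge_kernel s r * (b * exp (128 * r) + sqrt 2 * C0 * exp (- (c\<^sup>2 / 2) * r)))) \<partial>lborel))"
    by (rule mult_left_mono) simp
  also have "\<dots> \<le> ennreal (K * (heat_kernel t x)\<^sup>2) * ennreal ((b + \<beta>) / 2 * exp (128 * \<bar>s\<bar>))"
    unfolding mult.left_commute[of 4] by (intro mult_left_mono volterra_step b) auto
  also have "\<dots> = ennreal (K * (heat_kernel t x)\<^sup>2 * ((b + \<beta>) / 2 * exp (128 * s)))"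
    using K s by (simp add: ennreal_mult'[symmetric])
  finally show ?thesis .
qed

lemma error_map_at_target:
  assumes Um: "U \<in> borel_measurable borel" and b: "0 \<le> b"
    and U: "\<And>r. 0 < r \<Longrightarrow> r < t \<Longrightarrow> weighted U r \<le> ennreal (bridge_kernel t r * (heat_kernel t x)\<^sup>2 * (b * exp (128 * r)))"
  shows "error_map U (t, x) \<le> ennreal ((heat_kernel t x)\<^sup>2 * ((b + \<beta>) / 2 * exp (128 * t)))"
proof -
  note [measurable] = Um source_measurable[OF Um]
  note [measurable] = borel_measurable_fst_snd
  have "error_map U (t, x) = 4 * (\<integral>\<^sup>+r. \<integral>\<^sup>+z. ennreal (indicator {0<..<t} r * (heat_kernel (t - r) (x - z))\<^sup>2) * source U (r, z) \<partial>lborel \<partial>lborel)"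
    unfolding error_map_def by (subst nn_integral_pair) auto
  also have "(\<integral>\<^sup>+r. \<integral>\<^sup>+z. ennreal (indicator {0<..<t} r * (heat_kernel (t - r) (x - z))\<^sup>2) * source U (r, z) \<partial>lborel \<partial>lborel) =
      (\<integral>\<^sup>+r. ennreal (indicator {0<..<t} r * 1) * weighted (source U) r \<partial>lborel)"
    by (intro nn_integral_cong) (auto simp: indicator_def weighted_def)
  also have "4 * \<dots> \<le> ennreal (1 * (heat_kernel t x)\<^sup>2 * ((b + \<beta>) / 2 * exp (128 * t)))"
    by (rule time_integral_bound[OF Um b U]) (use t in auto)
  finally show ?thesis by simp
qed

text \<open>Tonelli's theorem lets the intermediate point at time \<open>s\<close> be integrated out
  first, and the two squared kernels merge into the squared kernel from time \<open>r\<close> to the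
  target, times \<open>\<kappa> r\<close>. The identity \<open>\<kappa> r * bridge_kernel t r =
  bridge_kernel t s * bridge_kernel s r\<close> then reproduces the form of the hypothesis with
  \<open>s\<close> in the role of \<open>t\<close>.\<close>

lemma weighted_error_map:
  assumes Um: "U \<in> borel_measurable borel" and b: "0 \<le> b" and s: "0 < s" "s < t"
    and U: "\<And>r. 0 < r \<Longrightarrow> r < t \<Longrightarrow> weighted U r \<le> ennreal (bridge_kernel t r * (heat_kernel t x)\<^sup>2 * (b * exp (128 * r)))"
  shows "weighted (error_map U) s \<le> ennreal (bridge_kernel t s * (heat_kernel t x)\<^sup>2 * ((b + \<beta>) / 2 * exp (128 * s)))"
proof -
  note [measurable] = Um source_measurable[OF Um]
  note [measurable] = borel_measurable_fst_snd
  define g where "g y w = ennreal ((heat_kernel (t - s) (x - y))\<^sup>2) *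
     (ennreal (indicator {0<..<s} (fst w) * (heat_kernel (s - fst w) (y - snd w))\<^sup>2) * source U w)" for y :: real and w :: "real \<times> real"
  have gm: "case_prod g \<in> borel_measurable (lborel \<Otimes>\<^sub>M lborel)"
    unfolding g_def[abs_def] case_prod_beta' by measurable
  define \<kappa> where "\<kappa> r = sqrt ((t - r) / (4 * pi * (t - s) * (s - r)))" for r
  have "weighted (error_map U) s = (\<integral>\<^sup>+y. 4 * (\<integral>\<^sup>+w. g y w \<partial>lborel) \<partial>lborel)"
    unfolding weighted_def error_map_def
  proof (rule nn_integral_cong)
    fix y
    show "ennreal ((heat_kernel (t - s) (x - y))\<^sup>2) * (4 * (\<integral>\<^sup>+w. ennreal (indicator {0<..<fst (s, y)} (fst w) *
         (heat_kernel (fst (s, y) - fst w) (snd (s, y) - snd w))\<^sup>2) * source U w \<partial>lborel)) = 4 * (\<integral>\<^sup>+w. g y w \<partial>lborel)"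
      unfolding g_def by (subst nn_integral_cmult) (auto simp: mult.left_commute)
  qed
  also have "\<dots> = 4 * (\<integral>\<^sup>+y. (\<integral>\<^sup>+w. g y w \<partial>lborel) \<partial>lborel)"
    using gm by (intro nn_integral_cmult lborel.borel_measurable_nn_integral)
  also have "(\<integral>\<^sup>+y. (\<integral>\<^sup>+w. g y w \<partial>lborel) \<partial>lborel) = (\<integral>\<^sup>+w. (\<integral>\<^sup>+y. g y w \<partial>lborel) \<partial>lborel)"
    by (rule lborel_pair.Fubini'[OF gm, symmetric])
  also have "\<dots> = (\<integral>\<^sup>+w. ennreal (indicator {0<..<s} (fst w) * \<kappa> (fst w)) * (ennreal ((heat_kernel (t - fst w) (x - snd w))\<^sup>2) * source U w) \<partial>lborel)"
  proof (rule nn_integral_cong)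
    fix w :: "real \<times> real"
    show "(\<integral>\<^sup>+y. g y w \<partial>lborel) = ennreal (indicator {0<..<s} (fst w) * \<kappa> (fst w)) * (ennreal ((heat_kernel (t - fst w) (x - snd w))\<^sup>2) * source U w)"
    proof (cases "0 < fst w \<and> fst w < s")
      case True
      have "(\<integral>\<^sup>+y. g y w \<partial>lborel) = (\<integral>\<^sup>+y. ennreal ((heat_kernel (t - s) (x - y))\<^sup>2 * (heat_kernel (s - fst w) (y - snd w))\<^sup>2) * source U w \<partial>lborel)"
        using True by (intro nn_integral_cong) (simp add: g_def ennreal_mult' mult.assoc)
      also have "\<dots> = (\<integral>\<^sup>+y. ennreal ((heat_kernel (t - s) (x - y))\<^sup>2 * (heat_kernel (s - fst w) (y - snd w))\<^sup>2) \<partial>lborel) * source U w"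
        by (rule nn_integral_multc) measurable
      also have "(\<integral>\<^sup>+y. ennreal ((heat_kernel (t - s) (x - y))\<^sup>2 * (heat_kernel (s - fst w) (y - snd w))\<^sup>2) \<partial>lborel) =
          ennreal (sqrt ((t - s + (s - fst w)) / (4 * pi * (t - s) * (s - fst w))) * (heat_kernel (t - s + (s - fst w)) (x - snd w))\<^sup>2)"
        using True s by (intro heat_kernel_square_convolution) auto
      also have "\<dots> = ennreal (\<kappa> (fst w)) * ennreal ((heat_kernel (t - fst w) (x - snd w))\<^sup>2)"
        by (subst ennreal_mult''[symmetric]) (auto simp: \<kappa>_def)
      finally show ?thesis using True by (simp add: mult.assoc)
    qed (auto simp: g_def)
  qed
  also have "\<dots> = (\<integral>\<^sup>+r. \<integral>\<^sup>+z. ennreal (indicator {0<..<s} r * \<kappa> r) * (ennreal ((heat_kernel (t - r) (x - z))\<^sup>2) * source U (r, z)) \<partial>lborel \<partial>lborel)"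
    unfolding \<kappa>_def by (subst nn_integral_pair) auto
  also have "\<dots> = (\<integral>\<^sup>+r. ennreal (indicator {0<..<s} r * \<kappa> r) * weighted (source U) r \<partial>lborel)"
  proof (rule nn_integral_cong)
    fix r :: real
    have [measurable]: "(\<lambda>z::real. (r, z)) \<in> borel_measurable borel"
      by (auto intro!: borel_measurable_continuous_onI continuous_intros)
    have [measurable]: "(\<lambda>z. source U (r, z)) \<in> borel_measurable borel"
      by (rule measurable_compose[OF \<open>(\<lambda>z::real. (r, z)) \<in> borel_measurable borel\<close>], measurable)
    show "(\<integral>\<^sup>+z. ennreal (indicator {0<..<s} r * \<kappa> r) * (ennreal ((heat_kernel (t - r) (x - z))\<^sup>2) * source U (r, z)) \<partial>lborel) =
      ennreal (indicator {0<..<s} r * \<kappa> r) * weighted (source U) r"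
      unfolding weighted_def by (rule nn_integral_cmult) measurable
  qed
  also have "4 * \<dots> \<le> ennreal (bridge_kernel t s * (heat_kernel t x)\<^sup>2 * ((b + \<beta>) / 2 * exp (128 * s)))"
  proof (rule time_integral_bound[OF Um b U])
    fix r assume r: "0 < r" "r < s"
    have "(t - r) / (4 * pi * (t - s) * (s - r)) * (t / (4 * pi * r * (t - r))) = t / (4 * pi * s * (t - s)) * (s / (4 * pi * r * (s - r)))"
    proof -
      have "p / (4 * pi * q * w) * (t / (4 * pi * r * p)) = t / (4 * pi * s * q) * (s / (4 * pi * r * w))"
        if "p \<noteq> 0" for p q w :: real using that s by simp
      then show ?thesis using r s by auto
    qed
    then have "\<kappa> r * bridge_kernel t r = bridge_kernel t s * bridge_kernel s r"
      unfolding \<kappa>_def bridge_kernel_def real_sqrt_mult[symmetric] by simp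
    moreover have "0 \<le> \<kappa> r" using r s by (simp add: \<kappa>_def)
    ultimately show "0 \<le> \<kappa> r \<and> \<kappa> r * bridge_kernel t r = bridge_kernel t s * bridge_kernel s r" by simp
  qed (use s bridge_kernel_nonneg in auto)
  finally show ?thesis .
qed

definition error_bound :: "nat \<Rightarrow> real \<times> real \<Rightarrow> ennreal" where
  "error_bound n = (error_map ^^ n) (\<lambda>w. ennreal (C0 * (heat_kernel (fst w) (snd w))\<^sup>2))"

lemma error_bound_0: "error_bound 0 w = ennreal (C0 * (heat_kernel (fst w) (snd w))\<^sup>2)"
  by (simp add: error_bound_def)

lemma error_bound_Suc: "error_bound (Suc n) = error_map (error_bound n)"
  by (simp add: error_bound_def)

lemma error_bound_measurable: "error_bound n \<in> borel_measurable borel"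
proof (induction n)
  case 0
  note [measurable] = borel_measurable_fst_snd
  show ?case by (simp add: error_bound_def)
next
  case (Suc n) then show ?case by (simp add: error_bound_Suc)
qed

lemma \<beta>_nonneg: "0 \<le> \<beta>" using c C0 by (simp add: \<beta>_def)

lemma weighted_error_bound:
  "0 < s \<Longrightarrow> s < t \<Longrightarrow> weighted (error_bound n) s \<le> ennreal (bridge_kernel t s * (heat_kernel t x)\<^sup>2 * ((\<beta> + C0 / 2 ^ n) * exp (128 * s)))"
proof (induction n arbitrary: s)
  case 0
  have "weighted (error_bound 0) s = ennreal (bridge_kernel t s * (heat_kernel t x)\<^sup>2 * C0)"
    using weighted_initial[OF 0] by (simp add: error_bound_def)
  also have "\<dots> \<le> ennreal (bridge_kernel t s * (heat_kernel t x)\<^sup>2 * ((\<beta> + C0 / 2 ^ 0) * exp (128 * s)))"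
  proof (intro ennreal_leI mult_left_mono)
    have "C0 * 1 \<le> (\<beta> + C0 / 2 ^ 0) * exp (128 * s)" using \<beta>_nonneg C0 0 by (intro mult_mono) auto
    then show "C0 \<le> (\<beta> + C0 / 2 ^ 0) * exp (128 * s)" by simp
  qed (use 0 bridge_kernel_nonneg in auto)
  finally show ?case .
next
  case (Suc n)
  have b: "0 \<le> \<beta> + C0 / 2 ^ n" using \<beta>_nonneg C0 by simp
  have "weighted (error_bound (Suc n)) s \<le> ennreal (bridge_kernel t s * (heat_kernel t x)\<^sup>2 * ((\<beta> + C0 / 2 ^ n + \<beta>) / 2 * exp (128 * s)))"
    unfolding error_bound_Suc by (rule weighted_error_map[OF error_bound_measurable b Suc.prems Suc.IH])
  also have "(\<beta> + C0 / 2 ^ n + \<beta>) / 2 = \<beta> + C0 / 2 ^ Suc n" by (simp add: field_simps)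
  finally show ?case .
qed

text \<open>The averaged bounds \<open>\<beta> + C0 / 2 ^ n\<close> decrease to
  \<open>\<beta>\<close>, and a last application of \<open>error_map\<close> turns the average into
  a value at the target. Neither a limit of the iterates nor a fixed point has to be
  constructed.\<close>

theorem error_bound_limit:
  assumes e: "\<And>n. e \<le> error_bound n (t, x)"
  shows "e \<le> ennreal (16 * sqrt 2 * C0 / c * exp (128 * t) * (heat_kernel t x)\<^sup>2)"
proof -
  have "e \<le> ennreal ((heat_kernel t x)\<^sup>2 * ((\<beta> + C0 / 2 ^ n + \<beta>) / 2 * exp (128 * t)))" for n
  proof -
    have "error_bound (Suc n) (t, x) \<le> ennreal ((heat_kernel t x)\<^sup>2 * ((\<beta> + C0 / 2 ^ n + \<beta>) / 2 * exp (128 * t)))"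
      unfolding error_bound_Suc
      by (rule error_map_at_target[OF error_bound_measurable _ weighted_error_bound]) (use \<beta>_nonneg C0 in auto)
    then show ?thesis using e[of "Suc n"] by (rule order_trans[rotated])
  qed
  moreover have "(\<lambda>n. ennreal ((heat_kernel t x)\<^sup>2 * ((\<beta> + C0 / 2 ^ n + \<beta>) / 2 * exp (128 * t)))) \<longlonglongrightarrow>
     ennreal ((heat_kernel t x)\<^sup>2 * ((\<beta> + C0 * 0 + \<beta>) / 2 * exp (128 * t)))"
  proof -
    have "(\<lambda>n. (1 / 2) ^ n :: real) \<longlonglongrightarrow> 0" by (rule LIMSEQ_realpow_zero) auto
    then have "(\<lambda>n. (heat_kernel t x)\<^sup>2 * ((\<beta> + C0 * (1 / 2) ^ n + \<beta>) / 2 * exp (128 * t))) \<longlonglongrightarrow>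
     (heat_kernel t x)\<^sup>2 * ((\<beta> + C0 * 0 + \<beta>) / 2 * exp (128 * t))"
      by (intro tendsto_mult tendsto_divide tendsto_add tendsto_const) auto
    then show ?thesis by (intro tendsto_ennrealI) (simp add: power_one_over)
  qed
  ultimately have "e \<le> ennreal ((heat_kernel t x)\<^sup>2 * ((\<beta> + C0 * 0 + \<beta>) / 2 * exp (128 * t)))"
    by (intro LIMSEQ_le_const) auto
  then show ?thesis by (simp add: \<beta>_def mult_ac)
qed

end

subsection \<open>A subsolution of the heat equation with a box potential\<close>

lemma std_normal_cos_sin:
  "integrable lborel (\<lambda>y. std_normal_density y * cos (k * y))" "(\<integral>y. std_normal_density y * cos (k * y) \<partial>lborel) = exp (- k\<^sup>2 / 2)"
  "integrable lborel (\<lambda>y. std_normal_density y * sin (k * y))" "(\<integral>y. std_normal_density y * sin (k * y) \<partial>lborel) = 0"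
proof -
  have bd: "integrable lborel (\<lambda>y. std_normal_density y * f y)"
    if "f \<in> borel_measurable borel" "\<And>y. \<bar>f y\<bar> \<le> 1" for f :: "real \<Rightarrow> real"
    by (rule Bochner_Integration.integrable_bound[of _ std_normal_density])
      (use that in \<open>auto simp: abs_mult mult_left_le\<close>)
  show i1: "integrable lborel (\<lambda>y. std_normal_density y * cos (k * y))" by (rule bd) auto
  show i2: "integrable lborel (\<lambda>y. std_normal_density y * sin (k * y))" by (rule bd) auto
  have "complex_of_real (exp (- k\<^sup>2 / 2)) = (CLINT y|std_normal_distribution. iexp (k * y))"
    using char_std_normal_distribution by (simp add: char_def fun_eq_iff)
  also have "\<dots> = (CLINT y|lborel. std_normal_density y *\<^sub>R iexp (k * y))"
    by (subst integral_density) auto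
  finally have e: "(CLINT y|lborel. std_normal_density y *\<^sub>R iexp (k * y)) = complex_of_real (exp (- k\<^sup>2 / 2))" by simp
  have ic: "integrable lborel (\<lambda>y. std_normal_density y *\<^sub>R iexp (k * y))"
    by (rule Bochner_Integration.integrable_bound[of _ std_normal_density]) auto
  have "(\<integral>y. Re (std_normal_density y *\<^sub>R iexp (k * y)) \<partial>lborel) = exp (- k\<^sup>2 / 2)"
    unfolding integral_Re[OF ic] e by simp
  then show "(\<integral>y. std_normal_density y * cos (k * y) \<partial>lborel) = exp (- k\<^sup>2 / 2)" by (simp add: Re_exp)
  have "(\<integral>y. Im (std_normal_density y *\<^sub>R iexp (k * y)) \<partial>lborel) = 0"
    unfolding integral_Im[OF ic] e by simp
  then show "(\<integral>y. std_normal_density y * sin (k * y) \<partial>lborel) = 0" by (simp add: Im_exp)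
qed

lemma heat_kernel_scale: "0 < \<tau> \<Longrightarrow> heat_kernel \<tau> (sqrt \<tau> * y) = std_normal_density y / sqrt \<tau>"
  by (simp add: heat_kernel_def std_normal_density_def power_mult_distrib real_sqrt_mult field_simps)

text \<open>The cosine is an eigenfunction of the heat semigroup. The proof rescales to the standard
  normal law, whose characteristic function supplies the eigenvalue and removes the sine
  part.\<close>

lemma heat_kernel_cos:
  assumes \<tau>: "0 < \<tau>"
  shows "integrable lborel (\<lambda>y. heat_kernel \<tau> (z - y) * cos (k * y))"
    "(\<integral>y. heat_kernel \<tau> (z - y) * cos (k * y) \<partial>lborel) = exp (- k\<^sup>2 * \<tau> / 2) * cos (k * z)"
proof -
  let ?f = "\<lambda>y. heat_kernel \<tau> (z - y) * cos (k * y)"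
  define m where "m = k * sqrt \<tau>"
  have eq: "?f (z + sqrt \<tau> * y) = (cos (k * z) * (std_normal_density y * cos (m * y)) - sin (k * z) * (std_normal_density y * sin (m * y))) / sqrt \<tau>" for y
  proof -
    have A: "heat_kernel \<tau> (z - (z + sqrt \<tau> * y)) = std_normal_density y / sqrt \<tau>"
      using heat_kernel_minus[of \<tau> "sqrt \<tau> * y"] heat_kernel_scale[OF \<tau>, of y] by simp
    have B: "cos (k * (z + sqrt \<tau> * y)) = cos (k * z) * cos (m * y) - sin (k * z) * sin (m * y)"
      by (simp add: distrib_left cos_add m_def mult.assoc)
    show ?thesis unfolding A B by (simp add: diff_divide_distrib right_diff_distrib mult_ac)
  qed
  have i: "integrable lborel (\<lambda>y. ?f (z + sqrt \<tau> * y))"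
    unfolding eq using std_normal_cos_sin by simp
  have "integrable lborel ?f = integrable lborel (\<lambda>y. ?f (z + sqrt \<tau> * y))"
    using \<tau> by (intro lborel_integrable_real_affine_iff[symmetric]) auto
  then show "integrable lborel ?f" using i by simp
  have "(\<integral>y. ?f y \<partial>lborel) = \<bar>sqrt \<tau>\<bar> *\<^sub>R (\<integral>y. ?f (z + sqrt \<tau> * y) \<partial>lborel)"
    using \<tau> by (intro lborel_integral_real_affine) auto
  also have "\<dots> = cos (k * z) * exp (- m\<^sup>2 / 2)"
    unfolding eq using \<tau> std_normal_cos_sin[of m] by simp
  also have "m\<^sup>2 = k\<^sup>2 * \<tau>" using \<tau> by (simp add: m_def power_mult_distrib)
  finally show "(\<integral>y. ?f y \<partial>lborel) = exp (- k\<^sup>2 * \<tau> / 2) * cos (k * z)" by simp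
qed

text \<open>Integration by parts against \<open>(1 - cos (k y)) / k\<close> gives the sign.\<close>

lemma decreasing_sin_integral_nonneg:
  fixes q q' :: "real \<Rightarrow> real"
  assumes k: "0 < k" and q: "\<And>y. 0 \<le> q y" and d: "\<And>y. (q has_real_derivative q' y) (at y)"
    and c: "\<And>y. isCont q' y" and q': "\<And>y. 0 \<le> y \<Longrightarrow> q' y \<le> 0"
    and i: "set_integrable lborel {0..} (\<lambda>y. q y * sin (k * y))"
  shows "0 \<le> (\<integral>y\<in>{0..}. q y * sin (k * y) \<partial>lborel)"
proof -
  have qc: "isCont q y" for y using d DERIV_isCont by blast
  have fin: "0 \<le> (\<integral>y\<in>{0..R}. q y * sin (k * y) \<partial>lborel)" if R: "0 \<le> R" for R
  proof -
    define h where "h y = q' y * ((1 - cos (k * y)) / k)" for y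
    have "(\<integral>y. (q y * sin (k * y) + h y) * indicator {0..R} y \<partial>lborel) =
        q R * ((1 - cos (k * R)) / k) - q 0 * ((1 - cos (k * 0)) / k)"
    proof (rule integral_FTC_Icc_real[OF R])
      fix y
      have "((\<lambda>y. q y * ((1 - cos (k * y)) / k)) has_real_derivative (q' y * ((1 - cos (k * y)) / k) + sin (k * y) * q y)) (at y)"
        using k by (auto intro!: derivative_eq_intros d simp: field_simps)
      then show "((\<lambda>y. q y * ((1 - cos (k * y)) / k)) has_real_derivative (q y * sin (k * y) + h y)) (at y)"
        by (simp add: h_def algebra_simps)
      show "isCont (\<lambda>y. q y * sin (k * y) + h y) y"
        unfolding h_def using k by (intro continuous_intros c qc) auto
    qed
    then have e: "(\<integral>y. (q y * sin (k * y) + h y) * indicator {0..R} y \<partial>lborel) \<ge> 0"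
      using q k by simp
    have ih: "integrable lborel (\<lambda>y. indicator {0..R} y *\<^sub>R h y)"
      unfolding h_def using k by (intro borel_integrable_atLeastAtMost' [unfolded set_integrable_def] continuous_at_imp_continuous_on ballI continuous_intros c) auto
    have iq: "integrable lborel (\<lambda>y. indicator {0..R} y *\<^sub>R (q y * sin (k * y)))"
      by (intro borel_integrable_atLeastAtMost' [unfolded set_integrable_def] continuous_at_imp_continuous_on ballI continuous_intros qc)
    have "(\<integral>y. (q y * sin (k * y) + h y) * indicator {0..R} y \<partial>lborel) =
       (\<integral>y. indicator {0..R} y *\<^sub>R (q y * sin (k * y)) + indicator {0..R} y *\<^sub>R h y \<partial>lborel)"
      by (intro Bochner_Integration.integral_cong) (auto simp: algebra_simps)
    also have "\<dots> = (\<integral>y\<in>{0..R}. q y * sin (k * y) \<partial>lborel) + (\<integral>y. indicator {0..R} y *\<^sub>R h y \<partial>lborel)"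
      unfolding set_lebesgue_integral_def by (rule Bochner_Integration.integral_add[OF iq ih])
    also have "(\<integral>y. indicator {0..R} y *\<^sub>R h y \<partial>lborel) \<le> 0"
    proof -
      have "h y \<le> 0" if "0 \<le> y" for y
        unfolding h_def using k q'[OF that] by (intro mult_nonpos_nonneg divide_nonneg_pos) auto
      then have "0 \<le> (\<integral>y. - (indicator {0..R} y *\<^sub>R h y) \<partial>lborel)"
        by (intro integral_nonneg_AE AE_I2) (auto simp: indicator_def)
      then show ?thesis by simp
    qed
    finally show ?thesis using e by simp
  qed
  have "((\<lambda>R. \<integral>y\<in>{0..R}. q y * sin (k * y) \<partial>lborel) \<longlongrightarrow> (\<integral>y\<in>{0..}. q y * sin (k * y) \<partial>lborel)) at_top"
    by (rule tendsto_set_lebesgue_integral_at_top[OF _ i]) auto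
  then show ?thesis
    by (rule tendsto_lowerbound) (auto intro: eventually_mono[OF eventually_ge_at_top[of 0]] fin)
qed

text \<open>The principal Dirichlet eigenfunction of the interval \<open>[-w, w]\<close>, extended
  by 0.\<close>

definition arch :: "real \<Rightarrow> real \<Rightarrow> real" where
  "arch w z = (if \<bar>z\<bar> \<le> w then cos (pi * z / (2 * w)) else 0)"

lemma arch_bounds: "0 < w \<Longrightarrow> 0 \<le> arch w z" "arch w z \<le> 1"
proof -
  assume w: "0 < w"
  show "0 \<le> arch w z"
  proof (cases "\<bar>z\<bar> \<le> w")
    case True
    then have "pi * z \<le> pi * w" "pi * (- w) \<le> pi * z" by (intro mult_left_mono; simp)+
    then have "pi * z / (2 * w) \<le> pi / 2" "- (pi / 2) \<le> pi * z / (2 * w)" using w by (auto simp: field_simps)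
    then show ?thesis using True by (auto simp: arch_def intro!: cos_ge_zero)
  qed (simp add: arch_def)
qed (simp add: arch_def)

lemma arch_measurable [measurable]: "arch w \<in> borel_measurable borel"
  unfolding arch_def[abs_def] by measurable

text \<open>Beyond \<open>w\<close> the cosine continues as \<open>- sin (k * y)\<close>, that is,
  with a negative half wave. Seen from a point of the interval the heat kernel decreases there, so
  each negative half wave outweighs the positive one after it.\<close>

lemma cos_tail_nonpos:
  assumes \<tau>: "0 < \<tau>" and w: "0 < w" and z: "\<bar>z\<bar> \<le> w"
  defines "k \<equiv> pi / (2 * w)"
  shows "(\<integral>y. indicator {w..} y * (heat_kernel \<tau> (z - y) * cos (k * y)) \<partial>lborel) \<le> 0"
proof -
  define q where "q y = heat_kernel \<tau> (y + (w - z))" for y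
  define q' where "q' y = - (y + (w - z)) / \<tau> * q y" for y
  have k: "k > 0" using w by (simp add: k_def)
  have d: "(q has_real_derivative q' y) (at y)" for y
  proof -
    define K where "K = 1 / sqrt (2 * pi * \<tau>)"
    have "((\<lambda>y. K * exp (- (y + (w - z))\<^sup>2 / (2 * \<tau>))) has_real_derivative
       - (y + (w - z)) / \<tau> * (K * exp (- (y + (w - z))\<^sup>2 / (2 * \<tau>)))) (at y)"
      using \<tau> by (auto intro!: derivative_eq_intros simp: field_simps)
    then show ?thesis unfolding q_def[abs_def] q'_def heat_kernel_def K_def .
  qed
  have f: "indicator {w..} (w + 1 * y) * (heat_kernel \<tau> (z - (w + 1 * y)) * cos (k * (w + 1 * y))) = - (indicator {0..} y *\<^sub>R (q y * sin (k * y)))" for y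
  proof -
    have "k * (w + 1 * y) = pi / 2 + k * y" using w by (simp add: k_def field_simps)
    then have "cos (k * (w + 1 * y)) = - sin (k * y)" by (simp add: cos_add)
    moreover have "heat_kernel \<tau> (z - (w + 1 * y)) = q y"
      unfolding q_def by (subst heat_kernel_minus[symmetric]) (simp add: algebra_simps)
    ultimately show ?thesis by (simp add: indicator_def)
  qed
  have "integrable lborel (\<lambda>y. indicator {w..} y *\<^sub>R (heat_kernel \<tau> (z - y) * cos (k * y)))"
    by (rule integrable_mult_indicator[OF _ heat_kernel_cos(1)[OF \<tau>]]) auto
  then have "integrable lborel (\<lambda>y. indicator {w..} (w + 1 * y) * (heat_kernel \<tau> (z - (w + 1 * y)) * cos (k * (w + 1 * y))))"
    using lborel_integrable_real_affine[of "\<lambda>y. indicator {w..} y * (heat_kernel \<tau> (z - y) * cos (k * y))" 1 w] by simp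
  then have i: "set_integrable lborel {0..} (\<lambda>y. q y * sin (k * y))"
    unfolding f set_integrable_def by simp
  have "0 \<le> (\<integral>y\<in>{0..}. q y * sin (k * y) \<partial>lborel)"
  proof (rule decreasing_sin_integral_nonneg[OF k _ d _ _ i])
    show "0 \<le> q y" for y using heat_kernel_pos[OF \<tau>, of "y + (w - z)"] by (simp add: q_def)
    show "isCont q' y" for y
      unfolding q'_def using d \<tau> by (intro continuous_intros DERIV_isCont[OF d]) auto
    show "q' y \<le> 0" if "0 \<le> y" for y
      using heat_kernel_pos[OF \<tau>, of "y + (w - z)"] that z \<tau> by (auto simp: q'_def q_def mult_le_0_iff divide_le_0_iff)
  qed
  moreover have "(\<integral>y. indicator {w..} y * (heat_kernel \<tau> (z - y) * cos (k * y)) \<partial>lborel) =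
    \<bar>1\<bar> *\<^sub>R (\<integral>y. indicator {w..} (w + 1 * y) * (heat_kernel \<tau> (z - (w + 1 * y)) * cos (k * (w + 1 * y))) \<partial>lborel)"
    by (rule lborel_integral_real_affine) auto
  ultimately show ?thesis unfolding f set_lebesgue_integral_def by simp
qed

text \<open>For the cosine on the whole line equality holds. Removing the two tails, whose
  contributions are nonpositive, can only raise the integral. The decay rate is
  \<open>k\<^sup>2 / 2\<close> for \<open>k = pi / (2 * w)\<close>.\<close>

lemma heat_kernel_arch:
  assumes \<tau>: "0 < \<tau>" and w: "0 < w"
  shows "ennreal (exp (- (pi\<^sup>2 / (8 * w\<^sup>2)) * \<tau>) * arch w z) \<le> (\<integral>\<^sup>+y. ennreal (heat_kernel \<tau> (z - y) * arch w y) \<partial>lborel)"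
proof (cases "\<bar>z\<bar> \<le> w")
  case True
  define k where "k = pi / (2 * w)"
  let ?f = "\<lambda>y. heat_kernel \<tau> (z - y) * cos (k * y)"
  have k2: "k\<^sup>2 / 2 = pi\<^sup>2 / (8 * w\<^sup>2)" by (simp add: k_def power_divide power_mult_distrib)
  have fi: "integrable lborel ?f" by (rule heat_kernel_cos(1)[OF \<tau>])
  have si: "integrable lborel (\<lambda>y. indicator S y * ?f y)" if "S \<in> sets borel" for S
    using integrable_mult_indicator[OF _ fi, of S] that by simp
  have tail1: "(\<integral>y. indicator {w..} y * ?f y \<partial>lborel) \<le> 0"
    unfolding k_def by (rule cos_tail_nonpos[OF \<tau> w True])
  have tail2: "(\<integral>y. indicator {..-w} y * ?f y \<partial>lborel) \<le> 0"
  proof -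
    have "(\<integral>y. indicator {..-w} y * ?f y \<partial>lborel) = \<bar>-1\<bar> *\<^sub>R (\<integral>y. indicator {..-w} (0 + -1 * y) * ?f (0 + -1 * y) \<partial>lborel)"
      by (rule lborel_integral_real_affine) auto
    also have "\<dots> = (\<integral>y. indicator {w..} y * (heat_kernel \<tau> (- z - y) * cos (k * y)) \<partial>lborel)"
    proof -
      have "heat_kernel \<tau> (z + y) = heat_kernel \<tau> (- z - y)" for y
        using heat_kernel_minus[of \<tau> "z + y"] by simp
      then show ?thesis by (auto intro!: Bochner_Integration.integral_cong simp: indicator_def)
    qed
    also have "\<dots> \<le> 0" unfolding k_def by (rule cos_tail_nonpos[OF \<tau> w]) (use True in simp)
    finally show ?thesis .
  qed
  have ai: "integrable lborel (\<lambda>y. indicator {-w<..<w} y * ?f y)" by (rule si) auto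
  have "exp (- (k\<^sup>2 / 2) * \<tau>) * cos (k * z) = (\<integral>y. ?f y \<partial>lborel)"
    using heat_kernel_cos(2)[OF \<tau>, of z k] by simp
  also have "\<dots> = (\<integral>y. (indicator {-w<..<w} y * ?f y + indicator {w..} y * ?f y) + indicator {..-w} y * ?f y \<partial>lborel)"
    using w by (intro Bochner_Integration.integral_cong refl) (auto simp: indicator_def)
  also have "\<dots> = (\<integral>y. indicator {-w<..<w} y * ?f y \<partial>lborel) + (\<integral>y. indicator {w..} y * ?f y \<partial>lborel) + (\<integral>y. indicator {..-w} y * ?f y \<partial>lborel)"
    using si by simp
  finally have "exp (- (k\<^sup>2 / 2) * \<tau>) * cos (k * z) \<le> (\<integral>y. indicator {-w<..<w} y * ?f y \<partial>lborel)"
    using tail1 tail2 by simp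
  moreover have "arch w z = cos (k * z)" using True by (simp add: arch_def k_def)
  ultimately have "ennreal (exp (- (pi\<^sup>2 / (8 * w\<^sup>2)) * \<tau>) * arch w z) \<le> ennreal (\<integral>y. indicator {-w<..<w} y * ?f y \<partial>lborel)"
    unfolding k2 by (intro ennreal_leI) simp
  also have "\<dots> = (\<integral>\<^sup>+y. ennreal (indicator {-w<..<w} y * ?f y) \<partial>lborel)"
  proof (rule nn_integral_eq_integral[symmetric, OF ai], rule AE_I2)
    fix y
    show "0 \<le> indicator {-w<..<w} y * ?f y"
    proof (cases "y \<in> {-w<..<w}")
      case True
      then have "cos (k * y) = arch w y" by (auto simp: arch_def k_def)
      then show ?thesis using arch_bounds(1)[OF w, of y] heat_kernel_pos[OF \<tau>, of "z - y"] by simp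
    qed simp
  qed
  also have "\<dots> \<le> (\<integral>\<^sup>+y. ennreal (heat_kernel \<tau> (z - y) * arch w y) \<partial>lborel)"
  proof (intro nn_integral_mono ennreal_leI)
    fix y
    have "0 \<le> heat_kernel \<tau> (z - y) * arch w y" using arch_bounds(1)[OF w, of y] heat_kernel_pos[OF \<tau>, of "z - y"] by simp
    moreover have "y \<in> {-w<..<w} \<Longrightarrow> cos (k * y) = arch w y" by (auto simp: arch_def k_def)
    ultimately show "indicator {-w<..<w} y * ?f y \<le> heat_kernel \<tau> (z - y) * arch w y" by (auto simp: indicator_def)
  qed
  finally show ?thesis .
qed (simp add: arch_def)

text \<open>The tube starts at a positive time \<open>s0\<close>, because a positive multiple of the
  eigenfunction fits below the heat kernel only at a distance from the initial point mass.\<close>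

locale tilted_tube =
  fixes t x s0 a w :: real and T :: "(real \<times> real) set"
  assumes s0: "0 < s0" "s0 \<le> t" and a: "0 < a" and w: "0 < w"
    and T_def: "T = {z. s0 \<le> fst z \<and> fst z \<le> t \<and> \<bar>snd z - fst z * (x / t)\<bar> \<le> w}"
begin

definition b :: real where "b = x / t"
definition \<mu> :: real where "\<mu> = pi\<^sup>2 / (8 * w\<^sup>2)"
text \<open>A lower bound for the heat kernel on \<open>[-w, w]\<close> at all times from
  \<open>s0\<close> to \<open>t\<close>, so that the subsolution starts below the free
  solution.\<close>

definition \<kappa> :: real where "\<kappa> = exp (- w\<^sup>2 / (2 * s0)) / sqrt (2 * pi * t)"
definition shear :: "real \<Rightarrow> real \<Rightarrow> real" where "shear s y = exp (- b * (y - b * s) - b\<^sup>2 * s / 2)"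
text \<open>The candidate subsolution: the Dirichlet eigenfunction of the cross-section, carried
  along the tube and growing at rate \<open>a - \<mu>\<close>. It vanishes before \<open>s0\<close>,
  where there is no potential yet.\<close>

definition g :: "real \<Rightarrow> real \<Rightarrow> real" where
  "g s y = (if s0 \<le> s \<and> s \<le> t then \<kappa> * exp ((a - \<mu>) * (s - s0)) * arch w (y - b * s) * shear s y else 0)"

lemma t: "0 < t" using s0 by simp
lemma \<kappa>_pos: "0 < \<kappa>" using t by (simp add: \<kappa>_def)
lemma \<mu>_nonneg: "0 \<le> \<mu>" by (simp add: \<mu>_def)
lemma shear_pos: "0 < shear s y" by (simp add: shear_def)

lemma g_nonneg: "0 \<le> g s y"
  using \<kappa>_pos arch_bounds(1)[OF w] shear_pos[of s y] by (auto simp: g_def intro!: mult_nonneg_nonneg less_imp_le)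

text \<open>The Galilean transformation moves the tube to the vertical axis.\<close>

lemma heat_kernel_shear: "0 < s \<Longrightarrow> heat_kernel s y = heat_kernel s (y - b * s) * shear s y"
proof -
  assume s: "0 < s"
  have "- y\<^sup>2 / (2 * s) = - (y - b * s)\<^sup>2 / (2 * s) + (- b * (y - b * s) - b\<^sup>2 * s / 2)"
    using s by (simp add: field_simps power2_eq_square)
  then have "exp (- y\<^sup>2 / (2 * s)) = exp (- (y - b * s)\<^sup>2 / (2 * s)) * shear s y"
    unfolding shear_def by (simp only: exp_add)
  then show ?thesis by (simp add: heat_kernel_def)
qed

lemma shear_mult: "shear (s - r) (y - y') * shear r y' = shear s y"
  unfolding shear_def by (simp add: exp_add[symmetric] algebra_simps diff_divide_distrib add_divide_distrib)

lemma \<kappa>_arch_le: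
  assumes s: "s0 \<le> s" "s \<le> t"
  shows "\<kappa> * arch w z \<le> heat_kernel s z"
proof (cases "\<bar>z\<bar> \<le> w")
  case True
  have sp: "0 < s" using s s0 by simp
  have "\<kappa> * arch w z \<le> \<kappa> * 1" using \<kappa>_pos arch_bounds(2) by (intro mult_left_mono) auto
  also have "\<dots> \<le> heat_kernel s z"
  proof -
    have "z\<^sup>2 \<le> w\<^sup>2" using True w by (simp add: abs_le_square_iff[symmetric])
    then have "z\<^sup>2 / (2 * s) \<le> w\<^sup>2 / (2 * s0)" using s s0 by (intro frac_le) auto
    then have "exp (- w\<^sup>2 / (2 * s0)) \<le> exp (- z\<^sup>2 / (2 * s))" by simp
    moreover have "1 / sqrt (2 * pi * t) \<le> 1 / sqrt (2 * pi * s)" using s sp by (intro divide_left_mono) auto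
    ultimately have "1 / sqrt (2 * pi * t) * exp (- w\<^sup>2 / (2 * s0)) \<le> 1 / sqrt (2 * pi * s) * exp (- z\<^sup>2 / (2 * s))"
      using sp by (intro mult_mono) auto
    then show ?thesis by (simp add: \<kappa>_def heat_kernel_def)
  qed
  finally show ?thesis .
next
  case False
  then show ?thesis using heat_kernel_pos[of s z] s s0 by (simp add: arch_def)
qed

lemma g_le:
  assumes s: "0 < s" "s \<le> t"
  shows "g s y \<le> exp (a * t) * heat_kernel s y"
proof (cases "s0 \<le> s")
  case True
  have "g s y = exp ((a - \<mu>) * (s - s0)) * (\<kappa> * arch w (y - b * s) * shear s y)"
    using True s by (simp add: g_def)
  also have "\<dots> \<le> exp (a * t) * (heat_kernel s (y - b * s) * shear s y)"
  proof (intro mult_mono mult_right_mono \<kappa>_arch_le True s)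
    have "(a - \<mu>) * (s - s0) \<le> a * (s - s0)" using \<mu>_nonneg True by (intro mult_right_mono) auto
    also have "\<dots> \<le> a * t" using a s s0 by (intro mult_left_mono) auto
    finally show "exp ((a - \<mu>) * (s - s0)) \<le> exp (a * t)" by simp
  qed (use heat_kernel_pos[OF s(1), of "y - b * s"] shear_pos[of s y] \<kappa>_pos arch_bounds(1)[OF w] in \<open>auto simp: less_imp_le\<close>)
  finally show ?thesis using heat_kernel_shear[OF s(1), of y] by simp
qed (use heat_kernel_pos[of s y] s in \<open>simp add: g_def\<close>)

lemmas fst_snd_measurable [measurable] = borel_measurable_fst_snd

lemma g_measurable [measurable]: "(\<lambda>z. g (fst z) (snd z)) \<in> borel_measurable borel"
  unfolding g_def shear_def by measurable

lemma T_measurable [measurable]: "T \<in> sets borel"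
  unfolding T_def by measurable

definition kern :: "real \<Rightarrow> real \<Rightarrow> real \<times> real \<Rightarrow> real" where
  "kern s y z = indicator {0<..<s} (fst z) * heat_kernel (s - fst z) (y - snd z)"

lemma kern_nonneg: "0 \<le> kern s y z"
  using heat_kernel_pos[of "s - fst z" "y - snd z"] by (auto simp: kern_def indicator_def)

lemma kern_measurable [measurable]: "kern s y \<in> borel_measurable borel"
  unfolding kern_def by measurable

text \<open>The constant \<open>c\<close> is \<open>g s y\<close> without its growth factor
  \<open>exp (a * (s - s0))\<close>. In the coordinates of the tube, \<open>heat_kernel_arch\<close>
  bounds the contribution of time \<open>r\<close> from below by \<open>c\<close> times the
  derivative of \<open>exp (a * (r - s0))\<close>: the decay \<open>exp (- \<mu> * (s - r))\<close>
  complements the one already in \<open>g r\<close>. Integration over \<open>r\<close> gives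
  \<open>g s y - c\<close>, and \<open>c\<close> is at most the heat kernel.\<close>

lemma g_subsolution:
  assumes s: "s0 \<le> s" "s \<le> t"
  shows "ennreal (g s y) \<le> ennreal (heat_kernel s y) + (\<integral>\<^sup>+z. ennreal (a * indicator T z * (kern s y z * g (fst z) (snd z))) \<partial>lborel)"
proof -
  have sp: "0 < s" using s s0 by simp
  define z where "z = y - b * s"
  define c where "c = \<kappa> * exp (- \<mu> * (s - s0)) * arch w z * shear s y"
  have c: "0 \<le> c" using \<kappa>_pos arch_bounds(1)[OF w, of z] shear_pos[of s y] by (simp add: c_def)
  have inner: "ennreal (c * (a * exp (a * (r - s0)))) \<le> (\<integral>\<^sup>+y'. ennreal (a * indicator T (r, y') * (kern s y (r, y') * g r y')) \<partial>lborel)"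
    if r: "s0 < r" "r < s" for r
  proof -
    have rp: "0 < r" "r \<le> t" using r s s0 by auto
    let ?c = "a * (\<kappa> * exp ((a - \<mu>) * (r - s0)) * shear s y)"
    have c0: "0 \<le> ?c" using a \<kappa>_pos shear_pos[of s y] by simp
    have "(\<integral>\<^sup>+y'. ennreal (a * indicator T (r, y') * (kern s y (r, y') * g r y')) \<partial>lborel) =
      ennreal \<bar>1\<bar> * (\<integral>\<^sup>+z'. ennreal (a * indicator T (r, b * r + 1 * z') * (kern s y (r, b * r + 1 * z') * g r (b * r + 1 * z'))) \<partial>lborel)"
    proof (rule nn_integral_real_affine)
      have [measurable]: "(\<lambda>y'::real. (r, y')) \<in> borel_measurable borel"
        by (auto intro!: borel_measurable_continuous_onI continuous_intros)
      have [measurable]: "(\<lambda>y'. g r y') \<in> borel_measurable borel" unfolding g_def shear_def by measurable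
      have [measurable]: "(\<lambda>y'. kern s y (r, y')) \<in> borel_measurable borel" unfolding kern_def by simp measurable
      have [measurable]: "(\<lambda>y'. indicator T (r, y') :: real) \<in> borel_measurable borel"
        by (rule measurable_compose[OF \<open>(\<lambda>y'::real. (r, y')) \<in> borel_measurable borel\<close>]) measurable
      show "(\<lambda>y'. ennreal (a * indicator T (r, y') * (kern s y (r, y') * g r y'))) \<in> borel_measurable borel" by measurable
    qed simp
    also have "\<dots> = (\<integral>\<^sup>+z'. ennreal (a * indicator T (r, b * r + 1 * z') * (kern s y (r, b * r + 1 * z') * g r (b * r + 1 * z'))) \<partial>lborel)"
      by simp
    also have "\<dots> = (\<integral>\<^sup>+z'. ennreal ?c * ennreal (heat_kernel (s - r) (z - z') * arch w z') \<partial>lborel)"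
    proof (rule nn_integral_cong)
      fix z'
      let ?y = "b * r + 1 * z'"
      have "heat_kernel (s - r) (y - ?y) = heat_kernel (s - r) (z - z') * shear (s - r) (y - ?y)"
        using heat_kernel_shear[of "s - r" "y - ?y"] r by (simp add: z_def algebra_simps)
      moreover have "g r ?y = \<kappa> * exp ((a - \<mu>) * (r - s0)) * arch w z' * shear r ?y"
        using r rp by (simp add: g_def)
      ultimately have "a * (heat_kernel (s - r) (y - ?y) * g r ?y) =
         a * (\<kappa> * exp ((a - \<mu>) * (r - s0)) * (shear (s - r) (y - ?y) * shear r ?y)) * (heat_kernel (s - r) (z - z') * arch w z')"
        by (simp only: mult_ac)
      also have "\<dots> = ?c * (heat_kernel (s - r) (z - z') * arch w z')" unfolding shear_mult ..
      finally have e: "a * (heat_kernel (s - r) (y - ?y) * g r ?y) = ?c * (heat_kernel (s - r) (z - z') * arch w z')" .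
      have e': "a * indicator T (r, ?y) * (kern s y (r, ?y) * g r ?y) = a * (heat_kernel (s - r) (y - ?y) * g r ?y)"
      proof (cases "\<bar>z'\<bar> \<le> w")
        case True
        then have "(r, ?y) \<in> T" using r rp by (simp add: T_def b_def mult.commute)
        then show ?thesis using r rp by (simp add: kern_def)
      next
        case False
        then show ?thesis by (simp add: g_def arch_def)
      qed
      show "ennreal (a * indicator T (r, ?y) * (kern s y (r, ?y) * g r ?y)) = ennreal ?c * ennreal (heat_kernel (s - r) (z - z') * arch w z')"
        unfolding e' e by (rule ennreal_mult'[OF c0])
    qed
    also have "\<dots> = ennreal ?c * (\<integral>\<^sup>+z'. ennreal (heat_kernel (s - r) (z - z') * arch w z') \<partial>lborel)"
      by (rule nn_integral_cmult) measurable
    also have "\<dots> \<ge> ennreal ?c * ennreal (exp (- \<mu> * (s - r)) * arch w z)"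
      unfolding \<mu>_def using r w by (intro mult_left_mono heat_kernel_arch) auto
    also have "ennreal ?c * ennreal (exp (- \<mu> * (s - r)) * arch w z) = ennreal (c * (a * exp (a * (r - s0))))"
    proof -
      have ee: "exp ((a - \<mu>) * (r - s0)) * exp (- \<mu> * (s - r)) = exp (- \<mu> * (s - s0)) * exp (a * (r - s0))"
        by (simp add: exp_add[symmetric] algebra_simps)
      have "?c * (exp (- \<mu> * (s - r)) * arch w z) =
          a * (\<kappa> * arch w z * shear s y) * (exp ((a - \<mu>) * (r - s0)) * exp (- \<mu> * (s - r)))"
        by (simp only: mult_ac)
      also have "\<dots> = c * (a * exp (a * (r - s0)))"
        unfolding ee c_def by (simp only: mult_ac)
      finally have "?c * (exp (- \<mu> * (s - r)) * arch w z) = c * (a * exp (a * (r - s0)))" .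
      then show ?thesis by (simp only: ennreal_mult'[OF c0, symmetric])
    qed
    finally show ?thesis .
  qed
  have "ennreal (c * exp (a * (s - s0)) - c * exp (a * (s0 - s0))) = (\<integral>\<^sup>+r. ennreal (c * (a * exp (a * (r - s0)))) * indicator {s0..s} r \<partial>lborel)"
    using a c s by (intro nn_integral_FTC_Icc[symmetric]) (auto intro!: derivative_eq_intros)
  also have "\<dots> \<le> (\<integral>\<^sup>+r. \<integral>\<^sup>+y'. ennreal (a * indicator T (r, y') * (kern s y (r, y') * g (fst (r, y')) (snd (r, y')))) \<partial>lborel \<partial>lborel)"
  proof (rule nn_integral_mono_AE)
    show "AE r in lborel. ennreal (c * (a * exp (a * (r - s0)))) * indicator {s0..s} r \<le>
       (\<integral>\<^sup>+y'. ennreal (a * indicator T (r, y') * (kern s y (r, y') * g (fst (r, y')) (snd (r, y')))) \<partial>lborel)"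
      using AE_lborel_singleton[of s0] AE_lborel_singleton[of s]
      by eventually_elim (use inner in \<open>auto simp: indicator_def\<close>)
  qed
  also have "\<dots> = (\<integral>\<^sup>+z. ennreal (a * indicator T z * (kern s y z * g (fst z) (snd z))) \<partial>(lborel \<Otimes>\<^sub>M lborel))"
    by (rule lborel.nn_integral_fst) (simp add: lborel_prod)
  finally have main: "ennreal (c * exp (a * (s - s0)) - c) \<le> (\<integral>\<^sup>+z. ennreal (a * indicator T z * (kern s y z * g (fst z) (snd z))) \<partial>lborel)"
    by (simp add: lborel_prod)
  have gc: "g s y = c * exp (a * (s - s0))"
    using s by (simp add: g_def c_def z_def exp_add[symmetric] left_diff_distrib exp_diff exp_minus field_simps)
  have "c \<le> heat_kernel s y"
  proof -
    have "c = exp (- \<mu> * (s - s0)) * (\<kappa> * arch w z * shear s y)" by (simp add: c_def)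
    also have "\<dots> \<le> 1 * (heat_kernel s z * shear s y)"
      using \<kappa>_arch_le[OF s, of z] \<mu>_nonneg s shear_pos[of s y] \<kappa>_pos arch_bounds(1)[OF w, of z]
      by (intro mult_mono mult_right_mono) auto
    finally show ?thesis using heat_kernel_shear[OF sp, of y] by (simp add: z_def)
  qed
  then have "ennreal (g s y) \<le> ennreal (heat_kernel s y + (c * exp (a * (s - s0)) - c))"
    unfolding gc by (intro ennreal_leI) simp
  also have "\<dots> = ennreal (heat_kernel s y) + ennreal (c * exp (a * (s - s0)) - c)"
  proof (rule ennreal_plus)
    have "c * 1 \<le> c * exp (a * (s - s0))" using c a s by (intro mult_left_mono) auto
    then show "0 \<le> c * exp (a * (s - s0)) - c" by simp
  qed (use heat_kernel_pos[OF sp, of y] in simp)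
  also have "\<dots> \<le> ennreal (heat_kernel s y) + (\<integral>\<^sup>+z. ennreal (a * indicator T z * (kern s y z * g (fst z) (snd z))) \<partial>lborel)"
    by (intro add_left_mono main)
  finally show ?thesis .
qed

text \<open>The weight \<open>exp (2 * a * r)\<close> is chosen so that integrating in time divides
  by 2: relative to \<open>exp (2 * a * s) * heat_kernel s y\<close>, the integral operator with
  potential \<open>a\<close> has norm at most 1/2.\<close>

definition major :: "real \<Rightarrow> real \<Rightarrow> real \<times> real \<Rightarrow> real" where
  "major s y z = a * (kern s y z * (exp (2 * a * fst z) * heat_kernel (fst z) (snd z)))"

lemma major_nonneg: "0 \<le> major s y z"
  using a heat_kernel_pos[of "s - fst z" "y - snd z"] heat_kernel_pos[of "fst z" "snd z"]
  by (auto simp: major_def kern_def indicator_def intro!: mult_nonneg_nonneg less_imp_le)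

lemma major_integral:
  assumes s: "0 < s"
  shows "integrable lborel (major s y)" "integral\<^sup>L lborel (major s y) \<le> exp (2 * a * s) / 2 * heat_kernel s y"
proof -
  have [measurable]: "major s y \<in> borel_measurable borel" unfolding major_def by measurable
  have "(\<integral>\<^sup>+z. ennreal (major s y z) \<partial>lborel) = (\<integral>\<^sup>+r. \<integral>\<^sup>+y'. ennreal (major s y (r, y')) \<partial>lborel \<partial>lborel)"
    unfolding lborel_prod[symmetric] by (rule lborel.nn_integral_fst[symmetric]) (simp add: lborel_prod)
  also have "\<dots> \<le> (\<integral>\<^sup>+r. ennreal (heat_kernel s y * (a * exp (2 * a * r))) * indicator {0..s} r \<partial>lborel)"
  proof (rule nn_integral_mono)
    fix r
    show "(\<integral>\<^sup>+y'. ennreal (major s y (r, y')) \<partial>lborel) \<le> ennreal (heat_kernel s y * (a * exp (2 * a * r))) * indicator {0..s} r"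
    proof (cases "0 < r \<and> r < s")
      case True
      have "(\<integral>\<^sup>+y'. ennreal (major s y (r, y')) \<partial>lborel) =
         (\<integral>\<^sup>+y'. ennreal (a * exp (2 * a * r)) * ennreal (heat_kernel (s - r) (y - y') * heat_kernel r (y' - 0)) \<partial>lborel)"
        using True a by (intro nn_integral_cong) (auto simp: major_def kern_def ennreal_mult'[symmetric] mult_ac)
      also have "\<dots> = ennreal (a * exp (2 * a * r)) * (\<integral>\<^sup>+y'. ennreal (heat_kernel (s - r) (y - y') * heat_kernel r (y' - 0)) \<partial>lborel)"
        by (rule nn_integral_cmult) measurable
      also have "\<dots> = ennreal (a * exp (2 * a * r)) * ennreal (heat_kernel s y)"
        using True by (subst heat_kernel_convolution) auto
      also have "\<dots> = ennreal (heat_kernel s y * (a * exp (2 * a * r)))"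
        using a by (subst ennreal_mult'[symmetric]) (auto simp: mult_ac)
      finally show ?thesis using True by simp
    qed (auto simp: major_def kern_def)
  qed
  also have "\<dots> = ennreal (heat_kernel s y * (exp (2 * a * s) / 2) - heat_kernel s y * (exp (2 * a * 0) / 2))"
    using a s heat_kernel_pos[OF s, of y] by (intro nn_integral_FTC_Icc) (auto intro!: derivative_eq_intros)
  also have "\<dots> \<le> ennreal (exp (2 * a * s) / 2 * heat_kernel s y)"
    using heat_kernel_pos[OF s, of y] by (intro ennreal_leI) (simp add: mult.commute)
  finally have le: "(\<integral>\<^sup>+z. ennreal (major s y z) \<partial>lborel) \<le> ennreal (exp (2 * a * s) / 2 * heat_kernel s y)" .
  show i: "integrable lborel (major s y)"
    by (rule integrableI_nonneg) (use le major_nonneg in \<open>auto intro: order.strict_trans1\<close>)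
  have "ennreal (integral\<^sup>L lborel (major s y)) \<le> ennreal (exp (2 * a * s) / 2 * heat_kernel s y)"
    using le nn_integral_eq_integral[OF i] major_nonneg by simp
  then show "integral\<^sup>L lborel (major s y) \<le> exp (2 * a * s) / 2 * heat_kernel s y"
    using heat_kernel_pos[OF s, of y] by (subst (asm) ennreal_le_iff) auto
qed

text \<open>A comparison principle by contraction. Let \<open>K\<close> be the largest positive part
  of \<open>g - v\<close> relative to \<open>exp (2 * a * s) * heat_kernel s y\<close>; it is finite
  because \<open>g\<close> and \<open>v\<close> are both bounded by multiples of the heat kernel.
  Subtracting the equation for \<open>v\<close> from the inequality for \<open>g\<close> gives
  \<open>K \<le> K / 2\<close>, so \<open>K\<close> is 0. No sign of \<open>v\<close>
  enters.\<close>

theorem lower_bound: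
  fixes v :: "real \<Rightarrow> real \<Rightarrow> real"
  assumes bd: "\<And>s y. 0 < s \<Longrightarrow> s \<le> t \<Longrightarrow> \<bar>v s y\<bar> \<le> C * heat_kernel s y"
    and eq: "\<And>s y. 0 < s \<Longrightarrow> s \<le> t \<Longrightarrow> \<exists>F. integrable lborel F \<and>
      (AE z in lborel. F z = a * indicator T z * (kern s y z * v (fst z) (snd z))) \<and> v s y = heat_kernel s y + integral\<^sup>L lborel F"
  shows "exp (- w\<^sup>2 / (2 * s0)) * exp ((a - pi\<^sup>2 / (8 * w\<^sup>2)) * (t - s0)) * heat_kernel t x \<le> v t x"
proof -
  define R where "R p = max 0 ((g (fst p) (snd p) - v (fst p) (snd p)) / (exp (2 * a * fst p) * heat_kernel (fst p) (snd p)))" for p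
  define P where "P = {0<..t} \<times> (UNIV :: real set)"
  define K where "K = Sup (R ` P)"
  have Rb: "R p \<le> exp (a * t) + C" if pP: "p \<in> P" for p
  proof -
    obtain s y where p: "p = (s, y)" "0 < s" "s \<le> t" using pP by (cases p) (auto simp: P_def)
    have hk: "0 < heat_kernel s y" by (rule heat_kernel_pos[OF p(2)])
    have C: "0 \<le> C" using bd[OF p(2,3), of y] hk by (metis abs_ge_zero order_trans zero_le_mult_iff not_le)
    have "g s y - v s y \<le> (exp (a * t) + C) * heat_kernel s y"
      using g_le[OF p(2,3), of y] bd[OF p(2,3), of y] by (simp add: distrib_right abs_le_iff)
    also have "\<dots> \<le> (exp (a * t) + C) * (exp (2 * a * s) * heat_kernel s y)"
      using hk C a p by (intro mult_left_mono) (auto simp: mult_le_cancel_right1)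
    finally show ?thesis using hk C by (auto simp: R_def p pos_divide_le_eq)
  qed
  have bdd: "bdd_above (R ` P)" using Rb by (auto intro!: bdd_aboveI)
  have ne: "P \<noteq> {}" using t by (auto simp: P_def)
  have RK: "R p \<le> K" if "p \<in> P" for p unfolding K_def using bdd that by (rule cSUP_upper2) simp
  have K0: "0 \<le> K" using RK[of "(t, 0)"] t by (auto simp: R_def P_def)
  have gv: "g s y - v s y \<le> K * (exp (2 * a * s) * heat_kernel s y)" if s: "0 < s" "s \<le> t" for s y
  proof -
    have "(g s y - v s y) / (exp (2 * a * s) * heat_kernel s y) \<le> K"
      using RK[of "(s, y)"] s by (auto simp: R_def P_def)
    then show ?thesis using heat_kernel_pos[OF s(1), of y] by (simp add: pos_divide_le_eq)
  qed
  have "R p \<le> K / 2" if pP: "p \<in> P" for p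
  proof -
    obtain s y where p: "p = (s, y)" "0 < s" "s \<le> t" using pP by (cases p) (auto simp: P_def)
    have hk: "0 < heat_kernel s y" by (rule heat_kernel_pos[OF p(2)])
    obtain F where F: "integrable lborel F" "AE z in lborel. F z = a * indicator T z * (kern s y z * v (fst z) (snd z))"
      "v s y = heat_kernel s y + integral\<^sup>L lborel F" using eq[OF p(2,3)] by blast
    have "g s y - v s y \<le> K / 2 * (exp (2 * a * s) * heat_kernel s y)"
    proof (cases "s0 \<le> s")
      case True
      define G where "G z = a * indicator T z * (kern s y z * g (fst z) (snd z))" for z
      have Gn: "0 \<le> G z" for z unfolding G_def using a kern_nonneg g_nonneg by simp
      have Gm: "G \<in> borel_measurable lborel" unfolding G_def by measurable
      have Gle: "G z \<le> exp (a * t) * major s y z" for z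
      proof (cases "z \<in> T \<and> 0 < fst z \<and> fst z < s")
        case True
        then have z: "0 < fst z" "fst z \<le> t" using p by auto
        have hz: "0 < heat_kernel (fst z) (snd z)" by (rule heat_kernel_pos[OF z(1)])
        have "g (fst z) (snd z) \<le> exp (a * t) * heat_kernel (fst z) (snd z)" by (rule g_le[OF z])
        also have "\<dots> \<le> exp (a * t) * (exp (2 * a * fst z) * heat_kernel (fst z) (snd z))"
          using hz a z by (intro mult_left_mono) (auto simp: mult_le_cancel_right1)
        finally have "a * (kern s y z * g (fst z) (snd z)) \<le> a * (kern s y z * (exp (a * t) * (exp (2 * a * fst z) * heat_kernel (fst z) (snd z))))"
          using a kern_nonneg by (intro mult_left_mono) auto
        then show ?thesis using True by (simp add: G_def major_def mult_ac)
      next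
        case False
        then have "G z = 0" by (auto simp: G_def kern_def)
        then show ?thesis using major_nonneg[of s y z] by simp
      qed
      have Gi: "integrable lborel G"
      proof (rule Bochner_Integration.integrable_bound)
        show "integrable lborel (\<lambda>z. exp (a * t) * major s y z)" using major_integral(1)[OF p(2)] by simp
        have "norm (G z) \<le> norm (exp (a * t) * major s y z)" for z
          using Gn[of z] Gle[of z] by simp
        then show "AE z in lborel. norm (G z) \<le> norm (exp (a * t) * major s y z)" by simp
      qed (rule Gm)
      have "ennreal (g s y) \<le> ennreal (heat_kernel s y) + (\<integral>\<^sup>+z. ennreal (G z) \<partial>lborel)"
        unfolding G_def by (rule g_subsolution[OF True p(3)])
      also have "\<dots> = ennreal (heat_kernel s y + integral\<^sup>L lborel G)"
        using Gi Gn hk by (simp add: nn_integral_eq_integral)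
      finally have "g s y \<le> heat_kernel s y + integral\<^sup>L lborel G"
        using hk Gn by (subst (asm) ennreal_le_iff) (auto intro!: add_nonneg_nonneg)
      then have "g s y - v s y \<le> integral\<^sup>L lborel G - integral\<^sup>L lborel F" using F(3) by simp
      also have "\<dots> = (\<integral>z. G z - F z \<partial>lborel)" using Gi F(1) by simp
      also have "\<dots> \<le> (\<integral>z. K * major s y z \<partial>lborel)"
      proof (rule integral_mono_AE)
        show "integrable lborel (\<lambda>z. G z - F z)" using Gi F(1) by simp
        show "integrable lborel (\<lambda>z. K * major s y z)" using major_integral(1)[OF p(2)] by simp
        show "AE z in lborel. G z - F z \<le> K * major s y z"
          using F(2)
        proof eventually_elim
          case (elim z)
          have "G z - F z = a * indicator T z * (kern s y z * (g (fst z) (snd z) - v (fst z) (snd z)))"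
            unfolding elim G_def by (simp add: algebra_simps)
          also have "\<dots> \<le> K * major s y z"
          proof (cases "z \<in> T \<and> 0 < fst z \<and> fst z < s")
            case True
            then have z: "0 < fst z" "fst z \<le> t" using p by auto
            have "a * (kern s y z * (g (fst z) (snd z) - v (fst z) (snd z))) \<le>
                a * (kern s y z * (K * (exp (2 * a * fst z) * heat_kernel (fst z) (snd z))))"
              using a kern_nonneg gv[OF z] by (intro mult_left_mono) auto
            then show ?thesis using True by (simp add: major_def mult_ac)
          next
            case False
            then have "indicator T z * kern s y z = 0" by (auto simp: kern_def)
            then show ?thesis using major_nonneg[of s y z] K0 by auto
          qed
          finally show ?case .
        qed
      qed
      also have "\<dots> \<le> K * (exp (2 * a * s) / 2 * heat_kernel s y)"
      proof -
        have "(\<integral>z. K * major s y z \<partial>lborel) = K * integral\<^sup>L lborel (major s y)" by simp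
        also have "\<dots> \<le> K * (exp (2 * a * s) / 2 * heat_kernel s y)"
          using major_integral(2)[OF p(2), of y] K0 by (rule mult_left_mono)
        finally show ?thesis .
      qed
      finally show ?thesis by simp
    next
      case False
      \<comment> \<open>Before \<open>s0\<close> the time interval of \<open>kern s y\<close> misses
        the tube, so \<open>v\<close> is the free kernel there, while \<open>g\<close> is 0.\<close>
      have "AE z in lborel. F z = 0"
        using F(2) by eventually_elim (use False in \<open>auto simp: T_def kern_def indicator_def\<close>)
      then have "integral\<^sup>L lborel F = 0" by (rule integral_eq_zero_AE)
      then have "v s y = heat_kernel s y" using F(3) by simp
      moreover have "g s y = 0" using False by (simp add: g_def)
      ultimately show ?thesis using hk K0 by (simp add: order_trans[OF _ mult_nonneg_nonneg])
    qed
    then have "(g s y - v s y) / (exp (2 * a * s) * heat_kernel s y) \<le> K / 2"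
      using hk by (subst pos_divide_le_eq) auto
    then show ?thesis using K0 unfolding R_def p fst_conv snd_conv by (intro max.boundedI) auto
  qed
  then have "K \<le> K / 2" unfolding K_def using ne by (intro cSUP_least) auto
  then have "K = 0" using K0 by simp
  then have "g t x \<le> v t x" using gv[of t x] t by simp
  moreover have "g t x = exp (- w\<^sup>2 / (2 * s0)) * exp ((a - pi\<^sup>2 / (8 * w\<^sup>2)) * (t - s0)) * heat_kernel t x"
  proof -
    have "b * t = x" using t by (simp add: b_def)
    then have "arch w (x - b * t) = 1" using w by (simp add: arch_def)
    moreover have "heat_kernel t x = 1 / sqrt (2 * pi * t) * shear t x"
      using heat_kernel_shear[OF t, of x] \<open>b * t = x\<close> by (simp add: heat_kernel_def)
    ultimately show ?thesis using s0 by (simp add: g_def \<kappa>_def \<mu>_def)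
  qed
  ultimately show ?thesis by simp
qed

end

subsection \<open>The parabolic Anderson model\<close>

locale parabolic_anderson = white_noise_space M W for M :: "'a measure" and W +
  fixes u :: "real \<Rightarrow> real \<Rightarrow> 'a \<Rightarrow> real"
  assumes solution: "pam_narrow_wedge_solution M W u"
begin

lemma u_measurable: "0 < s \<Longrightarrow> u s y \<in> borel_measurable M"
  using solution unfolding pam_narrow_wedge_solution_def noise_filtration_eq by (blast intro: NA_measurable_M)

text \<open>A finite supremum excludes the value \<open>\<top>\<close> of \<open>Lk_norm\<close>,
  which stands for a missing moment; this is where integrability comes from. For natural
  \<open>k\<close> the norm bound becomes a bound with ordinary powers.\<close>

lemma u_moments:
  assumes t: "0 < t" and k: "2 \<le> k"
  obtains C where "0 \<le> C" "\<And>s y. 0 < s \<Longrightarrow> s \<le> t \<Longrightarrow> integrable M (\<lambda>\<omega>. \<bar>u s y \<omega>\<bar> ^ k)"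
    "\<And>s y. 0 < s \<Longrightarrow> s \<le> t \<Longrightarrow> expectation (\<lambda>\<omega>. \<bar>u s y \<omega>\<bar> ^ k) \<le> C * heat_kernel s y ^ k"
proof -
  have pw: "\<bar>z\<bar> powr real k = \<bar>z\<bar> ^ k" for z :: real
    using k by (cases "z = 0") (auto simp: powr_realpow)
  define S where "S = (SUP (s, y)\<in>{0<..t} \<times> UNIV. Lk_norm M (real k) (u s y) / ennreal (heat_kernel s y))"
  have *: "(SUP (s, y)\<in>{0<..t'} \<times> UNIV. Lk_norm M k' (u s y) / ennreal (heat_kernel s y)) < \<infinity>" if "0 < t'" "2 \<le> k'" for t' k'
    using solution that unfolding pam_narrow_wedge_solution_def by blast
  have "S < \<infinity>" unfolding S_def by (rule *) (use t k in auto)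
  then obtain c where c: "S = ennreal c" "0 \<le> c" by (cases S) auto
  have L: "Lk_norm M (real k) (u s y) \<le> ennreal (c * heat_kernel s y)" if s: "0 < s" "s \<le> t" for s y
  proof -
    have hk: "0 < heat_kernel s y" by (rule heat_kernel_pos[OF s(1)])
    have "Lk_norm M (real k) (u s y) / ennreal (heat_kernel s y) \<le> S"
      unfolding S_def by (rule SUP_upper2[of "(s, y)"]) (use s in auto)
    then have "Lk_norm M (real k) (u s y) / ennreal (heat_kernel s y) * ennreal (heat_kernel s y) \<le> ennreal c * ennreal (heat_kernel s y)"
      unfolding c by (rule mult_right_mono) simp
    moreover have "Lk_norm M (real k) (u s y) / ennreal (heat_kernel s y) * ennreal (heat_kernel s y) = Lk_norm M (real k) (u s y)"
      using hk by (simp add: ennreal_divide_times mult_divide_eq_ennreal)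
    ultimately show ?thesis using c by (simp add: ennreal_mult')
  qed
  have i: "integrable M (\<lambda>\<omega>. \<bar>u s y \<omega>\<bar> ^ k)" if s: "0 < s" "s \<le> t" for s y
  proof (rule ccontr)
    assume "\<not> integrable M (\<lambda>\<omega>. \<bar>u s y \<omega>\<bar> ^ k)"
    then have "Lk_norm M (real k) (u s y) = \<top>" by (simp add: Lk_norm_def pw)
    then show False using L[OF s, of y] by (simp add: top_unique)
  qed
  show ?thesis
  proof (rule that[of "c ^ k"])
    fix s y assume s: "0 < s" "s \<le> t"
    have hk: "0 < heat_kernel s y" by (rule heat_kernel_pos[OF s(1)])
    let ?E = "expectation (\<lambda>\<omega>. \<bar>u s y \<omega>\<bar> ^ k)"
    have E0: "0 \<le> ?E" by simp
    have "ennreal (?E powr (1 / real k)) \<le> ennreal (c * heat_kernel s y)"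
      using L[OF s, of y] i[OF s, of y] by (simp add: Lk_norm_def pw)
    then have "?E powr (1 / real k) \<le> c * heat_kernel s y" using c hk by simp
    then have "(?E powr (1 / real k)) ^ k \<le> (c * heat_kernel s y) ^ k" by (intro power_mono) auto
    also have "(?E powr (1 / real k)) ^ k = ?E"
    proof (cases "?E = 0")
      case False
      then have "(?E powr (1 / real k)) ^ k = (?E powr (1 / real k)) powr real k"
        using E0 by (subst powr_realpow) auto
      also have "\<dots> = ?E" using E0 False k by (simp add: powr_powr)
      finally show ?thesis .
    qed (use k in simp)
    finally show "?E \<le> c ^ k * heat_kernel s y ^ k" by (simp add: power_mult_distrib)
  qed (use c i in auto)
qed

definition mild_kernel :: "real \<Rightarrow> real \<Rightarrow> real \<Rightarrow> real \<Rightarrow> real" where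
  "mild_kernel s y r z = indicator {0<..<s} r * heat_kernel (s - r) (y - z)"

lemma mild_equation:
  assumes s: "0 < s"
  obtains I where "has_walsh_integral M W (\<lambda>r z \<omega>. mild_kernel s y r z * u r z \<omega>) I"
    "AE \<omega> in M. u s y \<omega> = heat_kernel s y + I \<omega>"
  using solution s unfolding pam_narrow_wedge_solution_def mild_kernel_def by blast

text \<open>Nothing is assumed about \<open>u r\<close> for \<open>r \<le> 0\<close>, but the kernel
  vanishes there.\<close>

lemma mild_integrand_measurable: "(\<lambda>\<omega>. mild_kernel s y r z * u r z \<omega>) \<in> borel_measurable M"
proof (cases "0 < r")
  case True then show ?thesis using u_measurable[of r z] by measurable
next
  case False then show ?thesis by (simp add: mild_kernel_def)
qed

definition tilt :: "real \<Rightarrow> (real \<times> real) set \<Rightarrow> 'a \<Rightarrow> real" where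
  "tilt a T \<omega> = exp (a * W T \<omega>) * exp (- a\<^sup>2 * measure lborel T / 2)"

lemma tilt_moments:
  assumes T: "T \<in> noise_sets"
  shows "tilt a T \<in> borel_measurable M" "integrable M (tilt a T)" "expectation (tilt a T) = 1"
    "integrable M (\<lambda>\<omega>. (tilt a T \<omega>)\<^sup>2)" "expectation (\<lambda>\<omega>. (tilt a T \<omega>)\<^sup>2) = exp (a\<^sup>2 * measure lborel T)"
proof -
  show "tilt a T \<in> borel_measurable M" unfolding tilt_def[abs_def]
    by (intro borel_measurable_times exp_W_measurable_M T borel_measurable_const)
  let ?m = "measure lborel T"
  have e: "integrable M (\<lambda>\<omega>. exp (a * W T \<omega>))" "expectation (\<lambda>\<omega>. exp (a * W T \<omega>)) = exp (a\<^sup>2 * ?m / 2)"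
    using exp_W_integrable[OF T, of a] by (auto simp: has_bochner_integral_iff)
  show "integrable M (tilt a T)" unfolding tilt_def[abs_def] using e(1) by (rule integrable_mult_left)
  have "expectation (tilt a T) = exp (a\<^sup>2 * ?m / 2) * exp (- a\<^sup>2 * ?m / 2)"
    unfolding tilt_def[abs_def] integral_mult_left_zero e(2) ..
  also have "\<dots> = 1" by (simp flip: exp_add)
  finally show "expectation (tilt a T) = 1" .
  have sq: "(\<lambda>\<omega>. (tilt a T \<omega>)\<^sup>2) = (\<lambda>\<omega>. (exp (a * W T \<omega>))\<^sup>2 * (exp (- a\<^sup>2 * ?m / 2))\<^sup>2)"
    by (simp add: tilt_def power_mult_distrib)
  show "integrable M (\<lambda>\<omega>. (tilt a T \<omega>)\<^sup>2)"
    unfolding sq by (rule integrable_mult_left[OF exp_W_square_integrable(1)[OF T]])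
  have "expectation (\<lambda>\<omega>. (tilt a T \<omega>)\<^sup>2) = exp (2 * a\<^sup>2 * ?m) * (exp (- a\<^sup>2 * ?m / 2))\<^sup>2"
    unfolding sq integral_mult_left_zero exp_W_square_integrable(2)[OF T] ..
  also have "\<dots> = exp (a\<^sup>2 * ?m)" unfolding power2_eq_square[of "exp _"] exp_add[symmetric] by simp
  finally show "expectation (\<lambda>\<omega>. (tilt a T \<omega>)\<^sup>2) = exp (a\<^sup>2 * ?m)" .
qed

lemma u_square_integrable:
  assumes s: "0 < s"
  shows "integrable M (\<lambda>\<omega>. (u s y \<omega>)\<^sup>2)"
proof (rule u_moments[OF s, of 2])
  fix C assume "\<And>r z. 0 < r \<Longrightarrow> r \<le> s \<Longrightarrow> integrable M (\<lambda>\<omega>. \<bar>u r z \<omega>\<bar> ^ 2)"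
  from this[of s y] show ?thesis using s by simp
qed simp

lemma u_second_moment:
  assumes t: "0 < t"
  shows "\<exists>C\<ge>0. \<forall>s y. 0 < s \<longrightarrow> s \<le> t \<longrightarrow> expectation (\<lambda>\<omega>. (u s y \<omega>)\<^sup>2) \<le> C * (heat_kernel s y)\<^sup>2"
proof (rule u_moments[OF t, of 2])
  fix C assume C: "0 \<le> C"
    "\<And>s y. 0 < s \<Longrightarrow> s \<le> t \<Longrightarrow> expectation (\<lambda>\<omega>. \<bar>u s y \<omega>\<bar> ^ 2) \<le> C * heat_kernel s y ^ 2"
  show ?thesis
  proof (intro exI[of _ C] conjI allI impI)
    show "expectation (\<lambda>\<omega>. (u s y \<omega>)\<^sup>2) \<le> C * (heat_kernel s y)\<^sup>2" if "0 < s" "s \<le> t" for s y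
      using C(2)[OF that, of y] by simp
  qed (rule C(1))
qed simp

text \<open>The weighted means \<open>v\<close> solve the mild equation with potential
  \<open>a\<close> on \<open>T\<close>: the deterministic initial term is unchanged because the
  weight has mean 1, and \<open>walsh_integral_tilt\<close> turns the stochastic integral into the
  potential term. The a priori bound on \<open>v\<close> that the comparison needs is the
  Cauchy--Schwarz inequality with the second moment of \<open>u\<close>.\<close>

theorem tilted_mean_lower_bound:
  assumes tube: "tilted_tube t x s0 a w T" and T: "T \<in> noise_sets"
  shows "exp (- w\<^sup>2 / (2 * s0)) * exp ((a - pi\<^sup>2 / (8 * w\<^sup>2)) * (t - s0)) * heat_kernel t x \<le>
     expectation (\<lambda>\<omega>. u t x \<omega> * tilt a T \<omega>)"
proof -
  interpret tilted_tube t x s0 a w T by fact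
  define v where "v s y = expectation (\<lambda>\<omega>. u s y \<omega> * tilt a T \<omega>)" for s y
  define n where "n = exp (- a\<^sup>2 * measure lborel T / 2)"
  note tm = tilt_moments[OF T, of a]
  obtain C where C: "0 \<le> C"
    "\<And>s y. 0 < s \<Longrightarrow> s \<le> t \<Longrightarrow> expectation (\<lambda>\<omega>. (u s y \<omega>)\<^sup>2) \<le> C * (heat_kernel s y)\<^sup>2"
    using u_second_moment[OF t] by blast
  have bound: "\<bar>v s y\<bar> \<le> (sqrt C * sqrt (exp (a\<^sup>2 * measure lborel T))) * heat_kernel s y" if s: "0 < s" "s \<le> t" for s y
  proof -
    have "\<bar>v s y\<bar> \<le> expectation (\<lambda>\<omega>. \<bar>u s y \<omega> * tilt a T \<omega>\<bar>)" unfolding v_def by (rule integral_abs_bound)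
    also have "\<dots> \<le> sqrt (expectation (\<lambda>\<omega>. (u s y \<omega>)\<^sup>2)) * sqrt (expectation (\<lambda>\<omega>. (tilt a T \<omega>)\<^sup>2))"
      by (rule Cauchy_Schwarz_integral[OF u_measurable[OF s(1)] tm(1) u_square_integrable[OF s(1)] tm(4)])
    also have "\<dots> \<le> sqrt (C * (heat_kernel s y)\<^sup>2) * sqrt (exp (a\<^sup>2 * measure lborel T))"
      using C(2)[OF s, of y] unfolding tm(5) by (intro mult_right_mono real_sqrt_le_mono) auto
    also have "\<dots> = (sqrt C * sqrt (exp (a\<^sup>2 * measure lborel T))) * heat_kernel s y"
      using heat_kernel_pos[OF s(1), of y] by (simp add: real_sqrt_mult)
    finally show ?thesis .
  qed
  have eq: "\<exists>F. integrable lborel F \<and>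
      (AE z in lborel. F z = a * indicator T z * (kern s y z * v (fst z) (snd z))) \<and> v s y = heat_kernel s y + integral\<^sup>L lborel F"
    if s: "0 < s" "s \<le> t" for s y
  proof (rule mild_equation[OF s(1), of y])
    fix I assume I: "has_walsh_integral M W (\<lambda>r z \<omega>. mild_kernel s y r z * u r z \<omega>) I"
      and uI: "AE \<omega> in M. u s y \<omega> = heat_kernel s y + I \<omega>"
    have Im: "I \<in> borel_measurable M" using I by (simp add: has_walsh_integral_def)
    show ?thesis
    proof (rule walsh_integral_tilt[OF I T mild_integrand_measurable, of a])
      fix F
      assume I2: "integrable M (\<lambda>\<omega>. (I \<omega>)\<^sup>2)" and F: "integrable lborel F"
        "AE z in lborel. F z = a * indicator T z * expectation (\<lambda>\<omega>. mild_kernel s y (fst z) (snd z) * u (fst z) (snd z) \<omega> * exp (a * W T \<omega>))"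
        "expectation (\<lambda>\<omega>. I \<omega> * exp (a * W T \<omega>)) = integral\<^sup>L lborel F"
      have Ie: "integrable M (\<lambda>\<omega>. I \<omega> * tilt a T \<omega>)" by (rule square_integrable_mult[OF Im tm(1) I2 tm(4)])
      have "v s y = expectation (\<lambda>\<omega>. heat_kernel s y * tilt a T \<omega> + I \<omega> * tilt a T \<omega>)"
        unfolding v_def
      proof (rule integral_cong_AE)
        show "AE \<omega> in M. u s y \<omega> * tilt a T \<omega> = heat_kernel s y * tilt a T \<omega> + I \<omega> * tilt a T \<omega>"
          using uI by eventually_elim (simp add: distrib_right)
      qed (use u_measurable[OF s(1), of y] tm(1) Im in measurable)
      also have "\<dots> = heat_kernel s y + expectation (\<lambda>\<omega>. I \<omega> * tilt a T \<omega>)"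
        using tm Ie by simp
      also have "expectation (\<lambda>\<omega>. I \<omega> * tilt a T \<omega>) = n * integral\<^sup>L lborel F"
        unfolding F(3)[symmetric] integral_mult_right_zero[symmetric]
        by (intro Bochner_Integration.integral_cong refl) (simp add: tilt_def n_def)
      also have "\<dots> = (\<integral>z. n * F z \<partial>lborel)" by simp
      finally have "v s y = heat_kernel s y + (\<integral>z. n * F z \<partial>lborel)" .
      moreover have "integrable lborel (\<lambda>z. n * F z)" using F(1) by simp
      moreover have "AE z in lborel. n * F z = a * indicator T z * (kern s y z * v (fst z) (snd z))"
        using F(2)
      proof eventually_elim
        case (elim z)
        have "n * expectation (\<lambda>\<omega>. mild_kernel s y (fst z) (snd z) * u (fst z) (snd z) \<omega> * exp (a * W T \<omega>)) =
           kern s y z * v (fst z) (snd z)"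
          unfolding v_def integral_mult_right_zero[symmetric]
          by (intro Bochner_Integration.integral_cong refl) (simp add: tilt_def n_def kern_def mild_kernel_def)
        then show ?case unfolding elim mult.left_commute[of n] by simp
      qed
      ultimately show ?thesis by (intro exI[of _ "\<lambda>z. n * F z"]) auto
    qed
  qed
  show ?thesis using lower_bound[of v, OF bound eq] unfolding v_def .
qed

text \<open>The affine image of \<open>cexp A Y\<close> is an admissible approximant of
  \<open>X\<close>. It serves both the mild equation, with \<open>q = 1\<close>, and the integrand,
  with the heat kernel as \<open>q\<close>.\<close>

lemma nn_cexp_error_le:
  assumes "X \<in> borel_measurable M" "integrable M (\<lambda>\<omega>. (X \<omega>)\<^sup>2)" "Y \<in> borel_measurable M" "integrable M (\<lambda>\<omega>. (Y \<omega>)\<^sup>2)"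
    and XY: "AE \<omega> in M. X \<omega> = p + q * Y \<omega>"
  shows "(\<integral>\<^sup>+\<omega>. ennreal ((X \<omega> - cexp A X \<omega>)\<^sup>2) \<partial>M) \<le> ennreal (q\<^sup>2) * (\<integral>\<^sup>+\<omega>. ennreal ((Y \<omega> - cexp A Y \<omega>)\<^sup>2) \<partial>M)"
proof -
  define Z where "Z \<omega> = p + q * cexp A Y \<omega>" for \<omega>
  have Z: "Z \<in> borel_measurable (NA A)" unfolding Z_def[abs_def]
    by (intro borel_measurable_add borel_measurable_times borel_measurable_const cexp_measurable)
  have qc: "(\<lambda>\<omega>. q * cexp A Y \<omega>) \<in> borel_measurable M" "integrable M (\<lambda>\<omega>. (q * cexp A Y \<omega>)\<^sup>2)"
    using cexp_square_integrable[OF assms(3,4)] by (auto simp: power_mult_distrib)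
  have Z2: "integrable M (\<lambda>\<omega>. (Z \<omega>)\<^sup>2)" unfolding Z_def
    by (rule square_integrable_add[OF _ qc(1) _ qc(2)]) auto
  have "(\<integral>\<^sup>+\<omega>. ennreal ((X \<omega> - cexp A X \<omega>)\<^sup>2) \<partial>M) \<le> (\<integral>\<^sup>+\<omega>. ennreal ((X \<omega> - Z \<omega>)\<^sup>2) \<partial>M)"
    by (rule cexp_best_approx_nn[OF assms(1,2) Z Z2])
  also have "\<dots> = (\<integral>\<^sup>+\<omega>. ennreal (q\<^sup>2) * ennreal ((Y \<omega> - cexp A Y \<omega>)\<^sup>2) \<partial>M)"
    using XY by (intro nn_integral_cong_AE) (auto elim!: eventually_mono
      simp: Z_def ennreal_mult'[symmetric] power_mult_distrib[symmetric] right_diff_distrib)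
  also have "\<dots> = ennreal (q\<^sup>2) * (\<integral>\<^sup>+\<omega>. ennreal ((Y \<omega> - cexp A Y \<omega>)\<^sup>2) \<partial>M)"
  proof (rule nn_integral_cmult)
    show "(\<lambda>\<omega>. ennreal ((Y \<omega> - cexp A Y \<omega>)\<^sup>2)) \<in> borel_measurable M"
      using assms(3) cexp_measurable_M[of A Y] by measurable
  qed
  finally show ?thesis .
qed

text \<open>The induction treats all points \<open>(s, y)\<close> at once, since the mild equation
  refers to every earlier point, but it keeps the one region \<open>A\<close>. That \<open>A\<close>
  is adapted to the target \<open>(t, x)\<close> matters only in \<open>error_bound_limit\<close>.
  The start of the induction is the second moment, reached by approximating with 0.\<close>

theorem localization_error:
  assumes R: "localization_region t x c C A"
    and C: "\<And>s y. 0 < s \<Longrightarrow> s \<le> t \<Longrightarrow> expectation (\<lambda>\<omega>. (u s y \<omega>)\<^sup>2) \<le> C * (heat_kernel s y)\<^sup>2"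
  shows "(\<integral>\<^sup>+\<omega>. ennreal ((u t x \<omega> - cexp A (u t x) \<omega>)\<^sup>2) \<partial>M) \<le>
    ennreal (16 * sqrt 2 * C / c * exp (128 * t) * (heat_kernel t x)\<^sup>2)"
proof -
  interpret localization_region t x c C A by fact
  have nC: "(\<integral>\<^sup>+\<omega>. ennreal ((u s y \<omega>)\<^sup>2) \<partial>M) \<le> ennreal (C * (heat_kernel s y)\<^sup>2)" if s: "0 < s" "s \<le> t" for s y
    using C[OF s, of y] nn_integral_eq_integral[OF u_square_integrable[OF s(1), of y]] by (simp add: ennreal_leI)
  have ind: "(\<integral>\<^sup>+\<omega>. ennreal ((u s y \<omega> - cexp A (u s y) \<omega>)\<^sup>2) \<partial>M) \<le> error_bound n (s, y)" if "0 < s" "s \<le> t" for n s y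
    using that
  proof (induction n arbitrary: s y)
    case (0 s y)
    have "(\<integral>\<^sup>+\<omega>. ennreal ((u s y \<omega> - cexp A (u s y) \<omega>)\<^sup>2) \<partial>M) \<le> (\<integral>\<^sup>+\<omega>. ennreal ((u s y \<omega> - 0)\<^sup>2) \<partial>M)"
      by (rule cexp_best_approx_nn[OF u_measurable u_square_integrable]) (use 0 in auto)
    also have "\<dots> \<le> ennreal (C * (heat_kernel s y)\<^sup>2)" using nC[OF 0] by simp
    finally show ?case by (simp add: error_bound_0)
  next
    case (Suc n s y)
    note s = Suc.prems
    show ?case
    proof (rule mild_equation[OF s(1), of y])
      let ?f = "\<lambda>r z \<omega>. mild_kernel s y r z * u r z \<omega>"
      fix I assume I: "has_walsh_integral M W ?f I"
        and uI: "AE \<omega> in M. u s y \<omega> = heat_kernel s y + I \<omega>"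
      have Im: "I \<in> borel_measurable M" using I by (simp add: has_walsh_integral_def)
      have I2: "integrable M (\<lambda>\<omega>. (I \<omega>)\<^sup>2)"
      proof -
        have i: "integrable M (\<lambda>\<omega>. (u s y \<omega> - heat_kernel s y)\<^sup>2)"
          by (rule square_integrable_diff[OF u_measurable[OF s(1)] _ u_square_integrable[OF s(1)]]) auto
        have "AE \<omega> in M. (u s y \<omega> - heat_kernel s y)\<^sup>2 = (I \<omega>)\<^sup>2" using uI by eventually_elim simp
        then show ?thesis using i Im u_measurable[OF s(1), of y] by (subst integrable_cong_AE[symmetric]) auto
      qed
      define K where "K z = ennreal (indicator {0<..<s} (fst z) * (heat_kernel (s - fst z) (y - snd z))\<^sup>2)" for z :: "real \<times> real"
      have K: "K z = ennreal ((mild_kernel s y (fst z) (snd z))\<^sup>2)" for z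
        by (auto simp: K_def mild_kernel_def indicator_def)
      note [measurable] = borel_measurable_fst_snd
      have Km[measurable]: "K \<in> borel_measurable borel" unfolding K_def by measurable
      note [measurable] = error_bound_measurable
      have f2: "integrable M (\<lambda>\<omega>. (?f (fst z) (snd z) \<omega>)\<^sup>2)" for z
      proof (cases "0 < fst z")
        case True then show ?thesis using u_square_integrable[of "fst z" "snd z"] by (simp add: power_mult_distrib)
      qed (simp add: mild_kernel_def)
      have "(\<integral>\<^sup>+\<omega>. ennreal ((u s y \<omega> - cexp A (u s y) \<omega>)\<^sup>2) \<partial>M) \<le> ennreal (1\<^sup>2) * (\<integral>\<^sup>+\<omega>. ennreal ((I \<omega> - cexp A I \<omega>)\<^sup>2) \<partial>M)"
        by (rule nn_cexp_error_le[OF u_measurable[OF s(1)] u_square_integrable[OF s(1)] Im I2, where p="heat_kernel s y"]) (use uI in simp)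
      also have "\<dots> = (\<integral>\<^sup>+\<omega>. ennreal ((I \<omega> - cexp A I \<omega>)\<^sup>2) \<partial>M)" by simp
      also have "\<dots> \<le> 4 * (\<integral>\<^sup>+z. indicator A z * (K z * error_bound n z) + indicator (- A) z * (K z * ennreal (C * (heat_kernel (fst z) (snd z))\<^sup>2)) \<partial>lborel)"
      proof (rule walsh_integral_localization[OF I A mild_integrand_measurable f2 _ _ _ _ I2])
        show "(\<lambda>z. K z * error_bound n z) \<in> borel_measurable lborel" by measurable
        show "(\<lambda>z. K z * ennreal (C * (heat_kernel (fst z) (snd z))\<^sup>2)) \<in> borel_measurable lborel" by measurable
        fix z :: "real \<times> real"
        show "(\<integral>\<^sup>+\<omega>. ennreal ((?f (fst z) (snd z) \<omega> - cexp A (?f (fst z) (snd z)) \<omega>)\<^sup>2) \<partial>M) \<le> K z * error_bound n z"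
        proof (cases "0 < fst z \<and> fst z < s")
          case True
          then have z: "0 < fst z" "fst z \<le> t" using s by auto
          have "(\<integral>\<^sup>+\<omega>. ennreal ((?f (fst z) (snd z) \<omega> - cexp A (?f (fst z) (snd z)) \<omega>)\<^sup>2) \<partial>M) \<le>
              ennreal ((mild_kernel s y (fst z) (snd z))\<^sup>2) * (\<integral>\<^sup>+\<omega>. ennreal ((u (fst z) (snd z) \<omega> - cexp A (u (fst z) (snd z)) \<omega>)\<^sup>2) \<partial>M)"
            by (rule nn_cexp_error_le[OF mild_integrand_measurable f2 u_measurable[OF z(1)] u_square_integrable[OF z(1)], where p=0]) simp
          also have "\<dots> \<le> K z * error_bound n (fst z, snd z)"
            unfolding K by (intro mult_left_mono Suc.IH z) simp
          finally show ?thesis by simp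
        next
          case False
          then have m0: "mild_kernel s y (fst z) (snd z) = 0" by (auto simp: mild_kernel_def)
          have "(\<integral>\<^sup>+\<omega>. ennreal ((?f (fst z) (snd z) \<omega> - cexp A (?f (fst z) (snd z)) \<omega>)\<^sup>2) \<partial>M) \<le> (\<integral>\<^sup>+\<omega>. ennreal ((?f (fst z) (snd z) \<omega> - 0)\<^sup>2) \<partial>M)"
            by (rule cexp_best_approx_nn[OF mild_integrand_measurable f2]) auto
          then show ?thesis using m0 by simp
        qed
        show "(\<integral>\<^sup>+\<omega>. ennreal ((?f (fst z) (snd z) \<omega>)\<^sup>2) \<partial>M) \<le> K z * ennreal (C * (heat_kernel (fst z) (snd z))\<^sup>2)"
        proof (cases "0 < fst z \<and> fst z < s")
          case True
          then have z: "0 < fst z" "fst z \<le> t" using s by auto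
          have "(\<integral>\<^sup>+\<omega>. ennreal ((?f (fst z) (snd z) \<omega>)\<^sup>2) \<partial>M) = K z * (\<integral>\<^sup>+\<omega>. ennreal ((u (fst z) (snd z) \<omega>)\<^sup>2) \<partial>M)"
            unfolding K using u_measurable[OF z(1), of "snd z"]
            by (subst nn_integral_cmult[symmetric]) (auto simp: power_mult_distrib ennreal_mult'[symmetric])
          also have "\<dots> \<le> K z * ennreal (C * (heat_kernel (fst z) (snd z))\<^sup>2)"
            by (intro mult_left_mono nC z) simp
          finally show ?thesis .
        next
          case False
          then have m0: "mild_kernel s y (fst z) (snd z) = 0" by (auto simp: mild_kernel_def)
          then show ?thesis by simp
        qed
      qed
      also have "\<dots> = error_bound (Suc n) (s, y)"
        unfolding error_bound_Suc error_map_def source_def K_def fst_conv snd_conv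
        by (intro arg_cong[where f="\<lambda>x. 4 * x"] nn_integral_cong) (simp add: distrib_left mult_ac)
      finally show ?case .
    qed
  qed
  show ?thesis by (rule error_bound_limit[OF ind]) (use t in auto)
qed

end

subsection \<open>The second-moment method on a grid\<close>

context prob_space
begin

text \<open>Compare \<open>\<Sum>i. Z i\<close>, which Chebyshev keeps near its mean, with \<open>\<Sum>i. m * T i\<close>, whose mean is small.\<close>

lemma prob_all_small_le:
  fixes A Z T :: "'i \<Rightarrow> 'a \<Rightarrow> real"
  assumes I: "finite I" "I \<noteq> {}"
    and A: "\<And>i. i \<in> I \<Longrightarrow> integrable M (A i)" and T: "\<And>i. i \<in> I \<Longrightarrow> integrable M (T i)"
    and Zm: "\<And>i. i \<in> I \<Longrightarrow> Z i \<in> borel_measurable M" and Z2: "\<And>i. i \<in> I \<Longrightarrow> integrable M (\<lambda>\<omega>. (Z i \<omega>)\<^sup>2)"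
    and T0: "\<And>i \<omega>. i \<in> I \<Longrightarrow> \<omega> \<in> space M \<Longrightarrow> 0 \<le> T i \<omega>" and T1: "\<And>i. i \<in> I \<Longrightarrow> expectation (T i) \<le> 1"
    and AZ: "\<And>i. i \<in> I \<Longrightarrow> expectation (\<lambda>\<omega>. \<bar>A i \<omega> - Z i \<omega>\<bar>) \<le> d"
    and AV: "\<And>i. i \<in> I \<Longrightarrow> V \<le> expectation (A i)"
    and ZB: "\<And>i. i \<in> I \<Longrightarrow> expectation (\<lambda>\<omega>. (Z i \<omega>)\<^sup>2) \<le> B"
    and unc: "\<And>i j. i \<in> I \<Longrightarrow> j \<in> I \<Longrightarrow> i \<noteq> j \<Longrightarrow> expectation (\<lambda>\<omega>. Z i \<omega> * Z j \<omega>) = expectation (Z i) * expectation (Z j)"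
    and F: "F \<in> events" "\<And>\<omega> i. \<omega> \<in> F \<Longrightarrow> i \<in> I \<Longrightarrow> A i \<omega> \<le> m * T i \<omega>"
    and pos: "0 < V" "0 < m" "d \<le> V / 4"
  shows "prob F \<le> 4 * m / V + 4 * d / V + 16 * B / (real (card I) * V\<^sup>2)"
proof -
  define N where "N = real (card I)"
  have N: "0 < N" using I by (simp add: N_def card_gt_0_iff)
  have Zi: "integrable M (Z i)" if "i \<in> I" for i using square_integrable_imp_integrable'[OF Zm Z2] that by blast
  define ST where "ST \<omega> = (\<Sum>i\<in>I. T i \<omega>)" for \<omega>
  define SD where "SD \<omega> = (\<Sum>i\<in>I. \<bar>A i \<omega> - Z i \<omega>\<bar>)" for \<omega>
  define SZ where "SZ \<omega> = (\<Sum>i\<in>I. Z i \<omega>)" for \<omega>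
  have ADi: "integrable M (\<lambda>\<omega>. \<bar>A i \<omega> - Z i \<omega>\<bar>)" if "i \<in> I" for i using A[OF that] Zi[OF that] by simp
  have STi: "integrable M ST" unfolding ST_def using T by (intro Bochner_Integration.integrable_sum)
  have SDi: "integrable M SD" unfolding SD_def using ADi by (intro Bochner_Integration.integrable_sum)
  have SZm: "SZ \<in> borel_measurable M" unfolding SZ_def using Zm by (intro borel_measurable_sum)
  have ZZ: "integrable M (\<lambda>\<omega>. Z i \<omega> * Z j \<omega>)" if "i \<in> I" "j \<in> I" for i j
    by (rule square_integrable_mult[OF Zm[OF that(1)] Zm[OF that(2)] Z2[OF that(1)] Z2[OF that(2)]])
  have SZ2eq: "(SZ \<omega>)\<^sup>2 = (\<Sum>i\<in>I. \<Sum>j\<in>I. Z i \<omega> * Z j \<omega>)" for \<omega>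
    unfolding SZ_def power2_eq_square sum_product ..
  have SZ2: "integrable M (\<lambda>\<omega>. (SZ \<omega>)\<^sup>2)" unfolding SZ2eq using ZZ by (intro Bochner_Integration.integrable_sum)
  have eST: "expectation ST \<le> N"
  proof -
    have "expectation ST = (\<Sum>i\<in>I. expectation (T i))" unfolding ST_def using T by (rule Bochner_Integration.integral_sum)
    also have "\<dots> \<le> (\<Sum>i\<in>I. 1)" using T1 by (rule sum_mono)
    finally show ?thesis by (simp add: N_def)
  qed
  have eSD: "expectation SD \<le> N * d"
  proof -
    have "expectation SD = (\<Sum>i\<in>I. expectation (\<lambda>\<omega>. \<bar>A i \<omega> - Z i \<omega>\<bar>))" unfolding SD_def using ADi by (rule Bochner_Integration.integral_sum)
    also have "\<dots> \<le> (\<Sum>i\<in>I. d)" using AZ by (rule sum_mono)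
    finally show ?thesis by (simp add: N_def)
  qed
  have eSZ: "expectation SZ = (\<Sum>i\<in>I. expectation (Z i))" unfolding SZ_def using Zi by (rule Bochner_Integration.integral_sum)
  have eZ: "V - d \<le> expectation (Z i)" if i: "i \<in> I" for i
  proof -
    have "expectation (A i) - expectation (Z i) = expectation (\<lambda>\<omega>. A i \<omega> - Z i \<omega>)" using A[OF i] Zi[OF i] by simp
    also have "\<dots> \<le> expectation (\<lambda>\<omega>. \<bar>A i \<omega> - Z i \<omega>\<bar>)"
      using A[OF i] Zi[OF i] by (intro integral_mono) auto
    finally show ?thesis using AV[OF i] AZ[OF i] by simp
  qed
  have eSZ': "N * (V - d) \<le> expectation SZ"
  proof -
    have "(\<Sum>i\<in>I. V - d) \<le> (\<Sum>i\<in>I. expectation (Z i))" using eZ by (rule sum_mono)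
    then show ?thesis using eSZ by (simp add: N_def)
  qed
  have var: "variance SZ \<le> N * B"
  proof -
    have "variance SZ = expectation (\<lambda>\<omega>. (SZ \<omega>)\<^sup>2) - (expectation SZ)\<^sup>2"
      using square_integrable_imp_integrable'[OF SZm SZ2] SZ2 by (rule variance_eq)
    also have "expectation (\<lambda>\<omega>. (SZ \<omega>)\<^sup>2) = (\<Sum>i\<in>I. \<Sum>j\<in>I. expectation (\<lambda>\<omega>. Z i \<omega> * Z j \<omega>))"
      unfolding SZ2eq using ZZ by (subst Bochner_Integration.integral_sum) (auto intro!: Bochner_Integration.integrable_sum sum.cong)
    also have "(expectation SZ)\<^sup>2 = (\<Sum>i\<in>I. \<Sum>j\<in>I. expectation (Z i) * expectation (Z j))"
      unfolding eSZ power2_eq_square sum_product ..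
    also have "(\<Sum>i\<in>I. \<Sum>j\<in>I. expectation (\<lambda>\<omega>. Z i \<omega> * Z j \<omega>)) - (\<Sum>i\<in>I. \<Sum>j\<in>I. expectation (Z i) * expectation (Z j)) =
        (\<Sum>i\<in>I. \<Sum>j\<in>I. expectation (\<lambda>\<omega>. Z i \<omega> * Z j \<omega>) - expectation (Z i) * expectation (Z j))"
      by (simp add: sum_subtractf)
    also have "\<dots> \<le> (\<Sum>i\<in>I. \<Sum>j\<in>I. if j = i then B else 0)"
    proof (intro sum_mono)
      fix i j assume ij: "i \<in> I" "j \<in> I"
      show "expectation (\<lambda>\<omega>. Z i \<omega> * Z j \<omega>) - expectation (Z i) * expectation (Z j) \<le> (if j = i then B else 0)"
      proof (cases "j = i")
        case True
        have "0 \<le> expectation (Z i) * expectation (Z i)" by simp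
        then have "expectation (\<lambda>\<omega>. Z i \<omega> * Z i \<omega>) - expectation (Z i) * expectation (Z i) \<le> B"
          using ZB[OF ij(1)] unfolding power2_eq_square by linarith
        then show ?thesis using True by simp
      next
        case False
        then show ?thesis using unc[OF ij] by simp
      qed
    qed
    also have "\<dots> = N * B" using I by (simp add: N_def)
    finally show ?thesis .
  qed
  have ST0: "AE \<omega> in M. 0 \<le> ST \<omega>" by (intro AE_I2) (auto simp: ST_def intro!: sum_nonneg T0)
  have SD0: "AE \<omega> in M. 0 \<le> SD \<omega>" by (intro AE_I2) (auto simp: SD_def intro!: sum_nonneg)
  \<comment> \<open>Off these events \<open>SZ\<close> exceeds \<open>N * V / 2\<close>, as its mean
    is at least \<open>3 / 4 * N * V\<close>; then the sum of the \<open>A i\<close> exceeds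
    \<open>N * V / 4\<close>, while \<open>m * ST\<close> stays below it. So \<open>F\<close> cannot
    occur there.\<close>
  define E1 where "E1 = {\<omega> \<in> space M. N * V / (4 * m) \<le> ST \<omega>}"
  define E2 where "E2 = {\<omega> \<in> space M. N * V / 4 \<le> SD \<omega>}"
  define E3 where "E3 = {\<omega> \<in> space M. N * V / 4 \<le> \<bar>SZ \<omega> - expectation SZ\<bar>}"
  have [measurable]: "ST \<in> borel_measurable M" "SD \<in> borel_measurable M" "SZ \<in> borel_measurable M"
    using STi SDi SZm by auto
  have Em[measurable]: "E1 \<in> events" "E2 \<in> events" "E3 \<in> events" unfolding E1_def E2_def E3_def by measurable
  have "F \<subseteq> E1 \<union> E2 \<union> E3"
  proof
    fix \<omega> assume w: "\<omega> \<in> F"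
    then have ws: "\<omega> \<in> space M" using F(1) sets.sets_into_space by auto
    show "\<omega> \<in> E1 \<union> E2 \<union> E3"
    proof (rule ccontr)
      assume "\<omega> \<notin> E1 \<union> E2 \<union> E3"
      then have n: "ST \<omega> < N * V / (4 * m)" "SD \<omega> < N * V / 4" "\<bar>SZ \<omega> - expectation SZ\<bar> < N * V / 4"
        using ws by (auto simp: E1_def E2_def E3_def not_le)
      have "N * d \<le> N * (V / 4)" using N pos by (intro mult_left_mono) auto
      then have "N * d \<le> N * V / 4" by simp
      then have "N * V / 2 < SZ \<omega>" using n(3) eSZ' unfolding right_diff_distrib by linarith
      moreover have "SZ \<omega> - SD \<omega> \<le> (\<Sum>i\<in>I. A i \<omega>)"
        unfolding SZ_def SD_def sum_subtractf[symmetric] by (rule sum_mono) auto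
      moreover have "(\<Sum>i\<in>I. A i \<omega>) \<le> m * ST \<omega>"
        unfolding ST_def sum_distrib_left using F(2)[OF w] by (rule sum_mono)
      moreover have "m * ST \<omega> < N * V / 4"
        using n(1) pos by (simp add: field_simps)
      ultimately show False using n(2) by simp
    qed
  qed
  then have "prob F \<le> prob (E1 \<union> E2 \<union> E3)" by (intro finite_measure_mono) auto
  also have "\<dots> \<le> prob E1 + prob E2 + prob E3"
    using measure_Un_le[of "E1 \<union> E2" M E3] measure_Un_le[of E1 M E2] Em by simp
  also have "prob E1 \<le> expectation ST / (N * V / (4 * m))" unfolding E1_def
    using integral_Markov_inequality_measure[OF STi, of "{}" "N * V / (4 * m)"] N pos ST0 by simp
  also have "\<dots> \<le> N / (N * V / (4 * m))" using eST N pos by (intro divide_right_mono) auto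
  also have "\<dots> = 4 * m / V" using N pos by (simp add: field_simps)
  also have "prob E2 \<le> expectation SD / (N * V / 4)" unfolding E2_def
    using integral_Markov_inequality_measure[OF SDi, of "{}" "N * V / 4"] N pos SD0 by simp
  also have "\<dots> \<le> (N * d) / (N * V / 4)" using eSD N pos by (intro divide_right_mono) auto
  also have "\<dots> = 4 * d / V" using N pos by (simp add: field_simps)
  also have "prob E3 \<le> variance SZ / (N * V / 4)\<^sup>2" unfolding E3_def
    using N pos by (intro Chebyshev_inequality SZ2) auto
  also have "\<dots> \<le> (N * B) / (N * V / 4)\<^sup>2" using var by (intro divide_right_mono) auto
  also have "\<dots> = 16 * B / (N * V\<^sup>2)" using N pos by (simp add: field_simps power2_eq_square)
  finally show ?thesis by (simp add: N_def)
qed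

end

text \<open>Three properties are wanted at once: boundedness, which controls the second moment of
  the product with the weight; Lipschitz constant 1, which does not enlarge the localization error;
  and preservation of upper bounds by \<open>m\<close>, which keeps the information that
  \<open>u\<close> is small.\<close>

definition clip :: "real \<Rightarrow> real \<Rightarrow> real" where "clip L z = max (- L) (min L z)"

lemma clip_measurable [measurable]: "clip L \<in> borel_measurable borel"
  unfolding clip_def[abs_def] by measurable

lemma clip_bound: "0 \<le> L \<Longrightarrow> \<bar>clip L z\<bar> \<le> L" by (auto simp: clip_def)
lemma clip_lipschitz: "\<bar>clip L z - clip L z'\<bar> \<le> \<bar>z - z'\<bar>" by (auto simp: clip_def)
lemma clip_le: "0 \<le> L \<Longrightarrow> 0 \<le> m \<Longrightarrow> z \<le> m \<Longrightarrow> clip L z \<le> m" by (auto simp: clip_def)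

text \<open>A high moment makes even a low clipping level affordable: the error falls like the power
  \<open>k - 1\<close> of \<open>L\<close>, while the variance pays only for
  \<open>L\<^sup>2\<close>.\<close>

lemma clip_error:
  assumes L: "0 < L" and k: "1 \<le> k"
  shows "\<bar>z - clip L z\<bar> \<le> \<bar>z\<bar> ^ k / L ^ (k - 1)"
proof (cases "\<bar>z\<bar> \<le> L")
  case True
  then have "clip L z = z" by (auto simp: clip_def)
  then show ?thesis using L by simp
next
  case False
  have "\<bar>z - clip L z\<bar> \<le> \<bar>z\<bar>" using L by (auto simp: clip_def)
  also have "\<bar>z\<bar> * L ^ (k - 1) \<le> \<bar>z\<bar> * \<bar>z\<bar> ^ (k - 1)" using False L by (intro mult_left_mono power_mono) auto
  then have "\<bar>z\<bar> \<le> \<bar>z\<bar> ^ k / L ^ (k - 1)" using L k by (cases k) (auto simp: field_simps)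
  finally show ?thesis .
qed

context prob_space
begin

text \<open>\<open>X * Y\<close> is at most the clipped and truncated product plus two errors. The
  clipping error is \<open>clip_error\<close> against \<open>Y\<close>, bounded by the
  Cauchy--Schwarz inequality with the moment of order \<open>2 * k\<close>; the truncation error is
  at most \<open>L\<close> times the tail of \<open>Y\<close>.\<close>

lemma clipped_mean_lower_bound:
  fixes X Y :: "'a \<Rightarrow> real"
  assumes [measurable]: "X \<in> borel_measurable M" "Y \<in> borel_measurable M"
    and Y0: "\<And>\<omega>. 0 \<le> Y \<omega>" and X2: "integrable M (\<lambda>\<omega>. (X \<omega>)\<^sup>2)" and Y2: "integrable M (\<lambda>\<omega>. (Y \<omega>)\<^sup>2)"
    and Xk: "integrable M (\<lambda>\<omega>. \<bar>X \<omega>\<bar> ^ (2 * k))" "expectation (\<lambda>\<omega>. \<bar>X \<omega>\<bar> ^ (2 * k)) \<le> C"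
    and L: "0 < L" and k: "1 \<le> k"
    and tail: "expectation (\<lambda>\<omega>. Y \<omega> * indicator {K<..} (Y \<omega>)) \<le> \<eta>"
  shows "expectation (\<lambda>\<omega>. X \<omega> * Y \<omega>) - sqrt C * sqrt (expectation (\<lambda>\<omega>. (Y \<omega>)\<^sup>2)) / L ^ (k - 1) - L * \<eta> \<le>
    expectation (\<lambda>\<omega>. clip L (X \<omega>) * (Y \<omega> * indicator {..K} (Y \<omega>)))"
proof -
  have Yi: "integrable M Y" by (rule square_integrable_imp_integrable'[OF _ Y2]) simp
  have XY: "integrable M (\<lambda>\<omega>. X \<omega> * Y \<omega>)" by (rule square_integrable_mult[OF _ _ X2 Y2]) auto
  have Yt: "integrable M (\<lambda>\<omega>. Y \<omega> * indicator {K<..} (Y \<omega>))"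
    by (rule Bochner_Integration.integrable_bound[OF Yi]) (auto simp: indicator_def)
  have Yk: "integrable M (\<lambda>\<omega>. Y \<omega> * indicator {..K} (Y \<omega>))"
    by (rule Bochner_Integration.integrable_bound[OF Yi]) (auto simp: indicator_def)
  have Xk2: "integrable M (\<lambda>\<omega>. (\<bar>X \<omega>\<bar> ^ k)\<^sup>2)" using Xk(1) by (simp add: power_mult[symmetric] mult.commute)
  have XkY: "integrable M (\<lambda>\<omega>. \<bar>X \<omega>\<bar> ^ k * Y \<omega>)" by (rule square_integrable_mult[OF _ _ Xk2 Y2]) auto
  have c: "integrable M (\<lambda>\<omega>. clip L (X \<omega>) * (Y \<omega> * indicator {..K} (Y \<omega>)))"
  proof (rule Bochner_Integration.integrable_bound)
    show "integrable M (\<lambda>\<omega>. L * (Y \<omega> * indicator {..K} (Y \<omega>)))" using Yk by simp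
    show "AE \<omega> in M. norm (clip L (X \<omega>) * (Y \<omega> * indicator {..K} (Y \<omega>))) \<le> norm (L * (Y \<omega> * indicator {..K} (Y \<omega>)))"
      using L clip_bound[of L] by (intro AE_I2) (auto simp: abs_mult intro!: mult_right_mono)
  qed measurable
  have "expectation (\<lambda>\<omega>. X \<omega> * Y \<omega>) \<le> expectation (\<lambda>\<omega>. clip L (X \<omega>) * (Y \<omega> * indicator {..K} (Y \<omega>)) +
      (1 / L ^ (k - 1)) * (\<bar>X \<omega>\<bar> ^ k * Y \<omega>) + L * (Y \<omega> * indicator {K<..} (Y \<omega>)))"
  proof (rule integral_mono[OF XY])
    show "integrable M (\<lambda>\<omega>. clip L (X \<omega>) * (Y \<omega> * indicator {..K} (Y \<omega>)) +
      (1 / L ^ (k - 1)) * (\<bar>X \<omega>\<bar> ^ k * Y \<omega>) + L * (Y \<omega> * indicator {K<..} (Y \<omega>)))"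
      using c XkY Yt by simp
    fix \<omega>
    have "X \<omega> * Y \<omega> = clip L (X \<omega>) * Y \<omega> + (X \<omega> - clip L (X \<omega>)) * Y \<omega>" by (simp add: algebra_simps)
    also have "(X \<omega> - clip L (X \<omega>)) * Y \<omega> \<le> (\<bar>X \<omega>\<bar> ^ k / L ^ (k - 1)) * Y \<omega>"
      using clip_error[OF L k, of "X \<omega>"] Y0 by (intro mult_right_mono) auto
    also have "clip L (X \<omega>) * Y \<omega> \<le> clip L (X \<omega>) * (Y \<omega> * indicator {..K} (Y \<omega>)) + L * (Y \<omega> * indicator {K<..} (Y \<omega>))"
      using clip_bound[of L "X \<omega>"] L Y0[of \<omega>] by (auto simp: indicator_def abs_le_iff intro: mult_right_mono)
    finally show "X \<omega> * Y \<omega> \<le> clip L (X \<omega>) * (Y \<omega> * indicator {..K} (Y \<omega>)) +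
      (1 / L ^ (k - 1)) * (\<bar>X \<omega>\<bar> ^ k * Y \<omega>) + L * (Y \<omega> * indicator {K<..} (Y \<omega>))" by simp
  qed
  also have "\<dots> = expectation (\<lambda>\<omega>. clip L (X \<omega>) * (Y \<omega> * indicator {..K} (Y \<omega>))) +
      (1 / L ^ (k - 1)) * expectation (\<lambda>\<omega>. \<bar>X \<omega>\<bar> ^ k * Y \<omega>) + L * expectation (\<lambda>\<omega>. Y \<omega> * indicator {K<..} (Y \<omega>))"
    using c XkY Yt by simp
  also have "(1 / L ^ (k - 1)) * expectation (\<lambda>\<omega>. \<bar>X \<omega>\<bar> ^ k * Y \<omega>) \<le> (1 / L ^ (k - 1)) * (sqrt C * sqrt (expectation (\<lambda>\<omega>. (Y \<omega>)\<^sup>2)))"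
  proof (intro mult_left_mono)
    have "expectation (\<lambda>\<omega>. \<bar>X \<omega>\<bar> ^ k * Y \<omega>) \<le> expectation (\<lambda>\<omega>. \<bar>\<bar>X \<omega>\<bar> ^ k * Y \<omega>\<bar>)"
      using XkY by (intro integral_mono) auto
    also have "\<dots> \<le> sqrt (expectation (\<lambda>\<omega>. (\<bar>X \<omega>\<bar> ^ k)\<^sup>2)) * sqrt (expectation (\<lambda>\<omega>. (Y \<omega>)\<^sup>2))"
      by (rule Cauchy_Schwarz_integral[OF _ _ Xk2 Y2]) auto
    also have "\<dots> \<le> sqrt C * sqrt (expectation (\<lambda>\<omega>. (Y \<omega>)\<^sup>2))"
      using Xk(2) by (intro mult_right_mono real_sqrt_le_mono) (auto simp: power_mult[symmetric] mult.commute)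
    finally show "expectation (\<lambda>\<omega>. \<bar>X \<omega>\<bar> ^ k * Y \<omega>) \<le> sqrt C * sqrt (expectation (\<lambda>\<omega>. (Y \<omega>)\<^sup>2))" .
  qed (use L in auto)
  also have "L * expectation (\<lambda>\<omega>. Y \<omega> * indicator {K<..} (Y \<omega>)) \<le> L * \<eta>" using tail L by (intro mult_left_mono) auto
  finally show ?thesis by simp
qed

end

section \<open>Tubes and sectors\<close>

definition tube :: "real \<Rightarrow> real \<Rightarrow> real \<Rightarrow> real \<Rightarrow> (real \<times> real) set" where
  "tube t x s0 w = {z. s0 \<le> fst z \<and> fst z \<le> t \<and> \<bar>snd z - fst z * (x / t)\<bar> \<le> w}"

text \<open>The linear opening is forced: the segments from the origin to different grid points
  separate only linearly in time. The strict inequality lets neighbouring sectors touch and still be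
  disjoint.\<close>

definition sector :: "real \<Rightarrow> real \<Rightarrow> real \<Rightarrow> (real \<times> real) set" where
  "sector t x c = {z. 0 < fst z \<and> fst z \<le> t \<and> \<bar>snd z - fst z * (x / t)\<bar> < c * fst z}"

lemma tube_borel: "tube t x s0 w \<in> sets borel"
proof -
  note [measurable] = borel_measurable_fst_snd
  show ?thesis unfolding tube_def by measurable
qed

lemma sector_borel: "sector t x c \<in> sets borel"
proof -
  note [measurable] = borel_measurable_fst_snd
  show ?thesis unfolding sector_def by measurable
qed

lemma emeasure_tube:
  assumes "s0 \<le> t" "0 \<le> w"
  shows "emeasure lborel (tube t x s0 w) = ennreal (2 * w * (t - s0))"
proof -
  have "emeasure (lborel \<Otimes>\<^sub>M lborel) (tube t x s0 w) = (\<integral>\<^sup>+r. emeasure lborel (Pair r -` tube t x s0 w) \<partial>lborel)"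
    by (rule lborel.emeasure_pair_measure_alt) (subst lborel_prod, simp add: tube_borel)
  also have "\<dots> = (\<integral>\<^sup>+r. ennreal (2 * w) * indicator {s0..t} r \<partial>lborel)"
  proof (rule nn_integral_cong)
    fix r
    show "emeasure lborel (Pair r -` tube t x s0 w) = ennreal (2 * w) * indicator {s0..t} r"
    proof (cases "s0 \<le> r \<and> r \<le> t")
      case True
      then have "Pair r -` tube t x s0 w = {r * (x / t) - w..r * (x / t) + w}"
        by (auto simp: tube_def abs_le_iff)
      then show ?thesis using True assms by simp
    next
      case False
      then have "Pair r -` tube t x s0 w = {}" by (auto simp: tube_def)
      then show ?thesis using False by (auto simp: indicator_def)
    qed
  qed
  also have "\<dots> = ennreal (2 * w) * ennreal (t - s0)"
    using assms by (simp add: nn_integral_cmult)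
  also have "\<dots> = ennreal (2 * w * (t - s0))" using assms by (simp add: ennreal_mult')
  finally show ?thesis by (simp add: lborel_prod)
qed

lemma tube_noise_sets:
  assumes "0 \<le> s0" "s0 \<le> t" "0 \<le> w"
  shows "tube t x s0 w \<in> noise_sets" "measure lborel (tube t x s0 w) = 2 * w * (t - s0)"
  using emeasure_tube[OF assms(2,3), of x] assms tube_borel[of t x s0 w]
  by (auto simp: noise_sets_def tube_def measure_def enn2real_ennreal)

lemma tube_subset_sector:
  assumes "0 < s0" "0 < c" "w < c * s0"
  shows "tube t x s0 w \<subseteq> sector t x c"
proof
  fix z assume z: "z \<in> tube t x s0 w"
  then have "c * s0 \<le> c * fst z" using assms by (intro mult_left_mono) (auto simp: tube_def)
  moreover have "\<bar>snd z - fst z * (x / t)\<bar> \<le> w" using z by (simp add: tube_def)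
  ultimately have "\<bar>snd z - fst z * (x / t)\<bar> < c * fst z" using assms by linarith
  then show "z \<in> sector t x c" using z assms unfolding tube_def sector_def by simp
qed

lemma sector_disjoint:
  assumes t: "0 < t" and D: "2 * c * t \<le> \<bar>x - x'\<bar>"
  shows "sector t x c \<inter> sector t x' c = {}"
proof (rule ccontr)
  assume "sector t x c \<inter> sector t x' c \<noteq> {}"
  then obtain r y where z: "0 < r" "\<bar>y - r * (x / t)\<bar> < c * r" "\<bar>y - r * (x' / t)\<bar> < c * r"
    by (auto simp: sector_def)
  have "\<bar>r * (x / t) - r * (x' / t)\<bar> < 2 * (c * r)" using z(2,3) by linarith
  moreover have "r * (x / t) - r * (x' / t) = r / t * (x - x')" using t by (simp add: field_simps)
  ultimately have "r / t * \<bar>x - x'\<bar> < 2 * (c * r)" using z t by (simp add: abs_mult)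
  moreover have "r / t * (2 * c * t) \<le> r / t * \<bar>x - x'\<bar>" using D z t by (intro mult_left_mono) auto
  moreover have "r / t * (2 * c * t) = 2 * (c * r)" using t by simp
  ultimately show False by linarith
qed

section \<open>Smallness of the solution on a whole grid\<close>

context parabolic_anderson
begin

text \<open>Chernoff's bound: where the weight exceeds \<open>K\<close>, the factor
  \<open>(tilt a T \<omega> / K) powr \<delta>\<close> is at least 1, and the moment of order
  \<open>1 + \<delta>\<close> of the weight is explicit.\<close>

lemma tilt_tail:
  assumes T: "T \<in> noise_sets" and \<delta>: "0 \<le> \<delta>" and K: "0 < K"
  shows "expectation (\<lambda>\<omega>. tilt a T \<omega> * indicator {K<..} (tilt a T \<omega>)) \<le>
    exp (\<delta> * (1 + \<delta>) / 2 * (a\<^sup>2 * measure lborel T)) * K powr (- \<delta>)"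
proof -
  let ?H = "a\<^sup>2 * measure lborel T"
  define B where "B = exp (- (1 + \<delta>) * ?H / 2) * K powr (- \<delta>)"
  note tm = tilt_moments[OF T, of a]
  have e: "integrable M (\<lambda>\<omega>. exp (((1 + \<delta>) * a) * W T \<omega>))"
    "expectation (\<lambda>\<omega>. exp (((1 + \<delta>) * a) * W T \<omega>)) = exp (((1 + \<delta>) * a)\<^sup>2 * measure lborel T / 2)"
    using exp_W_integrable[OF T, of "(1 + \<delta>) * a"] by (auto simp: has_bochner_integral_iff)
  have "expectation (\<lambda>\<omega>. tilt a T \<omega> * indicator {K<..} (tilt a T \<omega>)) \<le> expectation (\<lambda>\<omega>. exp (((1 + \<delta>) * a) * W T \<omega>) * B)"
  proof (rule integral_mono)
    have [measurable]: "tilt a T \<in> borel_measurable M" by (rule tm(1))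
    show "integrable M (\<lambda>\<omega>. tilt a T \<omega> * indicator {K<..} (tilt a T \<omega>))"
      by (rule Bochner_Integration.integrable_bound[OF tm(2)]) (auto simp: indicator_def)
    show "integrable M (\<lambda>\<omega>. exp (((1 + \<delta>) * a) * W T \<omega>) * B)" using e(1) by (rule integrable_mult_left)
    fix \<omega>
    let ?Y = "tilt a T \<omega>"
    have Y: "?Y = exp (a * W T \<omega> - ?H / 2)" by (simp add: tilt_def exp_add[symmetric])
    show "?Y * indicator {K<..} ?Y \<le> exp (((1 + \<delta>) * a) * W T \<omega>) * B"
    proof (cases "K < ?Y")
      case True
      then have "K powr \<delta> \<le> ?Y powr \<delta>" using K \<delta> by (intro powr_mono2) auto
      then have "1 \<le> ?Y powr \<delta> * K powr (- \<delta>)" using K by (simp add: powr_minus field_simps)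
      then have "?Y * 1 \<le> ?Y * (?Y powr \<delta> * K powr (- \<delta>))" by (intro mult_left_mono) (auto simp: Y)
      also have "?Y * (?Y powr \<delta> * K powr (- \<delta>)) = exp (((1 + \<delta>) * a) * W T \<omega>) * B"
      proof -
        define h where "h = ?H / 2"
        have e1: "- (1 + \<delta>) * ?H / 2 = - (1 + \<delta>) * h" by (simp add: h_def)
        have e2: "(a * W T \<omega> - h) + (a * W T \<omega> - h) * \<delta> = (1 + \<delta>) * a * W T \<omega> + - (1 + \<delta>) * h"
          by (simp add: algebra_simps)
        have "exp (a * W T \<omega> - h) * exp ((a * W T \<omega> - h) * \<delta>) = exp ((1 + \<delta>) * a * W T \<omega>) * exp (- (1 + \<delta>) * h)"
          unfolding exp_add[symmetric] e2 ..
        then show ?thesis unfolding Y B_def e1 h_def[symmetric] exp_powr_real by (simp only: mult.assoc[symmetric])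
      qed
      finally show ?thesis using True by simp
    next
      case False
      then show ?thesis by (simp add: B_def)
    qed
  qed
  also have "\<dots> = exp (((1 + \<delta>) * a)\<^sup>2 * measure lborel T / 2) * B" using e by simp
  also have "\<dots> = exp (\<delta> * (1 + \<delta>) / 2 * ?H) * K powr (- \<delta>)"
  proof -
    have "((1 + \<delta>) * a)\<^sup>2 * measure lborel T / 2 + - (1 + \<delta>) * ?H / 2 = \<delta> * (1 + \<delta>) / 2 * ?H"
    proof -
      have "((1 + \<delta>) * a)\<^sup>2 * measure lborel T - (1 + \<delta>) * ?H = \<delta> * (1 + \<delta>) * ?H"
        by (simp add: power2_eq_square algebra_simps)
      moreover have "((1 + \<delta>) * a)\<^sup>2 * measure lborel T / 2 + - (1 + \<delta>) * ?H / 2 =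
          (((1 + \<delta>) * a)\<^sup>2 * measure lborel T - (1 + \<delta>) * ?H) / 2"
        by (simp only: diff_divide_distrib mult_minus_left minus_divide_left[symmetric] add_uminus_conv_diff)
      ultimately show ?thesis by simp
    qed
    then show ?thesis unfolding B_def mult.assoc[symmetric] exp_add[symmetric] by simp
  qed
  finally show ?thesis .
qed

text \<open>Division by \<open>heat_kernel t x\<close> makes all grid points alike, so that every
  bound is uniform over the grid. In \<open>prob_all_small_le\<close> the family \<open>A\<close> is
  the clipped solution times the truncated weight, and \<open>Z\<close> is the same with the proxy
  in place of the solution. \<open>V\<close> is the tilted mean less the clipping and truncation
  errors, and \<open>d\<close> is the localization error against a truncated weight.\<close>

theorem grid_probability:
  fixes t s0 a w D L K m d V :: real and k N :: nat
  assumes t: "0 < t" and s0: "0 < s0" "s0 \<le> t" and a: "0 < a" and w: "0 < w" and D: "0 < D"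
    and wD: "w < D / (2 * t) * s0" and N: "1 \<le> N" and L: "0 < L" and K: "0 < K" and k: "1 \<le> k" and \<delta>: "0 \<le> \<delta>"
    and C2: "0 \<le> C2" "\<And>s y. 0 < s \<Longrightarrow> s \<le> t \<Longrightarrow> expectation (\<lambda>\<omega>. (u s y \<omega>)\<^sup>2) \<le> C2 * (heat_kernel s y)\<^sup>2"
    and Ck: "\<And>y. integrable M (\<lambda>\<omega>. \<bar>u t y \<omega>\<bar> ^ (2 * k))"
      "\<And>y. expectation (\<lambda>\<omega>. \<bar>u t y \<omega>\<bar> ^ (2 * k)) \<le> Ck * heat_kernel t y ^ (2 * k)"
    and V: "V \<le> exp (- w\<^sup>2 / (2 * s0)) * exp ((a - pi\<^sup>2 / (8 * w\<^sup>2)) * (t - s0)) -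
        sqrt Ck * sqrt (exp (a\<^sup>2 * (2 * w * (t - s0)))) / L ^ (k - 1) -
        L * (exp (\<delta> * (1 + \<delta>) / 2 * (a\<^sup>2 * (2 * w * (t - s0)))) * K powr (- \<delta>))" "0 < V"
    and d: "d = sqrt (16 * sqrt 2 * C2 / (D / (2 * t)) * exp (128 * t)) * sqrt K" "d \<le> V / 4"
    and m: "0 < m"
  shows "{\<omega> \<in> space M. \<forall>i\<in>{1..N}. u t (real i * D) \<omega> \<le> m * heat_kernel t (real i * D)} \<in> events"
    "prob {\<omega> \<in> space M. \<forall>i\<in>{1..N}. u t (real i * D) \<omega> \<le> m * heat_kernel t (real i * D)} \<le>
      4 * m / V + 4 * d / V + 16 * (L\<^sup>2 * K) / (real N * V\<^sup>2)"
proof -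
  \<comment> \<open>The largest slope for which the sectors of neighbouring grid points are
    disjoint.\<close>
  define c where "c = D / (2 * t)"
  have c: "0 < c" using D t by (simp add: c_def)
  define x where "x i = real i * D" for i
  define h where "h i = heat_kernel t (x i)" for i
  have h: "0 < h i" for i unfolding h_def by (rule heat_kernel_pos[OF t])
  define S where "S i = sector t (x i) c" for i
  define T where "T i = tube t (x i) s0 w" for i
  have Tn: "T i \<in> noise_sets" and Tm: "measure lborel (T i) = 2 * w * (t - s0)" for i
    using tube_noise_sets[of s0 t w "x i"] s0 w by (auto simp: T_def)
  have TS: "T i \<subseteq> S i" for i unfolding T_def S_def using s0 c wD by (intro tube_subset_sector) (auto simp: c_def)
  define Y where "Y i = tilt a (T i)" for i
  note tm = tilt_moments[OF Tn, of a, folded Y_def]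
  have Y0: "0 \<le> Y i \<omega>" for i \<omega> by (simp add: Y_def tilt_def)
  have YN: "Y i \<in> borel_measurable (NA (S i))" for i
    unfolding Y_def tilt_def[abs_def] by (intro borel_measurable_times exp_W_measurable Tn TS borel_measurable_const)
  define YK where "YK i \<omega> = Y i \<omega> * indicator {..K} (Y i \<omega>)" for i \<omega>
  have YKN: "YK i \<in> borel_measurable (NA (S i))" for i
    unfolding YK_def[abs_def] using YN by measurable
  have YK0: "0 \<le> YK i \<omega>" for i \<omega> using Y0 by (simp add: YK_def)
  have YKY: "YK i \<omega> \<le> Y i \<omega>" for i \<omega> using Y0 by (simp add: YK_def indicator_def)
  have YKK: "YK i \<omega> \<le> K" for i \<omega> using K by (simp add: YK_def indicator_def)
  have YKm: "YK i \<in> borel_measurable M" for i by (rule NA_measurable_M[OF YKN])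
  have YKi: "integrable M (YK i)" for i
    by (rule Bochner_Integration.integrable_bound[OF tm(2)[of i]]) (use YKm YK0 YKY Y0 in \<open>auto simp: abs_of_nonneg\<close>)
  have YK1: "expectation (YK i) \<le> 1" for i
    using integral_mono[OF YKi tm(2)[of i] YKY] tm(3)[of i] by simp
  \<comment> \<open>Since the weight has mean 1, truncation at \<open>K\<close> leaves a second
    moment of at most \<open>K\<close> instead of \<open>K\<^sup>2\<close>. The balance between
    truncation level and number of grid points depends on this.\<close>
  have YKsq: "(YK i \<omega>)\<^sup>2 \<le> K * YK i \<omega>" for i \<omega>
    unfolding power2_eq_square by (intro mult_right_mono YKK YK0)
  have YK2: "integrable M (\<lambda>\<omega>. (YK i \<omega>)\<^sup>2)" for i
  proof (rule Bochner_Integration.integrable_bound)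
    show "integrable M (\<lambda>\<omega>. K * YK i \<omega>)" using YKi by simp
    show "AE \<omega> in M. norm ((YK i \<omega>)\<^sup>2) \<le> norm (K * YK i \<omega>)" using YKsq YK0 K by (simp add: abs_of_nonneg)
    show "(\<lambda>\<omega>. (YK i \<omega>)\<^sup>2) \<in> borel_measurable M" using YKm by measurable
  qed
  have YKe: "expectation (\<lambda>\<omega>. (YK i \<omega>)\<^sup>2) \<le> K" for i
  proof -
    have "expectation (\<lambda>\<omega>. (YK i \<omega>)\<^sup>2) \<le> expectation (\<lambda>\<omega>. K * YK i \<omega>)"
      using YK2 YKi YKsq by (intro integral_mono) auto
    also have "\<dots> \<le> K * 1" using YK1[of i] K by (simp add: mult_left_le)
    finally show ?thesis by simp
  qed
  define X where "X i \<omega> = u t (x i) \<omega> / h i" for i \<omega>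
  define X' where "X' i \<omega> = cexp (S i) (u t (x i)) \<omega> / h i" for i \<omega>
  have um: "u t (x i) \<in> borel_measurable M" for i by (rule u_measurable[OF t])
  have u2: "integrable M (\<lambda>\<omega>. (u t (x i) \<omega>)\<^sup>2)" for i by (rule u_square_integrable[OF t])
  have Xm: "X i \<in> borel_measurable M" for i unfolding X_def[abs_def] using um by measurable
  have X2: "integrable M (\<lambda>\<omega>. (X i \<omega>)\<^sup>2)" for i unfolding X_def power_divide using u2 by simp
  have X'N: "X' i \<in> borel_measurable (NA (S i))" for i
    unfolding X'_def[abs_def] by (intro borel_measurable_divide cexp_measurable borel_measurable_const)
  have X'm: "X' i \<in> borel_measurable M" for i by (rule NA_measurable_M[OF X'N])
  have XX'2: "integrable M (\<lambda>\<omega>. (X i \<omega> - X' i \<omega>)\<^sup>2)" for i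
    using square_integrable_diff[OF um[of i] _ u2[of i] cexp_square_integrable[OF um[of i] u2[of i], of "S i"]]
    unfolding X_def X'_def diff_divide_distrib[symmetric] power_divide by simp
  have XX'e: "expectation (\<lambda>\<omega>. (X i \<omega> - X' i \<omega>)\<^sup>2) \<le> 16 * sqrt 2 * C2 / c * exp (128 * t)" for i
  proof -
    interpret localization_region t "x i" c C2 "S i"
    proof
      fix r z assume r: "0 < r" "r < t" "(r, z) \<notin> S i"
      then show "c * r \<le> \<bar>z - r * x i / t\<bar>" by (auto simp: S_def sector_def)
    qed (use t c C2 in \<open>auto simp: S_def sector_borel\<close>)
    have "(\<integral>\<^sup>+\<omega>. ennreal ((u t (x i) \<omega> - cexp (S i) (u t (x i)) \<omega>)\<^sup>2) \<partial>M) \<le>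
        ennreal (16 * sqrt 2 * C2 / c * exp (128 * t) * (h i)\<^sup>2)"
      unfolding h_def by (rule localization_error[OF localization_region_axioms C2(2)])
    moreover have i: "integrable M (\<lambda>\<omega>. (u t (x i) \<omega> - cexp (S i) (u t (x i)) \<omega>)\<^sup>2)"
      by (rule square_integrable_diff[OF um _ u2 cexp_square_integrable[OF um u2]]) simp
    ultimately have "expectation (\<lambda>\<omega>. (u t (x i) \<omega> - cexp (S i) (u t (x i)) \<omega>)\<^sup>2) \<le> 16 * sqrt 2 * C2 / c * exp (128 * t) * (h i)\<^sup>2"
      using c C2 by (simp add: nn_integral_eq_integral)
    then have "expectation (\<lambda>\<omega>. (u t (x i) \<omega> - cexp (S i) (u t (x i)) \<omega>)\<^sup>2) / (h i)\<^sup>2 \<le> 16 * sqrt 2 * C2 / c * exp (128 * t)"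
      using h[of i] by (simp add: pos_divide_le_eq)
    then show ?thesis
      unfolding X_def X'_def diff_divide_distrib[symmetric] power_divide by simp
  qed
  define A where "A i \<omega> = clip L (X i \<omega>) * YK i \<omega>" for i \<omega>
  define Z where "Z i \<omega> = clip L (X' i \<omega>) * YK i \<omega>" for i \<omega>
  have ZN: "Z i \<in> borel_measurable (NA (S i))" for i
    unfolding Z_def[abs_def] using X'N YKN by measurable
  have Zm: "Z i \<in> borel_measurable M" for i by (rule NA_measurable_M[OF ZN])
  have Am: "A i \<in> borel_measurable M" for i unfolding A_def[abs_def] using Xm YKm by measurable
  have AZb: "\<bar>clip L v * YK i \<omega>\<bar> \<le> L * YK i \<omega>" for i \<omega> v
    unfolding abs_mult using clip_bound[of L v] L YK0[of i \<omega>] by (simp add: mult_right_mono)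
  have Ai: "integrable M (A i)" for i
  proof (rule Bochner_Integration.integrable_bound[OF _ Am])
    show "integrable M (\<lambda>\<omega>. L * YK i \<omega>)" using YKi by simp
    show "AE \<omega> in M. norm (A i \<omega>) \<le> norm (L * YK i \<omega>)" using AZb L YK0 by (simp add: A_def abs_of_nonneg)
  qed
  have Zsq: "(Z i \<omega>)\<^sup>2 \<le> L\<^sup>2 * (YK i \<omega>)\<^sup>2" for i \<omega>
  proof -
    have "\<bar>Z i \<omega>\<bar>\<^sup>2 \<le> (L * YK i \<omega>)\<^sup>2" unfolding Z_def using AZb by (intro power_mono) auto
    then show ?thesis by (simp add: power_mult_distrib)
  qed
  have Z2: "integrable M (\<lambda>\<omega>. (Z i \<omega>)\<^sup>2)" for i
  proof (rule Bochner_Integration.integrable_bound)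
    show "integrable M (\<lambda>\<omega>. L\<^sup>2 * (YK i \<omega>)\<^sup>2)" using YK2 by simp
    show "AE \<omega> in M. norm ((Z i \<omega>)\<^sup>2) \<le> norm (L\<^sup>2 * (YK i \<omega>)\<^sup>2)" using Zsq by simp
    show "(\<lambda>\<omega>. (Z i \<omega>)\<^sup>2) \<in> borel_measurable M" using Zm by measurable
  qed
  have Zi: "integrable M (Z i)" for i by (rule square_integrable_imp_integrable'[OF Zm Z2])
  have Z2e: "expectation (\<lambda>\<omega>. (Z i \<omega>)\<^sup>2) \<le> L\<^sup>2 * K" for i
  proof -
    have "expectation (\<lambda>\<omega>. (Z i \<omega>)\<^sup>2) \<le> expectation (\<lambda>\<omega>. L\<^sup>2 * (YK i \<omega>)\<^sup>2)"
      using Z2 YK2 Zsq by (intro integral_mono) auto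
    also have "\<dots> \<le> L\<^sup>2 * K" using YKe[of i] by (simp add: mult_left_mono)
    finally show ?thesis .
  qed
  have AZ: "expectation (\<lambda>\<omega>. \<bar>A i \<omega> - Z i \<omega>\<bar>) \<le> d" for i
  proof -
    have "expectation (\<lambda>\<omega>. \<bar>A i \<omega> - Z i \<omega>\<bar>) \<le> expectation (\<lambda>\<omega>. \<bar>(X i \<omega> - X' i \<omega>) * YK i \<omega>\<bar>)"
    proof (rule integral_mono)
      show "integrable M (\<lambda>\<omega>. \<bar>A i \<omega> - Z i \<omega>\<bar>)" using Ai Zi by simp
      have "integrable M (\<lambda>\<omega>. (X i \<omega> - X' i \<omega>) * YK i \<omega>)"
        by (rule square_integrable_mult[OF _ YKm XX'2 YK2]) (use Xm X'm in measurable)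
      then show "integrable M (\<lambda>\<omega>. \<bar>(X i \<omega> - X' i \<omega>) * YK i \<omega>\<bar>)" by simp
      show "\<bar>A i \<omega> - Z i \<omega>\<bar> \<le> \<bar>(X i \<omega> - X' i \<omega>) * YK i \<omega>\<bar>" for \<omega>
        unfolding A_def Z_def left_diff_distrib[symmetric] abs_mult by (intro mult_right_mono clip_lipschitz) simp
    qed
    also have "\<dots> \<le> sqrt (expectation (\<lambda>\<omega>. (X i \<omega> - X' i \<omega>)\<^sup>2)) * sqrt (expectation (\<lambda>\<omega>. (YK i \<omega>)\<^sup>2))"
      by (rule Cauchy_Schwarz_integral[OF _ YKm XX'2 YK2]) (use Xm X'm in measurable)
    also have "\<dots> \<le> sqrt (16 * sqrt 2 * C2 / c * exp (128 * t)) * sqrt K"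
      using XX'e YKe c C2 by (intro mult_mono real_sqrt_le_mono) auto
    finally show ?thesis unfolding d c_def .
  qed
  have AV: "V \<le> expectation (A i)" for i
  proof -
    have Xk: "integrable M (\<lambda>\<omega>. \<bar>X i \<omega>\<bar> ^ (2 * k))" "expectation (\<lambda>\<omega>. \<bar>X i \<omega>\<bar> ^ (2 * k)) \<le> Ck"
    proof -
      have eq: "\<bar>X i \<omega>\<bar> ^ (2 * k) = \<bar>u t (x i) \<omega>\<bar> ^ (2 * k) / h i ^ (2 * k)" for \<omega>
        using h[of i] by (simp add: X_def power_divide)
      show "integrable M (\<lambda>\<omega>. \<bar>X i \<omega>\<bar> ^ (2 * k))" unfolding eq using Ck(1)[of "x i"] by simp
      have "expectation (\<lambda>\<omega>. \<bar>X i \<omega>\<bar> ^ (2 * k)) = expectation (\<lambda>\<omega>. \<bar>u t (x i) \<omega>\<bar> ^ (2 * k)) / h i ^ (2 * k)"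
        unfolding eq by simp
      also have "\<dots> \<le> Ck" using Ck(2)[of "x i"] h[of i] by (simp add: pos_divide_le_eq h_def[symmetric])
      finally show "expectation (\<lambda>\<omega>. \<bar>X i \<omega>\<bar> ^ (2 * k)) \<le> Ck" .
    qed
    have tail: "expectation (\<lambda>\<omega>. Y i \<omega> * indicator {K<..} (Y i \<omega>)) \<le>
        exp (\<delta> * (1 + \<delta>) / 2 * (a\<^sup>2 * (2 * w * (t - s0)))) * K powr (- \<delta>)"
      using tilt_tail[OF Tn[of i] \<delta> K, of a] unfolding Tm Y_def .
    have tb: "tilted_tube t (x i) s0 a w (T i)"
      using s0 a w by unfold_locales (auto simp: T_def tube_def)
    have "exp (- w\<^sup>2 / (2 * s0)) * exp ((a - pi\<^sup>2 / (8 * w\<^sup>2)) * (t - s0)) * h i \<le> expectation (\<lambda>\<omega>. u t (x i) \<omega> * Y i \<omega>)"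
      unfolding h_def Y_def by (rule tilted_mean_lower_bound[OF tb Tn])
    then have "exp (- w\<^sup>2 / (2 * s0)) * exp ((a - pi\<^sup>2 / (8 * w\<^sup>2)) * (t - s0)) \<le> expectation (\<lambda>\<omega>. u t (x i) \<omega> * Y i \<omega>) / h i"
      using h[of i] by (simp add: pos_le_divide_eq)
    also have "\<dots> = expectation (\<lambda>\<omega>. X i \<omega> * Y i \<omega>)" by (simp add: X_def)
    finally have mean: "exp (- w\<^sup>2 / (2 * s0)) * exp ((a - pi\<^sup>2 / (8 * w\<^sup>2)) * (t - s0)) \<le> expectation (\<lambda>\<omega>. X i \<omega> * Y i \<omega>)" .
    have "expectation (\<lambda>\<omega>. X i \<omega> * Y i \<omega>) - sqrt Ck * sqrt (expectation (\<lambda>\<omega>. (Y i \<omega>)\<^sup>2)) / L ^ (k - 1) -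
        L * (exp (\<delta> * (1 + \<delta>) / 2 * (a\<^sup>2 * (2 * w * (t - s0)))) * K powr (- \<delta>)) \<le>
      expectation (\<lambda>\<omega>. clip L (X i \<omega>) * (Y i \<omega> * indicator {..K} (Y i \<omega>)))"
      by (rule clipped_mean_lower_bound[OF Xm tm(1) Y0 X2 tm(4) Xk L k tail])
    then show ?thesis
      using V mean unfolding A_def YK_def tm(5) Tm by linarith
  qed
  have unc: "expectation (\<lambda>\<omega>. Z i \<omega> * Z j \<omega>) = expectation (Z i) * expectation (Z j)" if ij: "i \<noteq> j" for i j
  proof (rule indep_NA_mult(2)[OF _ ZN ZN Zi Zi])
    have "1 \<le> \<bar>real i - real j\<bar>" using ij by (cases "i < j") auto
    then have "1 * D \<le> \<bar>real i - real j\<bar> * D" using D by (intro mult_right_mono) auto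
    also have "\<dots> = \<bar>x i - x j\<bar>" using D by (simp add: x_def abs_mult left_diff_distrib[symmetric])
    finally show "S i \<inter> S j = {}" unfolding S_def using t by (intro sector_disjoint) (auto simp: c_def)
  qed
  let ?F = "{\<omega> \<in> space M. \<forall>i\<in>{1..N}. u t (real i * D) \<omega> \<le> m * heat_kernel t (real i * D)}"
  show F: "?F \<in> events"
  proof (rule sets.sets_Collect_finite_All')
    fix i
    have [measurable]: "u t (real i * D) \<in> borel_measurable M" by (rule u_measurable[OF t])
    show "{\<omega> \<in> space M. u t (real i * D) \<omega> \<le> m * heat_kernel t (real i * D)} \<in> events" by measurable
  qed (use N in auto)
  have "prob ?F \<le> 4 * m / V + 4 * d / V + 16 * (L\<^sup>2 * K) / (real (card {1..N}) * V\<^sup>2)"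
  proof (rule prob_all_small_le[where A=A and Z=Z and T=YK])
    fix \<omega> i assume w: "\<omega> \<in> ?F" "i \<in> {1..N}"
    then have "u t (x i) \<omega> \<le> m * h i" by (auto simp: x_def h_def)
    then have "X i \<omega> \<le> m" using h[of i] by (simp add: X_def pos_divide_le_eq)
    then have "clip L (X i \<omega>) \<le> m" using L m by (intro clip_le) auto
    then show "A i \<omega> \<le> m * YK i \<omega>" unfolding A_def using YK0 by (intro mult_right_mono) auto
  next
    show "?F \<in> events" by (rule F)
  qed ((rule Ai YKi Zm Z2 YK0 YK1 AZ AV Z2e unc V(2) m d(2) | use N in force)+)
  then show "prob ?F \<le> 4 * m / V + 4 * d / V + 16 * (L\<^sup>2 * K) / (real N * V\<^sup>2)" by simp
qed

end

subsection \<open>Borel--Cantelli along exponential scales\<close>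

lemma eventually_error_small:
  fixes A b c :: real
  assumes "0 < b" "0 < c"
  shows "eventually (\<lambda>n::nat. A * exp (- real n / 100) + exp (- real n / 1000) \<le> c * exp (b * real n powr (2/3))) sequentially"
  using assms by real_asymp

lemma eventually_exp_le:
  fixes A b c :: real
  assumes "0 < b" "0 < c"
  shows "eventually (\<lambda>n::nat. A * exp (- real n / 50) \<le> c * exp (b * real n powr (2/3))) sequentially"
  using assms by real_asymp

lemma eventually_width_small:
  fixes A :: real
  shows "eventually (\<lambda>n::nat. A / real n powr (1/3) < exp (real n / 2) / 200) sequentially"
  by real_asymp

lemma summable_stretched_exp:
  fixes A B b :: real
  assumes "0 < b"
  shows "summable (\<lambda>n::nat. A * exp (- b * real n powr (2/3)) + B * exp (- real n / 50))"
proof (rule summable_comparison_test_bigo)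
  show "summable (\<lambda>n::nat. norm (1 / real n ^ 2))" using inverse_power_summable[of 2] by (simp add: inverse_eq_divide)
  show "(\<lambda>n::nat. A * exp (- b * real n powr (2/3)) + B * exp (- real n / 50)) \<in> O(\<lambda>n. 1 / real n ^ 2)"
    using assms by real_asymp
qed

text \<open>The number 0.1985 lies strictly between \<open>2 powr (-1/3) / 4\<close> and 1/5. The
  room below 1/5 absorbs the step from \<open>n\<close> to \<open>n + 1\<close> and the additive
  constant.\<close>

lemma eventually_ratio_ge:
  fixes \<tau> c0 :: real
  assumes "0 < \<tau>"
  shows "eventually (\<lambda>n::nat. \<tau> * (1985/10000) * (real n + 1) powr (2/3) \<le> \<tau> / 5 * real n powr (2/3) - c0) sequentially"
  using assms by real_asymp

lemma sqrt_exp: "sqrt (exp x) = exp (x / 2 :: real)"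
  by (rule real_sqrt_unique) (simp_all add: power2_eq_square flip: exp_add)

text \<open>With the spacing \<open>exp (n / 2)\<close> the grid stays inside
  \<open>[0, exp n]\<close>.\<close>

definition grid_size :: "nat \<Rightarrow> nat" where
  "grid_size n = nat \<lfloor>exp (real n / 2)\<rfloor>"

lemma grid_size:
  assumes "2 \<le> n"
  shows "1 \<le> grid_size n" "exp (real n / 2) / 2 \<le> real (grid_size n)" "real (grid_size n) \<le> exp (real n / 2)"
proof -
  have "(2::real) \<le> exp 1" using exp_ge_add_one_self[of 1] by simp
  also have "\<dots> \<le> exp (real n / 2)" using assms by simp
  finally have e: "2 \<le> exp (real n / 2)" .
  have r: "real (grid_size n) = of_int \<lfloor>exp (real n / 2)\<rfloor>" by (simp add: grid_size_def)
  have l: "exp (real n / 2) - 1 \<le> real (grid_size n)" unfolding r by linarith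
  show "real (grid_size n) \<le> exp (real n / 2)" unfolding r by linarith
  show "exp (real n / 2) / 2 \<le> real (grid_size n)" using l e by linarith
  show "1 \<le> grid_size n" using l e by linarith
qed

definition low_grid :: "'a measure \<Rightarrow> (real \<Rightarrow> real \<Rightarrow> 'a \<Rightarrow> real) \<Rightarrow> real \<Rightarrow> nat \<Rightarrow> 'a set" where
  "low_grid M u t n = {\<omega> \<in> space M. \<forall>i\<in>{1..grid_size n}.
     u t (real i * exp (real n / 2)) \<omega> \<le>
     exp (t powr (1/3) / 5 * real n powr (2/3)) * heat_kernel t (real i * exp (real n / 2))}"

context parabolic_anderson
begin

text \<open>Choice of the parameters: the weight has entropy \<open>0.333 n\<close>, so \<open>K = exp (0.46 n)\<close> truncates only a small part of it,
  and \<open>L\<^sup>2 * K = exp (0.48 n)\<close> stays below the number \<open>exp (n / 2)\<close> of grid points. The width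
  \<open>4 * \<tau> / \<nu>\<close> of the tube leaves the growth rate \<open>0.29 - pi\<^sup>2 / 128 > 0.2\<close>, which exceeds
  the constant \<open>2 powr (-1/3) / 4 < 0.1985\<close> of the theorem.\<close>

lemma low_grid_summable:
  assumes t: "0 < t"
  obtains A B b where "0 < b"
    "eventually (\<lambda>n. low_grid M u t n \<in> events \<and>
       prob (low_grid M u t n) \<le> A * exp (- b * real n powr (2/3)) + B * exp (- real n / 50)) sequentially"
proof -
  \<comment> \<open>With cube roots \<open>\<tau>\<close> of \<open>t\<close> and
    \<open>\<nu>\<close> of \<open>n\<close> as variables, all quantities below involve integral
    powers only.\<close>
  define \<tau> where "\<tau> = t powr (1/3)"
  have \<tau>: "0 < \<tau>" "t = \<tau> ^ 3"
    using t by (simp_all add: \<tau>_def powr_powr flip: powr_numeral)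
  obtain C2 where C2: "0 \<le> C2" "\<And>s y. 0 < s \<Longrightarrow> s \<le> t \<Longrightarrow> expectation (\<lambda>\<omega>. (u s y \<omega>)\<^sup>2) \<le> C2 * (heat_kernel s y)\<^sup>2"
    using u_second_moment[OF t] by blast
  have "\<exists>Ck. (\<forall>y. integrable M (\<lambda>\<omega>. \<bar>u t y \<omega>\<bar> ^ (2 * 36))) \<and>
      (\<forall>y. expectation (\<lambda>\<omega>. \<bar>u t y \<omega>\<bar> ^ (2 * 36)) \<le> Ck * heat_kernel t y ^ (2 * 36))"
  proof (rule u_moments[OF t, of "2 * 36"])
    fix C assume C: "\<And>s y. 0 < s \<Longrightarrow> s \<le> t \<Longrightarrow> integrable M (\<lambda>\<omega>. \<bar>u s y \<omega>\<bar> ^ (2 * 36))"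
      "\<And>s y. 0 < s \<Longrightarrow> s \<le> t \<Longrightarrow> expectation (\<lambda>\<omega>. \<bar>u s y \<omega>\<bar> ^ (2 * 36)) \<le> C * heat_kernel s y ^ (2 * 36)"
    show ?thesis using C[OF t order_refl] by (intro exI[of _ C] conjI allI)
  qed simp
  then obtain Ck where Ck: "\<And>y. integrable M (\<lambda>\<omega>. \<bar>u t y \<omega>\<bar> ^ (2 * 36))"
      "\<And>y. expectation (\<lambda>\<omega>. \<bar>u t y \<omega>\<bar> ^ (2 * 36)) \<le> Ck * heat_kernel t y ^ (2 * 36)" by blast
  \<comment> \<open>The exponent bounds
    \<open>w\<^sup>2 / (2 * s0) = 800 / (\<tau> * \<nu>\<^sup>2)\<close>, the cost of starting the
    tube at \<open>s0\<close>. The factor 1/2 sets half of the tilted mean aside for the clipping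
    and truncation errors.\<close>
  define c where "c = exp (- 800 / \<tau>) / 2"
  \<comment> \<open>This is \<open>0.99 * 0.21\<close>: the loss of the time before
    \<open>s0 = t / 100\<close>, and \<open>0.29 - pi\<^sup>2 / 128\<close> with \<open>pi\<close>
    replaced by 3.2. It exceeds the threshold 1/5 of \<open>low_grid\<close> by 79/10000, which is
    the decay rate of \<open>m / V\<close>.\<close>
  define b where "b = 2079 / 10000 * \<tau>"
  define C' where "C' = sqrt (32 * sqrt 2 * C2 * t * exp (128 * t))"
  have c: "0 < c" "0 < c / 4" and b: "0 < b" using \<tau> by (simp_all add: c_def b_def)
  have "eventually (\<lambda>n. low_grid M u t n \<in> events \<and>
       prob (low_grid M u t n) \<le> 4 / c * exp (- (79 / 10000 * \<tau>) * real n powr (2/3)) + (4 * C' / c + 32 / c\<^sup>2) * exp (- real n / 50)) sequentially"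
    using eventually_error_small[OF b c(1), of "sqrt Ck"] eventually_exp_le[OF b c(2), of C'] eventually_width_small[of "4 * \<tau>"]
      eventually_ge_at_top[of 2]
  proof eventually_elim
    case (elim n)
    define \<nu> where "\<nu> = real n powr (1/3)"
    have n: "0 < real n" "2 \<le> n" using elim(4) by auto
    have \<nu>: "0 < \<nu>" "real n = \<nu> ^ 3" "real n powr (2/3) = \<nu>\<^sup>2"
      using n by (simp_all add: \<nu>_def powr_powr flip: powr_numeral)
    have \<nu>1: "1 \<le> \<nu>" unfolding \<nu>_def using n by (intro ge_one_powr_ge_zero) auto
    define s0 where "s0 = t / 100"
    define a where "a = 29 / 100 * \<nu>\<^sup>2 / \<tau>\<^sup>2"
    \<comment> \<open>At entropy near \<open>n / 3\<close> the rate
      \<open>a - pi\<^sup>2 / (8 * w\<^sup>2)\<close> is largest for a width of about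
      \<open>4.2 * \<tau> / \<nu>\<close>.\<close>
    define w where "w = 4 * \<tau> / \<nu>"
    define D where "D = exp (real n / 2)"
    define K where "K = exp (46 / 100 * real n)"
    define L where "L = exp (real n / 100)"
    define m where "m = exp (\<tau> / 5 * real n powr (2/3))"
    define N where "N = grid_size n"
    define V where "V = c * exp (b * real n powr (2/3))"
    define d where "d = sqrt (16 * sqrt 2 * C2 / (D / (2 * t)) * exp (128 * t)) * sqrt K"
    have V: "0 < V" "c \<le> V" using c b by (simp_all add: V_def)
    have ts: "t - s0 = 99 / 100 * \<tau> ^ 3" using \<tau> by (simp add: s0_def)
    \<comment> \<open>Twice the relative entropy of the weight, and the logarithm of its second
      moment.\<close>
    have H: "a\<^sup>2 * (2 * w * (t - s0)) = 666072 / 1000000 * real n"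
      unfolding a_def w_def ts \<nu>(2) using \<tau>(1) \<nu>(1) by (simp add: field_simps power2_eq_square power3_eq_cube)
    have "w\<^sup>2 / (2 * s0) = 800 / \<tau> * (1 / \<nu>\<^sup>2)"
      unfolding w_def s0_def \<tau>(2) using \<tau>(1) \<nu>(1) by (simp add: field_simps power2_eq_square power3_eq_cube)
    also have "\<dots> \<le> 800 / \<tau> * 1" using \<tau> \<nu>1 by (intro mult_left_mono) (auto simp: one_le_power)
    finally have w2: "- 800 / \<tau> \<le> - w\<^sup>2 / (2 * s0)" by simp
    have "pi\<^sup>2 \<le> (32 / 10)\<^sup>2" using pi_less_4 pi_approx(2) by (intro power_mono) auto
    then have p2: "2079 / 10000 \<le> (29 / 100 - pi\<^sup>2 / 128) * (99 / 100)" by (simp add: power2_eq_square)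
    have "(a - pi\<^sup>2 / (8 * w\<^sup>2)) * (t - s0) = ((29 / 100 - pi\<^sup>2 / 128) * (99 / 100)) * (\<tau> * \<nu>\<^sup>2)"
      unfolding a_def w_def ts using \<tau>(1) \<nu>(1) by (simp add: field_simps power2_eq_square power3_eq_cube)
    also have "\<dots> \<ge> 2079 / 10000 * (\<tau> * \<nu>\<^sup>2)" using \<tau>(1) by (intro mult_right_mono p2) auto
    finally have e2: "b * real n powr (2/3) \<le> (a - pi\<^sup>2 / (8 * w\<^sup>2)) * (t - s0)" by (simp add: b_def \<nu>(3))
    have "2 * V = exp (- 800 / \<tau>) * exp (b * real n powr (2/3))" by (simp add: V_def c_def)
    also have "\<dots> \<le> exp (- w\<^sup>2 / (2 * s0)) * exp ((a - pi\<^sup>2 / (8 * w\<^sup>2)) * (t - s0))"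
      using w2 e2 by (intro mult_mono) auto
    finally have main: "2 * V \<le> exp (- w\<^sup>2 / (2 * s0)) * exp ((a - pi\<^sup>2 / (8 * w\<^sup>2)) * (t - s0))" .
    \<comment> \<open>The order of the moment is determined here: \<open>35 / 100\<close> has to
      exceed 0.333036, half the exponent in \<open>H\<close>, by at least
      \<open>1 / 100\<close>.\<close>
    have "sqrt Ck * sqrt (exp (a\<^sup>2 * (2 * w * (t - s0)))) / L ^ (36 - 1) = sqrt Ck * exp (333036 / 1000000 * real n - 35 / 100 * real n)"
    proof -
      have "L ^ (36 - 1) = exp (35 / 100 * real n)" unfolding L_def exp_of_nat_mult[symmetric] by simp
      moreover have "sqrt (exp (a\<^sup>2 * (2 * w * (t - s0)))) = exp (333036 / 1000000 * real n)"
        unfolding H sqrt_exp by simp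
      ultimately show ?thesis by (simp only: exp_diff times_divide_eq_right)
    qed
    moreover have "0 \<le> Ck"
    proof (rule ccontr)
      assume "\<not> 0 \<le> Ck"
      then have "Ck * heat_kernel t 0 ^ (2 * 36) < 0" using heat_kernel_pos[OF t, of 0] by (intro mult_neg_pos) auto
      moreover have "0 \<le> expectation (\<lambda>\<omega>. \<bar>u t 0 \<omega>\<bar> ^ (2 * 36))" by (rule Bochner_Integration.integral_nonneg) simp
      ultimately show False using Ck(2)[of 0] by linarith
    qed
    moreover have "exp (333036 / 1000000 * real n - 35 / 100 * real n) \<le> exp (- real n / 100)" by simp
    ultimately have E1: "sqrt Ck * sqrt (exp (a\<^sup>2 * (2 * w * (t - s0)))) / L ^ (36 - 1) \<le> sqrt Ck * exp (- real n / 100)"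
      by (simp add: mult_left_mono)
    \<comment> \<open>The exponent per unit of \<open>n\<close> is \<open>0.01 + \<delta> * (1 +
      \<delta>) / 2 * 0.666072 - 0.46 * \<delta>\<close>. It is smallest near
      \<open>\<delta> = 0.19\<close>, and \<open>\<delta> = 1/6\<close> makes it about
      -0.0019.\<close>
    have "L * (exp ((1/6) * (1 + 1/6) / 2 * (a\<^sup>2 * (2 * w * (t - s0)))) * K powr (- (1/6))) =
        exp (real n / 100 + ((7 / 72) * (666072 / 1000000 * real n) - 46 / 600 * real n))"
      unfolding H L_def K_def exp_powr_real exp_add exp_diff by (simp add: exp_minus field_simps)
    also have "\<dots> \<le> exp (- real n / 1000)" using n by (simp add: field_simps)
    finally have E2: "L * (exp ((1/6) * (1 + 1/6) / 2 * (a\<^sup>2 * (2 * w * (t - s0)))) * K powr (- (1/6))) \<le> exp (- real n / 1000)" .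
    have VV: "V \<le> exp (- w\<^sup>2 / (2 * s0)) * exp ((a - pi\<^sup>2 / (8 * w\<^sup>2)) * (t - s0)) -
        sqrt Ck * sqrt (exp (a\<^sup>2 * (2 * w * (t - s0)))) / L ^ (36 - 1) -
        L * (exp ((1/6) * (1 + 1/6) / 2 * (a\<^sup>2 * (2 * w * (t - s0)))) * K powr (- (1/6)))"
      using main E1 E2 elim(1) unfolding V_def by linarith
    \<comment> \<open>The spacing exceeds the truncation level by the factor
      \<open>exp (0.04 * n)\<close>; its square root gives the decay
      \<open>exp (- n / 50)\<close>.\<close>
    have "16 * sqrt 2 * C2 / (D / (2 * t)) * exp (128 * t) * K = (32 * sqrt 2 * C2 * t * exp (128 * t)) * exp (46 / 100 * real n - real n / 2)"
      unfolding D_def K_def exp_diff using t by (simp add: field_simps)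
    then have "d = C' * sqrt (exp (46 / 100 * real n - real n / 2))"
      unfolding d_def C'_def by (simp flip: real_sqrt_mult)
    also have "\<dots> = C' * exp (- real n / 50)" unfolding sqrt_exp by (simp add: field_simps)
    finally have d: "d = C' * exp (- real n / 50)" .
    have d4: "d \<le> V / 4" using elim(2) unfolding d V_def by simp
    have wD: "w < D / (2 * t) * s0" using elim(3) t by (simp add: w_def D_def s0_def \<nu>_def)
    note gp = grid_probability[of t s0 a w D N L K 36 "1/6" C2 Ck V d m, OF t _ _ _ _ _ wD _ _ _ _ _ C2 Ck VV V(1) d_def d4]
    have pos: "0 < s0" "s0 \<le> t" "0 < a" "0 < w" "0 < D" "1 \<le> N" "0 < L" "0 < K" "0 < m"
      using t \<tau> \<nu> grid_size(1)[OF n(2)] by (simp_all add: s0_def a_def w_def D_def L_def K_def m_def N_def)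
    have lg: "low_grid M u t n = {\<omega> \<in> space M. \<forall>i\<in>{1..N}. u t (real i * D) \<omega> \<le> m * heat_kernel t (real i * D)}"
      by (simp add: low_grid_def N_def D_def m_def \<tau>_def)
    have "low_grid M u t n \<in> events" unfolding lg by (rule gp(1)) (use pos in auto)
    moreover have "prob (low_grid M u t n) \<le> 4 * m / V + 4 * d / V + 16 * (L\<^sup>2 * K) / (real N * V\<^sup>2)"
      unfolding lg by (rule gp(2)) (use pos in auto)
    moreover have "4 * m / V = 4 / c * exp (- (79 / 10000 * \<tau>) * real n powr (2/3))"
    proof -
      have "m = exp (- (79 / 10000 * \<tau>) * real n powr (2/3)) * exp (b * real n powr (2/3))"
        unfolding m_def b_def exp_add[symmetric] by (simp add: field_simps)
      then show ?thesis using c by (simp add: V_def field_simps)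
    qed
    moreover have "4 * d / V \<le> 4 * C' / c * exp (- real n / 50)"
    proof -
      have "0 \<le> d" unfolding d C'_def using C2(1) t by simp
      then have "4 * d / V \<le> 4 * d / c" using V c by (intro divide_left_mono) auto
      then show ?thesis by (simp add: d)
    qed
    moreover have "16 * (L\<^sup>2 * K) / (real N * V\<^sup>2) \<le> 32 / c\<^sup>2 * exp (- real n / 50)"
    proof -
      have "exp (real n / 2) / 2 * c\<^sup>2 \<le> real N * V\<^sup>2"
        using grid_size(2)[OF n(2)] V c by (intro mult_mono power_mono) (auto simp: N_def)
      then have "16 * (L\<^sup>2 * K) / (real N * V\<^sup>2) \<le> 16 * (L\<^sup>2 * K) / (exp (real n / 2) / 2 * c\<^sup>2)"
        using pos c V by (intro divide_left_mono) (auto simp: K_def)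
      moreover have "L\<^sup>2 * K = exp (- real n / 50) * exp (real n / 2)"
        unfolding L_def K_def power2_eq_square exp_add[symmetric] by simp
      ultimately show ?thesis by simp
    qed
    ultimately show ?case by (simp add: distrib_right)
  qed
  moreover have "0 < 79 / 10000 * \<tau>" using \<tau> by simp
  ultimately show ?thesis using that by blast
qed

lemma eventually_not_low_grid:
  assumes t: "0 < t"
  shows "AE \<omega> in M. eventually (\<lambda>n. \<omega> \<in> space M - low_grid M u t n) sequentially"
proof (rule low_grid_summable[OF t])
  fix A B b assume b: "0 < b" and ev: "eventually (\<lambda>n. low_grid M u t n \<in> events \<and>
       prob (low_grid M u t n) \<le> A * exp (- b * real n powr (2/3)) + B * exp (- real n / 50)) sequentially"
  then obtain n0 where n0: "\<And>n. n0 \<le> n \<Longrightarrow> low_grid M u t n \<in> events"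
    "\<And>n. n0 \<le> n \<Longrightarrow> prob (low_grid M u t n) \<le> A * exp (- b * real n powr (2/3)) + B * exp (- real n / 50)"
    by (auto simp: eventually_sequentially)
  have "summable (\<lambda>n. prob (low_grid M u t (n + n0)))"
  proof (rule summable_comparison_test)
    show "summable (\<lambda>n. A * exp (- b * real (n + n0) powr (2/3)) + B * exp (- real (n + n0) / 50))"
      using summable_stretched_exp[OF b, of A B] by (subst summable_iff_shift)
    show "\<exists>N. \<forall>n\<ge>N. norm (prob (low_grid M u t (n + n0))) \<le> A * exp (- b * real (n + n0) powr (2/3)) + B * exp (- real (n + n0) / 50)"
      using n0(2)[of "_ + n0"] by auto
  qed
  then have "AE \<omega> in M. eventually (\<lambda>n. \<omega> \<in> space M - low_grid M u t (n + n0)) sequentially"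
    using n0(1) by (intro borel_cantelli_AE1) (auto simp: emeasure_eq_measure)
  then show ?thesis by (subst (asm) eventually_sequentially_seg)
qed

end

text \<open>The Gaussian factor of the heat kernel cancels the parabola and leaves only the constant
  \<open>ln (2 * pi * t) / 2\<close>. At the grid point that exceeds the threshold \<open>u\<close>
  is positive, so its logarithm is genuine; one such point suffices for the supremum.\<close>

lemma not_low_grid_SUP_ge:
  assumes t: "0 < t" and n: "2 \<le> n" and \<omega>: "\<omega> \<in> space M - low_grid M u t n" and R: "exp (real n) \<le> R"
  shows "ereal (t powr (1/3) / 5 * real n powr (2/3) - ln (2 * pi * t) / 2) \<le>
    (SUP x\<in>{-R..R}. ereal (ln (u t x \<omega>) + x\<^sup>2 / (2 * t)))"
proof -
  define m where "m = t powr (1/3) / 5 * real n powr (2/3)"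
  obtain i where i: "i \<in> {1..grid_size n}"
    "exp m * heat_kernel t (real i * exp (real n / 2)) < u t (real i * exp (real n / 2)) \<omega>"
    using \<omega> by (auto simp: low_grid_def m_def not_le)
  define x where "x = real i * exp (real n / 2)"
  have "x \<le> exp (real n / 2) * exp (real n / 2)"
    unfolding x_def using i(1) grid_size(3)[OF n] by (intro mult_right_mono) auto
  also have "\<dots> = exp (real n)" by (simp flip: exp_add)
  finally have x: "0 \<le> x" "x \<le> R" using R by (auto simp: x_def)
  have h: "heat_kernel t x = exp (- ln (2 * pi * t) / 2 - x\<^sup>2 / (2 * t))"
  proof -
    have "exp (ln (2 * pi * t) / 2) = sqrt (2 * pi * t)" using t by (simp flip: sqrt_exp)
    then have "1 / sqrt (2 * pi * t) = exp (- (ln (2 * pi * t) / 2))" by (simp add: exp_minus inverse_eq_divide)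
    then show ?thesis by (simp add: heat_kernel_def flip: exp_add)
  qed
  have u: "exp (m - ln (2 * pi * t) / 2 - x\<^sup>2 / (2 * t)) < u t x \<omega>"
    using i(2) unfolding x_def[symmetric] h by (simp flip: exp_add add: algebra_simps)
  then have "0 < u t x \<omega>" using exp_gt_zero less_trans by blast
  then have "m - ln (2 * pi * t) / 2 - x\<^sup>2 / (2 * t) \<le> ln (u t x \<omega>)"
    using u by (subst ln_ge_iff) auto
  then have "ereal (m - ln (2 * pi * t) / 2) \<le> ereal (ln (u t x \<omega>) + x\<^sup>2 / (2 * t))" by simp
  then show ?thesis unfolding m_def[symmetric] by (rule SUP_upper2[rotated]) (use x in auto)
qed

text \<open>The cube of 0.794 is slightly above 1/2, and a quarter of 0.794 is 0.1985.\<close>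

lemma quarter_half_powr:
  fixes t :: real
  assumes "0 < t"
  shows "1 / 4 * (t / 2) powr (1/3) \<le> t powr (1/3) * (1985/10000)"
proof -
  have "(1/2::real) powr (1/3) \<le> ((794/1000)^3) powr (1/3)"
    by (intro powr_mono2) (simp_all add: power3_eq_cube)
  also have "\<dots> = 794/1000" by (simp add: powr_powr flip: powr_numeral)
  finally have "(1/2::real) powr (1/3) \<le> 794/1000" .
  then have "t powr (1/3) * (1/2) powr (1/3) \<le> t powr (1/3) * (794/1000)" by (intro mult_left_mono) auto
  moreover have "(t / 2) powr (1/3) = t powr (1/3) * (1/2) powr (1/3)"
    using assms powr_mult[of t "1/2" "1/3"] by simp
  ultimately show ?thesis by simp
qed

theorem theorem1p1:
  fixes M :: "'a measure"
    and W :: "(real \<times> real) set \<Rightarrow> 'a \<Rightarrow> real"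
    and u :: "real \<Rightarrow> real \<Rightarrow> 'a \<Rightarrow> real"
    and t :: real
  assumes "prob_space M"
    and "white_noise M W"
    and "pam_narrow_wedge_solution M W u"
    and "t > 0"
  shows "AE \<omega> in M.
    Liminf at_top (\<lambda>R :: real.
      (SUP x\<in>{-R..R}. ereal (ln (u t x \<omega>) + x\<^sup>2 / (2 * t))) / ereal (ln R powr (2 / 3)))
    \<ge> ereal (1 / 4 * (t / 2) powr (1 / 3))"
proof -
  interpret prob_space M by fact
  interpret parabolic_anderson M W u by unfold_locales fact+
  note t = \<open>t > 0\<close>
  have \<tau>: "0 < t powr (1/3)" using t by simp
  show ?thesis using eventually_not_low_grid[OF t]
  proof eventually_elim
    case (elim \<omega>)
    have large: "eventually (\<lambda>n. 2 \<le> n \<and> \<omega> \<in> space M - low_grid M u t n \<and>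
        t powr (1/3) * (1985/10000) * (real n + 1) powr (2/3) \<le> t powr (1/3) / 5 * real n powr (2/3) - ln (2 * pi * t) / 2) sequentially"
      by (intro eventually_conj eventually_ge_at_top elim eventually_ratio_ge \<tau>)
    \<comment> \<open>Interpolation between exponential scales: for
      \<open>n = nat \<lfloor>ln R\<rfloor>\<close> the window of radius \<open>R\<close> contains
      the one of radius \<open>exp n\<close>, and \<open>ln R\<close> is at most
      \<open>n + 1\<close>.\<close>
    have "filterlim (\<lambda>R::real. nat \<lfloor>ln R\<rfloor>) sequentially at_top"
      by real_asymp
    from eventually_compose_filterlim[OF large this]
    have "eventually (\<lambda>R. ereal (1 / 4 * (t / 2) powr (1/3)) \<le>
      (SUP x\<in>{-R..R}. ereal (ln (u t x \<omega>) + x\<^sup>2 / (2 * t))) / ereal (ln R powr (2 / 3))) at_top"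
      using eventually_gt_at_top[of 1]
    proof eventually_elim
      case (elim R)
      define n where "n = nat \<lfloor>ln R\<rfloor>"
      have lnR: "0 < ln R" using elim by simp
      have n: "real n \<le> ln R" "ln R \<le> real n + 1" unfolding n_def using lnR by linarith+
      have "exp (real n) \<le> R" using n(1) elim by (metis exp_le_cancel_iff exp_ln less_trans zero_less_one)
      have "1 / 4 * (t / 2) powr (1/3) * (ln R powr (2/3)) \<le> t powr (1/3) * (1985/10000) * (real n + 1) powr (2/3)"
        by (rule mult_mono[OF quarter_half_powr[OF t]]) (use n lnR in \<open>auto intro: powr_mono2\<close>)
      also have "\<dots> \<le> t powr (1/3) / 5 * real n powr (2/3) - ln (2 * pi * t) / 2"
        using elim by (simp add: n_def)
      finally have "ereal (1 / 4 * (t / 2) powr (1/3) * (ln R powr (2/3))) \<le>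
          ereal (t powr (1/3) / 5 * real n powr (2/3) - ln (2 * pi * t) / 2)" by simp
      also have "\<dots> \<le> (SUP x\<in>{-R..R}. ereal (ln (u t x \<omega>) + x\<^sup>2 / (2 * t)))"
        by (rule not_low_grid_SUP_ge[where M = M]) (use elim t \<open>exp (real n) \<le> R\<close> in \<open>auto simp: n_def\<close>)
      finally show ?case using lnR by (subst ereal_le_divide_pos) (auto simp: mult.commute)
    qed
    then show ?case by (rule Liminf_bounded)
  qed
qed

end
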